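(* Let $\mu^{(e)}$ be the exponential Möbius function, i.e. the multiplicative function with $\mu^{(e)}(1)=1$ and $\mu^{(e)}(p^a)=\mu(a)$ for every prime $p$ and every $a\ge 1$, and let \[ m(\mu^{(e)})=\prod_p\left(1+\sum_{a=2}^{\infty}\frac{\mu(a)-\mu(a-1)}{p^a}\right). \] (i) The Dirichlet series of $\mu^{(e)}$ is of the form \[ \sum_{n=1}^{\infty}\frac{\mu^{(e)}(n)}{n^s}=\frac{\zeta(s)}{\zeta^2(2s)}\,U(s),\qquad \operatorname{Re} s>1, \] where $U(s)=\sum_{n=1}^{\infty}\frac{u(n)}{n^s}$ is a Dirichlet series that is absolutely convergent for $\operatorname{Re} s>1/5$. (ii) For every constant $\Delta$ with $0<\Delta<9/25$ there is a constant $c>0$ such that \[ \sum_{n\le x}\mu^{(e)}(n)=m(\mu^{(e)})\,x+O\left(x^{1/2}\exp(-c(\log x)^{\Delta})\right). \] (iii) Assume the Riemann hypothesis. Let $1/4<r<1/3$ be an exponent such that $D(x):=\sum_{n\le x}\mu^2(n)-x/\zeta(2)=O(x^{r+\varepsilon})$ for every $\varepsilon>0$. Then \[ \sum_{n\le x}\mu^{(e)}(n)=m(\mu^{(e)})\,x+O\left(x^{(2-r)/(5-4r)+\varepsilon}\right) \] for every $\varepsilon>0$.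
   Context: Here $\mu$ is the classical Möbius function, $\zeta$ is the Riemann zeta function, products over $p$ run over all primes. A multiplicative function is one with $f(1)=1$ and $f(mn)=f(m)f(n)$ for coprime $m,n$; thus for $n=p_1^{a_1}\cdots p_r^{a_r}>1$ (canonical prime factorization), $\mu^{(e)}(n)=\mu(a_1)\cdots\mu(a_r)$. All $O$-estimates are as $x\to\infty$; implied constants may depend on $\varepsilon$, $\Delta$, $r$. *)

theory Defs
  imports
    "HOL-Complex_Analysis.Complex_Analysis"
    "HOL-Computational_Algebra.Computational_Algebra"
    "HOL-Library.Landau_Symbols"
begin

section \<open>The exponential Moebius function\<close>

definition moebius_mu :: "nat \<Rightarrow> int" where
  "moebius_mu n = (if squarefree n then (-1) ^ card (prime_factors n) else 0)"

text \<open>The value at \<open>0\<close> is immaterial.\<close>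

definition exp_moebius_mu :: "nat \<Rightarrow> int" where
  "exp_moebius_mu n = (\<Prod>p\<in>prime_factors n. moebius_mu (multiplicity p n))"

lemma exp_moebius_mu_1: "exp_moebius_mu 1 = 1"
  by (simp add: exp_moebius_mu_def)

lemma exp_moebius_mu_prime_power:
  assumes "prime p" "a \<ge> 1"
  shows "exp_moebius_mu (p ^ a) = moebius_mu a"
  using assms by (simp add: exp_moebius_mu_def prime_factorization_prime_power)

lemma exp_moebius_mu_mult:
  assumes "coprime m n" "m > 0" "n > 0"
  shows "exp_moebius_mu (m * n) = exp_moebius_mu m * exp_moebius_mu n"
proof -
  have disj: "prime_factors m \<inter> prime_factors n = {}"
    using assms(1) by (auto simp: in_prime_factors_iff dest: coprime_common_divisor_nat)
  have eq: "multiplicity p (m * n) = multiplicity p m + multiplicity p n" if "prime p" for p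
    using assms that by (simp add: prime_elem_multiplicity_mult_distrib)
  have m0: "multiplicity p n = 0" if "p \<in> prime_factors m" for p
    using that disj assms by (intro not_dvd_imp_multiplicity_0) (auto simp: in_prime_factors_iff)
  have n0: "multiplicity p m = 0" if "p \<in> prime_factors n" for p
    using that disj assms by (intro not_dvd_imp_multiplicity_0) (auto simp: in_prime_factors_iff)
  have "prime_factors (m * n) = prime_factors m \<union> prime_factors n"
    using assms by (simp add: prime_factors_product)
  then have "exp_moebius_mu (m * n) = (\<Prod>p\<in>prime_factors m. moebius_mu (multiplicity p (m * n))) *
      (\<Prod>p\<in>prime_factors n. moebius_mu (multiplicity p (m * n)))"
    unfolding exp_moebius_mu_def using disj by (simp add: prod.union_disjoint)
  then show ?thesis
    using m0 n0 unfolding exp_moebius_mu_def by (simp add: eq in_prime_factors_iff)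
qed

definition exp_moebius_factor :: "nat \<Rightarrow> real" where
  "exp_moebius_factor p = 1 + (\<Sum>a. of_int (moebius_mu (a + 2) - moebius_mu (a + 1)) / of_nat p ^ (a + 2))"

definition exp_moebius_mean :: real where
  "exp_moebius_mean = (\<Prod>p. if prime p then exp_moebius_factor p else 1)"

lemma abs_moebius_mu_le: "\<bar>moebius_mu n\<bar> \<le> 1"
  by (simp add: moebius_mu_def)

lemma summable_exp_moebius_factor:
  assumes "prime p"
  shows "summable (\<lambda>a. of_int (moebius_mu (a + 2) - moebius_mu (a + 1)) / real p ^ (a + 2))"
    and "\<bar>exp_moebius_factor p - 1\<bar> \<le> 4 * inverse (real p ^ 2)"
proof -
  let ?t = "\<lambda>a. of_int (moebius_mu (a + 2) - moebius_mu (a + 1)) / real p ^ (a + 2)"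
  have p: "real p \<ge> 2" using prime_ge_2_nat[OF assms] by simp
  have bd: "norm (?t a) \<le> 2 / real p ^ 2 * (1 / 2) ^ a" for a
  proof -
    have "\<bar>moebius_mu (a + 2) - moebius_mu (a + 1)\<bar> \<le> 2"
      using abs_moebius_mu_le[of "a + 2"] abs_moebius_mu_le[of "a + 1"] by linarith
    then have num: "\<bar>real_of_int (moebius_mu (a + 2) - moebius_mu (a + 1))\<bar> \<le> 2"
      by linarith
    have den: "real p ^ 2 * 2 ^ a \<le> real p ^ (a + 2)"
      unfolding power_add mult.commute[of "real p ^ a" "real p ^ 2"]
      by (rule mult_left_mono[OF power_mono[OF p]]) simp_all
    have le: "\<bar>real_of_int (moebius_mu (a + 2) - moebius_mu (a + 1))\<bar> / real p ^ (a + 2)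
        \<le> 2 / (real p ^ 2 * 2 ^ a)"
      by (rule frac_le[OF _ num _ den]) (use p in simp_all)
    have "norm (?t a) = \<bar>real_of_int (moebius_mu (a + 2) - moebius_mu (a + 1))\<bar> / real p ^ (a + 2)"
      by (simp only: real_norm_def abs_divide abs_of_nonneg[OF zero_le_power[OF of_nat_0_le_iff]])
    also note le
    also have "2 / (real p ^ 2 * 2 ^ a) = 2 / real p ^ 2 * (1 / 2) ^ a"
      by (simp only: power_inverse divide_inverse inverse_mult_distrib mult_1_left mult.assoc)
    finally show ?thesis .
  qed
  have G: "(\<lambda>a. 2 / real p ^ 2 * (1 / 2) ^ a) sums (2 / real p ^ 2 * (1 / (1 - 1 / 2)))"
    by (rule sums_mult[OF geometric_sums]) simp
  note S = sums_summable[OF G]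
  show sm: "summable ?t" by (rule summable_comparison_test'[OF S bd])
  have "exp_moebius_factor p - 1 = (\<Sum>a. ?t a)"
    unfolding exp_moebius_factor_def by (rule add_diff_cancel_left')
  moreover have "norm (\<Sum>a. ?t a) \<le> (\<Sum>a. 2 / real p ^ 2 * (1 / 2) ^ a)"
    by (rule norm_suminf_le[where f = ?t and g = "\<lambda>a. 2 / real p ^ 2 * (1 / 2) ^ a", OF bd S])
  moreover have "(\<Sum>a. 2 / real p ^ 2 * (1 / 2) ^ a) = 4 * inverse (real p ^ 2)"
    unfolding sums_unique[OF G, symmetric] by (simp add: field_simps)
  ultimately show "\<bar>exp_moebius_factor p - 1\<bar> \<le> 4 * inverse (real p ^ 2)"
    by (simp only: real_norm_def)
qed

lemma abs_convergent_prod_exp_moebius_mean: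
  "abs_convergent_prod (\<lambda>p. if prime p then exp_moebius_factor p else 1)"
proof -
  have "summable (\<lambda>p. norm ((if prime p then exp_moebius_factor p else 1) - 1))"
  proof (rule summable_comparison_test')
    show "summable (\<lambda>p. 4 * inverse (real p ^ 2))"
      by (intro summable_mult inverse_power_summable) simp
    show "norm (norm ((if prime p then exp_moebius_factor p else 1) - 1)) \<le> 4 * inverse (real p ^ 2)"
      for p
      using summable_exp_moebius_factor(2)[of p] by (cases "prime p") simp_all
  qed
  then show ?thesis by (rule summable_imp_abs_convergent_prod)
qed

section \<open>Dirichlet series\<close>

definition dirichlet_series :: "(nat \<Rightarrow> complex) \<Rightarrow> complex \<Rightarrow> complex" where
  "dirichlet_series f s = (\<Sum>n. f (Suc n) / of_nat (Suc n) powr s)"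

section \<open>The Riemann zeta function\<close>

text \<open>
  The zeta function is defined as the analytic continuation of its Dirichlet series to the
  punctured plane; existence and uniqueness are \<open>zeta_ex1\<close> below. The value \<open>0\<close> at the
  pole is a convention making the function total.
\<close>

definition zeta :: "complex \<Rightarrow> complex" where
  "zeta = (THE f. f holomorphic_on - {1} \<and> f 1 = 0 \<and>
     (\<forall>s. Re s > 1 \<longrightarrow> f s = dirichlet_series (\<lambda>_. 1) s))"

lemma holomorphic_on_suminf:
  fixes f :: "nat \<Rightarrow> complex \<Rightarrow> complex"
  assumes "open S" and "\<And>n. f n holomorphic_on S"
    and "\<And>x. x \<in> S \<Longrightarrow> \<exists>d M. 0 < d \<and> cball x d \<subseteq> S \<and> summable M \<and> (\<forall>n. \<forall>y\<in>cball x d. norm (f n y) \<le> M n)"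
  shows "(\<lambda>s. \<Sum>n. f n s) holomorphic_on S"
proof (rule holomorphic_uniform_sequence[OF \<open>open S\<close>])
  show "(\<lambda>s. \<Sum>i<n. f i s) holomorphic_on S" for n
    by (rule holomorphic_on_sum) (rule assms(2))
next
  fix x assume "x \<in> S"
  from assms(3)[OF this] obtain d M where d: "0 < d" "cball x d \<subseteq> S" and M: "summable M"
    and le: "\<forall>n. \<forall>y\<in>cball x d. norm (f n y) \<le> M n"
    by (elim exE conjE)
  have "uniform_limit (cball x d) (\<lambda>n s. \<Sum>i<n. f i s) (\<lambda>s. \<Sum>n. f n s) sequentially"
    by (rule Weierstrass_m_test[OF le[rule_format] M])
  with d show "\<exists>d. 0 < d \<and> cball x d \<subseteq> S \<and>
      uniform_limit (cball x d) (\<lambda>n s. \<Sum>i<n. f i s) (\<lambda>s. \<Sum>n. f n s) sequentially"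
    by (intro exI conjI)
qed

text \<open>
  The continuation proceeds by strips of width one. Expand \<open>(N - 1) powr (1 - s)\<close> for
  \<open>N \<ge> 2\<close> by the binomial series, subtract the terms of index at most \<open>K\<close>, and sum over \<open>N\<close>.
\<close>

definition zeta_tail :: "complex \<Rightarrow> complex" where
  "zeta_tail s = (\<Sum>n. of_real (real n + 2) powr - s)"

definition binomial_remainder :: "nat \<Rightarrow> nat \<Rightarrow> complex \<Rightarrow> complex" where
  "binomial_remainder K n s = of_real (real n + 1) powr (1 - s)
     - (\<Sum>k\<le>K. pochhammer (s - 1) k / fact k * of_real (real n + 2) powr (1 - s - of_nat k))"

lemma norm_powr_nat2: "norm (of_real (real n + 2) powr z :: complex) = (real n + 2) powr Re z"
  by (subst norm_powr_real_powr) auto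

lemma norm_pochhammer_le:
  fixes z :: complex
  assumes "norm z \<le> R"
  shows "norm (pochhammer z k) \<le> pochhammer R k"
proof -
  have "norm (z + of_nat i) \<le> R + real i" for i
    using assms norm_triangle_ineq[of z "of_nat i"] by simp
  then have "(\<Prod>i = 0..<k. norm (z + of_nat i)) \<le> (\<Prod>i = 0..<k. R + of_nat i)"
    by (intro prod_mono conjI norm_ge_zero) simp
  then show ?thesis
    by (simp add: pochhammer_prod prod_norm)
qed

lemma pochhammer_nonneg': "0 \<le> R \<Longrightarrow> 0 \<le> pochhammer (R::real) k"
  unfolding pochhammer_prod by (intro prod_nonneg) auto

lemma summable_poch_half: "summable (\<lambda>k. pochhammer R k / fact k * (1/2::real) ^ k)"
proof -
  have eq: "((-R) gchoose k) * (-(1/2)) ^ k = pochhammer R k / fact k * (1/2::real) ^ k" for k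
  proof -
    have "((-R) gchoose k) * (-(1/2)) ^ k = pochhammer R k / fact k * ((-1) ^ k * (-(1/2)) ^ k)"
      by (simp add: gbinomial_pochhammer)
    also have "(-1) ^ k * (-(1/2)) ^ k = (1/2::real) ^ k"
      by (subst power_mult_distrib[symmetric]) simp
    finally show ?thesis .
  qed
  have "(\<lambda>k. ((-R) gchoose k) * (-(1/2)) ^ k) sums (1 + -(1/2)) powr (-R)"
    by (rule gen_binomial_real) simp
  then show ?thesis unfolding eq by (rule sums_summable)
qed

lemma binomial_remainder_bound:
  assumes "norm (s - 1) \<le> R"
  shows "norm (binomial_remainder K n s) \<le> (\<Sum>j. pochhammer R (j + Suc K) / fact (j + Suc K) * (1/2) ^ j)
            * (real n + 2) powr (- Re s - real K)"
proof -
  define N where "N = real n + 2"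
  have N: "N \<ge> 2" by (simp add: N_def)
  have R: "R \<ge> 0" using assms norm_ge_zero order_trans by blast
  define t where "t k = pochhammer (s - 1) k / fact k * of_real N powr (1 - s - of_nat k)" for k
  have "t sums of_real (N - 1) powr (1 - s)"
  proof -
    have "t k = ((1 - s) gchoose k) * of_real N powr (1 - s - of_nat k) * of_real (-1) ^ k" for k
    proof -
      have "((1 - s) gchoose k) * of_real (-1) ^ k = pochhammer (s - 1) k / fact k * ((-1) ^ k * (-1) ^ k)"
        by (simp add: gbinomial_pochhammer)
      also have "(-1) ^ k * (-1) ^ k = (1::complex)"
        by (subst power_mult_distrib[symmetric]) simp
      finally have *: "((1 - s) gchoose k) * of_real (-1) ^ k = pochhammer (s - 1) k / fact k" by simp
      show ?thesis unfolding t_def *[symmetric] by (simp only: mult_ac)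
    qed
    then show ?thesis
      using gen_binomial_complex''[of "-1" N "1 - s"] N by (simp add: t_def[abs_def])
  qed
  then have "(\<lambda>j. t (j + Suc K)) sums (of_real (N - 1) powr (1 - s) - (\<Sum>k<Suc K. t k))"
    using sums_split_initial_segment by blast
  then have sm: "(\<lambda>j. t (j + Suc K)) sums binomial_remainder K n s"
    by (simp add: binomial_remainder_def N_def t_def lessThan_Suc_atMost add.commute)
  let ?C = "\<lambda>j. pochhammer R (j + Suc K) / fact (j + Suc K) * (1/2::real) ^ j"
  have sC: "summable ?C"
  proof -
    have "summable (\<lambda>j. pochhammer R (j + Suc K) / fact (j + Suc K) * (1/2::real) ^ (j + Suc K) * 2 ^ Suc K)"
      by (rule summable_mult2[OF summable_ignore_initial_segment[OF summable_poch_half]])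
    also have "(\<lambda>j. pochhammer R (j + Suc K) / fact (j + Suc K) * (1/2::real) ^ (j + Suc K) * 2 ^ Suc K) = ?C"
      by (auto simp: power_add power_divide)
    finally show ?thesis .
  qed
  have bd: "norm (t (j + Suc K)) \<le> ?C j * N powr (- Re s - real K)" for j
  proof -
    have "norm (t (j + Suc K)) = norm (pochhammer (s - 1) (j + Suc K)) / fact (j + Suc K) * N powr (- Re s - real K + - real j)"
      using norm_powr_nat2[of n "1 - s - of_nat (j + Suc K)"]
      by (simp add: t_def norm_mult norm_divide N_def algebra_simps del: fact_Suc)
    also have "N powr (- Re s - real K + - real j) = N powr (- Re s - real K) * N powr (- real j)"
      by (rule powr_add)
    also have "N powr (- real j) = (1 / N) ^ j"
      using N by (simp add: powr_minus powr_realpow power_divide field_simps)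
    also have "norm (pochhammer (s - 1) (j + Suc K)) / fact (j + Suc K) * (N powr (- Re s - real K) * (1 / N) ^ j)
       \<le> pochhammer R (j + Suc K) / fact (j + Suc K) * (N powr (- Re s - real K) * (1 / 2) ^ j)"
      using N R assms
      by (intro mult_mono divide_right_mono norm_pochhammer_le power_mono mult_left_mono frac_le) (auto intro!: pochhammer_nonneg' divide_nonneg_nonneg simp del: fact_Suc)
    finally show ?thesis by (simp add: mult_ac)
  qed
  have "norm (binomial_remainder K n s) = norm (\<Sum>j. t (j + Suc K))" using sm by (simp add: sums_iff)
  also have "\<dots> \<le> (\<Sum>j. ?C j * N powr (- Re s - real K))"
    by (rule norm_suminf_le[OF bd summable_mult2[OF sC]])
  also have "\<dots> = (\<Sum>j. ?C j) * N powr (- Re s - real K)"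
    by (rule suminf_mult2[OF sC, symmetric])
  finally show ?thesis by (simp add: N_def)
qed

lemma summable_nat2_powr: "a < -1 \<Longrightarrow> summable (\<lambda>n. (real n + 2) powr a)"
  using summable_ignore_initial_segment[of "\<lambda>n. real n powr a" 2] summable_real_powr_iff[of a]
  by (simp add: add_ac)

lemma holomorphic_powr_nat2:
  assumes "f holomorphic_on A"
  shows "(\<lambda>s. of_real (real n + 2) powr f s) holomorphic_on A"
    and "(\<lambda>s. of_real (real n + 1) powr f s) holomorphic_on A"
proof -
  have *: "(\<lambda>s. of_real c powr f s) holomorphic_on A" if "c > 0" for c :: real
  proof -
    have "(\<lambda>s. of_real c powr f s) = (\<lambda>s. exp (f s * Ln (of_real c)))"
      using that by (simp add: powr_def fun_eq_iff)
    moreover have "(\<lambda>s. exp (f s * Ln (of_real c))) holomorphic_on A"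
      by (intro holomorphic_on_exp' holomorphic_on_mult assms holomorphic_on_const)
    ultimately show ?thesis by simp
  qed
  show "(\<lambda>s. of_real (real n + 2) powr f s) holomorphic_on A"
    and "(\<lambda>s. of_real (real n + 1) powr f s) holomorphic_on A"
    by (rule *, simp)+
qed

lemma zeta_tail_holomorphic: "zeta_tail holomorphic_on {s. 1 < Re s}"
  unfolding zeta_tail_def[abs_def]
proof (rule holomorphic_on_suminf)
  fix x assume x: "x \<in> {s. 1 < Re s}"
  define d where "d = (Re x - 1) / 2"
  have d: "d > 0" using x by (auto simp: d_def)
  have le: "Re y \<ge> 1 + d" if "y \<in> cball x d" for y
    using abs_Re_le_cmod[of "x - y"] that by (simp add: d_def dist_norm field_simps)
  show "\<exists>d M. 0 < d \<and> cball x d \<subseteq> {s. 1 < Re s} \<and> summable M \<and>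
      (\<forall>n. \<forall>y\<in>cball x d. norm (of_real (real n + 2) powr - y :: complex) \<le> M n)"
  proof (intro exI[of _ d] exI[of _ "\<lambda>n. (real n + 2) powr (-(1 + d))"] conjI allI ballI subsetI d)
    show "y \<in> {s. 1 < Re s}" if "y \<in> cball x d" for y using le[OF that] d by simp
    show "summable (\<lambda>n. (real n + 2) powr (-(1 + d)))" using d by (intro summable_nat2_powr) simp
    show "norm (of_real (real n + 2) powr - y :: complex) \<le> (real n + 2) powr (-(1 + d))"
      if "y \<in> cball x d" for n y
      unfolding norm_powr_nat2 using le[OF that] by (intro powr_mono) auto
  qed
next
  show "(\<lambda>s. of_real (real n + 2) powr - s) holomorphic_on {s. 1 < Re s}" for n
    by (intro holomorphic_powr_nat2 holomorphic_on_minus holomorphic_on_ident)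
qed (rule open_halfspace_Re_gt)

lemma binomial_remainder_suminf_holomorphic: "(\<lambda>s. \<Sum>n. binomial_remainder (Suc m) n s) holomorphic_on {s. - real m < Re s}"
proof (rule holomorphic_on_suminf)
  fix x assume x: "x \<in> {s. - real m < Re s}"
  define d where "d = (Re x + real m) / 2"
  have d: "d > 0" using x by (auto simp: d_def)
  have le: "Re y \<ge> - real m + d" if "y \<in> cball x d" for y
    using abs_Re_le_cmod[of "x - y"] that by (simp add: d_def dist_norm field_simps)
  define R where "R = norm (x - 1) + d"
  have R: "norm (y - 1) \<le> R" if "y \<in> cball x d" for y
    using norm_triangle_ineq[of "x - 1" "y - x"] that by (simp add: R_def dist_norm norm_minus_commute)
  have R0: "R \<ge> 0" using d by (simp add: R_def)
  define B where "B = (\<Sum>j. pochhammer R (j + Suc (Suc m)) / fact (j + Suc (Suc m)) * (1/2::real) ^ j)"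
  have B: "norm (binomial_remainder (Suc m) n y) \<le> B * (real n + 2) powr (- Re y - real (Suc m))" if "y \<in> cball x d" for n y
    using binomial_remainder_bound[OF R[OF that], of "Suc m" n] by (simp add: B_def)
  have B0: "B \<ge> 0"
  proof -
    have "0 \<le> B * (real 0 + 2) powr (- Re x - real (Suc m))"
      using order_trans[OF norm_ge_zero B[of x 0]] d by simp
    then show ?thesis by (simp only: zero_le_mult_iff) simp
  qed
  have bnd: "norm (binomial_remainder (Suc m) n y) \<le> B * (real n + 2) powr (- 1 - d)" if "y \<in> cball x d" for n y
    by (rule order_trans[OF B[OF that]]) (use le[OF that] B0 in \<open>auto intro!: mult_left_mono powr_mono\<close>)
  show "\<exists>d M. 0 < d \<and> cball x d \<subseteq> {s. - real m < Re s} \<and> summable M \<and>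
      (\<forall>n. \<forall>y\<in>cball x d. norm (binomial_remainder (Suc m) n y) \<le> M n)"
  proof (intro exI[of _ d] exI[of _ "\<lambda>n. B * (real n + 2) powr (- 1 - d)"] conjI allI ballI subsetI d)
    show "y \<in> {s. - real m < Re s}" if "y \<in> cball x d" for y using le[OF that] d by simp
    show "summable (\<lambda>n. B * (real n + 2) powr (- 1 - d))" using d by (intro summable_mult summable_nat2_powr) simp
  qed (rule bnd)
next
  show "binomial_remainder (Suc m) n holomorphic_on {s. - real m < Re s}" for n
    unfolding binomial_remainder_def[abs_def] pochhammer_prod divide_inverse
    by (intro holomorphic_powr_nat2 holomorphic_on_mult holomorphic_on_prod holomorphic_on_add
        holomorphic_on_diff holomorphic_on_sum holomorphic_on_ident holomorphic_on_const)
qed (rule open_halfspace_Re_gt)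

lemma zeta_tail_recurrence:
  assumes s: "1 < Re s"
  shows "(s - 1) * zeta_tail s = 1 - (\<Sum>k=1..m. pochhammer (s - 1) k / fact (Suc k) *
            ((s + of_nat k - 1) * zeta_tail (s + of_nat k))) - (\<Sum>n. binomial_remainder (Suc m) n s)"
proof -
  let ?e = "\<lambda>k. pochhammer (s - 1) k / fact k"
  have summ: "summable (\<lambda>n. of_real (real n + 2) powr - z :: complex)" if "1 < Re z" for z
    by (rule summable_norm_cancel) (unfold norm_powr_nat2, rule summable_nat2_powr, use that in simp)
  have "(\<lambda>n. of_real (real n + 1) powr (1 - s) :: complex) \<longlonglongrightarrow> 0"
  proof (rule tendsto_norm_zero_cancel)
    have "(\<lambda>n. (real n + 1) powr (1 - Re s)) \<longlonglongrightarrow> 0"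
      by (rule tendsto_neg_powr)
         (use s in simp, rule filterlim_at_top_mono[OF filterlim_real_sequentially], simp)
    then show "(\<lambda>n. norm (of_real (real n + 1) powr (1 - s) :: complex)) \<longlonglongrightarrow> 0"
      by (simp add: norm_powr_real_powr del: of_real_add)
  qed
  from telescope_sums'[OF this]
  have tel: "(\<lambda>n. of_real (real n + 1) powr (1 - s) - of_real (real n + 2) powr (1 - s)) sums (1::complex)"
    by (simp add: add_ac)
  have H: "(\<lambda>n. ?e (Suc k) * of_real (real n + 2) powr (1 - s - of_nat (Suc k))) sums (?e (Suc k) * zeta_tail (s + of_nat k))" for k
  proof -
    have "- (s + of_nat k) = 1 - s - of_nat (Suc k)" by simp
    moreover have "(\<lambda>n. of_real (real n + 2) powr - (s + of_nat k)) sums zeta_tail (s + of_nat k)"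
      unfolding zeta_tail_def by (rule summable_sums[OF summ]) (use s in simp)
    ultimately show ?thesis by (intro sums_mult) (simp only:)
  qed
  have "(\<lambda>n. \<Sum>k\<le>m. ?e (Suc k) * of_real (real n + 2) powr (1 - s - of_nat (Suc k))) sums (\<Sum>k\<le>m. ?e (Suc k) * zeta_tail (s + of_nat k))"
    using H by (intro sums_sum)
  from sums_diff[OF tel this]
  have "(\<lambda>n. binomial_remainder (Suc m) n s) sums (1 - (\<Sum>k\<le>m. ?e (Suc k) * zeta_tail (s + of_nat k)))"
  proof (rule sums_cong[THEN iffD1, rotated])
    fix n
    have "(\<Sum>k\<le>Suc m. ?e k * of_real (real n + 2) powr (1 - s - of_nat k)) =
        of_real (real n + 2) powr (1 - s) + (\<Sum>k\<le>m. ?e (Suc k) * of_real (real n + 2) powr (1 - s - of_nat (Suc k)))"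
      by (subst sum.atMost_Suc_shift) simp
    then show "of_real (real n + 1) powr (1 - s) - of_real (real n + 2) powr (1 - s)
        - (\<Sum>k\<le>m. ?e (Suc k) * of_real (real n + 2) powr (1 - s - of_nat (Suc k))) = binomial_remainder (Suc m) n s"
      unfolding binomial_remainder_def by (simp only: diff_diff_eq)
  qed
  then have Z: "(\<Sum>n. binomial_remainder (Suc m) n s) = 1 - (\<Sum>k\<le>m. ?e (Suc k) * zeta_tail (s + of_nat k))"
    by (simp add: sums_iff)
  have "(\<Sum>k\<le>m. ?e (Suc k) * zeta_tail (s + of_nat k))
      = (\<Sum>k\<le>m. pochhammer (s - 1) k / fact (Suc k) * ((s + of_nat k - 1) * zeta_tail (s + of_nat k)))"
  proof (intro sum.cong refl)
    fix k
    have "pochhammer (s - 1) (Suc k) = pochhammer (s - 1) k * (s + of_nat k - 1)"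
      by (simp add: pochhammer_Suc diff_add_eq)
    then show "?e (Suc k) * zeta_tail (s + of_nat k)
        = pochhammer (s - 1) k / fact (Suc k) * ((s + of_nat k - 1) * zeta_tail (s + of_nat k))"
      by (simp only: times_divide_eq_left times_divide_eq_right mult.assoc)
  qed
  also have ins: "{..m} = insert 0 {1..m}" by auto
  also have "(\<Sum>k\<in>insert 0 {1..m}. pochhammer (s - 1) k / fact (Suc k) * ((s + of_nat k - 1) * zeta_tail (s + of_nat k)))
     = (s - 1) * zeta_tail s + (\<Sum>k=1..m. pochhammer (s - 1) k / fact (Suc k) * ((s + of_nat k - 1) * zeta_tail (s + of_nat k)))"
    by (subst sum.insert) auto
  finally have E: "(\<Sum>k\<le>m. ?e (Suc k) * zeta_tail (s + of_nat k)) = (s - 1) * zeta_tail s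
     + (\<Sum>k=1..m. pochhammer (s - 1) k / fact (Suc k) * ((s + of_nat k - 1) * zeta_tail (s + of_nat k)))" unfolding ins .
  show ?thesis unfolding Z E by simp
qed

lemma zeta_tail_continuation:
  "\<exists>h. h holomorphic_on {s. 1 - real m < Re s} \<and> (\<forall>s. 1 < Re s \<longrightarrow> h s = (s - 1) * zeta_tail s)"
proof (induction m)
  case 0
  show ?case
    by (rule exI[of _ "\<lambda>s. (s - 1) * zeta_tail s"]) (simp add: holomorphic_on_mult holomorphic_on_diff holomorphic_on_ident holomorphic_on_const zeta_tail_holomorphic)
next
  case (Suc m)
  then obtain h where h: "h holomorphic_on {s. 1 - real m < Re s}" "\<And>s. 1 < Re s \<Longrightarrow> h s = (s - 1) * zeta_tail s"
    by blast
  define g where "g s = 1 - (\<Sum>k=1..m. pochhammer (s - 1) k / fact (Suc k) * h (s + of_nat k))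
      - (\<Sum>n. binomial_remainder (Suc m) n s)" for s
  have hk: "(\<lambda>s. h (s + of_nat k)) holomorphic_on {s. - real m < Re s}" if "k \<ge> 1" for k
  proof (rule holomorphic_on_compose_gen[OF _ h(1), unfolded comp_def])
    show "(\<lambda>s. s + of_nat k) holomorphic_on {s. - real m < Re s}"
      by (intro holomorphic_on_add holomorphic_on_ident holomorphic_on_const)
    show "(\<lambda>s. s + of_nat k) ` {s. - real m < Re s} \<subseteq> {s. 1 - real m < Re s}"
      using that by auto
  qed
  have pk: "(\<lambda>s. pochhammer (s - 1) k / fact (Suc k)) holomorphic_on S" for k S
    unfolding pochhammer_prod divide_inverse
    by (intro holomorphic_on_mult holomorphic_on_prod holomorphic_on_add holomorphic_on_diff holomorphic_on_ident holomorphic_on_const)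
  have "g holomorphic_on {s. - real m < Re s}"
    unfolding g_def[abs_def]
    by (intro holomorphic_on_diff holomorphic_on_sum holomorphic_on_mult holomorphic_on_const pk hk binomial_remainder_suminf_holomorphic) auto
  moreover have "g s = (s - 1) * zeta_tail s" if "1 < Re s" for s
    unfolding g_def zeta_tail_recurrence[OF that, of m] using that by (simp add: h(2))
  ultimately show ?case by (intro exI[of _ g]) simp
qed

lemma dirichlet_series_1_eq:
  assumes "1 < Re s"
  shows "(\<lambda>n. 1 / of_nat (Suc n) powr s) sums (1 + zeta_tail s)"
proof -
  have "summable (\<lambda>n. of_real (real n + 2) powr - s :: complex)"
    by (rule summable_norm_cancel, unfold norm_powr_nat2, rule summable_nat2_powr) (use assms in simp)
  then have "(\<lambda>n. of_real (real n + 2) powr - s) sums zeta_tail s"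
    unfolding zeta_tail_def by (rule summable_sums)
  moreover have "of_real (real n + 2) powr - s = 1 / of_nat (Suc (Suc n)) powr s" for n
    by (simp add: powr_minus_divide add.commute)
  ultimately show ?thesis
    using sums_Suc[of "\<lambda>n. 1 / of_nat (Suc n) powr s" "zeta_tail s"] by (simp add: add.commute)
qed

theorem zeta_ex1:
  "\<exists>!f. f holomorphic_on - {1} \<and> f 1 = 0 \<and>
     (\<forall>s. Re s > 1 \<longrightarrow> f s = dirichlet_series (\<lambda>_. 1) s)" (is "\<exists>!f. ?P f")
proof (rule ex_ex1I)
  have "\<forall>m. \<exists>h. h holomorphic_on {s. 1 - real m < Re s} \<and> (\<forall>s. 1 < Re s \<longrightarrow> h s = (s - 1) * zeta_tail s)"
    using zeta_tail_continuation by blast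
  then obtain h where hol: "\<And>m. h m holomorphic_on {s. 1 - real m < Re s}"
    and h: "\<And>m s. 1 < Re s \<Longrightarrow> h m s = (s - 1) * zeta_tail s"
    by metis
  have le: "h m s = h k s" if "m \<le> k" "1 - real m < Re s" for m k s
  proof (rule analytic_continuation_open[where f = "h m" and g = "h k" and z = s
        and s = "{s. 1 < Re s}" and s' = "{s. 1 - real m < Re s}"])
    show "connected {s. 1 - real m < Re s}"
      by (intro convex_connected convex_halfspace_Re_gt)
    show "{s. 1 < Re s} \<noteq> {}"
      by (rule ex_in_conv[THEN iffD1]) (rule exI[of _ 2], simp)
    show "h k holomorphic_on {s. 1 - real m < Re s}"
      by (rule holomorphic_on_subset[OF hol]) (use that in auto)
  qed (use that in \<open>auto simp: open_halfspace_Re_gt hol h\<close>)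
  have eq: "h m s = h k s" if "1 - real m < Re s" "1 - real k < Re s" for m k s
    using le[OF _ that(1), of k] le[OF _ that(2), of m, symmetric] by (metis linear)
  define M where "M s = nat \<lceil>2 - Re s\<rceil>" for s
  have M: "1 - real (M s) < Re s" for s unfolding M_def by linarith
  define f where "f s = (if s = 1 then 0 else 1 + h (M s) s / (s - 1))" for s
  have "f holomorphic_on {s. 1 - real m < Re s} - {1}" for m
  proof -
    have "(\<lambda>s. 1 + h m s / (s - 1)) holomorphic_on {s. 1 - real m < Re s} - {1}"
      by (intro holomorphic_on_add holomorphic_on_divide holomorphic_on_diff holomorphic_on_const
          holomorphic_on_ident holomorphic_on_subset[OF hol]) auto
    then show ?thesis
    proof (rule holomorphic_transform)
      fix s assume s: "s \<in> {s. 1 - real m < Re s} - {1}"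
      then have "h m s = h (M s) s" by (intro eq M) simp
      with s show "1 + h m s / (s - 1) = f s" by (simp add: f_def)
    qed
  qed
  then have "f holomorphic_on (\<Union>m. {s. 1 - real m < Re s} - {1})"
    by (intro holomorphic_on_UN_open) (auto intro: open_halfspace_Re_gt)
  also have "(\<Union>m. {s. 1 - real m < Re s} - {1}) = - {1}"
    using M by auto
  finally have "f holomorphic_on - {1}" .
  moreover have "f s = dirichlet_series (\<lambda>_. 1) s" if "1 < Re s" for s
  proof -
    from that have "s \<noteq> 1" by auto
    then show ?thesis
      using that dirichlet_series_1_eq[OF that] by (simp add: f_def h dirichlet_series_def sums_iff)
  qed
  ultimately show "\<exists>f. ?P f" by (intro exI[of _ f]) (simp add: f_def)
next
  fix f g assume fg: "?P f" "?P g"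
  show "f = g"
  proof
    fix s
    show "f s = g s"
    proof (cases "s = 1")
      case False
      show ?thesis
      proof (rule analytic_continuation_open[where f = f and g = g and z = s
            and s = "{s. 1 < Re s}" and s' = "- {1}"])
        show "connected (- {1 :: complex})"
          by (intro connected_punctured_universe) simp
        show "{s. 1 < Re s} \<noteq> {}"
          by (rule ex_in_conv[THEN iffD1]) (rule exI[of _ 2], simp)
      qed (use fg False in \<open>auto simp: open_halfspace_Re_gt\<close>)
    qed (use fg in simp)
  qed
qed

lemma
  shows holomorphic_zeta: "zeta holomorphic_on - {1}"
    and zeta_1: "zeta 1 = 0"
    and zeta_eq_dirichlet_series: "Re s > 1 \<Longrightarrow> zeta s = dirichlet_series (\<lambda>_. 1) s"
proof -
  have "zeta holomorphic_on - {1} \<and> zeta 1 = 0 \<and>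
      (\<forall>s. Re s > 1 \<longrightarrow> zeta s = dirichlet_series (\<lambda>_. 1) s)"
    unfolding zeta_def by (rule theI'[OF zeta_ex1])
  then show "zeta holomorphic_on - {1}" and "zeta 1 = 0"
    and "Re s > 1 \<Longrightarrow> zeta s = dirichlet_series (\<lambda>_. 1) s"
    by simp_all
qed

text \<open>The nontrivial zeros are those in the open critical strip.\<close>

definition riemann_hypothesis :: bool where
  "riemann_hypothesis \<longleftrightarrow> (\<forall>s. zeta s = 0 \<and> 0 < Re s \<and> Re s < 1 \<longrightarrow> Re s = 1 / 2)"

section \<open>Squarefree numbers\<close>

text \<open>Since \<open>zeta 2\<close> is a real number, taking its real part only changes the type.\<close>

definition squarefree_discrepancy :: "real \<Rightarrow> real" where
  "squarefree_discrepancy x = (\<Sum>n | 1 \<le> n \<and> real n \<le> x. of_int ((moebius_mu n)\<^sup>2)) - x / Re (zeta 2)"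

end

theory Submission
  imports Defs "HOL-Real_Asymp.Real_Asymp" "HOL-Number_Theory.Prime_Powers"
begin

text \<open>Write \<open>H = 1 + \<Sum> \<mu>(a) X\<^sup>a\<close> for the Euler factor of \<open>\<mu>\<^sup>(\<^sup>e\<^sup>)\<close>; it is the same for every prime. The first coefficients give
\<open>H = (1 - X)\<^sup>-\<^sup>1 (1 - X\<^sup>2)\<^sup>2 U\<close> with \<open>U = 1 + O(X\<^sup>5)\<close>. The first two factors belong to \<open>\<zeta>(s) / \<zeta>\<^sup>2(2s)\<close>. As \<open>U - 1\<close> starts with \<open>X\<^sup>5\<close>, the corresponding
Euler product, and with it the Dirichlet series \<open>\<Sum> u(n) / n\<^sup>s\<close>, converges absolutely for \<open>Re s > 1/5\<close> (\<open>norm_summable_cofactor\<close>). This is the first part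
(\<open>exp_moebius_dirichlet_series\<close>); dropping the factor \<open>(1 - X)\<^sup>-\<^sup>1\<close> and taking \<open>s = 1\<close> yields the mean value (\<open>exp_moebius_mean_eq\<close>).

Convolution with \<open>u\<close> does not change the quality of an asymptotic formula whose error has exponent above \<open>1/5\<close> (\<open>exp_moebius_sum_error\<close>). It remains to sum
the function with Dirichlet series \<open>\<zeta>(s) / \<zeta>\<^sup>2(2s)\<close>. It is a convolution of a function \<open>f\<close> of known mean value with an oscillating function \<open>g\<close> placed on the squares, and
\<open>square_hyperbola\<close> combines an asymptotic formula for the sums of \<open>f\<close> with cancellation in the sums of \<open>g\<close>.

For the second part \<open>f = 1\<close> and \<open>g = \<mu> * \<mu>\<close>. The sums of \<open>g\<close> save a factor \<open>exp (- c \<surd>(log N))\<close> (\<open>moebius_square_sum_bound\<close>), which is enough for every exponent \<open>\<Delta> < 1/2\<close>.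
This saving comes from the classical zero-free region of \<open>\<zeta>\<close>. The region is obtained from the 3-4-1 inequality and Landau's local estimate of \<open>\<zeta>'/\<zeta>\<close>
(\<open>landau_log_deriv_zero\<close>, \<open>zeta_w_zero_free\<close>), applied to the continuation of \<open>\<zeta>\<close> to \<open>Re s > 0\<close>. The Borel-Caratheodory theorem turns it
into a bound for \<open>1/\<zeta>\<close> (\<open>zeta_w_inverse_bound\<close>), Newman's contour integral into a bound for \<open>\<Sum> \<mu>(n) / n\<close> (\<open>newman_bound\<close>, \<open>moebius_log_sum_bound\<close>), partial summation into one
for \<open>\<Sum> \<mu>(n)\<close>, and the hyperbola method into one for \<open>\<mu> * \<mu>\<close>.

For the third part \<open>(1 - X)\<^sup>-\<^sup>1 (1 - X\<^sup>2)\<^sup>2\<close> is written as \<open>(1 + X) (1 - X\<^sup>2)\<close>, that is, \<open>f = \<mu>\<^sup>2\<close> and \<open>g = \<mu>\<close>. The sums of \<open>f\<close> are controlled by hypothesis. Under the Riemann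
hypothesis \<open>log \<zeta>\<close> exists for \<open>Re s > 1/2\<close> apart from the pole, interpolating its size between two circles gives \<open>1/\<zeta> = O(\<bar>t\<bar>\<^sup>\<epsilon>)\<close> (\<open>zeta_w_inverse_bound_RH\<close>), and Newman's
contour yields square root cancellation in the sums of \<open>\<mu>\<close>. Balancing the two errors of the hyperbola method produces the exponent \<open>(2 - r) / (5 - 4r)\<close>
(\<open>main_fun_sum_bound_RH\<close>).\<close>

section \<open>Multiplicative functions given by a power series\<close>

abbreviation norm_summable_on :: "('a \<Rightarrow> 'b::real_normed_vector) \<Rightarrow> 'a set \<Rightarrow> bool"
    (infix "norm'_summable'_on" 46) where
  "f norm_summable_on A \<equiv> (\<lambda>x. norm (f x)) summable_on A"

text \<open>The multiplicative functions of the proof take values at prime powers \<open>p\<^sup>a\<close> that depend on \<open>a\<close> only.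
Such a function is stored as the power series of these values, and every identity between Euler factors
becomes an identity of power series.\<close>

definition euler_fun :: "real fps \<Rightarrow> nat \<Rightarrow> real" where
  "euler_fun C n = (\<Prod>p\<in>prime_factors n. fps_nth C (multiplicity p n))"

definition dconv :: "(nat \<Rightarrow> 'a::comm_semiring_1) \<Rightarrow> (nat \<Rightarrow> 'a) \<Rightarrow> nat \<Rightarrow> 'a" where
  "dconv f g n = (\<Sum>(a, b) | a * b = n. f a * g b)"

lemma euler_fun_1 [simp]: "euler_fun C (Suc 0) = 1"
  by (simp add: euler_fun_def)

lemma euler_fun_prime_power_mult:
  assumes "prime p" "\<not> p dvd m" "m > 0" "fps_nth C 0 = 1"
  shows "euler_fun C (p ^ k * m) = fps_nth C k * euler_fun C m"
proof (cases "k = 0")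
  case False
  have m: "multiplicity p m = 0" by (rule not_dvd_imp_multiplicity_0[OF assms(2)])
  have pf: "prime_factors (p ^ k * m) = insert p (prime_factors m)"
    using assms False by (simp add: prime_factors_product prime_factorization_prime_power)
  have np: "p \<notin> prime_factors m" using assms by (auto simp: in_prime_factors_iff)
  have mq: "multiplicity q (p ^ k * m) = multiplicity q m" if "q \<in> prime_factors m" for q
  proof -
    have "prime q" using that by (auto simp: in_prime_factors_iff)
    moreover have "q \<noteq> p" using that np by auto
    ultimately show ?thesis using assms
      by (simp add: prime_elem_multiplicity_mult_distrib prime_elem_multiplicity_power_distrib
          prime_multiplicity_other)
  qed
  have mp: "multiplicity p (p ^ k * m) = k"
    using assms m by (simp add: prime_elem_multiplicity_mult_distrib)
  show ?thesis unfolding euler_fun_def pf using np mp mq by (simp cong: prod.cong)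
qed (use assms in simp)

lemma euler_fun_prime_power:
  assumes "prime p" "fps_nth C 0 = 1"
  shows "euler_fun C (p ^ k) = fps_nth C k"
  using euler_fun_prime_power_mult[of p 1 C k] assms by (auto simp: prime_nat_iff)

lemma prime_power_split:
  fixes n :: nat
  assumes "n > 0" "prime p"
  obtains m where "n = p ^ multiplicity p n * m" "\<not> p dvd m" "m > 0"
proof -
  have "p ^ multiplicity p n dvd n" by (rule multiplicity_dvd)
  then obtain m where m: "n = p ^ multiplicity p n * m" by (elim dvdE)
  moreover have "\<not> p dvd m"
  proof
    assume "p dvd m"
    then have "p ^ Suc (multiplicity p n) dvd n"
      by (subst m) (simp add: mult_dvd_mono mult.commute)
    then show False
      using assms not_dvd_imp_multiplicity_0 power_dvd_iff_le_multiplicity[of n p "Suc (multiplicity p n)"]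
      by (auto simp: prime_nat_iff)
  qed
  ultimately show ?thesis using assms(1) that by (metis gr0I mult_is_0)
qed

lemma finite_factor_pairs: "n > 0 \<Longrightarrow> finite {(a, b). a * b = (n::nat)}"
  by (rule finite_subset[of _ "{..n} \<times> {..n}"])
     (auto intro!: dvd_imp_le)

text \<open>The combinatorial core of multiplicativity: for \<open>p\<close> not dividing \<open>m\<close>, the factorizations of \<open>p\<^sup>k m\<close> into two
factors arise from those of \<open>m\<close> by distributing the \<open>k\<close> factors \<open>p\<close> in one of \<open>k + 1\<close> ways.\<close>

lemma bij_betw_factor_pairs:
  fixes m :: nat
  assumes "prime p" "\<not> p dvd m" "m > 0"
  shows "bij_betw (\<lambda>(i, a, b). (p ^ i * a, p ^ (k - i) * b))
     ({..k} \<times> {(a, b). a * b = m}) {(a, b). a * b = p ^ k * m}"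
proof (rule bij_betwI[where g = "\<lambda>(a, b). (multiplicity p a, a div p ^ multiplicity p a, b div p ^ multiplicity p b)"])
  have mult0: "multiplicity p (p ^ i * a) = i" "a > 0" if "a dvd m" for a i
  proof -
    have "\<not> p dvd a" using that assms(2) dvd_trans by blast
    moreover show "a > 0" using that assms(3) by (auto intro: dvd_pos_nat)
    ultimately show "multiplicity p (p ^ i * a) = i" using assms(1)
      by (simp add: prime_elem_multiplicity_mult_distrib not_dvd_imp_multiplicity_0)
  qed
  have p0: "p ^ i > 0" for i using assms(1) by (simp add: prime_gt_0_nat)
  show "(\<lambda>(i, a, b). (p ^ i * a, p ^ (k - i) * b)) \<in> {..k} \<times> {(a, b). a * b = m} \<rightarrow> {(a, b). a * b = p ^ k * m}"
    by (auto simp: mult_ac power_add[symmetric])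
  show "(case case x of (i, a, b) \<Rightarrow> (p ^ i * a, p ^ (k - i) * b) of
     (a, b) \<Rightarrow> (multiplicity p a, a div p ^ multiplicity p a, b div p ^ multiplicity p b)) = x"
    if x: "x \<in> {..k} \<times> {(a, b). a * b = m}" for x
  proof -
    obtain i a b where [simp]: "x = (i, a, b)" by (cases x)
    have "a dvd m" "b dvd m" using x by auto
    then show ?thesis using mult0 p0 prime_gt_0_nat[OF assms(1)] by simp
  qed
  have inv: "(case case x of (a, b) \<Rightarrow> (multiplicity p a, a div p ^ multiplicity p a, b div p ^ multiplicity p b) of
      (i, a, b) \<Rightarrow> (p ^ i * a, p ^ (k - i) * b)) = x"
    "(case x of (a, b) \<Rightarrow> (multiplicity p a, a div p ^ multiplicity p a, b div p ^ multiplicity p b))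
      \<in> {..k} \<times> {(a, b). a * b = m}"
    if x: "x \<in> {(a, b). a * b = p ^ k * m}" for x
  proof -
    obtain a b where [simp]: "x = (a, b)" and ab: "a * b = p ^ k * m" using x by auto
    have pos: "a > 0" "b > 0" using ab p0[of k] assms(3) by (auto intro!: Nat.gr0I)
    obtain a' where a': "a = p ^ multiplicity p a * a'" "\<not> p dvd a'" "a' > 0"
      by (rule prime_power_split[OF pos(1) assms(1)])
    obtain b' where b': "b = p ^ multiplicity p b * b'" "\<not> p dvd b'" "b' > 0"
      by (rule prime_power_split[OF pos(2) assms(1)])
    have "multiplicity p a + multiplicity p b = multiplicity p (p ^ k * m)"
      unfolding ab[symmetric] using assms(1) pos by (simp add: prime_elem_multiplicity_mult_distrib)
    also have "\<dots> = k" using mult0(1)[of m k] by simp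
    finally have k: "multiplicity p a + multiplicity p b = k" .
    have da: "a div p ^ multiplicity p a = a'"
      by (subst a'(1)) (use p0 in simp)
    have db: "b div p ^ multiplicity p b = b'"
      by (subst b'(1)) (use p0 in simp)
    have "p ^ k * (a' * b') = a * b"
      by (subst a'(1), subst b'(1)) (simp add: k[symmetric] power_add)
    then have "a' * b' = m" using ab prime_gt_0_nat[OF assms(1)] by simp
    moreover have "k - multiplicity p a = multiplicity p b" using k by simp
    ultimately show "(case case x of (a, b) \<Rightarrow> (multiplicity p a, a div p ^ multiplicity p a, b div p ^ multiplicity p b) of
      (i, a, b) \<Rightarrow> (p ^ i * a, p ^ (k - i) * b)) = x"
    "(case x of (a, b) \<Rightarrow> (multiplicity p a, a div p ^ multiplicity p a, b div p ^ multiplicity p b))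
      \<in> {..k} \<times> {(a, b). a * b = m}"
      using da db k a'(1) b'(1) by (auto simp del: One_nat_def)
  qed
  show "(\<lambda>(a, b). (multiplicity p a, a div p ^ multiplicity p a, b div p ^ multiplicity p b))
      \<in> {(a, b). a * b = p ^ k * m} \<rightarrow> {..k} \<times> {(a, b). a * b = m}"
    using inv(2) by blast
  show "(case case x of (a, b) \<Rightarrow> (multiplicity p a, a div p ^ multiplicity p a, b div p ^ multiplicity p b) of
      (i, a, b) \<Rightarrow> (p ^ i * a, p ^ (k - i) * b)) = x" if "x \<in> {(a, b). a * b = p ^ k * m}" for x
    using inv(1)[OF that] .
qed

text \<open>Dirichlet convolution is multiplication of Euler factors. Splitting one prime \<open>p\<close> off \<open>n\<close> turns the
convolution sum into the Cauchy product formula for the coefficient at the exponent of \<open>p\<close>, times the same sum for a smaller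
argument.\<close>

lemma dconv_euler_fun:
  assumes C: "fps_nth C 0 = 1" and D: "fps_nth D 0 = 1" and "n > 0"
  shows "dconv (euler_fun C) (euler_fun D) n = euler_fun (C * D) n"
  using \<open>n > 0\<close>
proof (induction n rule: less_induct)
  case (less n)
  show ?case
  proof (cases "n = 1")
    case True
    have "{(a, b). a * b = (1::nat)} = {(1, 1)}" by auto
    then show ?thesis using True by (simp add: dconv_def)
  next
    case False
    then obtain p where p: "prime p" "p dvd n" using prime_factor_nat by blast
    define k where "k = multiplicity p n"
    obtain m where m: "n = p ^ k * m" "\<not> p dvd m" "m > 0"
      unfolding k_def using prime_power_split[OF less.prems p(1)] by blast
    have "k > 0" using p less.prems by (simp add: k_def prime_multiplicity_gt_zero_iff)
    then have "p ^ k > 1" using p(1) using one_less_power[OF prime_gt_1_nat] by blast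
    then have "m < n" using m by simp
    have CD: "fps_nth (C * D) 0 = 1" using C D by simp
    have npd: "\<not> p dvd a" "a > 0" if "a dvd m" for a
      using that m dvd_trans dvd_pos_nat by blast+
    have "dconv (euler_fun C) (euler_fun D) n =
       (\<Sum>(a, b)\<in>{(a, b). a * b = p ^ k * m}. euler_fun C a * euler_fun D b)"
      unfolding dconv_def m(1) ..
    also have "\<dots> = (\<Sum>(i, a, b)\<in>{..k} \<times> {(a, b). a * b = m}. euler_fun C (p ^ i * a) * euler_fun D (p ^ (k - i) * b))"
      by (subst sum.reindex_bij_betw[OF bij_betw_factor_pairs[OF p(1) m(2,3)], symmetric])
         (simp add: case_prod_unfold)
    also have "\<dots> = (\<Sum>(i, a, b)\<in>{..k} \<times> {(a, b). a * b = m}. (fps_nth C i * fps_nth D (k - i)) * (euler_fun C a * euler_fun D b))"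
    proof (intro sum.cong refl, clarify)
      fix i a b assume "m = a * b"
      then have "a dvd m" "b dvd m" by auto
      then show "euler_fun C (p ^ i * a) * euler_fun D (p ^ (k - i) * b) =
         (fps_nth C i * fps_nth D (k - i)) * (euler_fun C a * euler_fun D b)"
        using npd p(1) C D by (simp add: euler_fun_prime_power_mult)
    qed
    also have "\<dots> = (\<Sum>i\<le>k. fps_nth C i * fps_nth D (k - i)) * dconv (euler_fun C) (euler_fun D) m"
      unfolding dconv_def by (simp add: sum.cartesian_product sum_product case_prod_unfold)
    also have "\<dots> = fps_nth (C * D) k * euler_fun (C * D) m"
      using less.IH[OF \<open>m < n\<close> m(3)] by (simp add: fps_mult_nth atLeast0AtMost)
    also have "\<dots> = euler_fun (C * D) n"
      unfolding m(1) by (rule euler_fun_prime_power_mult[OF p(1) m(2,3) CD, symmetric])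
    finally show ?thesis .
  qed
qed

section \<open>Special Euler factors and partial sums\<close>

definition geo_fps :: "real fps" where "geo_fps = Abs_fps (\<lambda>_. 1)"
definition exp_moebius_fps :: "real fps" where
  "exp_moebius_fps = Abs_fps (\<lambda>a. if a = 0 then 1 else of_int (moebius_mu a))"
text \<open>This is the substitution of \<open>X\<^sup>2\<close> for \<open>X\<close>. On arithmetic functions it moves the value at \<open>n\<close> to \<open>n\<^sup>2\<close>, so on Dirichlet
series it replaces \<open>s\<close> by \<open>2s\<close>.\<close>

definition fps_spread :: "real fps \<Rightarrow> real fps" where
  "fps_spread C = Abs_fps (\<lambda>k. if even k then fps_nth C (k div 2) else 0)"

lemma geo_fps_inverse: "geo_fps * (1 - fps_X) = 1"
  by (rule fps_ext) (auto simp: geo_fps_def fps_mult_nth_1 algebra_simps fps_X_mult_nth split: nat.splits)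

lemma nth_one_minus_X: "fps_nth (1 - fps_X :: real fps) k = (if k = 0 then 1 else if k = 1 then -1 else 0)"
  by (auto simp: fps_X_def)

lemma nth_one_plus_X: "fps_nth (1 + fps_X :: real fps) k = (if k \<le> 1 then 1 else 0)"
  by (auto simp: fps_X_def)

lemma euler_fun_geo: "euler_fun geo_fps n = 1"
  by (simp add: euler_fun_def geo_fps_def)

lemma euler_fun_exp_moebius: "euler_fun exp_moebius_fps n = of_int (exp_moebius_mu n)"
  unfolding euler_fun_def exp_moebius_mu_def of_int_prod
  by (intro prod.cong refl) (auto simp: exp_moebius_fps_def prime_factors_multiplicity)

text \<open>The Euler factor of \<open>\<mu>\<close> is \<open>1 - X\<close>, that of the indicator \<open>\<mu>\<^sup>2\<close> of the squarefree numbers is \<open>1 + X\<close>. At \<open>n = 0\<close> the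
empty product gives the value 1 on the left, hence the restriction to positive \<open>n\<close>.\<close>

lemma euler_fun_moebius:
  assumes "n > 0"
  shows "euler_fun (1 - fps_X) n = of_int (moebius_mu n)"
    and "euler_fun (1 + fps_X) n = of_int ((moebius_mu n)\<^sup>2)"
proof -
  have pos: "multiplicity p n > 0" if "p \<in> prime_factors n" for p
    using that by (simp add: prime_factors_multiplicity)
  have "euler_fun (1 - fps_X) n = of_int (moebius_mu n) \<and> euler_fun (1 + fps_X) n = of_int ((moebius_mu n)\<^sup>2)"
  proof (cases "squarefree n")
    case True
    then have "multiplicity p n = 1" if "p \<in> prime_factors n" for p
      using squarefree_factorial_semiring'[of n] assms that by simp
    then show ?thesis using True
      by (simp add: euler_fun_def nth_one_minus_X nth_one_plus_X moebius_mu_def flip: power_mult cong: prod.cong)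
  next
    case False
    then obtain p where p: "p \<in> prime_factors n" "multiplicity p n \<noteq> 1"
      using squarefree_factorial_semiring'[of n] assms by blast
    then have "multiplicity p n > 1" using pos[of p] by auto
    then have "euler_fun (1 - fps_X) n = 0" "euler_fun (1 + fps_X) n = 0"
      unfolding euler_fun_def using p(1)
      by (intro prod_zero bexI[of _ p]; simp add: nth_one_minus_X nth_one_plus_X)+
    then show ?thesis using False by (simp add: moebius_mu_def)
  qed
  then show "euler_fun (1 - fps_X) n = of_int (moebius_mu n)"
    and "euler_fun (1 + fps_X) n = of_int ((moebius_mu n)\<^sup>2)" by simp_all
qed

lemma euler_fun_spread_square:
  assumes "d > 0"
  shows "euler_fun (fps_spread C) (d ^ 2) = euler_fun C d"
proof -
  have "prime_factors (d ^ 2) = prime_factors d"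
    using assms by (auto simp: in_prime_factors_iff prime_dvd_power_iff)
  moreover have "multiplicity p (d ^ 2) = 2 * multiplicity p d" if "p \<in> prime_factors d" for p
    using that assms by (simp add: prime_elem_multiplicity_power_distrib in_prime_factors_iff)
  ultimately show ?thesis
    unfolding euler_fun_def by (simp add: fps_spread_def cong: prod.cong)
qed

lemma euler_fun_spread_nonsquare:
  assumes "n > 0" "\<And>d. n \<noteq> d ^ 2"
  shows "euler_fun (fps_spread C) n = 0"
proof -
  have "\<not> is_nth_power 2 n" using assms(2) by (auto simp: is_nth_power_def)
  then obtain p where p: "prime p" "odd (multiplicity p n)"
    using is_nth_power_conv_multiplicity_nat[of 2 n] by auto
  then have "p \<in> prime_factors n" by (auto simp: prime_factors_multiplicity odd_pos)
  then show ?thesis using p(2)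
    unfolding euler_fun_def by (intro prod_zero) (auto simp: fps_spread_def)
qed

lemma fps_spread_moebius: "fps_spread (1 - fps_X) = 1 - fps_X ^ 2"
  "fps_spread ((1 - fps_X) ^ 2) = (1 - fps_X ^ 2) ^ 2"
proof -
  show "fps_spread (1 - fps_X) = 1 - fps_X ^ 2"
    by (rule fps_ext) (auto simp: fps_spread_def nth_one_minus_X fps_X_power_iff elim!: evenE)
  have 1: "(1 - fps_X :: real fps) ^ 2 = 1 - fps_const 2 * fps_X + fps_X ^ 2"
    by (simp add: power2_eq_square algebra_simps numeral_fps_const[symmetric])
  have 2: "(1 - fps_X ^ 2 :: real fps) ^ 2 = 1 - fps_const 2 * fps_X ^ 2 + fps_X ^ 4"
    by (simp add: power2_eq_square algebra_simps numeral_fps_const[symmetric] power4_eq_xxxx)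
  show "fps_spread ((1 - fps_X) ^ 2) = (1 - fps_X ^ 2) ^ 2"
    unfolding 1 2 by (rule fps_ext) (auto simp: fps_spread_def fps_X_power_iff elim!: evenE)
qed

definition psum :: "(nat \<Rightarrow> real) \<Rightarrow> real \<Rightarrow> real" where
  "psum f x = (\<Sum>n | 1 \<le> n \<and> real n \<le> x. f n)"

lemma finite_nat_le_real [simp]: "finite {n. Suc 0 \<le> n \<and> real n \<le> x}"
  by (rule finite_subset[of _ "{..nat \<lfloor>x\<rfloor>}"]) (auto simp: le_nat_floor)

lemma psum_cong: "(\<And>n. n > 0 \<Longrightarrow> f n = g n) \<Longrightarrow> psum f x = psum g x"
  unfolding psum_def by (rule sum.cong) auto

lemma psum_dconv:
  "psum (dconv f g) x = (\<Sum>m | 1 \<le> m \<and> real m \<le> x. g m * psum f (x / real m))"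
proof -
  let ?N = "{n. 1 \<le> n \<and> real n \<le> x}"
  have "psum (dconv f g) x = (\<Sum>(n, a, b)\<in>Sigma ?N (\<lambda>n. {(a, b). a * b = n}). f a * g b)"
    unfolding psum_def dconv_def
    using finite_factor_pairs
    by (subst sum.Sigma) (auto simp: case_prod_unfold)
  also have "\<dots> = (\<Sum>(m, k)\<in>Sigma ?N (\<lambda>m. {k. 1 \<le> k \<and> real k \<le> x / real m}). g m * f k)"
  proof (rule sum.reindex_bij_witness[where i = "\<lambda>(m, k). (k * m, k, m)" and j = "\<lambda>(n, a, b). (b, a)"])
    fix z assume "z \<in> Sigma ?N (\<lambda>n. {(a, b). a * b = n})"
    then obtain a b where z: "z = (a * b, a, b)" and ab: "1 \<le> a * b" "real (a * b) \<le> x" by auto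
    have pos: "a > 0" "b > 0" using ab(1) by (auto intro!: Nat.gr0I)
    have "b \<le> a * b" using pos by simp
    then have "real b \<le> x" using ab(2) by (meson of_nat_mono order_trans)
    then show "(case z of (n, a, b) \<Rightarrow> (b, a)) \<in> Sigma ?N (\<lambda>m. {k. 1 \<le> k \<and> real k \<le> x / real m})"
      "(case case z of (n, a, b) \<Rightarrow> (b, a) of (m, k) \<Rightarrow> (k * m, k, m)) = z"
      "(case case z of (n, a, b) \<Rightarrow> (b, a) of (m, k) \<Rightarrow> g m * f k) = (case z of (n, a, b) \<Rightarrow> f a * g b)"
      using z ab pos by (auto simp: field_simps)
  next
    fix z assume "z \<in> Sigma ?N (\<lambda>m. {k. 1 \<le> k \<and> real k \<le> x / real m})"
    then show "(case z of (m, k) \<Rightarrow> (k * m, k, m)) \<in> Sigma ?N (\<lambda>n. {(a, b). a * b = n})"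
      "(case case z of (m, k) \<Rightarrow> (k * m, k, m) of (n, a, b) \<Rightarrow> (b, a)) = z"
      by (auto simp: field_simps)
  qed
  also have "\<dots> = (\<Sum>m\<in>?N. g m * psum f (x / real m))"
    unfolding psum_def by (subst sum.Sigma[symmetric]) (auto simp: sum_distrib_left)
  finally show ?thesis .
qed

text \<open>Only the squares \<open>d\<^sup>2\<close> contribute, which is why \<open>d\<close> runs up to \<open>\<surd>x\<close> only.\<close>

lemma psum_dconv_spread:
  "psum (dconv f (euler_fun (fps_spread C))) x =
     (\<Sum>d | 1 \<le> d \<and> real d ^ 2 \<le> x. euler_fun C d * psum f (x / real d ^ 2))"
proof -
  let ?N = "{n. 1 \<le> n \<and> real n \<le> x}" and ?D = "{d. 1 \<le> d \<and> real d ^ 2 \<le> x}"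
  let ?t = "\<lambda>n. euler_fun (fps_spread C) n * psum f (x / real n)"
  have "psum (dconv f (euler_fun (fps_spread C))) x = sum ?t ?N" by (rule psum_dconv)
  also have "\<dots> = sum ?t ((\<lambda>d. d ^ 2) ` ?D)"
  proof (rule sum.mono_neutral_right)
    show "\<forall>i\<in>?N - (\<lambda>d. d\<^sup>2) ` ?D. ?t i = 0"
    proof
      fix i assume i: "i \<in> ?N - (\<lambda>d. d\<^sup>2) ` ?D"
      have "i \<noteq> d ^ 2" for d
      proof
        assume "i = d ^ 2"
        moreover from this i have "d \<in> ?D" by (auto intro!: Nat.gr0I simp: Suc_le_eq)
        ultimately show False using i by blast
      qed
      with i show "?t i = 0" by (simp add: euler_fun_spread_nonsquare)
    qed
  qed auto
  also have "\<dots> = (\<Sum>d\<in>?D. ?t (d ^ 2))"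
    by (subst sum.reindex) (auto intro!: inj_onI simp: power2_eq_iff_nonneg)
  also have "\<dots> = (\<Sum>d\<in>?D. euler_fun C d * psum f (x / real d ^ 2))"
    by (intro sum.cong refl) (simp add: euler_fun_spread_square)
  finally show ?thesis .
qed

section \<open>Absolutely convergent series and Euler products\<close>

lemma abs_summable_on_Times:
  fixes f :: "'a \<Rightarrow> 'c :: {real_normed_field, banach}"
  assumes f: "f norm_summable_on A" and g: "g norm_summable_on B"
  shows "(\<lambda>(a, b). f a * g b) norm_summable_on A \<times> B"
  unfolding Infinite_Sum.abs_summable_on_Sigma_iff
proof (intro conjI ballI)
  show "(\<lambda>b. case (a, b) of (a, b) \<Rightarrow> f a * g b) norm_summable_on B" for a
    using summable_on_cmult_right[OF g, of "norm (f a)"] by (simp add: norm_mult)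
  have "infsum (\<lambda>b. norm (case (a, b) of (a, b) \<Rightarrow> f a * g b)) B = norm (f a) * infsum (\<lambda>b. norm (g b)) B" for a
    by (simp add: norm_mult infsum_cmult_right')
  moreover have "infsum (\<lambda>b. norm (g b)) B \<ge> 0" by (rule infsum_nonneg) simp
  ultimately show "(\<lambda>a. infsum (\<lambda>b. norm (case (a, b) of (a, b) \<Rightarrow> f a * g b)) B) norm_summable_on A"
    using summable_on_cmult_left[OF f, of "infsum (\<lambda>b. norm (g b)) B"] by (simp add: abs_mult)
qed

text \<open>The absolutely convergent double series over all pairs \<open>(a, b)\<close> is regrouped by the product \<open>n = a b\<close>.\<close>

lemma has_sum_dconv:
  fixes f g :: "nat \<Rightarrow> 'a :: {real_normed_field, banach}"
  assumes f: "f norm_summable_on {1..}" and g: "g norm_summable_on {1..}"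
  shows "(dconv f g has_sum (infsum f {1..} * infsum g {1..})) {1..}"
proof -
  let ?h = "\<lambda>(a, b). f a * g b"
  have abs: "?h norm_summable_on {1..} \<times> {1..}"
    using abs_summable_on_Times[OF f g] .
  have 1: "((\<lambda>b. ?h (a, b)) has_sum (f a * infsum g {1..})) {1..}" for a
    using has_sum_cmult_right[OF has_sum_infsum[OF abs_summable_summable[OF g]], of "f a"] by simp
  have 2: "((\<lambda>a. f a * infsum g {1..}) has_sum (infsum f {1..} * infsum g {1..})) {1..}"
    by (rule has_sum_cmult_left[OF has_sum_infsum[OF abs_summable_summable[OF f]]])
  have "(?h has_sum (infsum f {1..} * infsum g {1..})) ({1..} \<times> {1..})"
    by (rule has_sum_SigmaI[OF 1 2]) (rule abs_summable_summable[OF abs])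
  also have "(?h has_sum (infsum f {1..} * infsum g {1..})) ({1..} \<times> {1..}) \<longleftrightarrow>
     ((\<lambda>(n, a, b). f a * g b) has_sum (infsum f {1..} * infsum g {1..})) (Sigma {1..} (\<lambda>n. {(a, b). a * b = n}))"
    by (rule has_sum_reindex_bij_witness[where j = "\<lambda>(a, b). (a * b, a, b)" and i = snd])
       (auto simp: Suc_le_eq)
  finally have "((\<lambda>(n, a, b). f a * g b) has_sum (infsum f {1..} * infsum g {1..})) (Sigma {1..} (\<lambda>n. {(a, b). a * b = n}))" .
  then show ?thesis
  proof (rule has_sum_SigmaD)
    fix n :: nat assume "n \<in> {1..}"
    then have "finite {(a, b). a * b = n}" by (intro finite_factor_pairs) simp
    then have "((\<lambda>(a, b). f a * g b) has_sum dconv f g n) {(a, b). a * b = n}"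
      unfolding dconv_def by (rule has_sum_finite)
    then show "((\<lambda>y. case (n, y) of (n, a, b) \<Rightarrow> f a * g b) has_sum dconv f g n) {(a, b). a * b = n}"
      by simp
  qed
qed

lemma norm_dconv_le:
  fixes f g :: "nat \<Rightarrow> 'a :: {real_normed_field, banach}"
  shows "norm (dconv f g n) \<le> dconv (\<lambda>n. norm (f n)) (\<lambda>n. norm (g n)) n"
  unfolding dconv_def by (rule order_trans[OF norm_sum]) (simp add: norm_mult case_prod_unfold)

lemma abs_summable_dconv:
  fixes f g :: "nat \<Rightarrow> 'a :: {real_normed_field, banach}"
  assumes f: "f norm_summable_on {1..}" and g: "g norm_summable_on {1..}"
  shows "dconv f g norm_summable_on {1..}"
proof (rule Infinite_Sum.abs_summable_on_comparison_test)
  have "dconv (\<lambda>n. norm (f n)) (\<lambda>n. norm (g n)) summable_on {1..}"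
    using has_sum_dconv[of "\<lambda>n. norm (f n)" "\<lambda>n. norm (g n)"] f g
    by (auto simp: summable_on_def)
  moreover have "norm (dconv (\<lambda>n. norm (f n)) (\<lambda>n. norm (g n)) n) = dconv (\<lambda>n. norm (f n)) (\<lambda>n. norm (g n)) n" for n
    unfolding dconv_def real_norm_def by (intro abs_of_nonneg sum_nonneg) auto
  ultimately show "dconv (\<lambda>n. norm (f n)) (\<lambda>n. norm (g n)) norm_summable_on {1..}" by simp
  show "norm (dconv f g n) \<le> norm (dconv (\<lambda>n. norm (f n)) (\<lambda>n. norm (g n)) n)" for n
    using norm_dconv_le[of f g n] by simp
qed

lemma dconv_completely_multiplicative:
  assumes "\<And>a b. a > 0 \<Longrightarrow> b > 0 \<Longrightarrow> w (a * b) = w a * w b" "n > 0"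
  shows "dconv (\<lambda>n. f n * w n) (\<lambda>n. g n * w n) n = dconv f g n * w n"
  unfolding dconv_def sum_distrib_right
proof (intro sum.cong refl, clarify)
  fix a b assume "n = a * b"
  with assms have "w (a * b) = w a * w b" by (auto intro!: assms(1) Nat.gr0I)
  then show "f a * w a * (g b * w b) = f a * g b * w (a * b)" by (simp add: mult_ac)
qed

text \<open>The integers built from the primes in a given set index the expanded finite Euler product.\<close>

definition smooth_nats :: "nat set \<Rightarrow> nat set" where
  "smooth_nats P = {n. n > 0 \<and> prime_factors n \<subseteq> P}"

lemma smooth_nats_empty: "smooth_nats {} = {1}"
  by (auto simp: smooth_nats_def prime_factorization_empty_iff)

lemma bij_betw_smooth_nats_insert:
  assumes "prime p" "p \<notin> P"
  shows "bij_betw (\<lambda>(m, k). p ^ k * m) (smooth_nats P \<times> UNIV) (smooth_nats (insert p P))"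
proof (rule bij_betwI[where g = "\<lambda>n. (n div p ^ multiplicity p n, multiplicity p n)"])
  have p0: "p ^ k > 0" for k using assms(1) by (simp add: prime_gt_0_nat)
  show "(\<lambda>(m, k). p ^ k * m) \<in> smooth_nats P \<times> UNIV \<rightarrow> smooth_nats (insert p P)"
    using assms p0 by (auto simp: smooth_nats_def prime_factors_product prime_factorization_prime_power dest: prime_gt_0_nat split: if_splits)
  show "(case case x of (m, k) \<Rightarrow> p ^ k * m of n \<Rightarrow> (n div p ^ multiplicity p n, multiplicity p n)) = x"
    if x: "x \<in> smooth_nats P \<times> UNIV" for x
  proof -
    obtain m k where [simp]: "x = (m, k)" and m: "m > 0" "prime_factors m \<subseteq> P"
      using x by (auto simp: smooth_nats_def)
    have "\<not> p dvd m" using assms m by (auto simp: in_prime_factors_iff subset_iff)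
    then have "multiplicity p (p ^ k * m) = k" using assms(1) m
      by (simp add: prime_elem_multiplicity_mult_distrib not_dvd_imp_multiplicity_0)
    then show ?thesis using prime_gt_0_nat[OF assms(1)] by simp
  qed
  have split: "n div p ^ multiplicity p n \<in> smooth_nats P \<and> p ^ multiplicity p n * (n div p ^ multiplicity p n) = n"
    if n: "n \<in> smooth_nats (insert p P)" for n
  proof -
    have "n > 0" using n by (auto simp: smooth_nats_def)
    then obtain m where m: "n = p ^ multiplicity p n * m" "\<not> p dvd m" "m > 0"
      using prime_power_split[OF _ assms(1)] by metis
    then have eq: "n div p ^ multiplicity p n = m" using p0 by (metis nonzero_mult_div_cancel_left less_numeral_extra(3))
    have "m dvd n" by (subst m(1)) simp
    then have "prime_factors m \<subseteq> prime_factors n" using \<open>n > 0\<close> by (intro dvd_prime_factors) auto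
    moreover have "p \<notin> prime_factors m" using m(2) by (auto simp: in_prime_factors_iff)
    ultimately show ?thesis using n m eq by (auto simp: smooth_nats_def)
  qed
  show "(\<lambda>n. (n div p ^ multiplicity p n, multiplicity p n)) \<in> smooth_nats (insert p P) \<rightarrow> smooth_nats P \<times> UNIV"
    using split by blast
  show "(case (case n of n \<Rightarrow> (n div p ^ multiplicity p n, multiplicity p n)) of (m, k) \<Rightarrow> p ^ k * m) = n"
    if "n \<in> smooth_nats (insert p P)" for n
    using split[OF that] by simp
qed

text \<open>The Euler product over finitely many primes, by adjoining one prime at a time: every integer built from \<open>P\<close>
and \<open>p\<close> is uniquely \<open>p\<^sup>k m\<close> with \<open>m\<close> built from \<open>P\<close>, so that the series factors.\<close>

lemma has_sum_smooth_nats: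
  fixes f :: "nat \<Rightarrow> real"
  assumes "finite P" "\<And>p. p \<in> P \<Longrightarrow> prime p" "f 1 = 1"
    and mult: "\<And>p k m. prime p \<Longrightarrow> \<not> p dvd m \<Longrightarrow> m > 0 \<Longrightarrow> f (p ^ k * m) = f (p ^ k) * f m"
    and summ: "\<And>p. p \<in> P \<Longrightarrow> summable (\<lambda>k. \<bar>f (p ^ k)\<bar>)"
  shows "f norm_summable_on smooth_nats P \<and> (f has_sum (\<Prod>p\<in>P. \<Sum>k. f (p ^ k))) (smooth_nats P)"
  using assms(1,2,5)
proof (induction P)
  case empty
  show ?case using assms(3) by (auto simp: smooth_nats_empty intro!: has_sum_finiteI)
next
  case (insert p P)
  have p: "prime p" using insert.prems by simp
  have IH: "f norm_summable_on smooth_nats P" "(f has_sum (\<Prod>p\<in>P. \<Sum>k. f (p ^ k))) (smooth_nats P)"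
    using insert.IH insert.prems by auto
  have sk: "(\<lambda>k. f (p ^ k)) norm_summable_on UNIV"
    using insert.prems(2)[of p] by (simp add: summable_on_UNIV_nonneg_real_iff)
  have "((\<lambda>k. f (p ^ k)) has_sum (\<Sum>k. f (p ^ k))) UNIV"
  proof (rule norm_summable_imp_has_sum)
    show "summable (\<lambda>n. norm (f (p ^ n)))" using insert.prems(2)[of p] by simp
    then show "(\<lambda>n. f (p ^ n)) sums (\<Sum>k. f (p ^ k))" by (rule summable_sums[OF summable_norm_cancel])
  qed
  note hk = this
  let ?h = "\<lambda>(m, k). f m * f (p ^ k)"
  have abs: "?h norm_summable_on (smooth_nats P \<times> UNIV)"
    using abs_summable_on_Times[OF IH(1) sk] .
  have hs: "(?h has_sum ((\<Prod>p\<in>P. \<Sum>k. f (p ^ k)) * (\<Sum>k. f (p ^ k)))) (smooth_nats P \<times> UNIV)"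
  proof (rule has_sum_SigmaI)
    show "((\<lambda>m. f m * (\<Sum>k. f (p ^ k))) has_sum ((\<Prod>p\<in>P. \<Sum>k. f (p ^ k)) * (\<Sum>k. f (p ^ k)))) (smooth_nats P)"
      by (rule has_sum_cmult_left[OF IH(2)])
    show "((\<lambda>y. ?h (x, y)) has_sum f x * (\<Sum>k. f (p ^ k))) UNIV" for x
      using has_sum_cmult_right[OF hk, of "f x"] by simp
    show "?h summable_on smooth_nats P \<times> UNIV" by (rule abs_summable_summable[OF abs])
  qed
  have eq: "f ((\<lambda>(m, k). p ^ k * m) z) = ?h z" if z: "z \<in> smooth_nats P \<times> UNIV" for z
  proof -
    obtain m k where [simp]: "z = (m, k)" and m: "m > 0" "prime_factors m \<subseteq> P"
      using z by (auto simp: smooth_nats_def)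
    have "\<not> p dvd m" using m insert.hyps p by (auto simp: in_prime_factors_iff subset_iff)
    then show ?thesis using mult[OF p _ m(1)] by simp
  qed
  note bij = bij_betw_smooth_nats_insert[OF p insert.hyps(2)]
  have "((\<lambda>z. f ((\<lambda>(m, k). p ^ k * m) z)) has_sum ((\<Prod>p\<in>P. \<Sum>k. f (p ^ k)) * (\<Sum>k. f (p ^ k)))) (smooth_nats P \<times> UNIV)"
    by (rule has_sum_cong[OF eq, THEN iffD2, OF _ hs])
  then have "(f has_sum ((\<Prod>p\<in>P. \<Sum>k. f (p ^ k)) * (\<Sum>k. f (p ^ k)))) (smooth_nats (insert p P))"
    by (rule has_sum_reindex_bij_betw[OF bij, THEN iffD1])
  moreover have "f norm_summable_on smooth_nats (insert p P)"
  proof -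
    have "norm (f ((\<lambda>(m, k). p ^ k * m) z)) = norm (?h z)" if "z \<in> smooth_nats P \<times> UNIV" for z
      by (rule arg_cong[OF eq[OF that]])
    then have "(\<lambda>z. norm (f ((\<lambda>(m, k). p ^ k * m) z))) summable_on smooth_nats P \<times> UNIV"
      by (rule summable_on_cong[THEN iffD2, OF _ abs])
    from has_sum_infsum[OF this, unfolded has_sum_reindex_bij_betw[OF bij, of "\<lambda>n. norm (f n)"]]
    show ?thesis by (rule has_sum_imp_summable)
  qed
  moreover have "(\<Prod>q\<in>insert p P. \<Sum>k. f (q ^ k)) = (\<Prod>p\<in>P. \<Sum>k. f (p ^ k)) * (\<Sum>k. f (p ^ k))"
    using insert.hyps by (simp add: mult.commute)
  ultimately show ?case by (simp only: simp_thms)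
qed

lemma finite_nats_subset_smooth_nats:
  assumes "\<And>n. n \<in> F \<Longrightarrow> 0 < n \<and> n < N"
  shows "F \<subseteq> smooth_nats {p. prime p \<and> p < N}"
proof
  fix n assume "n \<in> F"
  then show "n \<in> smooth_nats {p. prime p \<and> p < N}"
  proof -
    have "0 < n" "n < N" using assms[OF \<open>n \<in> F\<close>] by blast+
    moreover have "prime p \<and> p < N" if "p \<in> prime_factors n" for p
    proof -
      have "prime p" "p dvd n" using that by (simp_all only: in_prime_factors_iff)
      moreover have "p \<le> n" by (rule dvd_imp_le[OF \<open>p dvd n\<close> \<open>0 < n\<close>])
      ultimately show ?thesis using \<open>n < N\<close> by linarith
    qed
    ultimately show ?thesis unfolding smooth_nats_def by blast
  qed
qed

text \<open>A finite sum of \<open>\<bar>f(n)\<bar>\<close> is at most the Euler product over all primes below some bound, and this product is at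
most \<open>\<Prod> (1 + b(p)) \<le> exp (\<Sum> b(p))\<close>. Thus only the prime powers need to be controlled.\<close>

lemma abs_summable_euler_criterion:
  fixes f :: "nat \<Rightarrow> real"
  assumes "f 1 = 1"
    and mult: "\<And>p k m. prime p \<Longrightarrow> \<not> p dvd m \<Longrightarrow> m > 0 \<Longrightarrow> f (p ^ k * m) = f (p ^ k) * f m"
    and summ: "\<And>p. prime p \<Longrightarrow> summable (\<lambda>k. \<bar>f (p ^ k)\<bar>)"
    and le: "\<And>p. prime p \<Longrightarrow> (\<Sum>k. \<bar>f (p ^ k)\<bar>) \<le> 1 + b p"
    and b: "summable b" "\<And>p. b p \<ge> 0"
  shows "f norm_summable_on {1..}"
proof (rule nonneg_bdd_above_summable_on)
  show "bdd_above (sum (\<lambda>x. norm (f x)) ` {F. F \<subseteq> {1..} \<and> finite F})"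
  proof (rule bdd_aboveI2)
    fix F :: "nat set" assume F: "F \<in> {F. F \<subseteq> {1..} \<and> finite F}"
    define N where "N = Suc (Max (insert 0 F))"
    have N: "0 < n \<and> n < N" if "n \<in> F" for n
      using F that by (auto simp: N_def less_Suc_eq_le)
    define P where "P = {p. prime p \<and> p < N}"
    have P: "finite P" "\<And>p. p \<in> P \<Longrightarrow> prime p" by (auto simp: P_def)
    have hs: "((\<lambda>n. \<bar>f n\<bar>) has_sum (\<Prod>p\<in>P. \<Sum>k. \<bar>f (p ^ k)\<bar>)) (smooth_nats P)"
      using has_sum_smooth_nats[of P "\<lambda>n. \<bar>f n\<bar>"] P assms(1) mult summ by (simp add: abs_mult)
    have "sum (\<lambda>x. \<bar>f x\<bar>) F \<le> (\<Prod>p\<in>P. \<Sum>k. \<bar>f (p ^ k)\<bar>)"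
    proof (rule has_sum_mono2[OF _ hs])
      show "((\<lambda>x. \<bar>f x\<bar>) has_sum sum (\<lambda>x. \<bar>f x\<bar>) F) F" using F by (intro has_sum_finite) auto
      show "F \<subseteq> smooth_nats P" unfolding P_def by (rule finite_nats_subset_smooth_nats[OF N])
    qed auto
    also have "\<dots> \<le> (\<Prod>p\<in>P. exp (b p))"
    proof (rule prod_mono, safe)
      fix p assume "p \<in> P"
      then have "prime p" using P by blast
      show "0 \<le> (\<Sum>k. \<bar>f (p ^ k)\<bar>)" by (rule suminf_nonneg[OF summ[OF \<open>prime p\<close>]]) simp
      show "(\<Sum>k. \<bar>f (p ^ k)\<bar>) \<le> exp (b p)"
        using le[OF \<open>prime p\<close>] exp_ge_add_one_self[of "b p"] by linarith
    qed
    also have "\<dots> = exp (sum b P)" using P by (simp add: exp_sum)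
    also have "sum b P \<le> suminf b" using b P by (intro sum_le_suminf) auto
    finally show "sum (\<lambda>x. norm (f x)) F \<le> exp (suminf b)" by simp
  qed
qed simp

text \<open>A finite set carrying almost the whole sum lies in the integers composed of the primes below \<open>N\<close>, once \<open>N\<close> is large. The
partial product is the sum over these integers, hence close to the full sum.\<close>

lemma euler_product_tendsto:
  fixes f :: "nat \<Rightarrow> real"
  assumes "f 1 = 1"
    and mult: "\<And>p k m. prime p \<Longrightarrow> \<not> p dvd m \<Longrightarrow> m > 0 \<Longrightarrow> f (p ^ k * m) = f (p ^ k) * f m"
    and summ: "f norm_summable_on {1..}"
  shows "(\<lambda>N. \<Prod>p | prime p \<and> p < N. \<Sum>k. f (p ^ k)) \<longlonglongrightarrow> infsum f {1..}"
proof (rule LIMSEQ_I)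
  fix e :: real assume "e > 0"
  obtain F where F: "finite F" "F \<subseteq> {1..}" "dist (sum f F) (infsum f {1..}) \<le> e / 4" 
    "\<And>F'. finite F' \<Longrightarrow> F \<subseteq> F' \<Longrightarrow> F' \<subseteq> {1..} \<Longrightarrow> dist (sum f F') (infsum f {1..}) \<le> e / 4"
  proof -
    have "(sum f \<longlongrightarrow> infsum f {1..}) (finite_subsets_at_top {1..})"
      by (rule infsum_tendsto[OF abs_summable_summable[OF summ]])
    then have "\<forall>\<^sub>F F in finite_subsets_at_top {1..}. dist (sum f F) (infsum f {1..}) < e / 4"
      using \<open>e > 0\<close> by (intro tendstoD) auto
    then obtain F where F: "finite F" "F \<subseteq> {1..}" "\<forall>F'. finite F' \<and> F \<subseteq> F' \<and> F' \<subseteq> {1..} \<longrightarrow> dist (sum f F') (infsum f {1..}) < e / 4"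
      unfolding eventually_finite_subsets_at_top by auto
    show ?thesis
    proof (rule that[of F])
      show "dist (sum f F) (infsum f {1..}) \<le> e / 4" using F by (intro less_imp_le) blast
      show "dist (sum f F') (infsum f {1..}) \<le> e / 4" if "finite F'" "F \<subseteq> F'" "F' \<subseteq> {1..}" for F'
        using F(3) that by (intro less_imp_le) blast
    qed (fact F)+
  qed
  define N0 where "N0 = Suc (Max (insert 0 F))"
  show "\<exists>N0. \<forall>N\<ge>N0. norm ((\<Prod>p | prime p \<and> p < N. \<Sum>k. f (p ^ k)) - infsum f {1..}) < e"
  proof (intro exI allI impI)
    fix N assume N: "N \<ge> N0"
    define P where "P = {p. prime p \<and> p < N}"
    have P: "finite P" "\<And>p. p \<in> P \<Longrightarrow> prime p" by (auto simp: P_def)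
    have sp: "summable (\<lambda>k. \<bar>f (p ^ k)\<bar>)" if "prime p" for p
    proof -
      have "(\<lambda>n. norm (f n)) summable_on range (\<lambda>k. p ^ k)"
        by (rule summable_on_subset[OF summ]) (use prime_gt_0_nat[OF that] in \<open>auto simp: Suc_le_eq\<close>)
      then have "((\<lambda>n. norm (f n)) \<circ> (\<lambda>k. p ^ k)) summable_on UNIV"
        by (subst (asm) summable_on_reindex) (use prime_gt_1_nat[OF that] in \<open>auto intro!: injI\<close>)
      then show ?thesis by (simp add: summable_on_UNIV_nonneg_real_iff o_def)
    qed
    have hs: "(f has_sum (\<Prod>p\<in>P. \<Sum>k. f (p ^ k))) (smooth_nats P)"
      using has_sum_smooth_nats[of P f] P assms(1) mult sp by simp
    have FP: "F \<subseteq> smooth_nats P" unfolding P_def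
    proof (rule finite_nats_subset_smooth_nats)
      fix n assume "n \<in> F"
      moreover from this have "n \<le> Max (insert 0 F)" using F(1) by simp
      ultimately show "0 < n \<and> n < N" using F(2) N by (auto simp: N0_def)
    qed
    have "dist (\<Prod>p\<in>P. \<Sum>k. f (p ^ k)) (infsum f {1..}) \<le> e / 2"
    proof -
      have "((sum f) \<longlongrightarrow> (\<Prod>p\<in>P. \<Sum>k. f (p ^ k))) (finite_subsets_at_top (smooth_nats P))"
        using hs by (simp add: has_sum_def)
      then have "((\<lambda>F. dist (sum f F) (infsum f {1..})) \<longlongrightarrow> dist (\<Prod>p\<in>P. \<Sum>k. f (p ^ k)) (infsum f {1..})) (finite_subsets_at_top (smooth_nats P))"
        by (intro tendsto_intros)
      then show ?thesis
      proof (rule tendsto_upperbound)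
        show "\<forall>\<^sub>F F' in finite_subsets_at_top (smooth_nats P). dist (sum f F') (infsum f {1..}) \<le> e / 2"
          unfolding eventually_finite_subsets_at_top
        proof (intro exI[of _ F] conjI allI impI)
          fix F' assume "finite F' \<and> F \<subseteq> F' \<and> F' \<subseteq> smooth_nats P"
          then have "dist (sum f F') (infsum f {1..}) \<le> e / 4"
            by (intro F(4)) (auto simp: smooth_nats_def Suc_le_eq)
          then show "dist (sum f F') (infsum f {1..}) \<le> e / 2" using \<open>e > 0\<close> by simp
        qed (use F FP in auto)
      qed simp
    qed
    then show "norm ((\<Prod>p | prime p \<and> p < N. \<Sum>k. f (p ^ k)) - infsum f {1..}) < e"
      using \<open>e > 0\<close> unfolding P_def dist_norm by linarith
  qed
qed

section \<open>Series of Euler functions\<close>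

text \<open>The weights are \<open>1 / n\<^sup>s\<close>, complex for the Dirichlet series and real for the mean value. Complete
multiplicativity is all that the product rule for Euler series uses, so both cases are treated together.\<close>

definition completely_mult :: "(nat \<Rightarrow> 'a::comm_semiring_1) \<Rightarrow> bool" where
  "completely_mult w \<longleftrightarrow> w 1 = 1 \<and> (\<forall>a>0. \<forall>b>0. w (a * b) = w a * w b)"

definition euler_series :: "real fps \<Rightarrow> (nat \<Rightarrow> 'a::{real_normed_field, banach}) \<Rightarrow> 'a" where
  "euler_series C w = infsum (\<lambda>n. of_real (euler_fun C n) * w n) {1..}"

lemma of_real_dconv: "of_real (dconv f g n) = dconv (\<lambda>n. of_real (f n)) (\<lambda>n. of_real (g n)) n"
  by (simp add: dconv_def case_prod_unfold)

lemma euler_series_mult: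
  fixes w :: "nat \<Rightarrow> 'a::{real_normed_field, banach}"
  assumes C: "fps_nth C 0 = 1" and D: "fps_nth D 0 = 1" and w: "completely_mult w"
    and sC: "(\<lambda>n. of_real (euler_fun C n) * w n) norm_summable_on {1..}"
    and sD: "(\<lambda>n. of_real (euler_fun D n) * w n) norm_summable_on {1..}"
  shows "(\<lambda>n. of_real (euler_fun (C * D) n) * w n) norm_summable_on {1..}"
    and "euler_series (C * D) w = euler_series C w * euler_series D w"
proof -
  have eq: "dconv (\<lambda>n. of_real (euler_fun C n) * w n) (\<lambda>n. of_real (euler_fun D n) * w n) n
      = of_real (euler_fun (C * D) n) * w n" if "n \<in> {1..}" for n
  proof -
    have n: "n > 0" using that by simp
    have "dconv (\<lambda>n. of_real (euler_fun C n) * w n) (\<lambda>n. of_real (euler_fun D n) * w n) n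
       = dconv (\<lambda>n. of_real (euler_fun C n)) (\<lambda>n. of_real (euler_fun D n)) n * w n"
      by (rule dconv_completely_multiplicative[OF _ n]) (use w in \<open>auto simp: completely_mult_def\<close>)
    then show ?thesis by (simp add: of_real_dconv[symmetric] dconv_euler_fun[OF C D n])
  qed
  have "dconv (\<lambda>n. of_real (euler_fun C n) * w n) (\<lambda>n. of_real (euler_fun D n) * w n) norm_summable_on {1..}"
    by (rule abs_summable_dconv[OF sC sD])
  then show "(\<lambda>n. of_real (euler_fun (C * D) n) * w n) norm_summable_on {1..}"
    by (rule summable_on_cong[THEN iffD1, rotated]) (simp only: eq)
  have "((\<lambda>n. of_real (euler_fun (C * D) n) * w n) has_sum (euler_series C w * euler_series D w)) {1..}"
    unfolding euler_series_def
    by (rule has_sum_cong[THEN iffD1, OF _ has_sum_dconv[OF sC sD]]) (rule eq)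
  then show "euler_series (C * D) w = euler_series C w * euler_series D w"
    unfolding euler_series_def[of "C * D"] by (rule infsumI)
qed

lemma has_sum_euler_fun_spread:
  fixes G :: "real \<Rightarrow> nat \<Rightarrow> 'b::real_normed_vector"
  assumes G: "((\<lambda>n. G (euler_fun C n) (n ^ 2)) has_sum S) {1..}" "\<And>n. G 0 n = 0"
  shows "((\<lambda>n. G (euler_fun (fps_spread C) n) n) has_sum S) {1..}"
proof -
  have "((\<lambda>n. G (euler_fun (fps_spread C) n) n) \<circ> (\<lambda>d. d ^ 2) has_sum S) {1..}"
    by (rule has_sum_cong[THEN iffD1, OF _ G(1)]) (simp add: euler_fun_spread_square)
  then have "((\<lambda>n. G (euler_fun (fps_spread C) n) n) has_sum S) ((\<lambda>d. d ^ 2) ` {1..})"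
    by (subst has_sum_reindex) (auto intro!: inj_onI simp: power2_eq_iff_nonneg)
  then show ?thesis
  proof (rule has_sum_cong_neutral[THEN iffD1, rotated -1])
    fix n :: nat assume n: "n \<in> {1..} - (\<lambda>d. d\<^sup>2) ` {1..}"
    have "n \<noteq> d ^ 2" for d
    proof
      assume d: "n = d ^ 2"
      then have "d \<in> {1..}" using n by (cases d) auto
      then show False using d n by blast
    qed
    then show "G (euler_fun (fps_spread C) n) n = 0"
      using n G(2) by (simp add: euler_fun_spread_nonsquare)
  qed auto
qed

lemma euler_series_spread:
  fixes w :: "nat \<Rightarrow> 'a::{real_normed_field, banach}"
  assumes "(\<lambda>n. of_real (euler_fun C n) * w (n ^ 2)) norm_summable_on {1..}"
  shows "(\<lambda>n. of_real (euler_fun (fps_spread C) n) * w n) norm_summable_on {1..}"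
    and "euler_series (fps_spread C) w = euler_series C (\<lambda>n. w (n ^ 2))"
proof -
  show "(\<lambda>n. of_real (euler_fun (fps_spread C) n) * w n) norm_summable_on {1..}"
    by (rule has_sum_imp_summable, rule has_sum_euler_fun_spread[where G = "\<lambda>c n. norm (of_real c * w n)"])
       (rule has_sum_infsum[OF assms], simp)
  have "((\<lambda>n. of_real (euler_fun (fps_spread C) n) * w n) has_sum euler_series C (\<lambda>n. w (n ^ 2))) {1..}"
    unfolding euler_series_def
    by (rule has_sum_euler_fun_spread[where G = "\<lambda>c n. of_real c * w n"])
       (rule has_sum_infsum[OF abs_summable_summable[OF assms]], simp)
  then show "euler_series (fps_spread C) w = euler_series C (\<lambda>n. w (n ^ 2))"
    unfolding euler_series_def[of "fps_spread C"] by (rule infsumI)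
qed

lemma has_sum_imp_sums_Suc: "(g has_sum S) {1..} \<Longrightarrow> (\<lambda>n. g (Suc n)) sums S"
proof -
  assume "(g has_sum S) {1..}"
  moreover have "bij_betw Suc UNIV {1..}"
    by (rule bij_betwI[where g = "\<lambda>n. n - 1"]) auto
  ultimately have "((\<lambda>n. g (Suc n)) has_sum S) UNIV"
    by (subst has_sum_reindex_bij_betw[of Suc UNIV "{1..}" g])
  then show ?thesis by (rule has_sum_imp_sums)
qed

lemma norm_summable_on_iff_Suc:
  fixes g :: "nat \<Rightarrow> 'a::real_normed_vector"
  shows "g norm_summable_on {1..} \<longleftrightarrow> summable (\<lambda>n. norm (g (Suc n)))"
proof -
  have bij: "bij_betw Suc UNIV {1..}"
    by (rule bij_betwI[where g = "\<lambda>n. n - 1"]) auto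
  have "g norm_summable_on {1..} \<longleftrightarrow> (\<lambda>n. norm (g (Suc n))) summable_on UNIV"
    unfolding summable_on_def has_sum_reindex_bij_betw[OF bij, of "\<lambda>n. norm (g n)", symmetric] ..
  then show ?thesis by (simp add: summable_on_UNIV_nonneg_real_iff)
qed

lemma completely_mult_powr: "completely_mult (\<lambda>n. 1 / of_nat n powr (s::complex))"
proof -
  have "(of_nat (a * b) :: complex) powr s = of_nat a powr s * of_nat b powr s" for a b
    by (simp add: powr_times_real)
  then show ?thesis by (auto simp: completely_mult_def)
qed

lemma norm_nat_powr: "n > 0 \<Longrightarrow> norm (of_nat n powr (s::complex)) = real n powr Re s"
  by (subst norm_powr_real_powr) auto

lemma dirichlet_series_euler:
  assumes "(\<lambda>n. of_real (euler_fun C n) * (1 / of_nat n powr s :: complex)) norm_summable_on {1..}"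
  shows "(\<lambda>n. of_real (euler_fun C (Suc n)) / of_nat (Suc n) powr s) sums euler_series C (\<lambda>n. 1 / of_nat n powr s)"
    and "dirichlet_series (\<lambda>n. of_real (euler_fun C n)) s = euler_series C (\<lambda>n. 1 / of_nat n powr s)"
proof -
  show 1: "(\<lambda>n. of_real (euler_fun C (Suc n)) / of_nat (Suc n) powr s) sums euler_series C (\<lambda>n. 1 / of_nat n powr s)"
    using has_sum_imp_sums_Suc[OF has_sum_infsum[OF abs_summable_summable[OF assms]]]
    by (simp add: euler_series_def)
  show "dirichlet_series (\<lambda>n. of_real (euler_fun C n)) s = euler_series C (\<lambda>n. 1 / of_nat n powr s)"
    unfolding dirichlet_series_def using 1 by (simp only: sums_iff)
qed

lemma summable_Suc_powr: "a > 1 \<Longrightarrow> summable (\<lambda>n. real (Suc n) powr - a)"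
  using summable_real_powr_iff[of "-a"] by (subst summable_Suc_iff) simp

lemma norm_summable_bounded_euler:
  assumes "\<And>n. \<bar>euler_fun C n\<bar> \<le> 1" "Re s > 1"
  shows "(\<lambda>n. of_real (euler_fun C n) * (1 / of_nat n powr s :: complex)) norm_summable_on {1..}"
  unfolding norm_summable_on_iff_Suc
proof (rule summable_comparison_test')
  show "summable (\<lambda>n. real (Suc n) powr - Re s)" using assms(2) by (rule summable_Suc_powr)
  fix n
  have "norm (of_real (euler_fun C (Suc n)) * (1 / of_nat (Suc n) powr s) :: complex) = \<bar>euler_fun C (Suc n)\<bar> / real (Suc n) powr Re s"
    by (simp add: norm_mult norm_divide norm_nat_powr del: of_nat_Suc)
  also have "\<dots> \<le> 1 / real (Suc n) powr Re s" by (intro divide_right_mono assms(1)) auto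
  finally show "norm (norm (of_real (euler_fun C (Suc n)) * (1 / of_nat (Suc n) powr s) :: complex)) \<le> real (Suc n) powr - Re s"
    by (simp add: powr_minus_divide)
qed

lemma abs_euler_fun_le_1:
  assumes "\<And>k. \<bar>fps_nth C k\<bar> \<le> 1"
  shows "\<bar>euler_fun C n\<bar> \<le> 1"
  unfolding euler_fun_def abs_prod using assms by (intro prod_le_1) auto

text \<open>The power series identity \<open>(1 + X + X\<^sup>2 + \<dots>) (1 - X) = 1\<close> becomes \<open>\<zeta>(s) \<Sum> \<mu>(n) / n\<^sup>s = 1\<close>, and in particular \<open>\<zeta>\<close> has no
zero with \<open>Re s > 1\<close>.\<close>

lemma zeta_euler_series:
  assumes "Re s > 1"
  shows "zeta s = euler_series geo_fps (\<lambda>n. 1 / of_nat n powr s)"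
    and "zeta s * euler_series (1 - fps_X) (\<lambda>n. 1 / of_nat n powr s) = 1"
    and "zeta s \<noteq> 0"
proof -
  have s1: "(\<lambda>n. of_real (euler_fun geo_fps n) * (1 / of_nat n powr s :: complex)) norm_summable_on {1..}"
    by (rule norm_summable_bounded_euler[OF _ assms]) (simp add: euler_fun_geo)
  have s2: "(\<lambda>n. of_real (euler_fun (1 - fps_X) n) * (1 / of_nat n powr s :: complex)) norm_summable_on {1..}"
    by (rule norm_summable_bounded_euler[OF abs_euler_fun_le_1 assms]) (simp add: nth_one_minus_X)
  show z: "zeta s = euler_series geo_fps (\<lambda>n. 1 / of_nat n powr s)"
    using zeta_eq_dirichlet_series[OF assms] dirichlet_series_euler(2)[OF s1]
    by (simp add: euler_fun_geo)
  have "euler_fun 1 n = (if n = 1 then 1 else 0)" if "n > 0" for n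
  proof (cases "n = 1")
    case False
    then obtain p where p: "prime p" "p dvd n" using prime_factor_nat by blast
    then show ?thesis using that False unfolding euler_fun_def
      by (auto intro!: prod_zero bexI[of _ p] simp: in_prime_factors_iff prime_multiplicity_gt_zero_iff)
  qed simp
  then have "((\<lambda>n. of_real (euler_fun 1 n) * (1 / of_nat n powr s :: complex)) has_sum 1) {1..} \<longleftrightarrow>
     ((\<lambda>n. of_real (euler_fun 1 n) * (1 / of_nat n powr s :: complex)) has_sum 1) {1}"
    by (intro has_sum_cong_neutral) auto
  also have "\<dots>" by (rule has_sum_finiteI) auto
  finally have "euler_series 1 (\<lambda>n. 1 / of_nat n powr s) = 1"
    unfolding euler_series_def by (rule infsumI)
  then show m: "zeta s * euler_series (1 - fps_X) (\<lambda>n. 1 / of_nat n powr s) = 1"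
    using euler_series_mult(2)[OF _ _ completely_mult_powr s1 s2] geo_fps_inverse z
    by (simp add: geo_fps_def nth_one_minus_X)
  then show "zeta s \<noteq> 0" by auto
qed

section \<open>The cofactor, the Dirichlet series and the mean value\<close>

text \<open>This is \<open>H(X) (1 - X) / (1 - X\<^sup>2)\<^sup>2\<close> for the Euler factor \<open>H\<close> of \<open>\<mu>\<^sup>(\<^sup>e\<^sup>)\<close>. The division is multiplication by the power series
\<open>1 / (1 - X\<^sup>2)\<close>, taken twice.\<close>

definition cofactor_fps :: "real fps" where
  "cofactor_fps = exp_moebius_fps * (1 - fps_X) * fps_spread geo_fps * fps_spread geo_fps"

lemma fps_spread_geo: "fps_spread geo_fps * (1 - fps_X ^ 2) = 1"
proof -
  have "fps_nth (fps_spread geo_fps * fps_X ^ 2) k = (if k < 2 then 0 else fps_nth (fps_spread geo_fps) (k - 2))" for k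
    by (rule fps_X_power_mult_right_nth)
  then show ?thesis
    by (intro fps_ext) (auto simp: right_diff_distrib fps_spread_def geo_fps_def elim: oddE)
qed

lemma exp_moebius_fps_factorization:
  "exp_moebius_fps = geo_fps * fps_spread ((1 - fps_X) ^ 2) * cofactor_fps"
proof -
  have "geo_fps * fps_spread ((1 - fps_X) ^ 2) * cofactor_fps =
     exp_moebius_fps * (geo_fps * (1 - fps_X)) * (fps_spread geo_fps * (1 - fps_X ^ 2)) ^ 2"
    unfolding cofactor_fps_def fps_spread_moebius by (simp add: power2_eq_square algebra_simps)
  \<comment> \<open>Both brackets are 1.\<close>
  then show ?thesis by (simp add: geo_fps_inverse fps_spread_geo)
qed

lemma moebius_mu_prime: "prime p \<Longrightarrow> moebius_mu p = - 1"
  by (simp add: moebius_mu_def squarefree_prime prime_prime_factors)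

lemma moebius_mu_small: "moebius_mu (Suc 0) = 1" "moebius_mu 2 = -1" "moebius_mu 3 = -1" "moebius_mu 4 = 0"
proof -
  show "moebius_mu (Suc 0) = 1" by (simp add: moebius_mu_def)
  show "moebius_mu 2 = -1" by (rule moebius_mu_prime) simp
  have "prime (3::nat)" by simp
  then show "moebius_mu 3 = -1" by (rule moebius_mu_prime)
  have "\<not> squarefree (4::nat)" by (rule not_squarefreeI[of 2]) auto
  then show "moebius_mu 4 = 0" by (simp add: moebius_mu_def)
qed

text \<open>The reason for the abscissa \<open>1/5\<close>: from \<open>H = 1 + X - X\<^sup>2 - X\<^sup>3 + O(X\<^sup>5)\<close> one gets \<open>H (1 - X) = 1 - 2X\<^sup>2 + X\<^sup>4 + O(X\<^sup>5)\<close>, which agrees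
with \<open>(1 - X\<^sup>2)\<^sup>2\<close> up to \<open>O(X\<^sup>5)\<close>.\<close>

lemma cofactor_nth_small:
  "fps_nth cofactor_fps 0 = 1" "\<And>k. 1 \<le> k \<Longrightarrow> k \<le> 4 \<Longrightarrow> fps_nth cofactor_fps k = 0"
proof -
  define A where "A = exp_moebius_fps * (1 - fps_X)"
  define B where "B = fps_spread geo_fps"
  have A: "fps_nth A 0 = 1" "fps_nth A 1 = 0" "fps_nth A 2 = -2" "fps_nth A 3 = 0" "fps_nth A 4 = 1"
    by (simp_all add: A_def right_diff_distrib exp_moebius_fps_def moebius_mu_small)
  have B: "fps_nth B 0 = 1" "fps_nth B 1 = 0" "fps_nth B 2 = 1" "fps_nth B 3 = 0" "fps_nth B 4 = 1"
    by (simp_all add: B_def fps_spread_def geo_fps_def)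
  define D where "D = B * B"
  have D: "fps_nth D 0 = 1" "fps_nth D 1 = 0" "fps_nth D 2 = 2" "fps_nth D 3 = 0" "fps_nth D 4 = 3"
    using B by (simp_all add: D_def fps_mult_nth numeral_eq_Suc sum.atLeast0_atMost_Suc)
  have eq: "cofactor_fps = A * D" by (simp add: cofactor_fps_def A_def D_def B_def mult.assoc)
  show "fps_nth cofactor_fps 0 = 1" using A D by (simp add: eq)
  fix k :: nat assume "1 \<le> k" "k \<le> 4"
  then consider "k = 1" | "k = 2" | "k = 3" | "k = 4" by linarith
  then show "fps_nth cofactor_fps k = 0" unfolding eq
    by cases (use A D in \<open>simp_all add: fps_mult_nth numeral_eq_Suc sum.atLeast0_atMost_Suc\<close>)
qed

lemma fps_mult_nth_bound:
  fixes C D :: "real fps"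
  assumes "\<And>k. \<bar>fps_nth C k\<bar> \<le> (real k + 1) ^ j" "\<And>k. \<bar>fps_nth D k\<bar> \<le> 1"
  shows "\<bar>fps_nth (C * D) k\<bar> \<le> (real k + 1) ^ Suc j"
proof -
  have "\<bar>fps_nth (C * D) k\<bar> \<le> (\<Sum>i=0..k. \<bar>fps_nth C i * fps_nth D (k - i)\<bar>)"
    unfolding fps_mult_nth by (rule sum_abs)
  also have "\<dots> \<le> (\<Sum>i=0..k. (real k + 1) ^ j * 1)"
    unfolding abs_mult
  proof (intro sum_mono mult_mono assms(2))
    fix i assume "i \<in> {0..k}"
    then show "\<bar>fps_nth C i\<bar> \<le> (real k + 1) ^ j"
      by (intro order_trans[OF assms(1)] power_mono) auto
  qed auto
  finally show ?thesis by (simp add: add.commute)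
qed

text \<open>Each of the three factors applied to \<open>H\<close> has bounded coefficients, and each multiplication costs one factor \<open>k + 1\<close>.\<close>

lemma cofactor_nth_bound: "\<bar>fps_nth cofactor_fps k\<bar> \<le> (real k + 1) ^ 3"
proof -
  have "\<bar>fps_nth exp_moebius_fps k\<bar> \<le> (real k + 1) ^ 0" for k
    using abs_moebius_mu_le[of k] by (simp add: exp_moebius_fps_def flip: of_int_abs)
  from fps_mult_nth_bound[OF this, of "1 - fps_X"]
  have 1: "\<bar>fps_nth (exp_moebius_fps * (1 - fps_X)) k\<bar> \<le> (real k + 1) ^ 1" for k
    by (simp add: nth_one_minus_X)
  have sp: "\<bar>fps_nth (fps_spread geo_fps) k\<bar> \<le> 1" for k by (simp add: fps_spread_def geo_fps_def)
  show ?thesis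
    using fps_mult_nth_bound[OF fps_mult_nth_bound[OF 1 sp] sp, of k]
    by (simp add: cofactor_fps_def numeral_3_eq_3)
qed

lemma summable_cubes_times_power:
  assumes "0 < q" "q < (1::real)"
  shows "summable (\<lambda>k. (real k + c) ^ 3 * q ^ k)"
proof (rule summable_comparison_test_bigo)
  define r where "r = (1 + q) / 2"
  have r: "0 < r" "q < r" "r < 1" using assms by (auto simp: r_def)
  show "summable (\<lambda>k. norm (r ^ k))" using r by (simp add: summable_geometric)
  have "(\<lambda>k. (real k + c) ^ 3 * (q / r) ^ k) \<longlonglongrightarrow> 0"
  proof -
    have *: "(\<lambda>k. (real k + c) ^ 3 * t ^ k) \<longlonglongrightarrow> 0" if "0 < t" "t < 1" for t :: real
      using that by real_asymp
    show ?thesis by (rule *) (use r assms in auto)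
  qed
  then have "(\<lambda>k. (real k + c) ^ 3 * (q / r) ^ k) \<in> O(\<lambda>_. 1)"
    by (intro bigoI_tendsto[where c = 0]) auto
  then have "(\<lambda>k. (real k + c) ^ 3 * (q / r) ^ k * r ^ k) \<in> O(\<lambda>k. 1 * r ^ k)"
    by (intro landau_o.big.mult) auto
  then show "(\<lambda>k. (real k + c) ^ 3 * q ^ k) \<in> O(\<lambda>k. r ^ k)"
    using r by (simp add: power_divide)
qed

text \<open>Since the coefficients of \<open>X, \<dots>, X\<^sup>4\<close> vanish and the others grow polynomially, the part of the Euler
factor beyond 1 is \<open>O(p\<^sup>-\<^sup>5\<^sup>\<sigma>)\<close>, which is summable over \<open>p\<close> exactly when \<open>5\<sigma> > 1\<close>.\<close>

lemma norm_summable_cofactor: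
  assumes "\<sigma> > 1 / 5"
  shows "(\<lambda>n. euler_fun cofactor_fps n * real n powr - \<sigma>) norm_summable_on {1..}"
proof (rule abs_summable_euler_criterion)
  define Q where "Q = (2::real) powr - \<sigma>"
  have Q: "0 < Q" "Q < 1" using assms by (auto simp: Q_def powr_less_one)
  \<comment> \<open>As \<open>p \<ge> 2\<close>, the coefficient of \<open>X\<^sup>k\<^sup>+\<^sup>5\<close> enters with a weight of at most \<open>p\<^sup>-\<^sup>5\<^sup>\<sigma>\<close> times \<open>Q\<^sup>k\<close>.\<close>
  define K where "K = (\<Sum>k. (real k + 6) ^ 3 * Q ^ k)"
  define b where "b p = K * real p powr - (5 * \<sigma>)" for p
  have sK: "summable (\<lambda>k. (real k + 6) ^ 3 * Q ^ k)" by (rule summable_cubes_times_power[OF Q])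
  have K0: "K \<ge> 0" unfolding K_def using Q by (intro suminf_nonneg sK) auto
  show "euler_fun cofactor_fps 1 * real 1 powr - \<sigma> = 1" by simp
  have c0: "fps_nth cofactor_fps 0 = 1" by (rule cofactor_nth_small)
  show "euler_fun cofactor_fps (p ^ k * m) * real (p ^ k * m) powr - \<sigma> =
      euler_fun cofactor_fps (p ^ k) * real (p ^ k) powr - \<sigma> * (euler_fun cofactor_fps m * real m powr - \<sigma>)"
    if "prime p" "\<not> p dvd m" "m > 0" for p k m
    using that c0 by (simp add: euler_fun_prime_power_mult euler_fun_prime_power powr_mult)
  have main: "summable (\<lambda>k. \<bar>euler_fun cofactor_fps (p ^ k) * real (p ^ k) powr - \<sigma>\<bar>) \<and>
     (\<Sum>k. \<bar>euler_fun cofactor_fps (p ^ k) * real (p ^ k) powr - \<sigma>\<bar>) \<le> 1 + b p" if p: "prime p" for p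
  proof -
    define q where "q = real p powr - \<sigma>"
    have p2: "real p \<ge> 2" using prime_ge_2_nat[OF p] by simp
    have q: "0 < q" "q \<le> Q" using p2 assms unfolding q_def Q_def
      using powr_mono2'[of "- \<sigma>" 2 "real p"] by auto
    let ?f = "\<lambda>k. \<bar>euler_fun cofactor_fps (p ^ k) * real (p ^ k) powr - \<sigma>\<bar>"
    have f: "?f k = \<bar>fps_nth cofactor_fps k\<bar> * q ^ k" for k
    proof -
      have "real (p ^ k) powr - \<sigma> = (real p powr real k) powr - \<sigma>"
        using p2 by (simp add: powr_realpow)
      also have "\<dots> = q ^ k" using p2 unfolding q_def
        by (simp add: powr_powr powr_power mult.commute)
      finally have "real (p ^ k) powr - \<sigma> = q ^ k" .
      then show ?thesis using p c0 q by (simp add: euler_fun_prime_power abs_mult)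
    qed
    have le: "?f (k + 5) \<le> q ^ 5 * ((real k + 6) ^ 3 * Q ^ k)" for k
    proof -
      have "?f (k + 5) \<le> (real (k + 5) + 1) ^ 3 * q ^ (k + 5)"
        unfolding f using q by (intro mult_right_mono cofactor_nth_bound) auto
      also have "\<dots> = q ^ 5 * ((real k + 6) ^ 3 * q ^ k)" by (simp add: power_add add_ac)
      also have "\<dots> \<le> q ^ 5 * ((real k + 6) ^ 3 * Q ^ k)"
        using q by (intro mult_left_mono power_mono) auto
      finally show ?thesis .
    qed
    have s5: "summable (\<lambda>k. q ^ 5 * ((real k + 6) ^ 3 * Q ^ k))" by (rule summable_mult[OF sK])
    have sf5: "summable (\<lambda>k. ?f (k + 5))"
      by (rule summable_comparison_test'[OF s5]) (use le in simp)
    then have sf: "summable ?f" by (subst (asm) summable_iff_shift[of ?f])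
    have "(\<Sum>k. ?f k) = (\<Sum>k. ?f (k + 5)) + (\<Sum>k<5. ?f k)"
      by (rule suminf_split_initial_segment[OF sf])
    also have "(\<Sum>k<5. ?f k) = (\<Sum>k\<in>{0}. ?f k)"
    proof (rule sum.mono_neutral_right)
      show "\<forall>i\<in>{..<5} - {0}. ?f i = 0" unfolding f using cofactor_nth_small(2) by auto
    qed auto
    also have "\<dots> = 1" unfolding f using c0 by simp
    also have "(\<Sum>k. ?f (k + 5)) \<le> (\<Sum>k. q ^ 5 * ((real k + 6) ^ 3 * Q ^ k))"
      by (rule suminf_le[OF le sf5 s5])
    also have "\<dots> = q ^ 5 * K" unfolding K_def by (rule suminf_mult[OF sK])
    also have "\<dots> = b p" using p2 by (simp add: b_def q_def powr_power mult.commute)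
    finally show ?thesis using sf by simp
  qed
  show "summable (\<lambda>k. \<bar>euler_fun cofactor_fps (p ^ k) * real (p ^ k) powr - \<sigma>\<bar>)" if "prime p" for p
    using main[OF that] by blast
  show "(\<Sum>k. \<bar>euler_fun cofactor_fps (p ^ k) * real (p ^ k) powr - \<sigma>\<bar>) \<le> 1 + b p" if "prime p" for p
    using main[OF that] by blast
  show "summable b" unfolding b_def
    using assms by (intro summable_mult) (simp add: summable_real_powr_iff)
  show "b p \<ge> 0" for p using K0 by (simp add: b_def)
qed

lemma norm_summable_cofactor_complex:
  assumes "Re s > 1 / 5"
  shows "(\<lambda>n. of_real (euler_fun cofactor_fps n) * (1 / of_nat n powr s :: complex)) norm_summable_on {1..}"
proof -
  have "norm (of_real (euler_fun cofactor_fps n) * (1 / of_nat n powr s :: complex)) =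
     norm (euler_fun cofactor_fps n * real n powr - Re s)" if "n \<in> {1..}" for n
    using that by (simp add: norm_mult norm_divide norm_nat_powr powr_minus_divide abs_mult)
  then show ?thesis by (rule summable_on_cong[THEN iffD2, OF _ norm_summable_cofactor[OF assms]])
qed

theorem exp_moebius_dirichlet_series:
  assumes "Re s > 1"
  shows "(\<lambda>n. of_int (exp_moebius_mu (Suc n)) / of_nat (Suc n) powr s) sums
     (zeta s / (zeta (2 * s))\<^sup>2 * dirichlet_series (\<lambda>n. of_real (euler_fun cofactor_fps n)) s)"
proof -
  let ?w = "\<lambda>n. 1 / of_nat n powr s :: complex" and ?w2 = "\<lambda>n. 1 / of_nat n powr (2 * s) :: complex"
  note w = completely_mult_powr[of s]
  have w2: "?w (n ^ 2) = ?w2 n" for n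
  proof -
    have "(of_nat (n ^ 2) :: complex) powr s = of_nat n powr s * of_nat n powr s"
      by (simp add: powr_times_real power2_eq_square)
    then show ?thesis by (simp add: powr_add[symmetric])
  qed
  have s2: "Re (2 * s) > 1" using assms by simp
  have m2: "(\<lambda>n. of_real (euler_fun (1 - fps_X) n) * ?w2 n) norm_summable_on {1..}"
    by (rule norm_summable_bounded_euler[OF abs_euler_fun_le_1 s2]) (simp add: nth_one_minus_X)
  have sp: "(\<lambda>n. of_real (euler_fun (1 - fps_X ^ 2) n) * ?w n) norm_summable_on {1..}"
      "euler_series (1 - fps_X ^ 2) ?w = euler_series (1 - fps_X) ?w2"
    using euler_series_spread[of "1 - fps_X" ?w, unfolded fps_spread_moebius w2, OF m2] by simp_all
  have g0: "fps_nth geo_fps 0 = 1" "fps_nth (1 - fps_X ^ 2 :: real fps) 0 = 1"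
    by (simp_all add: geo_fps_def fps_X_power_iff)
  have g: "(\<lambda>n. of_real (euler_fun geo_fps n) * ?w n) norm_summable_on {1..}"
    by (rule norm_summable_bounded_euler[OF _ assms]) (simp add: euler_fun_geo)
  have c0: "fps_nth cofactor_fps 0 = 1" by (rule cofactor_nth_small)
  have s5: "Re s > 1 / 5" using assms by simp
  note c = norm_summable_cofactor_complex[OF s5]
  note p1 = euler_series_mult[OF g0(2) g0(2) w sp(1) sp(1)]
  have g1: "fps_nth ((1 - fps_X ^ 2) * (1 - fps_X ^ 2) :: real fps) 0 = 1" using g0 by simp
  note p2 = euler_series_mult[OF g0(1) g1 w g p1(1)]
  have g2: "fps_nth (geo_fps * ((1 - fps_X ^ 2) * (1 - fps_X ^ 2))) 0 = 1" using g0 by simp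
  note p3 = euler_series_mult[OF g2 c0 w p2(1) c]
  have H: "exp_moebius_fps = geo_fps * ((1 - fps_X ^ 2) * (1 - fps_X ^ 2)) * cofactor_fps"
    using exp_moebius_fps_factorization by (simp add: fps_spread_moebius power2_eq_square[of "1 - fps_X\<^sup>2"])
  have "euler_series (1 - fps_X) ?w2 = 1 / zeta (2 * s)"
    using zeta_euler_series(2,3)[OF s2] by (simp add: field_simps)
  then have "euler_series exp_moebius_fps ?w = zeta s / (zeta (2 * s))\<^sup>2 * euler_series cofactor_fps ?w"
    unfolding H p3(2) p2(2) p1(2) sp(2) zeta_euler_series(1)[OF assms] by (simp add: power2_eq_square)
  moreover have "(\<lambda>n. of_real (euler_fun exp_moebius_fps (Suc n)) / of_nat (Suc n) powr s) sums euler_series exp_moebius_fps ?w"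
    using dirichlet_series_euler(1)[OF p3(1)] H by simp
  ultimately show ?thesis
    using dirichlet_series_euler(2)[OF c] by (simp add: euler_fun_exp_moebius)
qed

text \<open>At \<open>s = 1\<close> the factor \<open>1 - X\<close> cancels the pole of \<open>\<zeta>\<close>: with \<open>A = H (1 - X) = (1 - X\<^sup>2)\<^sup>2 U\<close> the Euler factor of \<open>A\<close> at \<open>p\<close> is
the one in the definition of the mean value, because the coefficient of \<open>X\<^sup>a\<close> in \<open>A\<close> is \<open>\<mu>(a) - \<mu>(a - 1)\<close> for \<open>a \<ge> 2\<close> and 0 for \<open>a = 1\<close>.\<close>

lemma exp_moebius_mean_eq:
  "exp_moebius_mean = euler_series ((1 - fps_X) ^ 2) (\<lambda>n. 1 / real n ^ 2) * euler_series cofactor_fps (\<lambda>n. 1 / real n)"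
  and norm_summable_mu_mu: "(\<lambda>n. euler_fun ((1 - fps_X) ^ 2) n * (1 / real n ^ 2)) norm_summable_on {1..}"
  and euler_series_mu_mu: "euler_series ((1 - fps_X) ^ 2) (\<lambda>n. 1 / real n ^ 2) = (euler_series (1 - fps_X) (\<lambda>n. 1 / real n ^ 2))\<^sup>2"
proof -
  let ?w = "\<lambda>n. 1 / real n" and ?w2 = "\<lambda>n. 1 / real n ^ 2"
  have w: "completely_mult ?w" "completely_mult ?w2"
    by (auto simp: completely_mult_def power_mult_distrib)
  have X0: "fps_nth (1 - fps_X :: real fps) 0 = 1" by (simp add: nth_one_minus_X)
  have "(\<lambda>n. of_real (euler_fun (1 - fps_X) n) * ?w2 n) norm_summable_on {1..}"
    unfolding norm_summable_on_iff_Suc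
  proof (rule summable_comparison_test')
    show "summable (\<lambda>n. inverse (real (Suc n) ^ 2))"
      using inverse_power_summable[of 2, where 'a = real] by (subst summable_Suc_iff) auto
    fix n
    have "\<bar>euler_fun (1 - fps_X) (Suc n)\<bar> \<le> 1"
      by (rule abs_euler_fun_le_1) (simp add: nth_one_minus_X)
    then show "norm (norm (of_real (euler_fun (1 - fps_X) (Suc n)) * ?w2 (Suc n))) \<le> inverse (real (Suc n) ^ 2)"
      by (simp add: abs_mult divide_inverse mult_left_le_one_le del: of_nat_Suc)
  qed
  note m = euler_series_mult[OF X0 X0 w(2) this this]
  then show mm: "(\<lambda>n. euler_fun ((1 - fps_X) ^ 2) n * (1 / real n ^ 2)) norm_summable_on {1..}"
    and "euler_series ((1 - fps_X) ^ 2) ?w2 = (euler_series (1 - fps_X) ?w2)\<^sup>2"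
    by (simp_all add: power2_eq_square)
  have sp: "(\<lambda>n. of_real (euler_fun ((1 - fps_X ^ 2) ^ 2) n) * ?w n) norm_summable_on {1..}"
      "euler_series ((1 - fps_X ^ 2) ^ 2) ?w = euler_series ((1 - fps_X) ^ 2) ?w2"
    using euler_series_spread[of "(1 - fps_X) ^ 2" ?w, unfolded fps_spread_moebius] mm by simp_all
  have c: "(\<lambda>n. of_real (euler_fun cofactor_fps n) * ?w n) norm_summable_on {1..}"
    by (rule summable_on_cong[THEN iffD1, OF _ norm_summable_cofactor[of 1]])
       (simp_all add: powr_minus_divide)
  have c0: "fps_nth cofactor_fps 0 = 1" by (rule cofactor_nth_small)
  have g0: "fps_nth ((1 - fps_X ^ 2) ^ 2 :: real fps) 0 = 1" by (simp add: fps_X_power_iff fps_power_zeroth)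
  define A where "A = (1 - fps_X ^ 2) ^ 2 * cofactor_fps"
  note pr = euler_series_mult[OF g0 c0 w(1) sp(1) c, folded A_def]
  have A: "A = exp_moebius_fps * (1 - fps_X)"
  proof -
    have "A = exp_moebius_fps * (1 - fps_X) * (fps_spread geo_fps * (1 - fps_X ^ 2)) ^ 2"
      unfolding A_def cofactor_fps_def by (simp add: power2_eq_square algebra_simps)
    then show ?thesis by (simp add: fps_spread_geo)
  qed
  have A0: "fps_nth A 0 = 1" using g0 c0 by (simp add: A_def)
  define f where "f n = euler_fun A n * ?w n" for n
  have f: "f norm_summable_on {1..}" using pr(1) by (simp add: f_def)
  have lim: "(\<lambda>N. \<Prod>p | prime p \<and> p < N. \<Sum>k. f (p ^ k)) \<longlonglongrightarrow> infsum f {1..}"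
  proof (rule euler_product_tendsto[OF _ _ f])
    show "f 1 = 1" by (simp add: f_def)
    show "f (p ^ k * m) = f (p ^ k) * f m" if "prime p" "\<not> p dvd m" "m > 0" for p k m
      using that A0 by (simp add: f_def euler_fun_prime_power_mult euler_fun_prime_power)
  qed
  have fac: "(\<Sum>k. f (p ^ k)) = exp_moebius_factor p" if p: "prime p" for p
  proof -
    have fk: "f (p ^ k) = fps_nth A k / real p ^ k" for k
      using p A0 by (simp add: f_def euler_fun_prime_power)
    have Ak: "fps_nth A (a + 2) = of_int (moebius_mu (a + 2) - moebius_mu (a + 1))" for a
      by (simp add: A right_diff_distrib exp_moebius_fps_def)
    have A1: "fps_nth A 1 = 0" by (simp add: A right_diff_distrib exp_moebius_fps_def moebius_mu_small)
    have "summable (\<lambda>k. f (p ^ (k + 2)))"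
      unfolding fk Ak by (rule summable_exp_moebius_factor(1)[OF p])
    then have "summable (\<lambda>k. f (p ^ k))" by (subst (asm) summable_iff_shift[of "\<lambda>k. f (p ^ k)" 2])
    then have "(\<Sum>k. f (p ^ k)) = (\<Sum>k. f (p ^ (k + 2))) + (\<Sum>k<2. f (p ^ k))"
      by (rule suminf_split_initial_segment)
    also have "(\<Sum>k<2. f (p ^ k)) = 1" using A0 A1 by (simp add: fk numeral_2_eq_2)
    finally show ?thesis unfolding fk Ak exp_moebius_factor_def by simp
  qed
  let ?g = "\<lambda>p. if prime p then exp_moebius_factor p else 1"
  have "(\<lambda>n. \<Prod>p\<le>n. ?g p) \<longlonglongrightarrow> exp_moebius_mean"
    unfolding exp_moebius_mean_def
    by (rule convergent_prod_LIMSEQ[OF abs_convergent_prod_imp_convergent_prod[OF abs_convergent_prod_exp_moebius_mean]])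
  moreover have "(\<Prod>p\<le>n. ?g p) = (\<Prod>p | prime p \<and> p < Suc n. \<Sum>k. f (p ^ k))" for n
  proof -
    have "(\<Prod>p\<le>n. ?g p) = (\<Prod>p | prime p \<and> p < Suc n. ?g p)"
      by (rule prod.mono_neutral_right) auto
    then show ?thesis by (simp add: fac)
  qed
  ultimately have "(\<lambda>n. \<Prod>p | prime p \<and> p < Suc n. \<Sum>k. f (p ^ k)) \<longlonglongrightarrow> exp_moebius_mean" by simp
  from LIMSEQ_unique[OF this LIMSEQ_Suc[OF lim]]
  have "exp_moebius_mean = infsum f {1..}" .
  also have "\<dots> = euler_series A ?w"
    unfolding euler_series_def by (rule infsum_cong) (simp add: f_def)
  finally show "exp_moebius_mean = euler_series ((1 - fps_X) ^ 2) ?w2 * euler_series cofactor_fps ?w"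
    by (simp add: pr(2) sp(2))
qed

section \<open>Hyperbola estimates for squares\<close>

lemma nat_le_real_set: "{n. 1 \<le> n \<and> real n \<le> x} = {1..nat \<lfloor>x\<rfloor>}"
proof -
  have "real n \<le> x \<longleftrightarrow> n \<le> nat \<lfloor>x\<rfloor>" if "1 \<le> n" for n
    using that by (auto simp: le_nat_floor) linarith
  then show ?thesis by auto
qed

lemma psum_eq: "psum f x = sum f {1..nat \<lfloor>x\<rfloor>}"
  unfolding psum_def nat_le_real_set ..

text \<open>Partial summation for the tail of \<open>\<Sum> g(d) / d\<^sup>2\<close>; the weights \<open>1 / d\<^sup>2\<close> turn the bound \<open>\<delta> n\<close> for the sums
of \<open>g\<close> into \<open>\<delta> \<Sum> 1 / d\<^sup>2\<close>, which is \<open>O(\<delta> / Y)\<close>.\<close>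

lemma sum_weighted_squares_tail:
  fixes g :: "nat \<Rightarrow> real"
  assumes G: "\<And>n. n \<ge> Y \<Longrightarrow> \<bar>sum g {1..n}\<bar> \<le> \<delta> * real n" and Y: "Y \<ge> 1" and L: "((\<lambda>d. g d / real d ^ 2) has_sum L) {1..}"
  shows "\<bar>(\<Sum>d=1..Y. g d / real d ^ 2) - L\<bar> \<le> 4 * \<delta> / real Y"
proof -
  define S where "S Z = (\<Sum>d=1..Z. g d / real d ^ 2)" for Z
  define G where "G n = sum g {1..n}" for n
  note G' = assms(1)[folded G_def]
  have d0: "\<delta> \<ge> 0"
    using order_trans[OF abs_ge_zero G'[OF le_refl]] Y by (simp add: zero_le_mult_iff)
  \<comment> \<open>Partial summation with both boundary terms moved to the left.\<close>
  have claim: "\<bar>S Z - S Y - G Z / real Z ^ 2 + G Y / real Y ^ 2\<bar> \<le> 2 * \<delta> * (1 / real Y - 1 / real Z)" if "Z \<ge> Y" for Z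
    using that
  proof (induction Z rule: dec_induct)
    case (step Z)
    have Z: "real Z \<ge> 1" using step Y by simp
    have "S (Suc Z) - G (Suc Z) / real (Suc Z) ^ 2 = S Z - G Z / real (Suc Z) ^ 2"
      by (simp add: S_def G_def add_divide_distrib)
    then have "S (Suc Z) - S Y - G (Suc Z) / real (Suc Z) ^ 2 + G Y / real Y ^ 2 =
       (S Z - S Y - G Z / real Z ^ 2 + G Y / real Y ^ 2) + G Z * (1 / real Z ^ 2 - 1 / real (Suc Z) ^ 2)"
      by (simp add: algebra_simps)
    also have "\<bar>\<dots>\<bar> \<le> 2 * \<delta> * (1 / real Y - 1 / real Z) + \<bar>G Z * (1 / real Z ^ 2 - 1 / real (Suc Z) ^ 2)\<bar>"
      by (rule order_trans[OF abs_triangle_ineq]) (use step.IH in simp)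
    also have "\<bar>G Z * (1 / real Z ^ 2 - 1 / real (Suc Z) ^ 2)\<bar> \<le> (\<delta> * real Z) * (2 / (real Z ^ 2 * (real Z + 1)))"
      unfolding abs_mult
    proof (rule mult_mono)
      have "1 / real Z ^ 2 - 1 / real (Suc Z) ^ 2 = (2 * real Z + 1) / (real Z ^ 2 * (real Z + 1) ^ 2)"
        using Z by (simp add: divide_simps add.commute) (simp add: power2_eq_square algebra_simps)
      also have "\<dots> \<le> (2 * (real Z + 1)) / (real Z ^ 2 * (real Z + 1) ^ 2)"
        by (intro divide_right_mono) auto
      also have "\<dots> = 2 / (real Z ^ 2 * (real Z + 1))" using Z by (subst frac_eq_eq) (auto simp: power2_eq_square)
      finally have "1 / real Z ^ 2 - 1 / real (Suc Z) ^ 2 \<le> 2 / (real Z ^ 2 * (real Z + 1))" .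
      moreover have "1 / real (Suc Z) ^ 2 \<le> 1 / real Z ^ 2"
        using Z by (intro divide_left_mono power_mono mult_pos_pos zero_less_power) auto
      ultimately show "\<bar>1 / (real Z)\<^sup>2 - 1 / (real (Suc Z))\<^sup>2\<bar> \<le> 2 / (real Z ^ 2 * (real Z + 1))"
        by linarith
      show "\<bar>G Z\<bar> \<le> \<delta> * real Z" by (rule G') (use step in simp)
    qed (use d0 in auto)
    also have "(\<delta> * real Z) * (2 / (real Z ^ 2 * (real Z + 1))) = 2 * \<delta> * (1 / real Z - 1 / real (Suc Z))"
    proof -
      have "1 / real Z - 1 / real (Suc Z) = 1 / (real Z * (real Z + 1))" using Z by (simp add: field_simps)
      moreover have "real Z * (2 / (real Z ^ 2 * (real Z + 1))) = 2 / (real Z * (real Z + 1))"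
        using Z by (simp add: power2_eq_square)
      ultimately show ?thesis by (simp only: mult.assoc[of \<delta>]) simp
    qed
    also have "2 * \<delta> * (1 / real Y - 1 / real Z) + 2 * \<delta> * (1 / real Z - 1 / real (Suc Z)) = 2 * \<delta> * (1 / real Y - 1 / real (Suc Z))"
      by (simp only: distrib_left[symmetric]) simp
    finally show ?case by simp
  qed simp
  have fin: "\<bar>S Y - S Z\<bar> \<le> 4 * \<delta> / real Y" if Z: "Z \<ge> Y" for Z
  proof -
    have G2: "\<bar>G n / real n ^ 2\<bar> \<le> \<delta> / real Y" if "n \<ge> Y" for n
    proof -
      have "\<bar>G n / real n ^ 2\<bar> \<le> (\<delta> * real n) / real n ^ 2"
        using G'[OF that] by (simp add: abs_divide divide_right_mono)
      also have "\<dots> = \<delta> / real n" using that Y by (simp add: power2_eq_square)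
      also have "\<dots> \<le> \<delta> / real Y" using that Y d0 by (intro divide_left_mono) auto
      finally show ?thesis .
    qed
    have "2 * \<delta> * (1 / real Y - 1 / real Z) = 2 * (\<delta> / real Y) - 2 * (\<delta> / real Z)"
      by (simp add: right_diff_distrib)
    moreover have "\<delta> / real Z \<ge> 0" using d0 by simp
    ultimately have "\<bar>S Z - S Y - G Z / real Z ^ 2 + G Y / real Y ^ 2\<bar> \<le> 2 * (\<delta> / real Y)"
      using claim[OF Z] by linarith
    moreover have "4 * \<delta> / real Y = 4 * (\<delta> / real Y)" by simp
    ultimately show ?thesis using G2[OF Z] G2[OF le_refl] by linarith
  qed
  have "(\<lambda>n. \<Sum>d<n. g (Suc d) / real (Suc d) ^ 2) \<longlonglongrightarrow> L"
    using has_sum_imp_sums_Suc[OF L] by (simp add: sums_def)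
  moreover have "(\<Sum>d<n. g (Suc d) / real (Suc d) ^ 2) = S n" for n
    unfolding S_def by (induction n) auto
  ultimately have "S \<longlonglongrightarrow> L" by simp
  then have "(\<lambda>Z. \<bar>S Y - S Z\<bar>) \<longlonglongrightarrow> \<bar>S Y - L\<bar>" by (intro tendsto_intros)
  then have "\<bar>S Y - L\<bar> \<le> 4 * \<delta> / real Y"
    by (rule Lim_bounded[of _ _ Y]) (use fin in auto)
  then show ?thesis by (simp add: S_def)
qed

lemma sum_inverse_sqrt_le: "(\<Sum>n=1..N. 1 / sqrt (real n)) \<le> 2 * sqrt (real N)"
proof (induction N)
  case (Suc N)
  have "(sqrt (real (Suc N)) - sqrt (real N)) * (sqrt (real (Suc N)) + sqrt (real N)) = 1"
    by (simp add: algebra_simps)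
  moreover have "0 < sqrt (real (Suc N)) + sqrt (real N)" by (simp add: add_pos_nonneg)
  ultimately have "sqrt (real (Suc N)) - sqrt (real N) = 1 / (sqrt (real (Suc N)) + sqrt (real N))"
    by (simp add: field_simps)
  also have "\<dots> \<ge> 1 / (2 * sqrt (real (Suc N)))"
    by (intro divide_left_mono mult_pos_pos add_pos_nonneg) auto
  finally have "1 / sqrt (real (Suc N)) \<le> 2 * (sqrt (real (Suc N)) - sqrt (real N))" by simp
  then show ?case using Suc.IH by (simp del: of_nat_Suc)
qed simp

text \<open>The hyperbola method for \<open>\<Sum> g(d) f(n)\<close> over \<open>d\<^sup>2 n \<le> x\<close>. For \<open>d \<le> Y\<close> the sum of \<open>f\<close> is evaluated, and completing the
main term costs a tail of \<open>\<Sum> g(d) / d\<^sup>2\<close>. For \<open>d > Y\<close> one has \<open>n \<le> x / Y\<^sup>2\<close>; the order of summation is exchanged, and the cancellation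
in the sums of \<open>g\<close> up to \<open>\<surd>(x / n)\<close> gives \<open>\<delta> \<Sum> \<surd>(x / n)\<close>, which is again \<open>O(\<delta> x / Y)\<close>.\<close>

theorem square_hyperbola:
  fixes f :: "nat \<Rightarrow> real" and C :: "real fps" and x \<delta> a L :: real
  defines "g \<equiv> euler_fun C"
  assumes f: "\<And>n. \<bar>f n\<bar> \<le> 1"
    and G: "\<And>n. n \<ge> Y \<Longrightarrow> \<bar>sum g {1..n}\<bar> \<le> \<delta> * real n"
    and Y: "Y \<ge> 1" "real Y ^ 2 \<le> x"
    and L: "((\<lambda>d. g d / real d ^ 2) has_sum L) {1..}"
    and F: "\<And>z. z \<ge> 1 \<Longrightarrow> \<bar>psum f z - a * z\<bar> \<le> e z"
  shows "\<bar>psum (dconv f (euler_fun (fps_spread C))) x - a * L * x\<bar>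
     \<le> (4 + 4 * \<bar>a\<bar>) * \<delta> * x / real Y + (\<Sum>d=1..Y. \<bar>g d\<bar> * e (x / real d ^ 2))"
proof -
  let ?D = "{d. 1 \<le> d \<and> real d ^ 2 \<le> x}"
  have "1 \<le> real Y ^ 2" using Y(1) by (intro one_le_power) simp
  then have x: "x \<ge> 1" using Y(2) by linarith
  have d0: "\<delta> \<ge> 0"
    using order_trans[OF abs_ge_zero G[OF le_refl]] Y by (simp add: zero_le_mult_iff)
  have finD: "finite ?D"
  proof (rule finite_subset[OF _ finite_nat_le_real[of x]])
    have "real d \<le> x" if "1 \<le> d" "real d ^ 2 \<le> x" for d
    proof -
      have "real d \<le> real d ^ 2" by (rule self_le_power) (use that in auto)
      with that(2) show ?thesis by linarith
    qed
    then show "?D \<subseteq> {n. Suc 0 \<le> n \<and> real n \<le> x}" by auto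
  qed
  have le: "real d ^ 2 \<le> x" if "d \<le> Y" for d
  proof -
    have "real d ^ 2 \<le> real Y ^ 2" by (rule power_mono) (use that in auto)
    with Y(2) show ?thesis by linarith
  qed
  define D where "D = {d. Y < d \<and> real d ^ 2 \<le> x}"
  have split: "?D = {1..Y} \<union> D" "{1..Y} \<inter> D = {}"
    using Y le by (auto simp: D_def not_less)
  have finD': "finite D" by (rule finite_subset[OF _ finD]) (use split in blast)
  have "psum (dconv f (euler_fun (fps_spread C))) x = (\<Sum>d\<in>?D. g d * psum f (x / real d ^ 2))"
    unfolding g_def by (rule psum_dconv_spread)
  also have "\<dots> = (\<Sum>d=1..Y. g d * psum f (x / real d ^ 2)) + (\<Sum>d\<in>D. g d * psum f (x / real d ^ 2))"
    unfolding split(1) using split(2) finD' by (intro sum.union_disjoint) auto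
  finally have S: "psum (dconv f (euler_fun (fps_spread C))) x =
     (\<Sum>d=1..Y. g d * psum f (x / real d ^ 2)) + (\<Sum>d\<in>D. g d * psum f (x / real d ^ 2))" .
  \<comment> \<open>The part \<open>d \<le> Y\<close>, with the main term.\<close>
  have first: "\<bar>(\<Sum>d=1..Y. g d * psum f (x / real d ^ 2)) - a * L * x\<bar> \<le> 4 * \<bar>a\<bar> * \<delta> * x / real Y + (\<Sum>d=1..Y. \<bar>g d\<bar> * e (x / real d ^ 2))"
  proof -
    have "(\<Sum>d=1..Y. g d * psum f (x / real d ^ 2)) =
       (\<Sum>d=1..Y. a * x * (g d / real d ^ 2) + g d * (psum f (x / real d ^ 2) - a * (x / real d ^ 2)))"
      by (intro sum.cong refl) (simp add: algebra_simps)
    also have "\<dots> = a * x * (\<Sum>d=1..Y. g d / real d ^ 2) + (\<Sum>d=1..Y. g d * (psum f (x / real d ^ 2) - a * (x / real d ^ 2)))"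
      by (simp add: sum.distrib sum_distrib_left)
    finally have "(\<Sum>d=1..Y. g d * psum f (x / real d ^ 2)) - a * L * x =
       a * x * ((\<Sum>d=1..Y. g d / real d ^ 2) - L) + (\<Sum>d=1..Y. g d * (psum f (x / real d ^ 2) - a * (x / real d ^ 2)))"
      by (simp add: algebra_simps)
    also have "\<bar>\<dots>\<bar> \<le> \<bar>a\<bar> * x * (4 * \<delta> / real Y) + (\<Sum>d=1..Y. \<bar>g d\<bar> * e (x / real d ^ 2))"
    proof (rule order_trans[OF abs_triangle_ineq add_mono])
      show "\<bar>a * x * ((\<Sum>d=1..Y. g d / real d ^ 2) - L)\<bar> \<le> \<bar>a\<bar> * x * (4 * \<delta> / real Y)"
        unfolding abs_mult using x by (intro mult_mono sum_weighted_squares_tail[OF G Y(1) L]) auto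
      show "\<bar>\<Sum>d=1..Y. g d * (psum f (x / real d ^ 2) - a * (x / real d ^ 2))\<bar> \<le> (\<Sum>d=1..Y. \<bar>g d\<bar> * e (x / real d ^ 2))"
      proof (rule order_trans[OF sum_abs], rule sum_mono)
        fix d assume d: "d \<in> {1..Y}"
        then have "x / real d ^ 2 \<ge> 1" using le[of d] by (simp add: field_simps)
        then show "\<bar>g d * (psum f (x / real d ^ 2) - a * (x / real d ^ 2))\<bar> \<le> \<bar>g d\<bar> * e (x / real d ^ 2)"
          unfolding abs_mult by (intro mult_left_mono F) auto
      qed
    qed
    finally show ?thesis by (simp add: algebra_simps)
  qed
  \<comment> \<open>The part \<open>d > Y\<close>, where the roles of \<open>d\<close> and \<open>n\<close> are exchanged.\<close>
  have second: "\<bar>\<Sum>d\<in>D. g d * psum f (x / real d ^ 2)\<bar> \<le> 4 * \<delta> * x / real Y"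
  proof -
    define N where "N = {n. 1 \<le> n \<and> real n \<le> x / real Y ^ 2}"
    have finN: "finite N" by (simp add: N_def)
    have "(\<Sum>d\<in>D. g d * psum f (x / real d ^ 2)) = (\<Sum>d\<in>D. \<Sum>n | n \<in> N \<and> real d ^ 2 * real n \<le> x. g d * f n)"
    proof (intro sum.cong refl)
      fix d assume d: "d \<in> D"
      then have "real d > 0" "real Y \<le> real d" "real d ^ 2 > 0" using Y by (auto simp: D_def)
      then have "real Y ^ 2 \<le> real d ^ 2" by (intro power_mono) auto
      then have "x / real d ^ 2 \<le> x / real Y ^ 2" using x Y \<open>real d > 0\<close> by (intro divide_left_mono) auto
      moreover have "real n \<le> x / real d ^ 2 \<longleftrightarrow> real d ^ 2 * real n \<le> x" for n
        using pos_le_divide_eq[OF \<open>real d ^ 2 > 0\<close>, of "real n" x] by (simp only: mult.commute)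
      ultimately have "{n. 1 \<le> n \<and> real n \<le> x / real d ^ 2} = {n \<in> N. real d ^ 2 * real n \<le> x}"
        unfolding N_def by (auto simp only: mem_Collect_eq intro: order_trans)
      then show "g d * psum f (x / real d ^ 2) = (\<Sum>n | n \<in> N \<and> real d ^ 2 * real n \<le> x. g d * f n)"
        unfolding psum_def by (simp add: sum_distrib_left)
    qed
    also have "\<dots> = (\<Sum>n\<in>N. \<Sum>d | d \<in> D \<and> real d ^ 2 * real n \<le> x. g d * f n)"
      by (rule sum.swap_restrict[OF finD' finN])
    also have "\<dots> = (\<Sum>n\<in>N. f n * (sum g {1..nat \<lfloor>sqrt (x / real n)\<rfloor>} - sum g {1..Y}))"
    proof (intro sum.cong refl)
      fix n assume n: "n \<in> N"
      then have n0: "real n > 0" by (simp add: N_def)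
      have Ysq: "real Y \<le> sqrt (x / real n)"
        using n n0 Y by (intro real_le_rsqrt) (auto simp: N_def field_simps)
      have "real d ^ 2 * real n \<le> x \<longleftrightarrow> d \<le> nat \<lfloor>sqrt (x / real n)\<rfloor>" for d
      proof -
        have "real d ^ 2 * real n \<le> x \<longleftrightarrow> real d ^ 2 \<le> x / real n"
          by (rule pos_le_divide_eq[OF n0, symmetric])
        also have "\<dots> \<longleftrightarrow> real d \<le> sqrt (x / real n)" using x n0
          by (metis abs_of_nat real_sqrt_abs real_sqrt_le_iff)
        also have "\<dots> \<longleftrightarrow> d \<le> nat \<lfloor>sqrt (x / real n)\<rfloor>"
          using x n0 by (auto simp: le_nat_floor le_floor_iff nat_le_iff le_nat_iff)
        finally show ?thesis .
      qed
      moreover have "real d ^ 2 \<le> x" if "real d ^ 2 * real n \<le> x" for d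
        using that n mult_left_mono[of 1 "real n" "real d ^ 2"] by (simp add: N_def)
      ultimately have eq: "{d \<in> D. real d ^ 2 * real n \<le> x} = {Y<..nat \<lfloor>sqrt (x / real n)\<rfloor>}"
        by (auto simp: D_def)
      have "Y \<le> nat \<lfloor>sqrt (x / real n)\<rfloor>" using Ysq by (simp add: le_nat_floor)
      then have "{1..nat \<lfloor>sqrt (x / real n)\<rfloor>} = {1..Y} \<union> {Y<..nat \<lfloor>sqrt (x / real n)\<rfloor>}" using Y by auto
      then have "sum g {1..nat \<lfloor>sqrt (x / real n)\<rfloor>} = sum g {1..Y} + sum g {Y<..nat \<lfloor>sqrt (x / real n)\<rfloor>}"
        by (simp add: sum.union_disjoint ivl_disj_int)
      then show "(\<Sum>d | d \<in> D \<and> real d ^ 2 * real n \<le> x. g d * f n) = f n * (sum g {1..nat \<lfloor>sqrt (x / real n)\<rfloor>} - sum g {1..Y})"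
        unfolding eq by (simp add: sum_distrib_left mult.commute)
    qed
    also have "\<bar>\<dots>\<bar> \<le> (\<Sum>n\<in>N. 1 * (2 * \<delta> * sqrt (x / real n)))"
    proof (rule order_trans[OF sum_abs], rule sum_mono)
      fix n assume n: "n \<in> N"
      then have n0: "real n > 0" by (simp add: N_def)
      have Ysq: "real Y \<le> sqrt (x / real n)"
        using n n0 Y by (intro real_le_rsqrt) (auto simp: N_def field_simps)
      let ?M = "nat \<lfloor>sqrt (x / real n)\<rfloor>"
      have M: "Y \<le> ?M" using Ysq by (simp add: le_nat_floor)
      have rM: "real ?M \<le> sqrt (x / real n)" using x n0 by simp
      have "\<bar>sum g {1..?M} - sum g {1..Y}\<bar> \<le> \<delta> * real ?M + \<delta> * real Y"
        using G[OF M] G[OF le_refl] by linarith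
      also have "\<dots> \<le> \<delta> * sqrt (x / real n) + \<delta> * sqrt (x / real n)"
        using rM Ysq d0 by (intro add_mono mult_left_mono) auto
      finally show "\<bar>f n * (sum g {1..?M} - sum g {1..Y})\<bar> \<le> 1 * (2 * \<delta> * sqrt (x / real n))"
        unfolding abs_mult using f[of n] by (intro mult_mono) auto
    qed
    also have "\<dots> = 2 * \<delta> * sqrt x * (\<Sum>n=1..nat \<lfloor>x / real Y ^ 2\<rfloor>. 1 / sqrt (real n))"
      unfolding N_def nat_le_real_set by (simp add: sum_distrib_left real_sqrt_divide)
    also have "\<dots> \<le> 2 * \<delta> * sqrt x * (2 * sqrt (x / real Y ^ 2))"
    proof (rule mult_left_mono)
      have "real (nat \<lfloor>x / real Y ^ 2\<rfloor>) \<le> x / real Y ^ 2" using x by simp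
      then show "(\<Sum>n=1..nat \<lfloor>x / real Y ^ 2\<rfloor>. 1 / sqrt (real n)) \<le> 2 * sqrt (x / real Y ^ 2)"
        by (intro order_trans[OF sum_inverse_sqrt_le]) simp
    qed (use d0 x in simp)
    also have "\<dots> = 4 * \<delta> * x / real Y" using x by (simp add: real_sqrt_divide)
    finally show ?thesis .
  qed
  have "\<bar>psum (dconv f (euler_fun (fps_spread C))) x - a * L * x\<bar> \<le>
     (4 * \<bar>a\<bar> * \<delta> * x / real Y + (\<Sum>d=1..Y. \<bar>g d\<bar> * e (x / real d ^ 2))) + 4 * \<delta> * x / real Y"
    unfolding S using first second by linarith
  then show ?thesis by (simp add: algebra_simps add_divide_distrib)
qed

text \<open>Convolution with a function \<open>u\<close> whose Dirichlet series converges absolutely at \<open>\<theta>\<close> preserves an asymptotic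
formula: the main terms add up to \<open>a\<^sub>0 x \<Sum> u(m) / m\<close>, where truncating at \<open>m \<le> x\<close> costs \<open>O(x\<^sup>\<theta>)\<close>.\<close>

lemma psum_dconv_asymptotics:
  fixes B u :: "nat \<Rightarrow> real" and a0 U \<theta> :: real
  assumes B: "\<And>z. z \<ge> 1 \<Longrightarrow> \<bar>psum B z - a0 * z\<bar> \<le> e z"
    and u: "(\<lambda>n. u n * real n powr - \<theta>) norm_summable_on {1..}" "0 \<le> \<theta>" "\<theta> \<le> 1"
    and U: "((\<lambda>n. u n / real n) has_sum U) {1..}" and x: "x \<ge> 1"
  shows "\<bar>psum (dconv B u) x - a0 * U * x\<bar> \<le>
     \<bar>a0\<bar> * infsum (\<lambda>n. norm (u n * real n powr - \<theta>)) {1..} * x powr \<theta> + (\<Sum>m=1..nat \<lfloor>x\<rfloor>. \<bar>u m\<bar> * e (x / real m))"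
proof -
  let ?N = "{m. 1 \<le> m \<and> real m \<le> x}"
  have tail: "\<bar>(\<Sum>m\<in>?N. u m / real m) - U\<bar> \<le> infsum (\<lambda>n. norm (u n * real n powr - \<theta>)) {1..} * x powr (\<theta> - 1)"
  proof -
    have Nsub: "?N \<subseteq> {1..}" by auto
    have finN: "finite ?N" by simp
    have hsN: "((\<lambda>n. u n / real n) has_sum (\<Sum>m\<in>?N. u m / real m)) ?N"
      using finN by (rule has_sum_finite)
    have hs: "((\<lambda>n. u n / real n) has_sum (U - (\<Sum>m\<in>?N. u m / real m))) ({1..} - ?N)"
      by (rule has_sum_Diff[OF U hsN Nsub])
    have sm: "(\<lambda>n. norm (u n * real n powr - \<theta>)) summable_on {1..} - ?N"
      by (rule summable_on_subset_banach[OF u(1)]) auto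
    have hs2: "((\<lambda>n. norm (u n * real n powr - \<theta>) * x powr (\<theta> - 1)) has_sum
       (infsum (\<lambda>n. norm (u n * real n powr - \<theta>)) ({1..} - ?N) * x powr (\<theta> - 1))) ({1..} - ?N)"
      by (rule has_sum_cmult_left[OF has_sum_infsum[OF sm]])
    have "norm (U - (\<Sum>m\<in>?N. u m / real m)) \<le> infsum (\<lambda>n. norm (u n * real n powr - \<theta>)) ({1..} - ?N) * x powr (\<theta> - 1)"
    proof (rule norm_infsum_le[OF hs hs2])
      fix n assume "n \<in> {1..} - ?N"
      then have n: "real n > x" "n \<ge> 1" by auto
      have "real n powr - \<theta> * real n powr (\<theta> - 1) = real n powr (-1)"
        by (simp flip: powr_add)
      then have "1 / real n = real n powr - \<theta> * real n powr (\<theta> - 1)"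
        using n by (simp add: powr_minus_divide)
      also have "\<dots> \<le> real n powr - \<theta> * x powr (\<theta> - 1)"
        using n x u(3) by (intro mult_left_mono powr_mono2') auto
      finally have "\<bar>u n\<bar> * (1 / real n) \<le> \<bar>u n\<bar> * (real n powr - \<theta> * x powr (\<theta> - 1))"
        by (rule mult_left_mono) simp
      then show "norm (u n / real n) \<le> norm (u n * real n powr - \<theta>) * x powr (\<theta> - 1)"
        by (simp add: abs_mult mult.assoc)
    qed
    also have "\<dots> \<le> infsum (\<lambda>n. norm (u n * real n powr - \<theta>)) {1..} * x powr (\<theta> - 1)"
      by (intro mult_right_mono infsum_mono2[OF sm u(1)]) auto
    finally show ?thesis by (simp add: abs_minus_commute)
  qed
  have "psum (dconv B u) x = (\<Sum>m\<in>?N. u m * psum B (x / real m))" by (rule psum_dconv)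
  also have "\<dots> = (\<Sum>m\<in>?N. a0 * x * (u m / real m) + u m * (psum B (x / real m) - a0 * (x / real m)))"
    by (intro sum.cong refl) (simp add: algebra_simps)
  also have "\<dots> = a0 * x * (\<Sum>m\<in>?N. u m / real m) + (\<Sum>m\<in>?N. u m * (psum B (x / real m) - a0 * (x / real m)))"
    by (simp add: sum.distrib sum_distrib_left)
  finally have eq: "psum (dconv B u) x - a0 * U * x = a0 * x * ((\<Sum>m\<in>?N. u m / real m) - U)
      + (\<Sum>m\<in>?N. u m * (psum B (x / real m) - a0 * (x / real m)))"
    by (simp add: algebra_simps)
  have main: "\<bar>psum (dconv B u) x - a0 * U * x\<bar> \<le> \<bar>a0\<bar> * x * (infsum (\<lambda>n. norm (u n * real n powr - \<theta>)) {1..} * x powr (\<theta> - 1)) + (\<Sum>m\<in>?N. \<bar>u m\<bar> * e (x / real m))"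
    unfolding eq
  proof (rule order_trans[OF abs_triangle_ineq add_mono])
    show "\<bar>a0 * x * ((\<Sum>m\<in>?N. u m / real m) - U)\<bar> \<le> \<bar>a0\<bar> * x * (infsum (\<lambda>n. norm (u n * real n powr - \<theta>)) {1..} * x powr (\<theta> - 1))"
      unfolding abs_mult using x by (intro mult_mono tail) auto
    show "\<bar>\<Sum>m\<in>?N. u m * (psum B (x / real m) - a0 * (x / real m))\<bar> \<le> (\<Sum>m\<in>?N. \<bar>u m\<bar> * e (x / real m))"
    proof (rule order_trans[OF sum_abs], rule sum_mono)
      fix m assume "m \<in> ?N"
      then have "x / real m \<ge> 1" by (auto simp: field_simps)
      then show "\<bar>u m * (psum B (x / real m) - a0 * (x / real m))\<bar> \<le> \<bar>u m\<bar> * e (x / real m)"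
        unfolding abs_mult by (intro mult_left_mono B) auto
    qed
  qed
  have "\<bar>a0\<bar> * x * (infsum (\<lambda>n. norm (u n * real n powr - \<theta>)) {1..} * x powr (\<theta> - 1)) =
     \<bar>a0\<bar> * infsum (\<lambda>n. norm (u n * real n powr - \<theta>)) {1..} * x powr \<theta>"
  proof -
    have eq: "x * x powr (\<theta> - 1) = x powr \<theta>" using powr_mult_base[of x "\<theta> - 1"] x by simp
    show ?thesis by (simp only: eq[symmetric] mult_ac)
  qed
  with main show ?thesis unfolding nat_le_real_set by (simp only:)
qed

section \<open>Logarithmic derivatives and zeros in a disc\<close>

lemma holomorphic_comp_scale:
  assumes "g holomorphic_on ball c r" "r > 0"
  shows "(\<lambda>w. g (c + of_real r * w)) holomorphic_on ball 0 1"
proof (rule holomorphic_on_compose_gen[OF _ assms(1), unfolded o_def])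
  show "(\<lambda>w. c + of_real r * w) holomorphic_on ball 0 1" by (intro holomorphic_intros)
  show "(\<lambda>w. c + of_real r * w) ` ball 0 1 \<subseteq> ball c r"
    using assms(2) by (auto simp: dist_norm norm_mult)
qed

text \<open>With \<open>M = A - Re g(c)\<close> and \<open>p = g - g(c)\<close>, the function \<open>p / (2M - p)\<close> maps the disc to itself, because \<open>p\<close> stays in the
half-plane \<open>Re < M\<close>, and it vanishes at the centre. The lemma of Schwarz applies to it.\<close>

lemma borel_caratheodory:
  fixes g :: "complex \<Rightarrow> complex"
  assumes g: "g holomorphic_on ball c r" and r: "r > 0"
    and A: "\<And>z. z \<in> ball c r \<Longrightarrow> Re (g z) < A"
  shows "z \<in> ball c r \<Longrightarrow> norm (g z - g c) \<le> 2 * (A - Re (g c)) * norm (z - c) / (r - norm (z - c))"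
    and "norm (deriv g c) \<le> 2 * (A - Re (g c)) / r"
proof -
  define M where "M = A - Re (g c)"
  have M: "M > 0" using A[of c] r by (simp add: M_def)
  define p where "p w = g (c + of_real r * w) - g c" for w
  have inb: "c + of_real r * w \<in> ball c r" if "norm w < 1" for w
    using that r by (simp add: dist_norm norm_mult)
  have holp: "p holomorphic_on ball 0 1" unfolding p_def
    by (intro holomorphic_on_diff holomorphic_comp_scale g r holomorphic_on_const)
  have Rep: "Re (p w) < M" if "norm w < 1" for w
    using A[OF inb[OF that]] by (simp add: p_def M_def)
  have nz: "2 * of_real M - p w \<noteq> 0" if "norm w < 1" for w
  proof
    assume "2 * of_real M - p w = 0"
    then have "p w = 2 * of_real M" by simp
    then have "Re (p w) = 2 * M" by simp
    then show False using Rep[OF that] M by simp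
  qed
  define \<phi> where "\<phi> w = p w / (2 * of_real M - p w)" for w
  have hol: "\<phi> holomorphic_on ball 0 1" unfolding \<phi>_def
    by (intro holomorphic_on_divide holp holomorphic_intros) (use nz in auto)
  have \<phi>0: "\<phi> 0 = 0" by (simp add: \<phi>_def p_def)
  have lt: "norm (\<phi> w) < 1" if "norm w < 1" for w
  proof -
    have "norm (p w) ^ 2 < norm (2 * of_real M - p w) ^ 2"
    proof -
      have "norm (2 * of_real M - p w) ^ 2 - norm (p w) ^ 2 = 4 * (M * (M - Re (p w)))"
        unfolding cmod_power2 by (simp add: power2_eq_square algebra_simps)
      moreover have "M * (M - Re (p w)) > 0" using M Rep[OF that] by simp
      ultimately show ?thesis by linarith
    qed
    then have "norm (p w) < norm (2 * of_real M - p w)"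
      by (rule power2_less_imp_less) simp
    then show ?thesis using nz[OF that] by (simp add: \<phi>_def norm_divide)
  qed
  note S = Schwarz_Lemma[OF hol \<phi>0 lt]
  show "norm (g z - g c) \<le> 2 * (A - Re (g c)) * norm (z - c) / (r - norm (z - c))" if z: "z \<in> ball c r"
  proof -
    define w where "w = (z - c) / of_real r"
    have zw: "z = c + of_real r * w" using r by (simp add: w_def)
    define q where "q = norm w"
    have q: "q < 1" "norm (z - c) = r * q" using z r by (simp_all add: q_def w_def norm_divide dist_norm norm_minus_commute)
    have w1: "norm w < 1" using q by (simp add: q_def)
    have "norm (p w) / norm (2 * of_real M - p w) \<le> q"
      using S(1)[OF _ w1] by (simp add: \<phi>_def norm_divide q_def)
    then have "norm (p w) \<le> q * norm (2 * of_real M - p w)"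
      using nz[OF w1] by (simp add: pos_divide_le_eq)
    also have "\<dots> \<le> q * (2 * M + norm (p w))"
      using M norm_triangle_ineq4[of "2 * of_real M" "p w"]
      by (intro mult_left_mono) (auto simp: q_def norm_mult)
    finally have "norm (p w) * (1 - q) \<le> 2 * M * q" by (simp add: algebra_simps)
    then have "norm (p w) \<le> 2 * M * q / (1 - q)" using q by (simp add: pos_le_divide_eq)
    also have "\<dots> = 2 * M * (r * q) / (r - r * q)"
    proof -
      have "r - r * q = r * (1 - q)" by (simp add: algebra_simps)
      then show ?thesis using r by simp
    qed
    also have "p w = g z - g c" by (simp add: p_def zw)
    finally show ?thesis unfolding q(2) M_def .
  qed
  show "norm (deriv g c) \<le> 2 * (A - Re (g c)) / r"
  proof -
    have dg: "(g has_field_derivative deriv g c) (at c)"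
      using holomorphic_derivI[OF g] r by simp
    have dp: "(p has_field_derivative (deriv g c * of_real r)) (at 0)"
    proof -
      have "((\<lambda>w. g (c + of_real r * w)) has_field_derivative (deriv g c * of_real r)) (at 0)"
        by (rule DERIV_chain2[where f = g]) (use dg in \<open>auto intro!: derivative_eq_intros\<close>)
      then show ?thesis unfolding p_def by (auto intro!: derivative_eq_intros)
    qed
    have "(\<phi> has_field_derivative (deriv g c * of_real r / (2 * of_real M))) (at 0)"
      unfolding \<phi>_def
      by (rule derivative_eq_intros dp refl)+ (use M in \<open>simp_all add: p_def power2_eq_square\<close>)
    then have "deriv \<phi> 0 = deriv g c * of_real r / (2 * of_real M)" by (rule DERIV_imp_deriv)
    then have "norm (deriv g c) * r / (2 * M) \<le> 1"
      using S(2)[of 0] M r by (simp add: norm_mult norm_divide)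
    then show "norm (deriv g c) \<le> 2 * (A - Re (g c)) / r" using M r by (simp add: field_simps M_def)
  qed
qed

text \<open>A substitute for the three circles theorem: the first \<open>n\<^sub>0\<close> Taylor coefficients are estimated on the small
circle and the remaining ones on the large circle. When \<open>K\<close> is bounded, the large bound \<open>L\<close> enters only with a factor that is
arbitrarily small for large \<open>n\<^sub>0\<close>.\<close>

lemma two_radii_bound:
  fixes p :: "complex \<Rightarrow> complex"
  assumes p: "p holomorphic_on ball c R" and r: "0 < r1" "r1 < R" "0 < r3" "r3 < R" "norm (z - c) \<le> \<rho>" "\<rho> < r3"
    and K: "\<And>w. norm (c - w) = r1 \<Longrightarrow> norm (p w) \<le> K"
    and L: "\<And>w. norm (c - w) = r3 \<Longrightarrow> norm (p w) \<le> L"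
  shows "norm (p z) \<le> K * (\<Sum>n<n0. (\<rho> / r1) ^ n) + L * ((\<rho> / r3) ^ n0 / (1 - \<rho> / r3))"
proof -
  define a where "a n = (deriv ^^ n) p c / fact n" for n
  have \<rho>: "0 \<le> \<rho>" using r(5) norm_ge_zero order_trans by blast
  have co: "norm (a n) \<le> B / r ^ n" if "0 < r" "r < R" "\<And>w. norm (c - w) = r \<Longrightarrow> norm (p w) \<le> B" for r B n
  proof -
    have "norm ((deriv ^^ n) p c) \<le> fact n * B / r ^ n"
    proof (rule Cauchy_inequality[OF _ _ that(1) that(3)])
      show "p holomorphic_on ball c r" by (rule holomorphic_on_subset[OF p]) (use that in auto)
      show "continuous_on (cball c r) p"
        by (rule continuous_on_subset[OF holomorphic_on_imp_continuous_on[OF p]]) (use that in auto)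
    qed
    then show ?thesis by (simp add: a_def norm_divide field_simps)
  qed
  define q where "q = \<rho> / r3"
  have q: "0 \<le> q" "q < 1" using r \<rho> by (simp_all add: q_def)
  have zb: "z \<in> ball c R" using r by (simp add: dist_norm norm_minus_commute)
  have sums: "(\<lambda>n. a n * (z - c) ^ n) sums p z"
    unfolding a_def by (rule holomorphic_power_series[OF p zb])
  have t1: "norm (a n * (z - c) ^ n) \<le> K * (\<rho> / r1) ^ n" for n
  proof -
    have "norm (a n * (z - c) ^ n) = norm (a n) * norm (z - c) ^ n" by (simp add: norm_mult norm_power)
    also have "\<dots> \<le> (K / r1 ^ n) * \<rho> ^ n"
      using co[OF r(1,2) K, of n] r \<rho> by (intro mult_mono power_mono) (auto intro: order_trans[OF norm_ge_zero])
    finally show ?thesis by (simp add: power_divide)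
  qed
  have t2: "norm (a n * (z - c) ^ n) \<le> L * q ^ n" for n
  proof -
    have "norm (a n * (z - c) ^ n) = norm (a n) * norm (z - c) ^ n" by (simp add: norm_mult norm_power)
    also have "\<dots> \<le> (L / r3 ^ n) * \<rho> ^ n"
      using co[OF r(3,4) L, of n] r \<rho> by (intro mult_mono power_mono) (auto intro: order_trans[OF norm_ge_zero])
    finally show ?thesis by (simp add: power_divide q_def)
  qed
  have G: "(\<lambda>n. L * q ^ n0 * q ^ n) sums (L * q ^ n0 * (1 / (1 - q)))"
    by (rule sums_mult[OF geometric_sums]) (use q in simp)
  have sm: "summable (\<lambda>n. norm (a (n + n0) * (z - c) ^ (n + n0)))"
    by (rule summable_comparison_test'[OF sums_summable[OF G]]) (use t2[of "_ + n0"] in \<open>simp add: power_add mult_ac\<close>)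
  have "p z = (\<Sum>n. a n * (z - c) ^ n)" using sums by (simp add: sums_iff)
  also have "\<dots> = (\<Sum>n. a (n + n0) * (z - c) ^ (n + n0)) + (\<Sum>n<n0. a n * (z - c) ^ n)"
    by (rule suminf_split_initial_segment[OF sums_summable[OF sums]])
  finally have "norm (p z) \<le> norm (\<Sum>n. a (n + n0) * (z - c) ^ (n + n0)) + norm (\<Sum>n<n0. a n * (z - c) ^ n)"
    by (simp add: norm_triangle_ineq)
  also have "norm (\<Sum>n. a (n + n0) * (z - c) ^ (n + n0)) \<le> (\<Sum>n. L * q ^ n0 * q ^ n)"
    by (rule norm_suminf_le[OF _ sums_summable[OF G]]) (use t2[of "_ + n0"] in \<open>simp add: power_add mult_ac\<close>)
  also have "\<dots> = L * (q ^ n0 / (1 - q))" using G by (simp add: sums_iff)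
  also have "norm (\<Sum>n<n0. a n * (z - c) ^ n) \<le> (\<Sum>n<n0. K * (\<rho> / r1) ^ n)"
    by (rule order_trans[OF norm_sum sum_mono[OF t1]])
  finally show ?thesis by (simp add: q_def sum_distrib_left)
qed

text \<open>Conjugating by the disc automorphism that moves \<open>w\<close> to 0, this is the lemma of Schwarz. The factor \<open>k < 1\<close> in the
proof only serves to turn the bound \<open>\<le> 1\<close> into the strict bound required there.\<close>

lemma blaschke_division:
  fixes f :: "complex \<Rightarrow> complex"
  assumes f: "f holomorphic_on ball 0 1" "\<And>z. norm z < 1 \<Longrightarrow> norm (f z) \<le> 1" and w: "norm w < 1" "f w = 0"
  obtains h where "h holomorphic_on ball 0 1" "\<And>z. norm z < 1 \<Longrightarrow> norm (h z) \<le> 1"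
    "\<And>z. norm z < 1 \<Longrightarrow> f z = Moebius_function 0 w z * h z"
proof -
  have le: "norm (f z) \<le> norm (Moebius_function 0 w z)" if z: "norm z < 1" for z
  proof -
    have Mz: "norm (Moebius_function 0 w z) < 1" by (rule Moebius_function_norm_lt_1[OF w(1) z])
    have w': "norm (- w) < 1" using w by simp
    have "k * norm (f z) \<le> norm (Moebius_function 0 w z)" if k: "0 < k" "k < 1" for k :: real
    proof -
      let ?F = "\<lambda>u. of_real k * f (Moebius_function 0 (- w) u)"
      have "norm (?F (Moebius_function 0 w z)) \<le> norm (Moebius_function 0 w z)"
      proof (rule Schwarz_Lemma(1)[of ?F])
        have "(f \<circ> Moebius_function 0 (- w)) holomorphic_on ball 0 1"
          by (rule holomorphic_on_compose_gen[OF Moebius_function_holomorphic[OF w'] f(1)])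
             (use Moebius_function_norm_lt_1[OF w'] in auto)
        then show "?F holomorphic_on ball 0 1"
          by (intro holomorphic_on_mult holomorphic_on_const) (simp add: o_def)
        show "?F 0 = 0" using w by (simp add: Moebius_function_of_zero)
        show "norm (?F u) < 1" if "norm u < 1" for u
        proof -
          have "norm (f (Moebius_function 0 (- w) u)) \<le> 1"
            by (rule f(2)) (rule Moebius_function_norm_lt_1[OF w' that])
          then have "k * norm (f (Moebius_function 0 (- w) u)) \<le> k * 1" using k by (intro mult_left_mono) auto
          moreover have "norm (?F u) = k * norm (f (Moebius_function 0 (- w) u))"
            using k by (simp add: norm_mult)
          ultimately show ?thesis using k by linarith
        qed
      qed (rule Mz)
      moreover have "Moebius_function 0 (- w) (Moebius_function 0 w z) = z"
        by (rule Moebius_function_compose) (use w z in auto)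
      ultimately show ?thesis using k by (simp add: norm_mult)
    qed
    then show ?thesis by (rule field_le_mult_one_interval)
  qed
  define h0 where "h0 z = (if z = w then deriv f w else (f z - f w) / (z - w))" for z
  define h where "h z = (1 - cnj w * z) * h0 z" for z
  have "h0 holomorphic_on ball 0 1" unfolding h0_def by (rule pole_lemma_open[OF f(1)]) simp
  then have hol: "h holomorphic_on ball 0 1" unfolding h_def by (intro holomorphic_on_mult holomorphic_intros)
  have nz: "1 - cnj w * z \<noteq> 0" if "norm z < 1" for z
  proof
    assume "1 - cnj w * z = 0"
    then have "norm (cnj w * z) = 1" by simp
    moreover have "norm w * norm z < 1 * 1" using that w(1) by (intro mult_strict_mono') auto
    ultimately show False by (simp add: norm_mult)
  qed
  have eq: "f z = Moebius_function 0 w z * h z" if "norm z < 1" for z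
    using nz[OF that] w(2) by (simp add: Moebius_function_simple h_def h0_def)
  have b1: "norm (h z) \<le> 1" if z: "norm z < 1" "z \<noteq> w" for z
  proof -
    have "Moebius_function 0 w z \<noteq> 0" using nz[OF z(1)] z(2) by (simp add: Moebius_function_simple)
    then show ?thesis using le[OF z(1)] unfolding eq[OF z(1)] by (simp add: norm_mult)
  qed
  have "norm (h z) \<le> 1" if z: "norm z < 1" for z
  proof (cases "z = w")
    case True
    have "isCont h w" using hol w(1) holomorphic_on_imp_continuous_on continuous_on_eq_continuous_at
      by (metis dist_0_norm mem_ball open_ball)
    then have "(h \<longlongrightarrow> h w) (at w)" by (simp add: isCont_def)
    moreover have "eventually (\<lambda>x. norm (h x) \<le> 1) (at w)"
      unfolding eventually_at
    proof (intro exI[of _ "1 - norm w"] conjI ballI impI)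
      fix x assume "x \<noteq> w \<and> dist x w < 1 - cmod w"
      moreover have "norm x \<le> norm w + dist x w" by (metis dist_norm norm_triangle_sub)
      ultimately show "norm (h x) \<le> 1" by (intro b1) auto
    qed (use w in simp)
    ultimately show ?thesis unfolding True by (intro Lim_norm_ubound[of "at w" h "h w"]) auto
  qed (use b1 z in simp)
  with hol eq show ?thesis by (intro that)
qed

lemma blaschke_log_deriv:
  assumes h: "h holomorphic_on ball 0 1" and w: "norm w < 1" "w \<noteq> 0" and h0: "h 0 \<noteq> 0"
    and f: "\<And>z. norm z < 1 \<Longrightarrow> f z = Moebius_function 0 w z * h z"
  shows "- Re (deriv f 0 / f 0) = (1 - norm w ^ 2) * Re (1 / w) - Re (deriv h 0 / h 0)"
proof -
  have dh: "(h has_field_derivative deriv h 0) (at 0)"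
    using holomorphic_derivI[OF h] by simp
  have dM: "(Moebius_function 0 w has_field_derivative (1 - w * cnj w)) (at 0)"
    unfolding Moebius_function_simple by (auto intro!: derivative_eq_intros)
  have "((\<lambda>z. Moebius_function 0 w z * h z) has_field_derivative
      ((1 - w * cnj w) * h 0 + deriv h 0 * Moebius_function 0 w 0)) (at 0)"
    by (rule DERIV_mult[OF dM dh])
  then have "(f has_field_derivative ((1 - w * cnj w) * h 0 + deriv h 0 * Moebius_function 0 w 0)) (at 0)"
    by (rule has_field_derivative_transform_within_open[where S = "ball 0 1"]) (use f in auto)
  then have "deriv f 0 = (1 - w * cnj w) * h 0 - deriv h 0 * w"
    by (simp add: DERIV_imp_deriv Moebius_function_of_zero)
  moreover have "f 0 = - w * h 0" using f[of 0] by (simp add: Moebius_function_of_zero)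
  ultimately have "deriv f 0 / f 0 = - (1 - w * cnj w) * (1 / w) + deriv h 0 / h 0"
    using w h0 by (simp add: field_simps)
  moreover have "w * cnj w = of_real (norm w ^ 2)" using complex_norm_square[of w] by (simp only: of_real_power)
  ultimately have "deriv f 0 / f 0 = of_real (- (1 - norm w ^ 2)) * (1 / w) + deriv h 0 / h 0" by simp
  then show ?thesis by (simp only: plus_complex.simps Re_complex_of_real times_complex.simps Im_complex_of_real)
qed

text \<open>Landau's local estimate. Zeros close to the centre are divided out one by one by Blaschke factors. This
changes \<open>- Re (f'/f)(0)\<close> by \<open>(1 - \<bar>w\<bar>\<^sup>2) Re (1/w)\<close>, which is not positive as the zeros lie in the left half of the disc. Each division by a
zero with \<open>\<bar>w\<bar> < 1/2\<close> at least doubles \<open>\<bar>f(0)\<bar>\<close>, so the process ends; then \<open>f\<close> has a logarithm on the half disc, and the theorem of Borel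
and Caratheodory bounds its derivative.\<close>

lemma landau_log_deriv:
  fixes f :: "complex \<Rightarrow> complex"
  assumes "f holomorphic_on ball 0 1" "\<And>z. norm z < 1 \<Longrightarrow> norm (f z) \<le> 1" "f 0 \<noteq> 0"
    and "\<And>z. norm z < 1 \<Longrightarrow> f z = 0 \<Longrightarrow> Re z \<le> 0"
  shows "- Re (deriv f 0 / f 0) \<le> 4 * (1 + ln (1 / norm (f 0)))"
proof -
  \<comment> \<open>The number \<open>n\<close> bounds how often a zero can be divided out.\<close>
  obtain n where "(1 / 2) ^ n < norm (f 0)" using assms(3) real_arch_pow_inv[of "norm (f 0)" "1 / 2"] by auto
  then show ?thesis using assms
  proof (induction n arbitrary: f)
    case 0
    then have "norm (f 0) \<le> 1" using "0.prems"(3)[of 0] by auto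
    then show ?case using "0.prems"(1) by simp
  next
    case (Suc n)
    note f = Suc.prems(2,3) and f0 = Suc.prems(4) and zeros = Suc.prems(5)
    have l0: "ln (1 / norm (f 0)) \<ge> 0" using f(2)[of 0] f0 by simp
    show ?case
    proof (cases "\<exists>w\<in>ball 0 (1 / 2). f w = 0")
      case True
      then obtain w where w: "norm w < 1 / 2" "f w = 0" by (auto simp: dist_norm)
      have w1: "norm w < 1" using w by linarith
      have wn: "w \<noteq> 0" using w f0 by auto
      obtain h where h: "h holomorphic_on ball 0 1" "\<And>z. norm z < 1 \<Longrightarrow> norm (h z) \<le> 1"
        "\<And>z. norm z < 1 \<Longrightarrow> f z = Moebius_function 0 w z * h z"
        using blaschke_division[OF f w1 w(2)] by blast
      have fh: "norm (f 0) = norm w * norm (h 0)"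
        using h(3)[of 0] by (simp add: Moebius_function_of_zero norm_mult)
      have h0: "h 0 \<noteq> 0" using f0 fh by auto
      have "norm w * norm (h 0) \<le> 1 / 2 * norm (h 0)" using w by (intro mult_right_mono) auto
      then have hn: "(1 / 2) ^ n < norm (h 0)"
        using Suc.prems(1) fh by simp
      have hf: "norm (f 0) \<le> norm (h 0)" unfolding fh using w1 by (intro mult_left_le_one_le) auto
      have IH: "- Re (deriv h 0 / h 0) \<le> 4 * (1 + ln (1 / norm (h 0)))"
        by (rule Suc.IH[OF hn h(1,2) h0]) (use zeros h(3) in auto)
      have "ln (1 / norm (h 0)) \<le> ln (1 / norm (f 0))"
        using hf f0 h0 by (simp add: ln_div)
      moreover have "(1 - norm w ^ 2) * Re (1 / w) \<le> 0"
      proof (rule mult_nonneg_nonpos)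
        show "0 \<le> 1 - norm w ^ 2" using w1 by (simp add: abs_square_le_1)
        show "Re (1 / w) \<le> 0" using zeros[OF w1 w(2)] by (simp add: Re_divide divide_nonpos_nonneg)
      qed
      ultimately show ?thesis using blaschke_log_deriv[OF h(1) w1 wn h0, of f] h(3) IH by auto
    next
      case False
      have fh: "f holomorphic_on ball 0 (1 / 2)" by (rule holomorphic_on_subset[OF f(1)]) auto
      obtain g where g: "g holomorphic_on ball 0 (1 / 2)" "\<And>z. z \<in> ball 0 (1 / 2) \<Longrightarrow> exp (g z) = f z"
        by (rule holomorphic_logarithm_exists[of "ball 0 (1/2)" f 0]) (use fh False in auto)
      have Re_g: "Re (g z) < 1" if "z \<in> ball 0 (1 / 2)" for z
      proof -
        have "exp (Re (g z)) = norm (f z)" using norm_exp_eq_Re[of "g z"] g(2)[OF that] by simp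
        also have "\<dots> \<le> 1" using f(2)[of z] that by simp
        finally show ?thesis by simp
      qed
      have Re_g0: "Re (g 0) = ln (norm (f 0))"
        unfolding g(2)[of 0, simplified, symmetric] by simp
      have dg: "(g has_field_derivative deriv g 0) (at 0)" using holomorphic_derivI[OF g(1)] by simp
      have "((\<lambda>z. exp (g z)) has_field_derivative (exp (g 0) * deriv g 0)) (at 0)"
        by (rule DERIV_chain2[OF DERIV_exp dg])
      then have "(f has_field_derivative (exp (g 0) * deriv g 0)) (at 0)"
        by (rule has_field_derivative_transform_within_open[where S = "ball 0 (1/2)"]) (use g(2) in auto)
      then have "deriv f 0 = f 0 * deriv g 0" using g(2)[of 0] by (simp add: DERIV_imp_deriv)
      then have "- Re (deriv f 0 / f 0) = - Re (deriv g 0)" using f0 by simp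
      also have "\<dots> \<le> norm (deriv g 0)" using abs_Re_le_cmod[of "deriv g 0"] by linarith
      also have "\<dots> \<le> 2 * (1 - Re (g 0)) / (1 / 2)"
        by (rule borel_caratheodory(2)[OF g(1) _ Re_g]) simp
      also have "\<dots> = 4 * (1 + ln (1 / norm (f 0)))" using f0 by (simp add: Re_g0 ln_div)
      finally show ?thesis .
    qed
  qed
qed

text \<open>Here the contribution of one chosen zero is kept: for a zero close to the imaginary axis it is a large
negative term, which is the source of the zero-free region.\<close>

lemma landau_log_deriv_zero:
  fixes f :: "complex \<Rightarrow> complex"
  assumes f: "f holomorphic_on ball 0 1" "\<And>z. norm z < 1 \<Longrightarrow> norm (f z) \<le> 1" "f 0 \<noteq> 0"
    and zeros: "\<And>z. norm z < 1 \<Longrightarrow> f z = 0 \<Longrightarrow> Re z \<le> 0"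
    and w: "norm w < 1" "f w = 0"
  shows "- Re (deriv f 0 / f 0) \<le> (1 - norm w ^ 2) * Re (1 / w) + 4 * (1 + ln (1 / norm (f 0)))"
proof -
  have wn: "w \<noteq> 0" using w f by auto
  obtain h where h: "h holomorphic_on ball 0 1" "\<And>z. norm z < 1 \<Longrightarrow> norm (h z) \<le> 1"
    "\<And>z. norm z < 1 \<Longrightarrow> f z = Moebius_function 0 w z * h z"
    using blaschke_division[OF f(1,2) w] by blast
  have fh: "norm (f 0) = norm w * norm (h 0)"
    using h(3)[of 0] by (simp add: Moebius_function_of_zero norm_mult)
  have h0: "h 0 \<noteq> 0" using f(3) fh by auto
  have hf: "norm (f 0) \<le> norm (h 0)" unfolding fh using w by (intro mult_left_le_one_le) auto
  have "- Re (deriv h 0 / h 0) \<le> 4 * (1 + ln (1 / norm (h 0)))"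
    by (rule landau_log_deriv[OF h(1,2) h0]) (use zeros h(3) in auto)
  moreover have "ln (1 / norm (h 0)) \<le> ln (1 / norm (f 0))" using hf f(3) h0 by (simp add: ln_div)
  ultimately show ?thesis using blaschke_log_deriv[OF h(1) w(1) wn h0, of f] h(3) by auto
qed

section \<open>Newman's bound for partial sums\<close>

lemma powr_diff_mvt:
  fixes p :: real
  assumes "0 < m"
  obtains \<xi> where "m < \<xi>" "\<xi> < m + 1" "(m + 1) powr p - m powr p = p * \<xi> powr (p - 1)"
proof -
  have "\<exists>z. m < z \<and> z < m + 1 \<and> (m + 1) powr p - m powr p = (m + 1 - m) * (p * z powr (p - 1))"
    by (rule MVT2) (use assms in \<open>auto intro!: derivative_eq_intros\<close>)
  then show ?thesis using that by auto
qed

lemma sum_powr_tail_le: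
  assumes x: "0 < x" and N: "1 \<le> N"
  shows "(\<Sum>n<k. (real (n + N) + 1) powr (- 1 - x)) \<le> real N powr - x / x"
proof -
  have "(\<Sum>n<k. (real (n + N) + 1) powr (- 1 - x)) \<le> (\<Sum>n<k. (real (n + N) powr - x - real (Suc n + N) powr - x) / x)"
  proof (rule sum_mono)
    fix n
    have m: "0 < real (n + N)" using N by simp
    obtain \<xi> where \<xi>: "real (n + N) < \<xi>" "\<xi> < real (n + N) + 1"
      "(real (n + N) + 1) powr - x - real (n + N) powr - x = - x * \<xi> powr (- x - 1)"
      by (rule powr_diff_mvt[OF m])
    have "(real (n + N) + 1) powr (- 1 - x) \<le> \<xi> powr (- 1 - x)"
      using \<xi> m x by (intro powr_mono2') auto
    moreover have "real (n + N) powr - x - (real (n + N) + 1) powr - x = x * \<xi> powr (- 1 - x)"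
    proof -
      have e: "- x - 1 = - 1 - x" by simp
      show ?thesis using \<xi>(3) unfolding e by simp
    qed
    ultimately show "(real (n + N) + 1) powr (- 1 - x) \<le> (real (n + N) powr - x - real (Suc n + N) powr - x) / x"
      using x by (simp add: field_simps)
  qed
  also have "\<dots> = (real N powr - x - real (k + N) powr - x) / x"
  proof (induction k)
    case (Suc k)
    then show ?case by (simp add: diff_divide_distrib)
  qed simp
  also have "\<dots> \<le> real N powr - x / x" using x by (intro divide_right_mono) auto
  finally show ?thesis .
qed

text \<open>Comparison with \<open>\<integral> u\<^sup>a\<^sup>-\<^sup>1 du\<close>. The summand is decreasing for \<open>a \<le> 1\<close> and increasing for \<open>a > 1\<close>; the term \<open>1/N\<close> covers the
last summand in the second case.\<close>

lemma sum_powr_head_le: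
  assumes a: "0 < a" and N: "1 \<le> N"
  shows "(\<Sum>n=1..N. real n powr (a - 1)) \<le> real N powr a * (1 / a + 1 / real N)"
proof (cases "a \<le> 1")
  case True
  have "(\<Sum>n=1..N. real n powr (a - 1)) \<le> real N powr a / a"
    using N
  proof (induction N rule: dec_induct)
    case base
    show ?case using True a by simp
  next
    case (step N)
    have m: "0 < real N" using step by simp
    obtain \<xi> where \<xi>: "real N < \<xi>" "\<xi> < real N + 1" "(real N + 1) powr a - real N powr a = a * \<xi> powr (a - 1)"
      by (rule powr_diff_mvt[OF m])
    have "(real N + 1) powr (a - 1) \<le> \<xi> powr (a - 1)"
      using \<xi> m True by (intro powr_mono2') auto
    also have "\<dots> = ((real N + 1) powr a - real N powr a) / a" using \<xi>(3) a by simp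
    finally show ?case using step.IH by (simp add: diff_divide_distrib add.commute)
  qed
  also have "\<dots> \<le> real N powr a * (1 / a + 1 / real N)" by (simp add: distrib_left)
  finally show ?thesis .
next
  case False
  have "(\<Sum>n=1..N. real n powr (a - 1)) \<le> real N powr a / a + real N powr (a - 1)"
    using N
  proof (induction N rule: dec_induct)
    case base
    show ?case using a by simp
  next
    case (step N)
    have m: "0 < real N" using step by simp
    obtain \<xi> where \<xi>: "real N < \<xi>" "\<xi> < real N + 1" "(real N + 1) powr a - real N powr a = a * \<xi> powr (a - 1)"
      by (rule powr_diff_mvt[OF m])
    have "real N powr (a - 1) \<le> \<xi> powr (a - 1)"
      using \<xi> m False by (intro powr_mono2) auto
    also have "\<dots> = ((real N + 1) powr a - real N powr a) / a" using \<xi>(3) a by simp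
    finally show ?case using step.IH by (simp add: diff_divide_distrib add.commute)
  qed
  also have "real N powr (a - 1) = real N powr a / real N" using N by (simp add: powr_diff)
  finally show ?thesis by (simp add: distrib_left)
qed

lemma contour_integral_rectpath_split:
  assumes "continuous_on (path_image (rectpath a c)) f" "Re a \<le> Re c" "Im a \<le> Im c"
  defines "b \<equiv> Complex (Re c) (Im a)" and "d \<equiv> Complex (Re a) (Im c)"
  shows "contour_integral (rectpath a c) f = contour_integral (linepath a b) f + contour_integral (linepath b c) f
     + contour_integral (linepath c d) f + contour_integral (linepath d a) f"
proof -
  have pi: "path_image (rectpath a c) = closed_segment a b \<union> closed_segment b c \<union> closed_segment c d \<union> closed_segment d a"
    unfolding rectpath_def Let_def b_def d_def by (simp add: path_image_join Un_assoc)
  have I: "f contour_integrable_on linepath a b" "f contour_integrable_on linepath b c"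
    "f contour_integrable_on linepath c d" "f contour_integrable_on linepath d a"
    by (rule contour_integrable_continuous_linepath, rule continuous_on_subset[OF assms(1)], unfold pi, blast)+
  show ?thesis
    unfolding rectpath_def Let_def b_def[symmetric] d_def[symmetric]
    using I by (simp add: contour_integrable_joinI valid_path_join)
qed

text \<open>On the circle \<open>\<bar>z\<bar> = R\<close> Newman's kernel \<open>1/z + z/R\<^sup>2\<close> equals \<open>2 Re z / R\<^sup>2\<close>. On the horizontal sides of a square it is still
bounded by a multiple of \<open>\<bar>Re z\<bar>\<close>, and this is what compensates the factor \<open>1 / \<bar>Re z\<bar>\<close> in the estimates of tails and partial sums.\<close>

lemma newman_kernel_horizontal:
  assumes "\<bar>x\<bar> \<le> R" "R > 0" "\<bar>y\<bar> = R"
  defines "z \<equiv> Complex x y"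
  shows "norm ((of_real R ^ 2 + z ^ 2) / (of_real R ^ 2 * z)) \<le> 3 * \<bar>x\<bar> / R ^ 2"
proof -
  have y2: "y ^ 2 = R ^ 2" using assms(3) by (metis power2_abs)
  have "of_real R ^ 2 + z ^ 2 = of_real x * Complex x (2 * y)"
    using y2 by (simp add: z_def complex_eq_iff power2_eq_square)
  then have "norm (of_real R ^ 2 + z ^ 2) \<le> \<bar>x\<bar> * (3 * R)"
  proof -
    have "norm (Complex x (2 * y)) \<le> \<bar>x\<bar> + \<bar>2 * y\<bar>" using cmod_le[of "Complex x (2 * y)"] by simp
    also have "\<dots> \<le> 3 * R" using assms by simp
    finally show ?thesis using \<open>of_real R ^ 2 + z ^ 2 = _\<close> by (simp add: norm_mult mult_left_mono)
  qed
  moreover have "norm z \<ge> R" using abs_Im_le_cmod[of z] assms by (simp add: z_def)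
  ultimately have "norm (of_real R ^ 2 + z ^ 2) / (R ^ 2 * norm z) \<le> (\<bar>x\<bar> * (3 * R)) / (R ^ 2 * R)"
    using assms by (intro frac_le mult_left_mono) auto
  also have "\<dots> = 3 * \<bar>x\<bar> / R ^ 2" using assms by (simp add: power2_eq_square)
  finally show ?thesis using assms by (simp add: norm_divide norm_mult norm_power)
qed

lemma newman_kernel_vertical:
  assumes "\<bar>Im z\<bar> \<le> R" "\<bar>Re z\<bar> \<le> R" "R > 0" "z \<noteq> 0"
  shows "norm ((of_real R ^ 2 + z ^ 2) / (of_real R ^ 2 * z)) \<le> 1 / norm z + 2 / R"
proof -
  have "(of_real R ^ 2 + z ^ 2) / (of_real R ^ 2 * z) = 1 / z + z / of_real R ^ 2"
    using assms by (simp add: field_simps power2_eq_square)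
  then have "norm ((of_real R ^ 2 + z ^ 2) / (of_real R ^ 2 * z)) \<le> 1 / norm z + norm z / R ^ 2"
    using norm_triangle_ineq[of "1 / z" "z / of_real R ^ 2"] assms by (simp add: norm_divide norm_power)
  also have "norm z / R ^ 2 \<le> 2 * R / R ^ 2"
    using cmod_le[of z] assms by (intro divide_right_mono) auto
  also have "\<dots> = 2 / R" using assms by (simp add: power2_eq_square)
  finally show ?thesis by simp
qed

lemma Complex_in_hsegment:
  "z \<in> closed_segment (Complex a y) (Complex b y) \<Longrightarrow> Im z = y \<and> Re z \<in> closed_segment a b"
  unfolding closed_segment_def by (auto simp: complex_eq_iff algebra_simps)

lemma Complex_in_vsegment:
  "z \<in> closed_segment (Complex x a) (Complex x b) \<Longrightarrow> Re z = x \<and> Im z \<in> closed_segment a b"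
  unfolding closed_segment_def by (auto simp: complex_eq_iff algebra_simps)

lemma norm_Complex_hdiff: "norm (Complex x y - Complex u y) = \<bar>x - u\<bar>"
proof -
  have "Complex x y - Complex u y = of_real (x - u)" by (simp add: complex_eq_iff)
  then show ?thesis by (simp only: norm_of_real)
qed

lemma norm_Complex_vdiff: "norm (Complex u x - Complex u y) = \<bar>x - y\<bar>"
proof -
  have "Complex u x - Complex u y = of_real (x - y) * \<i>" by (simp add: complex_eq_iff)
  then show ?thesis by (simp only: norm_of_real norm_mult norm_ii mult_1_right)
qed

lemma norm_linepath_integral_le:
  assumes "0 \<le> B" "\<And>z. z \<in> closed_segment a b \<Longrightarrow> norm (f z) \<le> B" "norm (b - a) \<le> l"
    and "continuous_on (closed_segment a b) f"
  shows "norm (contour_integral (linepath a b) f) \<le> B * l"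
proof -
  have "norm (contour_integral (linepath a b) f) \<le> B * norm (b - a)"
    by (rule contour_integral_bound_linepath[OF contour_integrable_continuous_linepath[OF assms(4)] assms(1,2)])
  also have "\<dots> \<le> B * l" using assms by (intro mult_left_mono) auto
  finally show ?thesis .
qed

text \<open>The integral of \<open>1 / \<bar>z\<bar>\<close> over a vertical segment at distance \<open>\<delta>\<close> from 0 costs only a logarithm, written exactly
as an inverse hyperbolic sine.\<close>

lemma norm_vertical_integral_le:
  assumes \<delta>: "\<delta> > 0" and R: "R > 0" and B: "B \<ge> 0"
    and f: "\<And>z. Re z = - \<delta> \<Longrightarrow> \<bar>Im z\<bar> \<le> R \<Longrightarrow> norm (f z) \<le> B * (1 / norm z + 2 / R)"
    and cont: "continuous_on (closed_segment (Complex (- \<delta>) R) (Complex (- \<delta>) (- R))) f"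
  shows "norm (contour_integral (linepath (Complex (- \<delta>) R) (Complex (- \<delta>) (- R))) f) \<le> B * (2 * arsinh (R / \<delta>) + 4)"
proof -
  let ?a = "Complex (- \<delta>) R" and ?b = "Complex (- \<delta>) (- R)"
  let ?L = "linepath ?a ?b"
  have hci: "(f has_contour_integral contour_integral ?L f) ?L"
    by (rule has_contour_integral_integral[OF contour_integrable_continuous_linepath[OF cont]])
  then have hi: "((\<lambda>x. f (?L x) * (?b - ?a)) has_integral contour_integral ?L f) {0..1}"
    by (simp only: has_contour_integral_linepath)
  have L: "?L x = Complex (- \<delta>) (R * (1 - 2 * x))" for x
    by (simp add: linepath_def complex_eq_iff algebra_simps)
  define G where "G x = B * (arsinh (R * (2 * x - 1) / \<delta>) + 4 * x)" for x
  define g where "g x = B * (1 / norm (?L x) + 2 / R) * (2 * R)" for x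
  have nL: "norm (?L x) = sqrt (\<delta> ^ 2 + (R * (2 * x - 1)) ^ 2)" for x
    unfolding L by (simp add: cmod_def power2_eq_square algebra_simps)
  have "(g has_integral (G 1 - G 0)) {0..1}"
  proof (rule fundamental_theorem_of_calculus)
    fix x :: real
    have "((\<lambda>x. arsinh (R * (2 * x - 1) / \<delta>)) has_real_derivative (1 / sqrt ((R * (2 * x - 1) / \<delta>) ^ 2 + 1) * (R * 2 / \<delta>))) (at x within {0..1})"
      by (rule DERIV_chain2[OF arsinh_real_has_field_derivative])
         (use \<delta> in \<open>auto intro!: derivative_eq_intros\<close>)
    moreover have "1 / sqrt ((R * (2 * x - 1) / \<delta>) ^ 2 + 1) * (R * 2 / \<delta>) = 1 / norm (?L x) * (2 * R)"
    proof -
      have "\<delta> ^ 2 + (R * (2 * x - 1)) ^ 2 = \<delta> ^ 2 * ((R * (2 * x - 1) / \<delta>) ^ 2 + 1)"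
        using \<delta> by (simp add: power_divide distrib_left)
      then have "norm (?L x) = \<delta> * sqrt ((R * (2 * x - 1) / \<delta>) ^ 2 + 1)"
        using \<delta> unfolding nL by (simp add: real_sqrt_mult)
      then show ?thesis by (simp add: mult.commute)
    qed
    ultimately have "((\<lambda>x. arsinh (R * (2 * x - 1) / \<delta>)) has_real_derivative (1 / norm (?L x) * (2 * R))) (at x within {0..1})"
      by simp
    then have "(G has_real_derivative (B * (1 / norm (?L x) * (2 * R) + 4))) (at x within {0..1})"
      unfolding G_def by (auto intro!: derivative_eq_intros)
    moreover have "B * (1 / norm (?L x) * (2 * R) + 4) = g x"
      using R by (simp add: g_def field_simps)
    ultimately show "(G has_vector_derivative g x) (at x within {0..1})"
      by (simp add: has_real_derivative_iff_has_vector_derivative)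
  qed simp
  moreover have "G 1 - G 0 = B * (2 * arsinh (R / \<delta>) + 4)"
    by (simp add: G_def algebra_simps)
  ultimately have hg: "(g has_integral (B * (2 * arsinh (R / \<delta>) + 4))) {0..1}" by simp
  have "norm (integral {0..1} (\<lambda>x. f (?L x) * (?b - ?a))) \<le> integral {0..1} g"
  proof (rule integral_norm_bound_integral)
    fix x :: real assume x: "x \<in> {0..1}"
    have "\<bar>1 - 2 * x\<bar> \<le> 1" using x by (auto simp: abs_le_iff)
    then have "\<bar>R * (1 - 2 * x)\<bar> \<le> R" using mult_left_mono[of "\<bar>1 - 2 * x\<bar>" 1 R] R by (simp add: abs_mult)
    then have "norm (f (?L x)) \<le> B * (1 / norm (?L x) + 2 / R)" by (intro f) (simp_all add: L)
    moreover have "norm (?b - ?a) = 2 * R"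
    proof -
      have "?b - ?a = of_real (- 2 * R) * \<i>" by (simp add: complex_eq_iff)
      then show ?thesis using R by (simp add: norm_mult)
    qed
    ultimately show "norm (f (?L x) * (?b - ?a)) \<le> g x"
      unfolding norm_mult g_def using R B by (intro mult_mono mult_nonneg_nonneg add_nonneg_nonneg) auto
  qed (rule has_integral_integrable[OF hi] has_integral_integrable[OF hg])+
  then show ?thesis unfolding integral_unique[OF hi] integral_unique[OF hg] .
qed

text \<open>Newman's contour argument with explicit constants; it replaces Perron's formula. Let \<open>P\<close> be the partial sum up to \<open>N\<close> and
\<open>k(z) = 1/z + z/R\<^sup>2\<close>. Integrating \<open>(F - P) N\<^sup>z k\<close> over a rectangle around 0 gives \<open>2\<pi>\<i> (F(0) - P(0))\<close>. To the right of the imaginary axis \<open>F - P\<close>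
is the tail of the series. To the left \<open>F\<close> and \<open>P\<close> are separated: the entire function \<open>P\<close> is integrated over the left half of a square
instead, and \<open>F\<close> over the left part of the rectangle, on whose vertical side \<open>N\<^sup>z\<close> has size \<open>N\<^sup>-\<^sup>\<delta>\<close>.\<close>

theorem newman_bound:
  fixes a :: "nat \<Rightarrow> complex" and F :: "complex \<Rightarrow> complex" and \<delta> R B :: real and N :: nat
  assumes a: "\<And>n. norm (a n) \<le> 1" and \<delta>: "0 < \<delta>" "\<delta> \<le> 1" and R: "1 \<le> R" and N: "1 \<le> N"
    and F: "F holomorphic_on cbox (Complex (- \<delta>) (- R)) (Complex R R)"
    and ser: "\<And>z. 0 < Re z \<Longrightarrow> (\<lambda>n. a (Suc n) * of_nat (Suc n) powr (- 1 - z)) sums F z"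
    and B: "\<And>z. - \<delta> \<le> Re z \<Longrightarrow> Re z \<le> 0 \<Longrightarrow> \<bar>Im z\<bar> \<le> R \<Longrightarrow> norm (F z) \<le> B"
  shows "norm (F 0 - (\<Sum>n=1..N. a n / of_nat n)) \<le>
    4 / R + 2 / real N + B * \<delta> ^ 2 / R ^ 2 + B * real N powr - \<delta> * (arsinh (R / \<delta>) + 1)"
proof -
  define P where "P z = (\<Sum>n=1..N. a n * of_nat n powr (- 1 - z))" for z
  define kk where "kk z = (of_real R ^ 2 + z ^ 2) / (of_real R ^ 2 * z)" for z :: complex
  define Q where "Q = cbox (Complex (- \<delta>) (- R)) (Complex R R)"
  define \<Phi>F where "\<Phi>F z = F z * of_nat N powr z * kk z" for z
  define \<Phi>P where "\<Phi>P z = P z * of_nat N powr z * kk z" for z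
  define \<Phi> where "\<Phi> z = \<Phi>F z - \<Phi>P z" for z
  have Nc: "(of_nat N :: complex) \<noteq> 0" using N by simp
  have R0: "R > 0" using R by simp
  have Q: "z \<in> Q \<longleftrightarrow> - \<delta> \<le> Re z \<and> Re z \<le> R \<and> \<bar>Im z\<bar> \<le> R" for z
    by (auto simp: Q_def in_cbox_complex_iff)
  have holP: "P holomorphic_on S" for S
    unfolding P_def by (intro holomorphic_intros) auto
  have holN: "(\<lambda>z. of_nat N powr z :: complex) holomorphic_on S" for S
    using Nc by (intro holomorphic_intros) auto
  have holk: "kk holomorphic_on (S - {0})" for S
    unfolding kk_def using R0 by (intro holomorphic_intros) auto
  have holF: "F holomorphic_on Q" using F by (simp add: Q_def)
  have holF': "F holomorphic_on (Q - {0})" by (rule holomorphic_on_subset[OF holF]) auto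
  have cF: "continuous_on (Q - {0}) \<Phi>F"
    unfolding \<Phi>F_def by (intro holomorphic_on_imp_continuous_on holomorphic_on_mult holF' holN holk)
  have hP: "\<Phi>P holomorphic_on (S - {0})" for S
    unfolding \<Phi>P_def by (intro holomorphic_on_mult holP holN holk)
  then have cP: "continuous_on (- {0}) \<Phi>P"
    using holomorphic_on_imp_continuous_on[of \<Phi>P "UNIV - {0}"] by (simp add: Compl_eq_Diff_UNIV)
  have c\<Phi>: "continuous_on (Q - {0}) \<Phi>"
    unfolding \<Phi>_def by (intro continuous_on_diff cF continuous_on_subset[OF cP]) auto
  have nN: "norm (of_nat N powr z :: complex) = real N powr Re z" for z
    using N by (intro norm_nat_powr) simp
  have P0: "P 0 = (\<Sum>n=1..N. a n / of_nat n)"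
    unfolding P_def by (intro sum.cong refl) (simp add: powr_minus_divide)

  \<comment> \<open>The rectangle with corners \<open>A, b, c, d\<close> reaches left to \<open>-\<delta>\<close>, the square with corners \<open>e, b, c, f\<close> reaches to \<open>-R\<close>;
    \<open>m1\<close> and \<open>m2\<close> are the points where both cross the imaginary axis.\<close>
  define A b c d e f m1 m2 where "A = Complex (- \<delta>) (- R)" and "b = Complex R (- R)" and "c = Complex R R"
    and "d = Complex (- \<delta>) R" and "e = Complex (- R) (- R)" and "f = Complex (- R) R"
    and "m1 = Complex 0 (- R)" and "m2 = Complex 0 R"
  note pts = A_def b_def c_def d_def e_def f_def m1_def m2_def
  let ?J = "\<lambda>x y h. contour_integral (linepath x y) h"
  have hseg: "Im z = y \<and> Re z \<in> closed_segment u v" if "z \<in> closed_segment (Complex u y) (Complex v y)" for z u v y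
    by (rule Complex_in_hsegment[OF that])
  have vseg: "Re z = x \<and> Im z \<in> closed_segment u v" if "z \<in> closed_segment (Complex x u) (Complex x v)" for z u v x
    by (rule Complex_in_vsegment[OF that])
  have segQ: "closed_segment A b \<subseteq> Q - {0}" "closed_segment b c \<subseteq> Q - {0}" "closed_segment c d \<subseteq> Q - {0}"
    "closed_segment d A \<subseteq> Q - {0}" "closed_segment A m1 \<subseteq> Q - {0}" "closed_segment m1 b \<subseteq> Q - {0}"
    "closed_segment c m2 \<subseteq> Q - {0}" "closed_segment m2 d \<subseteq> Q - {0}"
    unfolding pts using \<delta> R by (auto dest!: hseg vseg simp: Q closed_segment_eq_real_ivl split: if_splits)
  have segP: "closed_segment e A \<subseteq> - {0}" "closed_segment A d \<subseteq> - {0}" "closed_segment d f \<subseteq> - {0}"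
    "closed_segment f e \<subseteq> - {0}" "closed_segment m2 f \<subseteq> - {0}" "closed_segment e m1 \<subseteq> - {0}"
    unfolding pts using \<delta> R by (auto dest!: hseg vseg simp: closed_segment_eq_real_ivl split: if_splits)
  have segQ': "closed_segment d A \<subseteq> - {0}" "closed_segment A m1 \<subseteq> - {0}" "closed_segment m2 d \<subseteq> - {0}"
    using segQ by auto

  \<comment> \<open>Cauchy's integral formula at 0, where the kernel has residue 1.\<close>
  have total: "?J A b \<Phi> + ?J b c \<Phi> + ?J c d \<Phi> + ?J d A \<Phi> = 2 * of_real pi * \<i> * (F 0 - P 0)"
  proof -
    let ?G = "\<lambda>z. (F z - P z) * (of_nat N powr z * (of_real R ^ 2 + z ^ 2) / of_real R ^ 2)"
    have rp: "path_image (rectpath A c) \<subseteq> Q - {0}"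
      using path_image_rectpath[of A c] \<delta> R by (auto simp: pts Q)
    have "((\<lambda>w. ?G w / (w - 0)) has_contour_integral (of_real (2 * pi) * \<i> * winding_number (rectpath A c) 0 * ?G 0)) (rectpath A c)"
    proof (rule Cauchy_integral_formula_convex_simple)
      show "convex Q" by (simp add: Q_def convex_box)
      show "?G holomorphic_on Q" using R0 by (intro holomorphic_intros holF holP holN) auto
      have "0 \<in> box (Complex (- \<delta>) (- R)) (Complex R R)" using \<delta> R by (simp add: in_box_complex_iff)
      then show "0 \<in> interior Q" by (simp add: Q_def)
    qed (use rp in auto)
    moreover have "winding_number (rectpath A c) 0 = 1"
      using \<delta> R by (intro winding_number_rectpath) (simp add: in_box_complex_iff pts)
    ultimately have e1: "contour_integral (rectpath A c) (\<lambda>w. ?G w / (w - 0)) = of_real (2 * pi) * \<i> * ?G 0"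
      by (simp add: contour_integral_unique)
    have e2: "contour_integral (rectpath A c) (\<lambda>w. ?G w / (w - 0)) = contour_integral (rectpath A c) \<Phi>"
    proof (rule contour_integral_eq)
      fix w assume "w \<in> path_image (rectpath A c)"
      then have "w \<noteq> 0" using rp by auto
      then show "?G w / (w - 0) = \<Phi> w" using R0
        by (simp add: \<Phi>_def \<Phi>F_def \<Phi>P_def kk_def field_simps)
    qed
    have e3: "contour_integral (rectpath A c) \<Phi> = ?J A b \<Phi> + ?J b c \<Phi> + ?J c d \<Phi> + ?J d A \<Phi>"
      using contour_integral_rectpath_split[OF continuous_on_subset[OF c\<Phi> rp]] \<delta> R by (simp add: pts)
    have e4: "?G 0 = F 0 - P 0" using R0 Nc by simp
    show ?thesis using e1 unfolding e2 e3 e4 by simp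
  qed
  have split: "?J A b \<Phi> = ?J A m1 \<Phi> + ?J m1 b \<Phi>" "?J c d \<Phi> = ?J c m2 \<Phi> + ?J m2 d \<Phi>"
  proof -
    have "m1 \<in> closed_segment A b"
      unfolding pts using \<delta> R by (subst closed_segment_same_Im) (auto simp: closed_segment_eq_real_ivl)
    then show "?J A b \<Phi> = ?J A m1 \<Phi> + ?J m1 b \<Phi>"
      by (rule contour_integral_split_linepath[OF continuous_on_subset[OF c\<Phi> segQ(1)]])
    have "m2 \<in> closed_segment c d"
      unfolding pts using \<delta> R by (subst closed_segment_same_Im) (auto simp: closed_segment_eq_real_ivl)
    then show "?J c d \<Phi> = ?J c m2 \<Phi> + ?J m2 d \<Phi>"
      by (rule contour_integral_split_linepath[OF continuous_on_subset[OF c\<Phi> segQ(3)]])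
  qed
  have diff: "?J x y \<Phi> = ?J x y \<Phi>F - ?J x y \<Phi>P" if "closed_segment x y \<subseteq> Q - {0}" for x y
  proof -
    have "closed_segment x y \<subseteq> - {0}" using that by auto
    then show ?thesis unfolding \<Phi>_def using that
      by (intro contour_integral_diff contour_integrable_continuous_linepath continuous_on_subset[OF cF] continuous_on_subset[OF cP])
  qed
  \<comment> \<open>The path of \<open>P\<close> is moved from the line \<open>Re z = -\<delta>\<close> to the left half of the square.\<close>
  have Ppath: "?J m2 d \<Phi>P + ?J d A \<Phi>P + ?J A m1 \<Phi>P = ?J m2 f \<Phi>P + ?J f e \<Phi>P + ?J e m1 \<Phi>P"
  proof -
    have rp: "path_image (rectpath e d) \<subseteq> {z. Re z < 0}"
      using path_image_rectpath[of e d] \<delta> R by (auto simp: pts)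
    have "(\<Phi>P has_contour_integral 0) (rectpath e d)"
    proof (rule Cauchy_theorem_convex_simple[OF _ convex_halfspace_Re_lt _ rp])
      show "\<Phi>P holomorphic_on {z. Re z < 0}"
        by (rule holomorphic_on_subset[OF hP[of UNIV]]) auto
    qed auto
    then have "contour_integral (rectpath e d) \<Phi>P = 0" by (rule contour_integral_unique)
    moreover have "contour_integral (rectpath e d) \<Phi>P = ?J e A \<Phi>P + ?J A d \<Phi>P + ?J d f \<Phi>P + ?J f e \<Phi>P"
    proof -
      have "path_image (rectpath e d) \<subseteq> - {0}" using rp by auto
      from contour_integral_rectpath_split[OF continuous_on_subset[OF cP this]] show ?thesis
        using \<delta> R by (simp add: pts)
    qed
    moreover have "?J m2 f \<Phi>P = ?J m2 d \<Phi>P + ?J d f \<Phi>P"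
      by (rule contour_integral_split_linepath[OF continuous_on_subset[OF cP segP(5)]])
         (unfold pts, subst closed_segment_same_Im, use \<delta> R in \<open>auto simp: closed_segment_eq_real_ivl\<close>)
    moreover have "?J e m1 \<Phi>P = ?J e A \<Phi>P + ?J A m1 \<Phi>P"
      by (rule contour_integral_split_linepath[OF continuous_on_subset[OF cP segP(6)]])
         (unfold pts, subst closed_segment_same_Im, use \<delta> R in \<open>auto simp: closed_segment_eq_real_ivl\<close>)
    moreover have "?J d A \<Phi>P = - ?J A d \<Phi>P"
      by (rule contour_integral_reverse_linepath[OF continuous_on_subset[OF cP segQ'(1)]])
    ultimately show ?thesis by (simp add: algebra_simps add_eq_0_iff)
  qed

  \<comment> \<open>To the right: the tail of the series is at most \<open>N\<^sup>-\<^sup>x / x\<close>, \<open>x = Re z\<close>.\<close>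
  have tail: "norm (F z - P z) * real N powr Re z \<le> 1 / Re z" if x: "0 < Re z" for z
  proof -
    let ?t = "\<lambda>n. a (Suc n) * of_nat (Suc n) powr (- 1 - z)"
    let ?g = "\<lambda>n. (real (n + N) + 1) powr (- 1 - Re z)"
    note S = ser[OF x]
    have sg: "summable ?g"
      by (rule summableI_nonneg_bounded[where x = "real N powr - Re z / Re z"]) (use sum_powr_tail_le[OF x N] in auto)
    have "P z = (\<Sum>n<N. ?t n)" unfolding P_def by (simp add: sum.atLeast1_atMost_eq)
    then have "F z - P z = (\<Sum>n. ?t (n + N))"
      using suminf_minus_initial_segment[OF sums_summable[OF S], of N] S by (simp add: sums_iff)
    also have "norm \<dots> \<le> (\<Sum>n. ?g n)"
    proof (rule norm_suminf_le[OF _ sg])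
      fix n
      have "norm (?t (n + N)) \<le> 1 * norm (of_nat (Suc (n + N)) powr (- 1 - z) :: complex)"
        unfolding norm_mult by (intro mult_right_mono a) auto
      also have "\<dots> = ?g n" by (subst norm_nat_powr) (auto simp: add_ac)
      finally show "norm (?t (n + N)) \<le> ?g n" .
    qed
    also have "\<dots> \<le> real N powr - Re z / Re z"
      by (rule suminf_le_const[OF sg sum_powr_tail_le[OF x N]])
    finally have "norm (F z - P z) * real N powr Re z \<le> real N powr - Re z / Re z * real N powr Re z"
      by (intro mult_right_mono) auto
    also have "\<dots> = 1 / Re z" using N by (simp add: powr_minus field_simps)
    finally show ?thesis .
  qed
  \<comment> \<open>To the left: the partial sum is at most about \<open>N\<^sup>-\<^sup>x / \<bar>x\<bar>\<close>.\<close>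
  have head: "norm (P z) * real N powr Re z \<le> - 1 / Re z + 1 / real N" if x: "Re z < 0" for z
  proof -
    have "norm (P z) \<le> (\<Sum>n=1..N. real n powr (- Re z - 1))"
      unfolding P_def
    proof (rule order_trans[OF norm_sum], rule sum_mono)
      fix n assume "n \<in> {1..N}"
      then have "norm (a n * of_nat n powr (- 1 - z)) \<le> 1 * real n powr (- 1 - Re z)"
        unfolding norm_mult by (subst norm_nat_powr) (auto intro!: mult_right_mono a)
      also have "- 1 - Re z = - Re z - 1" by simp
      finally show "norm (a n * of_nat n powr (- 1 - z)) \<le> real n powr (- Re z - 1)" by simp
    qed
    also have "\<dots> \<le> real N powr - Re z * (1 / (- Re z) + 1 / real N)"
      by (rule sum_powr_head_le) (use x N in auto)
    finally have "norm (P z) * real N powr Re z \<le> real N powr - Re z * (1 / (- Re z) + 1 / real N) * real N powr Re z"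
      by (intro mult_right_mono) auto
    also have "\<dots> = (real N powr - Re z * real N powr Re z) * (1 / (- Re z) + 1 / real N)" by (simp only: mult_ac)
    also have "real N powr - Re z * real N powr Re z = 1" using N by (simp flip: powr_add)
    finally show ?thesis by simp
  qed
  have n\<Phi>: "norm (\<Phi> z) = norm (F z - P z) * real N powr Re z * norm (kk z)" for z
  proof -
    have "\<Phi> z = (F z - P z) * of_nat N powr z * kk z" by (simp add: \<Phi>_def \<Phi>F_def \<Phi>P_def algebra_simps)
    then show ?thesis by (simp add: norm_mult nN)
  qed
  \<comment> \<open>The kernel compensates the factor \<open>1 / \<bar>x\<bar>\<close> on horizontal sides; on vertical ones \<open>\<bar>x\<bar> = R\<close>.\<close>
  have kh: "norm (kk z) \<le> 3 * \<bar>Re z\<bar> / R ^ 2" if "\<bar>Re z\<bar> \<le> R" "\<bar>Im z\<bar> = R" for z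
    using newman_kernel_horizontal[OF that(1) R0 that(2)] by (simp add: kk_def)
  have kv: "norm (kk z) \<le> 3 / R" if "\<bar>Re z\<bar> = R" "\<bar>Im z\<bar> \<le> R" for z
  proof -
    have "norm (kk z) \<le> 1 / norm z + 2 / R" unfolding kk_def
      using that R0 by (intro newman_kernel_vertical) auto
    also have "1 / norm z \<le> 1 / R" using abs_Re_le_cmod[of z] that R0 by (intro divide_left_mono) (auto intro!: mult_pos_pos)
    finally show ?thesis by simp
  qed
  have rh: "norm (\<Phi> z) \<le> 3 / R ^ 2" if "0 \<le> Re z" "Re z \<le> R" "\<bar>Im z\<bar> = R" for z
  proof (cases "Re z = 0")
    case True
    then have "norm (kk z) \<le> 0" using kh[of z] that R0 by simp
    then show ?thesis by (simp add: n\<Phi>)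
  next
    case False
    then have x: "Re z > 0" using that by simp
    have "norm (\<Phi> z) \<le> (1 / Re z) * (3 * \<bar>Re z\<bar> / R ^ 2)"
      unfolding n\<Phi> using x kh[of z] that by (intro mult_mono tail) auto
    then show ?thesis using x by simp
  qed
  have rv: "norm (\<Phi> z) \<le> 3 / R ^ 2" if "Re z = R" "\<bar>Im z\<bar> \<le> R" for z
  proof -
    have "norm (\<Phi> z) \<le> (1 / Re z) * (3 / R)"
      unfolding n\<Phi> using kv[of z] that R0 by (intro mult_mono tail) auto
    then show ?thesis using that by (simp add: power2_eq_square)
  qed
  have n\<Phi>P: "norm (\<Phi>P z) = norm (P z) * real N powr Re z * norm (kk z)" for z
    by (simp add: \<Phi>P_def norm_mult nN)
  have lh: "norm (\<Phi>P z) \<le> 3 / R ^ 2 + 3 / (real N * R)" if "- R \<le> Re z" "Re z \<le> 0" "\<bar>Im z\<bar> = R" for z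
  proof (cases "Re z = 0")
    case True
    then have "norm (kk z) \<le> 0" using kh[of z] that R0 by simp
    then show ?thesis using R0 by (simp add: n\<Phi>P)
  next
    case False
    then have x: "Re z < 0" using that by simp
    have nn: "0 \<le> - 1 / Re z + 1 / real N" by (rule order_trans[OF _ head[OF x]]) simp
    have "norm (\<Phi>P z) \<le> (- 1 / Re z + 1 / real N) * (3 * \<bar>Re z\<bar> / R ^ 2)"
      unfolding n\<Phi>P using x kh[of z] that by (intro mult_mono head nn) auto
    also have "\<dots> = 3 / R ^ 2 + 3 / (real N * R) * (- Re z / R)"
      using x R0 N by (simp add: field_simps power2_eq_square)
    also have "\<dots> \<le> 3 / R ^ 2 + 3 / (real N * R) * 1"
      using that R0 by (intro add_left_mono mult_left_mono) (auto simp: field_simps)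
    finally show ?thesis by simp
  qed
  have lv: "norm (\<Phi>P z) \<le> 3 / R ^ 2 + 3 / (real N * R)" if "Re z = - R" "\<bar>Im z\<bar> \<le> R" for z
  proof -
    have x: "Re z < 0" using that R0 by simp
    have nn: "0 \<le> - 1 / Re z + 1 / real N" by (rule order_trans[OF _ head[OF x]]) simp
    have "norm (\<Phi>P z) \<le> (- 1 / Re z + 1 / real N) * (3 / R)"
      unfolding n\<Phi>P using kv[of z] that R0 by (intro mult_mono head nn) auto
    also have "\<dots> = 3 / R ^ 2 + 3 / (real N * R)"
      using that R0 by (simp add: power2_eq_square distrib_right add_divide_distrib)
    finally show ?thesis .
  qed
  have B0: "B \<ge> 0" using order_trans[OF norm_ge_zero B[of 0]] \<delta> R by simp
  have fh: "norm (\<Phi>F z) \<le> 3 * B * \<delta> / R ^ 2" if "- \<delta> \<le> Re z" "Re z \<le> 0" "\<bar>Im z\<bar> = R" for z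
  proof -
    have "norm (\<Phi>F z) = norm (F z) * real N powr Re z * norm (kk z)" by (simp add: \<Phi>F_def norm_mult nN)
    also have "\<dots> \<le> B * 1 * (3 * \<delta> / R ^ 2)"
    proof (intro mult_mono B)
      have "real N powr Re z \<le> real N powr 0" using that N by (intro powr_mono) auto
      then show "real N powr Re z \<le> 1" using N by simp
      have "norm (kk z) \<le> 3 * \<bar>Re z\<bar> / R ^ 2" using that \<delta> R by (intro kh) auto
      also have "\<dots> \<le> 3 * \<delta> / R ^ 2" using that by (intro divide_right_mono) auto
      finally show "norm (kk z) \<le> 3 * \<delta> / R ^ 2" .
    qed (use that B0 in auto)
    finally show ?thesis by (simp add: mult_ac)
  qed
  have fv: "norm (\<Phi>F z) \<le> (B * real N powr - \<delta>) * (1 / norm z + 2 / R)" if "Re z = - \<delta>" "\<bar>Im z\<bar> \<le> R" for z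
  proof -
    have "norm (\<Phi>F z) = norm (F z) * real N powr Re z * norm (kk z)" by (simp add: \<Phi>F_def norm_mult nN)
    also have "\<dots> \<le> B * real N powr - \<delta> * (1 / norm z + 2 / R)"
    proof (intro mult_mono)
      show "norm (F z) \<le> B" using that \<delta> by (intro B) auto
      show "norm (kk z) \<le> 1 / norm z + 2 / R" unfolding kk_def
        using that \<delta> R by (intro newman_kernel_vertical) auto
    qed (use B0 that in auto)
    finally show ?thesis .
  qed

  \<comment> \<open>Bounds for the nine segments: three for \<open>F - P\<close>, three for \<open>P\<close>, three for \<open>F\<close>.\<close>
  have i1: "norm (?J m1 b \<Phi>) \<le> 3 / R ^ 2 * R"
  proof (rule norm_linepath_integral_le[OF _ _ _ continuous_on_subset[OF c\<Phi> segQ(6)]])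
    fix z assume "z \<in> closed_segment m1 b"
    then have "Im z = - R \<and> Re z \<in> closed_segment 0 R" unfolding pts by (rule hseg)
    then show "norm (\<Phi> z) \<le> 3 / R ^ 2"
      using R \<delta> by (intro rh) (auto simp: closed_segment_eq_real_ivl split: if_splits)
  qed (use R \<delta> B0 in \<open>auto simp: pts norm_Complex_hdiff norm_Complex_vdiff\<close>)
  have i2: "norm (?J b c \<Phi>) \<le> 3 / R ^ 2 * (2 * R)"
  proof (rule norm_linepath_integral_le[OF _ _ _ continuous_on_subset[OF c\<Phi> segQ(2)]])
    fix z assume "z \<in> closed_segment b c"
    then have "Re z = R \<and> Im z \<in> closed_segment (- R) R" unfolding pts by (rule vseg)
    then show "norm (\<Phi> z) \<le> 3 / R ^ 2"
      using R \<delta> by (intro rv) (auto simp: closed_segment_eq_real_ivl split: if_splits)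
  qed (use R \<delta> B0 in \<open>auto simp: pts norm_Complex_hdiff norm_Complex_vdiff\<close>)
  have i3: "norm (?J c m2 \<Phi>) \<le> 3 / R ^ 2 * R"
  proof (rule norm_linepath_integral_le[OF _ _ _ continuous_on_subset[OF c\<Phi> segQ(7)]])
    fix z assume "z \<in> closed_segment c m2"
    then have "Im z = R \<and> Re z \<in> closed_segment R 0" unfolding pts by (rule hseg)
    then show "norm (\<Phi> z) \<le> 3 / R ^ 2"
      using R \<delta> by (intro rh) (auto simp: closed_segment_eq_real_ivl split: if_splits)
  qed (use R \<delta> B0 in \<open>auto simp: pts norm_Complex_hdiff norm_Complex_vdiff\<close>)
  have i4: "norm (?J m2 f \<Phi>P) \<le> (3 / R ^ 2 + 3 / (real N * R)) * R"
  proof (rule norm_linepath_integral_le[OF _ _ _ continuous_on_subset[OF cP segP(5)]])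
    fix z assume "z \<in> closed_segment m2 f"
    then have "Im z = R \<and> Re z \<in> closed_segment 0 (- R)" unfolding pts by (rule hseg)
    then show "norm (\<Phi>P z) \<le> (3 / R ^ 2 + 3 / (real N * R))"
      using R \<delta> by (intro lh) (auto simp: closed_segment_eq_real_ivl split: if_splits)
  qed (use R \<delta> B0 in \<open>auto simp: pts norm_Complex_hdiff norm_Complex_vdiff\<close>)
  have i5: "norm (?J f e \<Phi>P) \<le> (3 / R ^ 2 + 3 / (real N * R)) * (2 * R)"
  proof (rule norm_linepath_integral_le[OF _ _ _ continuous_on_subset[OF cP segP(4)]])
    fix z assume "z \<in> closed_segment f e"
    then have "Re z = - R \<and> Im z \<in> closed_segment R (- R)" unfolding pts by (rule vseg)
    then show "norm (\<Phi>P z) \<le> (3 / R ^ 2 + 3 / (real N * R))"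
      using R \<delta> by (intro lv) (auto simp: closed_segment_eq_real_ivl split: if_splits)
  qed (use R \<delta> B0 in \<open>auto simp: pts norm_Complex_hdiff norm_Complex_vdiff\<close>)
  have i6: "norm (?J e m1 \<Phi>P) \<le> (3 / R ^ 2 + 3 / (real N * R)) * R"
  proof (rule norm_linepath_integral_le[OF _ _ _ continuous_on_subset[OF cP segP(6)]])
    fix z assume "z \<in> closed_segment e m1"
    then have "Im z = - R \<and> Re z \<in> closed_segment (- R) 0" unfolding pts by (rule hseg)
    then show "norm (\<Phi>P z) \<le> (3 / R ^ 2 + 3 / (real N * R))"
      using R \<delta> by (intro lh) (auto simp: closed_segment_eq_real_ivl split: if_splits)
  qed (use R \<delta> B0 in \<open>auto simp: pts norm_Complex_hdiff norm_Complex_vdiff\<close>)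
  have i7: "norm (?J m2 d \<Phi>F) \<le> 3 * B * \<delta> / R ^ 2 * \<delta>"
  proof (rule norm_linepath_integral_le[OF _ _ _ continuous_on_subset[OF cF segQ(8)]])
    fix z assume "z \<in> closed_segment m2 d"
    then have "Im z = R \<and> Re z \<in> closed_segment 0 (- \<delta>)" unfolding pts by (rule hseg)
    then show "norm (\<Phi>F z) \<le> 3 * B * \<delta> / R ^ 2"
      using R \<delta> by (intro fh) (auto simp: closed_segment_eq_real_ivl split: if_splits)
  qed (use R \<delta> B0 in \<open>auto simp: pts norm_Complex_hdiff norm_Complex_vdiff\<close>)
  have i8: "norm (?J A m1 \<Phi>F) \<le> 3 * B * \<delta> / R ^ 2 * \<delta>"
  proof (rule norm_linepath_integral_le[OF _ _ _ continuous_on_subset[OF cF segQ(5)]])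
    fix z assume "z \<in> closed_segment A m1"
    then have "Im z = - R \<and> Re z \<in> closed_segment (- \<delta>) 0" unfolding pts by (rule hseg)
    then show "norm (\<Phi>F z) \<le> 3 * B * \<delta> / R ^ 2"
      using R \<delta> by (intro fh) (auto simp: closed_segment_eq_real_ivl split: if_splits)
  qed (use R \<delta> B0 in \<open>auto simp: pts norm_Complex_hdiff norm_Complex_vdiff\<close>)
  have i9: "norm (?J d A \<Phi>F) \<le> (B * real N powr - \<delta>) * (2 * arsinh (R / \<delta>) + 4)"
    unfolding pts by (rule norm_vertical_integral_le[OF \<delta>(1) R0 _ fv])
       (use B0 continuous_on_subset[OF cF segQ(4)] in \<open>auto simp: pts\<close>)

  have eq: "2 * of_real pi * \<i> * (F 0 - P 0) =
     (?J m1 b \<Phi> + ?J b c \<Phi> + ?J c m2 \<Phi>) + (?J m2 d \<Phi>F + ?J A m1 \<Phi>F + ?J d A \<Phi>F)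
     - (?J m2 f \<Phi>P + ?J f e \<Phi>P + ?J e m1 \<Phi>P)"
    unfolding total[symmetric] split Ppath[symmetric] diff[OF segQ(5)] diff[OF segQ(8)] diff[OF segQ(4)]
    by (simp add: algebra_simps)
  have tri: "norm (2 * of_real pi * \<i> * (F 0 - P 0)) \<le> (norm (?J m1 b \<Phi>) + norm (?J b c \<Phi>) + norm (?J c m2 \<Phi>))
     + (norm (?J m2 d \<Phi>F) + norm (?J A m1 \<Phi>F) + norm (?J d A \<Phi>F))
     + (norm (?J m2 f \<Phi>P) + norm (?J f e \<Phi>P) + norm (?J e m1 \<Phi>P))"
    unfolding eq
    by (intro norm_triangle_le_diff norm_triangle_mono order_refl add_mono order_trans[OF norm_triangle_ineq4])
  have "norm (2 * of_real pi * \<i> * (F 0 - P 0)) \<le> (3 / R ^ 2 * R + 3 / R ^ 2 * (2 * R) + 3 / R ^ 2 * R)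
     + (3 * B * \<delta> / R ^ 2 * \<delta> + 3 * B * \<delta> / R ^ 2 * \<delta> + (B * real N powr - \<delta>) * (2 * arsinh (R / \<delta>) + 4))
     + ((3 / R ^ 2 + 3 / (real N * R)) * R + (3 / R ^ 2 + 3 / (real N * R)) * (2 * R) + (3 / R ^ 2 + 3 / (real N * R)) * R)"
    using tri i1 i2 i3 i4 i5 i6 i7 i8 i9 by linarith
  also have "\<dots> = 24 / R + 12 / real N + 6 * (B * \<delta> ^ 2 / R ^ 2) + (B * real N powr - \<delta>) * (2 * arsinh (R / \<delta>) + 4)"
    using R0 N by (simp add: power2_eq_square distrib_right)
  finally have main: "2 * pi * norm (F 0 - P 0) \<le> 24 / R + 12 / real N + 6 * (B * \<delta> ^ 2 / R ^ 2) + (B * real N powr - \<delta>) * (2 * arsinh (R / \<delta>) + 4)"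
    by (simp add: norm_mult)
  have "6 * norm (F 0 - P 0) \<le> 2 * pi * norm (F 0 - P 0)"
    using pi_gt3 by (intro mult_right_mono) auto
  moreover have "(B * real N powr - \<delta>) * (2 * arsinh (R / \<delta>) + 4) \<le> (B * real N powr - \<delta>) * (6 * (arsinh (R / \<delta>) + 1))"
  proof (rule mult_left_mono)
    have "0 \<le> R / \<delta>" using R \<delta> by simp
    then have "1 \<le> R / \<delta> + sqrt ((R / \<delta>) ^ 2 + 1)" by (simp add: add_increasing)
    then have "0 \<le> arsinh (R / \<delta>)" unfolding arsinh_real_def by (rule ln_ge_zero)
    then show "2 * arsinh (R / \<delta>) + 4 \<le> 6 * (arsinh (R / \<delta>) + 1)" by simp
  qed (use B0 in simp)
  ultimately have "6 * norm (F 0 - P 0) \<le> 24 / R + 12 / real N + 6 * (B * \<delta> ^ 2 / R ^ 2)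
      + (B * real N powr - \<delta>) * (6 * (arsinh (R / \<delta>) + 1))"
    using main by linarith
  also have "\<dots> = 6 * (4 / R + 2 / real N + B * \<delta> ^ 2 / R ^ 2 + B * real N powr - \<delta> * (arsinh (R / \<delta>) + 1))"
    by (simp add: distrib_left)
  finally show ?thesis unfolding P0 by simp
qed

section \<open>The zeta function for positive real part\<close>

text \<open>With \<open>m = n + 1\<close> this is \<open>(s - 1) (m\<^sup>-\<^sup>s - \<integral> u\<^sup>-\<^sup>s du)\<close>, the integral running from \<open>m\<close> to \<open>m + 1\<close>, written without integral so that it is
visibly entire in \<open>s\<close>. Summing over \<open>n\<close> gives \<open>(s - 1) \<zeta>(s) - 1\<close>.\<close>

definition zeta_term :: "nat \<Rightarrow> complex \<Rightarrow> complex" where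
  "zeta_term n s = (s - 1) * of_real (real n + 1) powr - s
     + (of_real (real n + 2) powr (1 - s) - of_real (real n + 1) powr (1 - s))"

definition zeta_reg :: "complex \<Rightarrow> complex" where
  "zeta_reg s = 1 + (\<Sum>n. zeta_term n s)"

text \<open>The difference between \<open>m\<^sup>-\<^sup>s\<close> and the mean of \<open>u\<^sup>-\<^sup>s\<close> over \<open>[m, m + 1]\<close> is bounded by the mean value inequality, applied first
to \<open>u\<^sup>-\<^sup>s\<close> and then to its antiderivative.\<close>

lemma norm_zeta_term_le:
  assumes s: "Re s > 0"
  shows "norm (zeta_term n s) \<le> norm (s - 1) * norm s * (real n + 1) powr (- 1 - Re s)"
proof -
  define m where "m = real n + 1"
  have m: "m \<ge> 1" by (simp add: m_def)
  let ?S = "closed_segment (of_real m) (of_real (m + 1)) :: complex set"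
  have S: "\<exists>u. z = of_real u \<and> m \<le> u \<and> u \<le> m + 1" if "z \<in> ?S" for z
    using that unfolding closed_segment_of_real by (auto simp: closed_segment_eq_real_ivl)
  have nonpos: "z \<notin> \<real>\<^sub>\<le>\<^sub>0" if "z \<in> ?S" for z
    using S[OF that] m by (auto simp: complex_nonpos_Reals_iff)
  have ends: "of_real m \<in> ?S" "of_real (m + 1) \<in> ?S" by auto
  have d1: "norm (z powr - s - of_real m powr - s) \<le> norm s * m powr (- 1 - Re s)" if z: "z \<in> ?S" for z
  proof -
    have "norm (z powr - s - of_real m powr - s) \<le> norm s * m powr (- 1 - Re s) * norm (z - of_real m)"
    proof (rule field_differentiable_bound[where S = ?S])
      show "((\<lambda>z. z powr - s) has_field_derivative (- s * w powr (- s - 1))) (at w within ?S)" if "w \<in> ?S" for w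
        by (rule has_field_derivative_at_within[OF has_field_derivative_powr[OF nonpos[OF that]]])
      show "norm (- s * w powr (- s - 1)) \<le> norm s * m powr (- 1 - Re s)" if w: "w \<in> ?S" for w
      proof -
        obtain u where u: "w = of_real u" "m \<le> u" using S[OF w] by blast
        have "norm (w powr (- s - 1)) = u powr (- Re s - 1)"
          unfolding u(1) using u(2) m by (subst norm_powr_real_powr) auto
        also have "\<dots> \<le> m powr (- Re s - 1)" using u m s by (intro powr_mono2') auto
        also have "- Re s - 1 = - 1 - Re s" by simp
        finally show ?thesis by (simp add: norm_mult mult_left_mono)
      qed
    qed (use z ends in auto)
    also have "\<dots> \<le> norm s * m powr (- 1 - Re s) * 1"
    proof (rule mult_left_mono)
      obtain u where u: "z = of_real u" "m \<le> u" "u \<le> m + 1" using S[OF z] by blast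
      have "z - of_real m = of_real (u - m)" by (simp add: u)
      then have "norm (z - of_real m) = \<bar>u - m\<bar>" by (simp only: norm_of_real)
      then show "norm (z - of_real m) \<le> 1" using u by simp
    qed simp
    finally show ?thesis by simp
  qed
  let ?f = "\<lambda>z. z powr (1 - s) + (s - 1) * of_real m powr - s * z"
  have "norm (?f (of_real (m + 1)) - ?f (of_real m)) \<le> norm (s - 1) * (norm s * m powr (- 1 - Re s)) * norm (of_real (m + 1) - of_real m :: complex)"
  proof (rule field_differentiable_bound[where S = ?S])
    show "(?f has_field_derivative ((1 - s) * z powr (- s) + (s - 1) * of_real m powr - s)) (at z within ?S)" if "z \<in> ?S" for z
    proof -
      have "((\<lambda>z. z powr (1 - s)) has_field_derivative ((1 - s) * z powr (1 - s - 1))) (at z within ?S)"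
        by (rule has_field_derivative_at_within[OF has_field_derivative_powr[OF nonpos[OF that]]])
      then have "((\<lambda>z. z powr (1 - s)) has_field_derivative ((1 - s) * z powr - s)) (at z within ?S)" by simp
      then show ?thesis by (rule DERIV_add) (rule DERIV_cmult_Id)
    qed
    show "norm ((1 - s) * z powr (- s) + (s - 1) * of_real m powr - s) \<le> norm (s - 1) * (norm s * m powr (- 1 - Re s))"
      if "z \<in> ?S" for z
    proof -
      have "(1 - s) * z powr (- s) + (s - 1) * of_real m powr - s = - ((s - 1) * (z powr - s - of_real m powr - s))"
        by (simp add: algebra_simps)
      then have "norm ((1 - s) * z powr (- s) + (s - 1) * of_real m powr - s) = norm (s - 1) * norm (z powr - s - of_real m powr - s)"
        by (simp only: norm_minus_cancel norm_mult)
      then show ?thesis using mult_left_mono[OF d1[OF that], of "norm (s - 1)"] by simp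
    qed
  qed (use ends in auto)
  moreover have "?f (of_real (m + 1)) - ?f (of_real m) = zeta_term n s"
  proof -
    have "of_real (m + 1) = (of_real (real n + 2) :: complex)" by (simp add: m_def)
    then show ?thesis unfolding zeta_term_def by (simp add: m_def algebra_simps)
  qed
  moreover have "norm (of_real (m + 1) - of_real m :: complex) = 1" by simp
  ultimately show ?thesis by (simp add: m_def mult.assoc)
qed

lemma summable_shift_powr:
  assumes "a > 0"
  shows "summable (\<lambda>n. (real n + 1) powr (- 1 - a))" and "(\<Sum>n. (real n + 1) powr (- 1 - a)) \<le> 1 + 1 / a"
proof -
  let ?g = "\<lambda>n. (real n + 1) powr (- 1 - a)"
  have b: "(\<Sum>n<k. ?g (n + 1)) \<le> 1 / a" for k
    using sum_powr_tail_le[OF assms, of 1 k] by simp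
  have s: "summable (\<lambda>n. ?g (n + 1))"
    by (rule summableI_nonneg_bounded[where x = "1 / a"]) (use b in auto)
  then show sg: "summable ?g" by (subst (asm) summable_iff_shift[of ?g])
  have "(\<Sum>n. ?g n) = (\<Sum>n. ?g (n + 1)) + (\<Sum>n<1. ?g n)"
    by (rule suminf_split_initial_segment[OF sg])
  moreover have "(\<Sum>n. ?g (n + 1)) \<le> 1 / a" by (rule suminf_le_const[OF s b])
  ultimately show "(\<Sum>n. ?g n) \<le> 1 + 1 / a" by simp
qed

lemma zeta_reg_bound:
  assumes s: "Re s > 0"
  shows "norm (zeta_reg s - 1) \<le> norm (s - 1) * norm s * (1 + 1 / Re s)" and "summable (\<lambda>n. zeta_term n s)"
proof -
  let ?g = "\<lambda>n. norm (s - 1) * norm s * (real n + 1) powr (- 1 - Re s)"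
  have sg: "summable ?g" by (intro summable_mult summable_shift_powr s)
  have "norm (zeta_reg s - 1) \<le> (\<Sum>n. ?g n)"
    unfolding zeta_reg_def using norm_suminf_le[OF norm_zeta_term_le[OF s] sg] by simp
  also have "\<dots> = norm (s - 1) * norm s * (\<Sum>n. (real n + 1) powr (- 1 - Re s))"
    by (rule suminf_mult[OF summable_shift_powr(1)[OF s]])
  also have "\<dots> \<le> norm (s - 1) * norm s * (1 + 1 / Re s)"
    by (intro mult_left_mono summable_shift_powr s) auto
  finally show "norm (zeta_reg s - 1) \<le> norm (s - 1) * norm s * (1 + 1 / Re s)" .
  show "summable (\<lambda>n. zeta_term n s)"
    by (rule summable_norm_cancel, rule summable_comparison_test'[OF sg]) (use norm_zeta_term_le[OF s] in simp)
qed

lemma holomorphic_zeta_reg: "zeta_reg holomorphic_on {s. Re s > 0}"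
proof -
  have "(\<lambda>s. \<Sum>n. zeta_term n s) holomorphic_on {s. Re s > 0}"
  proof (rule holomorphic_on_suminf)
    show "open {s. Re s > 0}" by (rule open_halfspace_Re_gt)
    show "zeta_term n holomorphic_on {s. Re s > 0}" for n
      unfolding zeta_term_def by (intro holomorphic_intros)
    fix x assume x: "x \<in> {s. Re s > 0}"
    define d where "d = Re x / 2"
    have d: "d > 0" using x by (simp add: d_def)
    define K where "K = norm x + d + 1"
    have y: "Re y \<ge> d" "norm y \<le> K" "norm (y - 1) \<le> K" if "y \<in> cball x d" for y
    proof -
      have n: "norm (y - x) \<le> d" using that by (simp add: dist_norm norm_minus_commute)
      show "Re y \<ge> d" using abs_Re_le_cmod[of "y - x"] n by (simp add: d_def)
      have "norm y \<le> norm x + d" using norm_triangle_sub[of y x] n by simp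
      then show "norm y \<le> K" "norm (y - 1) \<le> K" using norm_triangle_ineq4[of y 1] by (simp_all add: K_def)
    qed
    show "\<exists>d M. 0 < d \<and> cball x d \<subseteq> {s. Re s > 0} \<and> summable M \<and> (\<forall>n. \<forall>y\<in>cball x d. norm (zeta_term n y) \<le> M n)"
    proof (intro exI[of _ d] exI[of _ "\<lambda>n. K * K * (real n + 1) powr (- 1 - d)"] conjI allI ballI)
      show "cball x d \<subseteq> {s. Re s > 0}" using y d by fastforce
      show "summable (\<lambda>n. K * K * (real n + 1) powr (- 1 - d))" by (intro summable_mult summable_shift_powr d)
      fix n z assume z: "z \<in> cball x d"
      have "norm (zeta_term n z) \<le> norm (z - 1) * norm z * (real n + 1) powr (- 1 - Re z)"
        by (rule norm_zeta_term_le) (use y[OF z] d in linarith)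
      also have "\<dots> \<le> K * K * (real n + 1) powr (- 1 - d)"
        using y[OF z] by (intro mult_mono powr_mono mult_nonneg_nonneg) (auto intro: order_trans[OF norm_ge_zero])
      finally show "norm (zeta_term n z) \<le> K * K * (real n + 1) powr (- 1 - d)" .
    qed (rule d)
  qed
  then show ?thesis unfolding zeta_reg_def[abs_def] by (intro holomorphic_on_add holomorphic_on_const)
qed

lemma zeta_reg_eq_gt1:
  assumes s: "Re s > 1"
  shows "zeta_reg s = (s - 1) * zeta s"
proof -
  have "(\<lambda>n. 1 / of_nat (Suc n) powr s) sums zeta s"
    using dirichlet_series_1_eq[OF s] zeta_eq_dirichlet_series[OF s]
    unfolding dirichlet_series_def by (simp only: sums_iff)
  then have 1: "(\<lambda>n. (s - 1) * (1 / of_nat (Suc n) powr s)) sums ((s - 1) * zeta s)" by (rule sums_mult)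
  have "(\<lambda>n. of_real (real n + 1) powr (1 - s) :: complex) \<longlonglongrightarrow> 0"
  proof (rule tendsto_norm_zero_cancel)
    have "(\<lambda>n. (real n + 1) powr (1 - Re s)) \<longlonglongrightarrow> 0"
      by (rule tendsto_neg_powr)
         (use s in simp, rule filterlim_at_top_mono[OF filterlim_real_sequentially], simp)
    then show "(\<lambda>n. norm (of_real (real n + 1) powr (1 - s) :: complex)) \<longlonglongrightarrow> 0"
      by (simp add: norm_powr_real_powr del: of_real_add)
  qed
  from telescope_sums[OF this]
  have 2: "(\<lambda>n. of_real (real n + 2) powr (1 - s) - of_real (real n + 1) powr (1 - s)) sums (0 - 1 :: complex)"
    by (simp add: add_ac)
  have "(\<lambda>n. zeta_term n s) sums ((s - 1) * zeta s + (0 - 1))"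
  proof (rule sums_cong[THEN iffD1, OF _ sums_add[OF 1 2]])
    show "(s - 1) * (1 / of_nat (Suc n) powr s) + (of_real (real n + 2) powr (1 - s) - of_real (real n + 1) powr (1 - s)) = zeta_term n s" for n
      by (simp add: zeta_term_def powr_minus_divide add.commute)
  qed
  then show ?thesis by (simp add: zeta_reg_def sums_iff)
qed

text \<open>Identity of analytic functions on the punctured half-plane; the value of \<open>zeta\<close> at 1 is a convention and has to be
excluded.\<close>

lemma zeta_eq_zeta_reg:
  assumes s: "Re s > 0" "s \<noteq> 1"
  shows "zeta s = zeta_reg s / (s - 1)"
proof -
  have op: "open ({s. Re s > 0} - {1})" by (intro open_Diff open_halfspace_Re_gt) auto
  have "(s - 1) * zeta s = zeta_reg s"
  proof (rule analytic_continuation_open[where f = "\<lambda>s. (s - 1) * zeta s" and g = zeta_reg and s = "{s. Re s > 1}" and s' = "{s. Re s > 0} - {1}"])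
    show "connected ({s. Re s > 0} - {1})"
      by (rule connected_open_delete) (auto intro: open_halfspace_Re_gt convex_connected convex_halfspace_Re_gt)
    show "(\<lambda>s. (s - 1) * zeta s) holomorphic_on {s. Re s > 0} - {1}"
      by (intro holomorphic_on_mult holomorphic_on_subset[OF holomorphic_zeta] holomorphic_intros) auto
    show "zeta_reg holomorphic_on {s. Re s > 0} - {1}"
      by (rule holomorphic_on_subset[OF holomorphic_zeta_reg]) auto
    show "{s. Re s > 1} \<noteq> {}" by (rule ex_in_conv[THEN iffD1]) (rule exI[of _ 2], simp)
  qed (use s op zeta_reg_eq_gt1 in \<open>auto simp: open_halfspace_Re_gt\<close>)
  then show ?thesis using s by (simp add: field_simps)
qed

lemma summable_ln_powr:
  assumes "a > 1"
  shows "summable (\<lambda>n. ln (real (Suc n)) * real (Suc n) powr - a)"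
proof (rule summable_comparison_test')
  define e where "e = (a - 1) / 2"
  have e: "e > 0" "a - e > 1" using assms by (auto simp: e_def field_simps)
  show "summable (\<lambda>n. 1 / e * real (Suc n) powr - (a - e))" by (intro summable_mult summable_Suc_powr e)
  fix n
  have "ln (real (Suc n)) * real (Suc n) powr - a \<le> real (Suc n) powr e / e * real (Suc n) powr - a"
    using e by (intro mult_right_mono ln_powr_bound) auto
  also have "\<dots> = 1 / e * (real (Suc n) powr e * real (Suc n) powr - a)" by simp
  also have "real (Suc n) powr e * real (Suc n) powr - a = real (Suc n) powr - (a - e)"
    unfolding powr_add[symmetric] by simp
  finally show "norm (ln (real (Suc n)) * real (Suc n) powr - a) \<le> 1 / e * real (Suc n) powr - (a - e)"
    by (simp add: abs_mult)
qed

lemma deriv_zeta_sums: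
  assumes s: "Re s > 1"
  shows "(\<lambda>n. of_real (ln (real (Suc n))) * (1 / of_nat (Suc n) powr s)) sums (- deriv zeta s)"
proof -
  define a where "a = (1 + Re s) / 2"
  have a: "a > 1" "Re s > a" using s by (auto simp: a_def)
  let ?S = "{z. Re z > a}"
  let ?f = "\<lambda>n z. of_nat (Suc n) powr (- z) :: complex"
  let ?f' = "\<lambda>n z. - of_real (ln (real (Suc n))) * of_nat (Suc n) powr (- z) :: complex"
  have df: "(?f n has_field_derivative ?f' n z) (at z within ?S)" for n z
  proof -
    have "((\<lambda>z. of_nat (Suc n) powr (- z) :: complex) has_field_derivative (Ln (of_nat (Suc n)) * of_nat (Suc n) powr (- z) * (- 1))) (at z within ?S)"
      by (rule DERIV_chain2[OF has_field_derivative_powr_right]) (auto intro!: derivative_eq_intros simp del: of_nat_Suc)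
    moreover have "Ln (of_nat (Suc n)) = (of_real (ln (real (Suc n))) :: complex)"
      by (metis Ln_of_nat nat.distinct(1) of_nat_0 Ln_of_real of_real_of_nat_eq of_nat_0_less_iff zero_less_Suc)
    ultimately show ?thesis by (simp add: mult_ac del: of_nat_Suc)
  qed
  have nf: "norm (?f n z) = real (Suc n) powr - Re z" for n z
    by (subst norm_nat_powr) auto
  have uc: "uniformly_convergent_on ?S (\<lambda>n z. \<Sum>i<n. ?f' i z)"
  proof (rule Weierstrass_m_test')
    show "summable (\<lambda>n. ln (real (Suc n)) * real (Suc n) powr - a)" by (rule summable_ln_powr[OF a(1)])
    fix n z assume z: "z \<in> ?S"
    have "norm (?f' n z) = ln (real (Suc n)) * real (Suc n) powr - Re z"
      unfolding norm_mult nf by simp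
    also have "\<dots> \<le> ln (real (Suc n)) * real (Suc n) powr - a"
      using z by (intro mult_left_mono powr_mono) auto
    finally show "norm (?f' n z) \<le> ln (real (Suc n)) * real (Suc n) powr - a" .
  qed
  have zs: "(\<lambda>n. ?f n z) sums zeta z" if "Re z > 1" for z
    using dirichlet_series_1_eq[OF that] zeta_eq_dirichlet_series[OF that]
    unfolding dirichlet_series_def by (simp add: sums_iff powr_minus_divide)
  have s_in: "s \<in> ?S" using a by simp
  have ints: "s \<in> interior ?S" using a by (simp add: interior_open open_halfspace_Re_gt)
  have D: "((\<lambda>z. \<Sum>n. ?f n z) has_field_derivative (\<Sum>n. ?f' n s)) (at s)"
    by (rule has_field_derivative_series'(2)[OF convex_halfspace_Re_gt df uc s_in sums_summable[OF zs[OF s]] ints])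
  have "(zeta has_field_derivative (\<Sum>n. ?f' n s)) (at s)"
    by (rule has_field_derivative_transform_within_open[OF D, where S = "?S"])
       (use a zs in \<open>auto simp: sums_iff open_halfspace_Re_gt\<close>)
  then have dz: "deriv zeta s = (\<Sum>n. ?f' n s)" by (rule DERIV_imp_deriv)
  have "summable (\<lambda>n. ?f' n s)"
  proof (rule summable_norm_cancel, rule summable_comparison_test'[OF summable_ln_powr[OF s]])
    show "norm (norm (?f' n s)) \<le> ln (real (Suc n)) * real (Suc n) powr - Re s" for n
      unfolding norm_mult nf by simp
  qed
  then have "(\<lambda>n. ?f' n s) sums deriv zeta s" unfolding dz by (rule summable_sums)
  from sums_minus[OF this] show ?thesis by (simp add: powr_minus_divide)
qed

lemma mangoldt_nonneg: "mangoldt n \<ge> (0::real)"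
proof (cases "primepow n")
  case True
  then obtain p k where "prime p" "k > 0" "n = p ^ k" by (auto simp: primepow_def)
  then show ?thesis using prime_ge_1_nat[of p] by (simp add: mangoldt_primepow)
qed (simp add: mangoldt_def)

lemma dconv_mangoldt_1:
  assumes "n > 0"
  shows "dconv mangoldt (\<lambda>_. 1) n = ln (real n)"
proof -
  have "dconv mangoldt (\<lambda>_. 1) n = (\<Sum>d | d dvd n. mangoldt d :: real)"
    unfolding dconv_def
    by (rule sum.reindex_bij_witness[where i = "\<lambda>d. (d, n div d)" and j = fst]) (use assms in auto)
  then show ?thesis using mangoldt_sum[of n, where 'a = real] assms by simp
qed

lemma mangoldt_le_ln: "n > 0 \<Longrightarrow> mangoldt n \<le> ln (real n)"
proof -
  assume n: "n > 0"
  have "mangoldt n \<le> (\<Sum>d | d dvd n. mangoldt d :: real)"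
    by (rule member_le_sum) (use n mangoldt_nonneg in \<open>auto intro: finite_divisors_nat\<close>)
  then show ?thesis using mangoldt_sum[of n, where 'a = real] n by simp
qed

text \<open>From \<open>\<Lambda> * 1 = log\<close>: the series \<open>\<Sum> \<Lambda>(n) n\<^sup>-\<^sup>s\<close> times \<open>\<zeta>(s)\<close> is \<open>\<Sum> log n n\<^sup>-\<^sup>s = - \<zeta>'(s)\<close>.\<close>

lemma log_deriv_zeta_sums:
  assumes s: "Re s > 1"
  shows "(\<lambda>n. of_real (mangoldt (Suc n)) * (1 / of_nat (Suc n) powr s)) sums (- (deriv zeta s / zeta s))"
proof -
  let ?w = "\<lambda>n. 1 / of_nat n powr s :: complex"
  let ?L = "\<lambda>n. of_real (mangoldt n) * ?w n"
  have sL: "?L norm_summable_on {1..}"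
    unfolding norm_summable_on_iff_Suc
  proof (rule summable_comparison_test'[OF summable_ln_powr[OF s]])
    fix n
    have "norm (?L (Suc n)) = mangoldt (Suc n) * real (Suc n) powr - Re s"
      using mangoldt_nonneg[of "Suc n"] by (simp add: norm_mult norm_divide norm_nat_powr powr_minus_divide del: of_nat_Suc)
    also have "\<dots> \<le> ln (real (Suc n)) * real (Suc n) powr - Re s"
      by (intro mult_right_mono mangoldt_le_ln) auto
    finally show "norm (norm (?L (Suc n))) \<le> ln (real (Suc n)) * real (Suc n) powr - Re s" by simp
  qed
  have s1: "(\<lambda>n. 1 * ?w n) norm_summable_on {1..}"
    using norm_summable_bounded_euler[of geo_fps s] s by (simp add: euler_fun_geo)
  have z: "infsum (\<lambda>n. 1 * ?w n) {1..} = zeta s"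
    using zeta_euler_series(1)[OF s] by (simp add: euler_series_def euler_fun_geo)
  have "(dconv ?L (\<lambda>n. 1 * ?w n) has_sum (infsum ?L {1..} * zeta s)) {1..}"
    using has_sum_dconv[OF sL s1] unfolding z .
  from has_sum_imp_sums_Suc[OF this]
  have "(\<lambda>n. dconv ?L (\<lambda>n. 1 * ?w n) (Suc n)) sums (infsum ?L {1..} * zeta s)" .
  moreover have "dconv ?L (\<lambda>n. 1 * ?w n) (Suc n) = of_real (ln (real (Suc n))) * ?w (Suc n)" for n
  proof -
    have "dconv ?L (\<lambda>n. 1 * ?w n) (Suc n) = dconv (\<lambda>n. of_real (mangoldt n)) (\<lambda>n. 1) (Suc n) * ?w (Suc n)"
      by (rule dconv_completely_multiplicative) (use completely_mult_powr[of s] in \<open>auto simp: completely_mult_def\<close>)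
    also have "dconv (\<lambda>n. of_real (mangoldt n)) (\<lambda>n. 1) (Suc n) = (of_real (dconv mangoldt (\<lambda>_. 1) (Suc n)) :: complex)"
      unfolding of_real_dconv by simp
    finally show ?thesis by (simp only: dconv_mangoldt_1[OF zero_less_Suc])
  qed
  ultimately have "infsum ?L {1..} * zeta s = - deriv zeta s"
    using deriv_zeta_sums[OF s] by (simp only: sums_unique2)
  then have "infsum ?L {1..} = - (deriv zeta s / zeta s)"
    using zeta_euler_series(3)[OF s] by (simp add: field_simps)
  then show ?thesis
    using has_sum_imp_sums_Suc[OF has_sum_infsum[OF abs_summable_summable[OF sL]]] by simp
qed

text \<open>The classical inequality from \<open>3 + 4 cos \<phi> + cos 2\<phi> = 2 (1 + cos \<phi>)\<^sup>2 \<ge> 0\<close> and \<open>\<Lambda> \<ge> 0\<close>.\<close>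

lemma zeta_341:
  assumes "\<sigma> > 1"
  shows "0 \<le> 3 * Re (- (deriv zeta (of_real \<sigma>) / zeta (of_real \<sigma>)))
     + 4 * Re (- (deriv zeta (Complex \<sigma> t) / zeta (Complex \<sigma> t)))
     + Re (- (deriv zeta (Complex \<sigma> (2 * t)) / zeta (Complex \<sigma> (2 * t))))"
proof -
  have S: "(\<lambda>n. mangoldt (Suc n) * (real (Suc n) powr - \<sigma> * cos (y * ln (real (Suc n)))))
     sums Re (- (deriv zeta (Complex \<sigma> y) / zeta (Complex \<sigma> y)))" for y
  proof -
    have "Re (of_real (mangoldt (Suc n)) * (1 / of_nat (Suc n) powr Complex \<sigma> y)) =
       mangoldt (Suc n) * (real (Suc n) powr - \<sigma> * cos (y * ln (real (Suc n))))" for n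
    proof -
      have "1 / of_nat (Suc n) powr Complex \<sigma> y = exp (- Complex \<sigma> y * of_real (ln (real (Suc n))))"
      proof -
        have "Ln (of_nat (Suc n)) = (of_real (ln (real (Suc n))) :: complex)"
          by (metis Ln_of_real of_real_of_nat_eq of_nat_0_less_iff zero_less_Suc)
        then show ?thesis unfolding powr_def by (simp add: exp_minus divide_inverse del: of_nat_Suc)
      qed
      also have "Re \<dots> = exp (- \<sigma> * ln (real (Suc n))) * cos (y * ln (real (Suc n)))"
        by (simp add: Re_exp)
      also have "exp (- \<sigma> * ln (real (Suc n))) = real (Suc n) powr - \<sigma>" by (simp add: powr_def)
      finally show ?thesis by (simp only: Re_complex_of_real Im_complex_of_real times_complex.simps mult_zero_left diff_zero)
    qed
    then show ?thesis using sums_Re[OF log_deriv_zeta_sums[of "Complex \<sigma> y"]] assms by simp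
  qed
  have e: "Complex \<sigma> 0 = of_real \<sigma>" by (simp add: complex_eq_iff)
  note S3 = sums_add[OF sums_add[OF sums_mult[OF S[of 0, unfolded e], of 3] sums_mult[OF S[of t], of 4]] S[of "2 * t"]]
  show ?thesis
  proof (rule sums_le[OF _ sums_zero S3])
    fix n
    let ?x = "t * ln (real (Suc n))"
    have "3 + 4 * cos x + cos (2 * x) = 2 * (1 + cos x) ^ 2" for x :: real
      unfolding cos_double_cos by (simp add: power2_eq_square algebra_simps)
    then have p: "0 \<le> 3 + 4 * cos ?x + cos (2 * ?x)" by simp
    have "0 \<le> mangoldt (Suc n) * real (Suc n) powr - \<sigma> * (3 + 4 * cos ?x + cos (2 * ?x))"
      by (intro mult_nonneg_nonneg mangoldt_nonneg p) auto
    then show "0 \<le> 3 * (mangoldt (Suc n) * (real (Suc n) powr - \<sigma> * cos (0 * ln (real (Suc n))))) +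
        4 * (mangoldt (Suc n) * (real (Suc n) powr - \<sigma> * cos ?x)) +
        mangoldt (Suc n) * (real (Suc n) powr - \<sigma> * cos (2 * t * ln (real (Suc n))))"
      by (simp add: algebra_simps)
  qed
qed

section \<open>Zeros near the line with real part one\<close>

text \<open>This is \<open>(s - 1) \<zeta>(s) / (s + 1)\<close>: the pole at 1 is removed, the zeros with \<open>Re s > 0\<close> and \<open>s \<noteq> 1\<close> are those of \<open>\<zeta>\<close>, and dividing by \<open>s + 1\<close> keeps
the growth linear. Near the line \<open>Re s = 1\<close> its bounds hold uniformly down to \<open>Im s = 0\<close>.\<close>

definition zeta_w :: "complex \<Rightarrow> complex" where
  "zeta_w s = zeta_reg s / (s + 1)"

lemma norm_plus_1_ge: "Re s > 0 \<Longrightarrow> norm (s + 1) \<ge> 1" "Re s \<ge> 0 \<Longrightarrow> norm (s - 1) \<le> norm (s + 1)"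
proof -
  show "norm (s + 1) \<ge> 1" if "Re s > 0" using abs_Re_le_cmod[of "s + 1"] that by simp
  show "norm (s - 1) \<le> norm (s + 1)" if "Re s \<ge> 0"
  proof (rule power2_le_imp_le)
    show "(norm (s - 1))\<^sup>2 \<le> (norm (s + 1))\<^sup>2"
      unfolding cmod_power2 using that by (simp add: power2_eq_square algebra_simps)
  qed simp
qed

lemma holomorphic_zeta_w: "S \<subseteq> {s. Re s > 0} \<Longrightarrow> zeta_w holomorphic_on S"
proof -
  assume S: "S \<subseteq> {s. Re s > 0}"
  have "s + 1 \<noteq> 0" if "s \<in> S" for s using that S norm_plus_1_ge(1)[of s] by auto
  then show ?thesis unfolding zeta_w_def
    by (intro holomorphic_on_divide holomorphic_on_subset[OF holomorphic_zeta_reg S] holomorphic_intros) auto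
qed

lemma norm_zeta_w_le:
  assumes "Re s \<ge> 1 / 2"
  shows "norm (zeta_w s) \<le> 1 + 3 * norm s"
proof -
  have s0: "Re s > 0" using assms by simp
  have "1 / Re s \<le> 2" using assms s0 by (simp add: field_simps)
  then have "norm (s - 1) * norm s * (1 + 1 / Re s) \<le> norm (s - 1) * norm s * 3"
    by (intro mult_left_mono) auto
  then have "norm (zeta_reg s - 1) \<le> norm (s - 1) * (3 * norm s)"
    using zeta_reg_bound(1)[OF s0] by (simp add: mult_ac)
  also have "\<dots> \<le> norm (s + 1) * (3 * norm s)"
    using s0 by (intro mult_right_mono norm_plus_1_ge) auto
  finally have "norm (zeta_reg s) \<le> norm (s + 1) * (3 * norm s) + 1"
    using norm_triangle_sub[of "zeta_reg s" 1] by simp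
  also have "\<dots> \<le> norm (s + 1) * (1 + 3 * norm s)"
    using norm_plus_1_ge(1)[OF s0] by (simp add: distrib_left)
  finally show ?thesis using norm_plus_1_ge(1)[OF s0]
    by (simp add: zeta_w_def norm_divide divide_le_eq mult.commute)
qed

lemma zeta_w_eq:
  assumes "Re s > 0" "s \<noteq> 1"
  shows "zeta_w s = (s - 1) * zeta s / (s + 1)"
  using zeta_eq_zeta_reg[OF assms] assms by (simp add: zeta_w_def)

text \<open>At \<open>s = 1\<close> both sides are 0, the left one since \<open>zeta 1 = 0\<close> by convention.\<close>

lemma inverse_zeta_eq:
  assumes "Re s > 0"
  shows "inverse (zeta s) = (s - 1) / ((s + 1) * zeta_w s)"
proof (cases "s = 1")
  case True
  then show ?thesis by (simp add: zeta_1)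
next
  case False
  have "s + 1 \<noteq> 0" using norm_plus_1_ge(1)[OF assms] by auto
  then have "(s + 1) * zeta_w s = (s - 1) * zeta s" by (simp add: zeta_w_eq[OF assms False])
  then show ?thesis using False by (simp add: divide_inverse)
qed

text \<open>Here \<open>1 / \<zeta>(s) = \<Sum> \<mu>(n) / n\<^sup>s\<close> is bounded by \<open>\<sigma> / (\<sigma> - 1)\<close>, \<open>\<sigma> = Re s\<close>, and \<open>\<bar>s - 1\<bar> / \<bar>s + 1\<bar>\<close> is smallest on the real axis.\<close>

lemma norm_zeta_w_ge:
  assumes s: "Re s > 1"
  shows "norm (zeta_w s) \<ge> (Re s - 1)\<^sup>2 / (Re s * (Re s + 1))"
proof -
  define m where "m = euler_series (1 - fps_X) (\<lambda>n. 1 / of_nat n powr s :: complex)"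
  have zm: "zeta s * m = 1" unfolding m_def by (rule zeta_euler_series(2)[OF s])
  have sm: "(\<lambda>n. of_real (euler_fun (1 - fps_X) n) * (1 / of_nat n powr s :: complex)) norm_summable_on {1..}"
    by (rule norm_summable_bounded_euler[OF abs_euler_fun_le_1 s]) (simp add: nth_one_minus_X)
  have "(\<lambda>n. of_real (euler_fun (1 - fps_X) (Suc n)) / of_nat (Suc n) powr s) sums m"
    unfolding m_def by (rule dirichlet_series_euler(1)[OF sm])
  then have "m = (\<Sum>n. of_real (euler_fun (1 - fps_X) (Suc n)) / of_nat (Suc n) powr s)" by (simp add: sums_iff)
  also have "norm \<dots> \<le> (\<Sum>n. (real n + 1) powr (- 1 - (Re s - 1)))"
  proof (rule norm_suminf_le)
    show "summable (\<lambda>n. (real n + 1) powr (- 1 - (Re s - 1)))" using s by (intro summable_shift_powr) simp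
    fix n
    have "norm (of_real (euler_fun (1 - fps_X) (Suc n)) / of_nat (Suc n) powr s :: complex) = \<bar>euler_fun (1 - fps_X) (Suc n)\<bar> / real (Suc n) powr Re s"
      by (simp add: norm_divide norm_nat_powr del: of_nat_Suc)
    also have "\<dots> \<le> 1 / real (Suc n) powr Re s"
      by (intro divide_right_mono abs_euler_fun_le_1) (auto simp: nth_one_minus_X)
    also have "\<dots> = (real n + 1) powr (- 1 - (Re s - 1))" by (simp add: powr_minus_divide add.commute)
    finally show "norm (of_real (euler_fun (1 - fps_X) (Suc n)) / of_nat (Suc n) powr s :: complex) \<le> (real n + 1) powr (- 1 - (Re s - 1))" .
  qed
  also have "\<dots> \<le> 1 + 1 / (Re s - 1)" using s by (intro summable_shift_powr) simp
  also have "\<dots> = Re s / (Re s - 1)" using s by (simp add: field_simps)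
  finally have m: "norm m \<le> Re s / (Re s - 1)" .
  have "norm (zeta s) * norm m = 1" using zm by (metis norm_mult norm_one)
  then have "1 \<le> norm (zeta s) * (Re s / (Re s - 1))"
    using mult_left_mono[OF m norm_ge_zero[of "zeta s"]] by simp
  then have z: "norm (zeta s) \<ge> (Re s - 1) / Re s" using s by (simp add: field_simps)
  have r0: "(Re s - 1) * norm (s + 1) \<le> (Re s + 1) * norm (s - 1)"
  proof (rule power2_le_imp_le)
    have "((Re s + 1) * norm (s - 1))\<^sup>2 - ((Re s - 1) * norm (s + 1))\<^sup>2 = 4 * Re s * (Im s)\<^sup>2"
      unfolding power_mult_distrib cmod_power2 by (simp add: power2_eq_square algebra_simps)
    moreover have "0 \<le> 4 * Re s * (Im s)\<^sup>2" using s by simp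
    ultimately show "((Re s - 1) * norm (s + 1))\<^sup>2 \<le> ((Re s + 1) * norm (s - 1))\<^sup>2" by linarith
  qed (use s in simp)
  have r: "(Re s - 1) / (Re s + 1) \<le> norm (s - 1) / norm (s + 1)"
  proof -
    have n: "norm (s + 1) > 0" "Re s + 1 > 0" using s norm_plus_1_ge(1)[of s] by auto
    have "(Re s - 1) \<le> norm (s - 1) * (Re s + 1) / norm (s + 1)"
      using n r0 by (simp add: pos_le_divide_eq mult.commute)
    then show ?thesis using n by (simp add: pos_divide_le_eq)
  qed
  have "(Re s - 1)\<^sup>2 / (Re s * (Re s + 1)) = ((Re s - 1) / (Re s + 1)) * ((Re s - 1) / Re s)"
    by (simp add: power2_eq_square)
  also have "\<dots> \<le> (norm (s - 1) / norm (s + 1)) * norm (zeta s)"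
    using s by (intro mult_mono r z) auto
  also have "\<dots> = norm (zeta_w s)"
  proof -
    have "s \<noteq> 1" "Re s > 0" using s by auto
    then show ?thesis by (simp add: zeta_w_eq norm_mult norm_divide)
  qed
  finally show ?thesis .
qed

lemma zeta_w_lower:
  assumes "0 < \<eta>" "\<eta> \<le> 1" "Re s = 1 + \<eta>"
  shows "norm (zeta_w s) \<ge> \<eta>\<^sup>2 / 6" "zeta_w s \<noteq> 0"
proof -
  have "(1 + \<eta>) * (1 + \<eta> + 1) \<le> 2 * 3" using assms by (intro mult_mono) auto
  then have "\<eta>\<^sup>2 / 6 \<le> \<eta>\<^sup>2 / ((1 + \<eta>) * (1 + \<eta> + 1))" using assms by (intro divide_left_mono) auto
  moreover have "\<eta>\<^sup>2 / ((1 + \<eta>) * (1 + \<eta> + 1)) \<le> norm (zeta_w s)"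
    using norm_zeta_w_ge[of s] assms by simp
  ultimately show le: "norm (zeta_w s) \<ge> \<eta>\<^sup>2 / 6" by linarith
  have "0 < \<eta>\<^sup>2 / 6" using assms by simp
  with le show "zeta_w s \<noteq> 0" by auto
qed

lemma zeta_w_nonzero_gt1: "Re s > 1 \<Longrightarrow> zeta_w s \<noteq> 0"
proof -
  assume s: "Re s > 1"
  then have "0 < (Re s - 1)\<^sup>2 / (Re s * (Re s + 1))" by simp
  with norm_zeta_w_ge[OF s] show ?thesis by auto
qed

lemma log_deriv_zeta_w:
  assumes s: "Re s > 1"
  shows "deriv zeta_w s / zeta_w s = 1 / (s - 1) + deriv zeta s / zeta s - 1 / (s + 1)"
proof -
  have z: "zeta s \<noteq> 0" by (rule zeta_euler_series(3)[OF s])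
  have n1: "s - 1 \<noteq> 0" "s + 1 \<noteq> 0" using s norm_plus_1_ge(1)[of s] by auto
  have dz: "(zeta has_field_derivative deriv zeta s) (at s)"
    by (rule holomorphic_derivI[OF holomorphic_zeta]) (use n1 in auto)
  have "((\<lambda>s. (s - 1) * zeta s / (s + 1)) has_field_derivative
      (((1 * zeta s + deriv zeta s * (s - 1)) * (s + 1) - (s - 1) * zeta s * 1) / ((s + 1) * (s + 1)))) (at s)"
    by (rule DERIV_divide[OF DERIV_mult[OF _ dz]]) (use n1 in \<open>auto intro!: derivative_eq_intros\<close>)
  then have "(zeta_w has_field_derivative
      (((1 * zeta s + deriv zeta s * (s - 1)) * (s + 1) - (s - 1) * zeta s * 1) / ((s + 1) * (s + 1)))) (at s)"
  proof (rule has_field_derivative_transform_within_open[where S = "{s. Re s > 1}"])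
    fix x assume "x \<in> {s. 1 < Re s}"
    then have "Re x > 0" "x \<noteq> 1" by auto
    then show "(x - 1) * zeta x / (x + 1) = zeta_w x" by (simp add: zeta_w_eq)
  qed (use s in \<open>auto simp: open_halfspace_Re_gt\<close>)
  then have "deriv zeta_w s = (((1 * zeta s + deriv zeta s * (s - 1)) * (s + 1) - (s - 1) * zeta s * 1) / ((s + 1) * (s + 1)))"
    by (rule DERIV_imp_deriv)
  moreover have "zeta_w s = (s - 1) * zeta s / (s + 1)" using s by (intro zeta_w_eq) auto
  moreover have "((1 * Z + D * a) * b - a * Z * 1) / (b * b) / (a * Z / b) = 1 / a + D / Z - 1 / b"
    if "a \<noteq> 0" "b \<noteq> 0" "Z \<noteq> 0" for a b D Z :: complex
    using that by (simp add: field_simps)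
  ultimately show ?thesis using z n1 by metis
qed

text \<open>The quantity \<open>1 + log (1 / \<bar>f(0)\<bar>)\<close> of Landau's estimate, in terms of the centre \<open>1 + \<eta> + \<i>t\<close>.\<close>

definition log_size :: "real \<Rightarrow> real \<Rightarrow> real" where
  "log_size \<eta> t = 1 + ln (54 * (\<bar>t\<bar> + 1) / \<eta>\<^sup>2)"

text \<open>Landau's estimate on the disc of radius \<open>1/2\<close> around \<open>1 + \<eta> + \<i>t\<close>, scaled to the unit disc. Zeros of \<open>zeta_w\<close> lie in the left half since
there are none with \<open>Re s > 1\<close>. A zero \<open>\<beta> + \<i>t\<close> at distance \<open>d = 1 + \<eta> - \<beta>\<close> corresponds to the point \<open>-2d\<close> of the unit disc and contributes
\<open>-1/d\<close> up to a bounded amount.\<close>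

lemma zeta_w_landau:
  fixes \<eta> t \<beta> :: real
  assumes \<eta>: "0 < \<eta>" "\<eta> \<le> 1 / 4"
  defines "s0 \<equiv> Complex (1 + \<eta>) t"
  shows "- Re (deriv zeta_w s0 / zeta_w s0) \<le> 8 * log_size \<eta> t"
    and "\<lbrakk>zeta_w (Complex \<beta> t) = 0; 1 + \<eta> - \<beta> < 1 / 2\<rbrakk> \<Longrightarrow>
       - Re (deriv zeta_w s0 / zeta_w s0) \<le> 8 * log_size \<eta> t + 2 - 1 / (1 + \<eta> - \<beta>)"
proof -
  \<comment> \<open>A bound for \<open>zeta_w\<close> on the disc, which makes \<open>\<bar>f\<bar> \<le> 1\<close> on the unit disc.\<close>
  define K where "K = 9 * (\<bar>t\<bar> + 1)"
  have K: "K > 0" by (simp add: K_def add_nonneg_pos)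
  define f where "f z = zeta_w (s0 + of_real (1 / 2) * z) / of_real K" for z
  have ballRe: "Re (s0 + of_real (1 / 2) * z) \<ge> 1 / 2" "norm (s0 + of_real (1 / 2) * z) \<le> 2 + \<bar>t\<bar>" if "norm z < 1" for z
  proof -
    show "Re (s0 + of_real (1 / 2) * z) \<ge> 1 / 2" using abs_Re_le_cmod[of z] that \<eta> by (simp add: s0_def)
    have "norm (s0 + of_real (1 / 2) * z) \<le> norm s0 + norm (of_real (1 / 2) * z)" by (rule norm_triangle_ineq)
    moreover have "norm s0 \<le> 5 / 4 + \<bar>t\<bar>" using cmod_le[of s0] \<eta> by (simp add: s0_def)
    moreover have "norm (of_real (1 / 2) * z) \<le> 1 / 2" using that by (simp add: norm_mult)
    ultimately show "norm (s0 + of_real (1 / 2) * z) \<le> 2 + \<bar>t\<bar>" by linarith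
  qed
  have zw: "zeta_w holomorphic_on ball s0 (1 / 2)"
  proof (rule holomorphic_zeta_w, safe)
    fix x assume "x \<in> ball s0 (1 / 2)"
    then have "norm (s0 - x) < 1 / 2" by (simp add: dist_norm)
    then show "Re x > 0" using abs_Re_le_cmod[of "s0 - x"] \<eta> by (simp add: s0_def)
  qed
  have hol: "f holomorphic_on ball 0 1"
    unfolding f_def using holomorphic_comp_scale[OF zw] K by (intro holomorphic_on_divide holomorphic_on_const) auto
  have b: "norm (f z) \<le> 1" if "norm z < 1" for z
  proof -
    have "norm (zeta_w (s0 + of_real (1 / 2) * z)) \<le> 1 + 3 * norm (s0 + of_real (1 / 2) * z)"
      by (rule norm_zeta_w_le[OF ballRe(1)[OF that]])
    also have "\<dots> \<le> K" using ballRe(2)[OF that] by (simp add: K_def)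
    finally show ?thesis using K by (simp add: f_def norm_divide)
  qed
  have low: "norm (zeta_w s0) \<ge> \<eta>\<^sup>2 / 6" "zeta_w s0 \<noteq> 0"
    using zeta_w_lower[of \<eta> s0] \<eta> by (auto simp: s0_def)
  have f0: "f 0 \<noteq> 0" using low K by (simp add: f_def)
  have zeros: "Re z \<le> 0" if "norm z < 1" "f z = 0" for z
  proof (rule ccontr)
    assume "\<not> Re z \<le> 0"
    then have "Re (s0 + of_real (1 / 2) * z) > 1" using \<eta> by (simp add: s0_def)
    from zeta_w_nonzero_gt1[OF this] show False using that K by (simp add: f_def)
  qed
  have df: "deriv f 0 / f 0 = deriv zeta_w s0 / zeta_w s0 / 2"
  proof -
    have "(zeta_w has_field_derivative deriv zeta_w s0) (at s0)"
      by (rule holomorphic_derivI[OF zw]) auto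
    then have "((\<lambda>z. zeta_w (s0 + of_real (1 / 2) * z)) has_field_derivative (deriv zeta_w s0 * of_real (1 / 2))) (at 0)"
      by (intro DERIV_chain2[where f = zeta_w]) (auto intro!: derivative_eq_intros)
    then have "(f has_field_derivative (deriv zeta_w s0 * of_real (1 / 2) / of_real K)) (at 0)"
      unfolding f_def by (rule DERIV_cdivide)
    then have "deriv f 0 = deriv zeta_w s0 * of_real (1 / 2) / of_real K" by (rule DERIV_imp_deriv)
    then show ?thesis using K by (simp add: f_def)
  qed
  have size: "1 + ln (1 / norm (f 0)) \<le> log_size \<eta> t"
  proof -
    have "1 / norm (f 0) = K / norm (zeta_w s0)" using K by (simp add: f_def norm_divide)
    also have "\<dots> \<le> K / (\<eta>\<^sup>2 / 6)" using low K \<eta> by (intro divide_left_mono) auto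
    also have "\<dots> = 54 * (\<bar>t\<bar> + 1) / \<eta>\<^sup>2" by (simp add: K_def)
    finally have le: "1 / norm (f 0) \<le> 54 * (\<bar>t\<bar> + 1) / \<eta>\<^sup>2" .
    have pos: "0 < 1 / norm (f 0)" using f0 by simp
    have "ln (1 / norm (f 0)) \<le> ln (54 * (\<bar>t\<bar> + 1) / \<eta>\<^sup>2)"
      using le pos ln_le_cancel_iff[OF pos less_le_trans[OF pos le]] by blast
    then show ?thesis by (simp only: log_size_def add_left_mono)
  qed
  have re: "Re (deriv f 0 / f 0) = Re (deriv zeta_w s0 / zeta_w s0) / 2"
    unfolding df by (rule Re_divide_numeral)
  have L1: "- Re (deriv f 0 / f 0) \<le> 4 * (1 + ln (1 / norm (f 0)))"
    by (rule landau_log_deriv[OF hol _ f0]) (use b zeros in auto)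
  show "- Re (deriv zeta_w s0 / zeta_w s0) \<le> 8 * log_size \<eta> t"
  proof -
    have "- x \<le> 8 * L" if "- (x / 2) \<le> 4 * l" "l \<le> L" for x l L :: real using that by linarith
    from this[OF L1[unfolded re] size] show ?thesis .
  qed
  assume \<beta>: "zeta_w (Complex \<beta> t) = 0" "1 + \<eta> - \<beta> < 1 / 2"
  define d where "d = 1 + \<eta> - \<beta>"
  have "\<not> Re (Complex \<beta> t) > 1" using zeta_w_nonzero_gt1 \<beta>(1) by blast
  then have d: "0 < d" "d < 1 / 2" using \<beta> \<eta> by (auto simp: d_def)
  define w where "w = (of_real (- 2 * d) :: complex)"
  have w: "norm w < 1" "norm w ^ 2 = 4 * d ^ 2" unfolding w_def norm_of_real using d by (auto simp: power_mult_distrib)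
  have sw: "s0 + of_real (1 / 2) * w = Complex \<beta> t" by (simp add: w_def s0_def d_def complex_eq_iff field_simps)
  have fw: "f w = 0" unfolding f_def sw using \<beta> by simp
  have rw: "Re (1 / w) = - 1 / (2 * d)" using d by (simp add: w_def Re_divide power2_eq_square)
  have m1: "(1 - norm w ^ 2) * Re (1 / w) = - 1 / (2 * d) + 2 * d"
    unfolding rw w(2) using d by (simp add: field_simps power2_eq_square)
  have m2: "- Re (deriv f 0 / f 0) \<le> (1 - norm w ^ 2) * Re (1 / w) + 4 * (1 + ln (1 / norm (f 0)))"
    by (rule landau_log_deriv_zero[OF hol _ f0 _ w(1) fw]) (use b zeros in auto)
  have m3: "- 1 / (2 * d) = - (1 / d) / 2" by simp
  show "- Re (deriv zeta_w s0 / zeta_w s0) \<le> 8 * log_size \<eta> t + 2 - 1 / (1 + \<eta> - \<beta>)"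
  proof -
    have "- x \<le> 8 * L + 2 - e"
      if "m = - 1 / (2 * d) + 2 * d" "- (x / 2) \<le> m + 4 * l" "- 1 / (2 * d) = - e / 2" "l \<le> L" for x l L m e :: real
      using that d by linarith
    from this[OF m1 m2[unfolded re] m3 size] show ?thesis unfolding d_def .
  qed
qed

lemma neg_log_deriv_zeta:
  assumes "0 < \<eta>"
  shows "Re (- (deriv zeta (Complex (1 + \<eta>) t) / zeta (Complex (1 + \<eta>) t)))
     \<le> \<eta> / (\<eta>\<^sup>2 + t\<^sup>2) - Re (deriv zeta_w (Complex (1 + \<eta>) t) / zeta_w (Complex (1 + \<eta>) t))"
proof -
  let ?s = "Complex (1 + \<eta>) t"
  have "- (deriv zeta ?s / zeta ?s) = 1 / (?s - 1) - 1 / (?s + 1) - deriv zeta_w ?s / zeta_w ?s"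
    using log_deriv_zeta_w[of ?s] assms by simp
  then have "Re (- (deriv zeta ?s / zeta ?s)) = Re (1 / (?s - 1)) - Re (1 / (?s + 1)) - Re (deriv zeta_w ?s / zeta_w ?s)"
    by (simp only: minus_complex.simps)
  moreover have "Re (1 / (?s - 1)) = \<eta> / (\<eta>\<^sup>2 + t\<^sup>2)" by (simp add: Re_divide)
  moreover have "Re (1 / (?s + 1)) \<ge> 0" using assms by (simp add: Re_divide)
  ultimately show ?thesis by linarith
qed

text \<open>The inequality of de la Vallee Poussin: in the 3-4-1 combination the pole at 1 contributes \<open>3/\<eta>\<close>, a zero \<open>\<beta> + \<i>t\<close> contributes
\<open>-4 / (1 + \<eta> - \<beta>)\<close>, and everything else is \<open>O(log_size)\<close>. For \<open>\<bar>t\<bar> \<ge> 1/5\<close> the pole changes the terms at \<open>t\<close> and \<open>2t\<close> by a bounded amount.\<close>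

lemma zero_distance_bound:
  assumes \<eta>: "0 < \<eta>" "\<eta> \<le> 1 / 4" and t: "\<bar>t\<bar> \<ge> 1 / 5"
    and \<beta>: "zeta_w (Complex \<beta> t) = 0" "1 + \<eta> - \<beta> < 1 / 2"
  shows "4 / (1 + \<eta> - \<beta>) \<le> 3 / \<eta> + 64 * log_size \<eta> (2 * t) + 40"
proof -
  have mono: "log_size \<eta> 0 \<le> log_size \<eta> (2 * t)" "log_size \<eta> t \<le> log_size \<eta> (2 * t)"
    unfolding log_size_def using \<eta> by (auto simp: divide_right_mono)
  have e: "Complex (1 + \<eta>) 0 = of_real (1 + \<eta>)" by (simp add: complex_eq_iff)
  have t2: "1 / 25 \<le> t\<^sup>2" using power_mono[OF t, of 2] by (simp add: power2_eq_square)
  have p: "\<eta> / (\<eta>\<^sup>2 + y\<^sup>2) \<le> 25 / 4" if "1 / 25 \<le> y\<^sup>2" for y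
  proof -
    have "1 / 25 \<le> \<eta>\<^sup>2 + y\<^sup>2" using that by (intro add_increasing) auto
    then have "\<eta> / (\<eta>\<^sup>2 + y\<^sup>2) \<le> (1 / 4) / (1 / 25)" using \<eta> by (intro frac_le) auto
    then show ?thesis by simp
  qed
  have "0 \<le> 3 * Re (- (deriv zeta (of_real (1 + \<eta>)) / zeta (of_real (1 + \<eta>))))
     + 4 * Re (- (deriv zeta (Complex (1 + \<eta>) t) / zeta (Complex (1 + \<eta>) t)))
     + Re (- (deriv zeta (Complex (1 + \<eta>) (2 * t)) / zeta (Complex (1 + \<eta>) (2 * t))))"
    by (rule zeta_341) (use \<eta> in simp)
  moreover have "Re (- (deriv zeta (of_real (1 + \<eta>)) / zeta (of_real (1 + \<eta>)))) \<le> 1 / \<eta> + 8 * log_size \<eta> 0"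
    using neg_log_deriv_zeta[OF \<eta>(1), of 0] zeta_w_landau(1)[OF \<eta>, of 0] \<eta> unfolding e by (simp add: power2_eq_square)
  moreover have "Re (- (deriv zeta (Complex (1 + \<eta>) t) / zeta (Complex (1 + \<eta>) t)))
      \<le> 25 / 4 + (8 * log_size \<eta> t + 2 - 1 / (1 + \<eta> - \<beta>))"
    using neg_log_deriv_zeta[OF \<eta>(1), of t] zeta_w_landau(2)[OF \<eta> \<beta>] p[OF t2] by linarith
  moreover have "Re (- (deriv zeta (Complex (1 + \<eta>) (2 * t)) / zeta (Complex (1 + \<eta>) (2 * t)))) \<le> 25 / 4 + 8 * log_size \<eta> (2 * t)"
  proof -
    have "1 / 25 \<le> (2 * t)\<^sup>2" using t2 by (simp add: power_mult_distrib)
    then show ?thesis using neg_log_deriv_zeta[OF \<eta>(1), of "2 * t"] zeta_w_landau(1)[OF \<eta>, of "2 * t"] p[of "2 * t"] by linarith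
  qed
  ultimately have "4 * (1 / (1 + \<eta> - \<beta>)) \<le> 3 * (1 / \<eta>) + 64 * log_size \<eta> (2 * t) + 40"
    using mono by linarith
  then show ?thesis by simp
qed

section \<open>Zero-free regions and bounds for the reciprocal of zeta\<close>

lemma ln_ge_1: "T \<ge> 3 \<Longrightarrow> ln T \<ge> (1::real)"
  using exp_le by (subst ln_ge_iff) auto

lemma less_lnI: "exp y < x \<Longrightarrow> y < ln (x::real)"
  by (metis exp_gt_zero exp_less_cancel_iff exp_ln order_less_trans)

lemma ln_leI: "0 < x \<Longrightarrow> x \<le> exp y \<Longrightarrow> ln (x::real) \<le> y"
  by (metis exp_le_cancel_iff exp_ln)

text \<open>The classical zero-free region. The choice \<open>\<eta> = 1 / (10\<^sup>8 L)\<close>, \<open>L = log (T + 3)\<close>, makes the logarithmic terms smaller than \<open>1 / (4\<eta>)\<close>, so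
the distance \<open>d\<close> of a zero satisfies \<open>4/d \<le> 13 / (4\<eta>)\<close>, whereas a zero in the region would have \<open>d < 6\<eta>/5\<close>. For small \<open>\<bar>Im s\<bar>\<close> a direct estimate
of \<open>zeta_reg s - 1\<close> suffices.\<close>

theorem zeta_w_zero_free:
  assumes T: "T \<ge> 0" and s: "\<bar>Im s\<bar> \<le> T" "Re s > 1 - 1 / (5 * 10 ^ 8 * ln (T + 3))"
  shows "zeta_w s \<noteq> 0"
proof
  assume z: "zeta_w s = 0"
  define L where "L = ln (T + 3)"
  have L: "L \<ge> 1" unfolding L_def using T by (intro ln_ge_1) simp
  define \<eta> where "\<eta> = 1 / (10 ^ 8 * L)"
  have "1 / (10 ^ 8 * L) \<le> 1 / (10 ^ 8 * 1)" using L by (intro divide_left_mono mult_left_mono) auto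
  then have \<eta>: "0 < \<eta>" "\<eta> \<le> 1 / 10 ^ 8" using L by (auto simp: \<eta>_def)
  have sr: "Re s > 1 - \<eta> / 5" using s(2) by (simp add: \<eta>_def L_def mult_ac)
  have s1: "Re s \<le> 1" using zeta_w_nonzero_gt1[of s] z by force
  have s9: "Re s \<ge> 9 / 10" using sr \<eta> by simp
  show False
  proof (cases "\<bar>Im s\<bar> < 1 / 5")
    \<comment> \<open>Here \<open>s\<close> is close to 1, and \<open>zeta_reg\<close> is close to its value 1 there.\<close>
    case True
    have a: "norm (s - 1) \<le> 3 / 10" using cmod_le[of "s - 1"] s1 s9 True by simp
    have b: "norm s \<le> 6 / 5" using cmod_le[of s] s1 s9 True by simp
    have c: "1 + 1 / Re s \<le> 19 / 9" using s9 by (simp add: field_simps)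
    have "norm (zeta_reg s - 1) \<le> norm (s - 1) * norm s * (1 + 1 / Re s)"
      by (rule zeta_reg_bound) (use s9 in simp)
    also have "\<dots> \<le> 3 / 10 * (6 / 5) * (19 / 9)" using a b c s9 by (intro mult_mono) auto
    also have "\<dots> < 1" by simp
    finally have "zeta_reg s \<noteq> 0" by auto
    moreover have "s + 1 \<noteq> 0" using norm_plus_1_ge(1)[of s] s9 by auto
    ultimately show False using z by (simp add: zeta_w_def)
  next
    case False
    define d where "d = 1 + \<eta> - Re s"
    have d: "0 < d" "d < 6 / 5 * \<eta>" "d < 1 / 2" using sr s1 \<eta> by (auto simp: d_def)
    have z': "zeta_w (Complex (Re s) (Im s)) = 0" using z by simp
    have "4 / d \<le> 3 / \<eta> + 64 * log_size \<eta> (2 * Im s) + 40"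
      using zero_distance_bound[OF \<eta>(1) _ _ z'] \<eta> d False by (simp add: d_def)
    also have "log_size \<eta> (2 * Im s) \<le> 1 + (107 + L + 2 * (2 * (10 ^ 4 * L)))"
    proof -
      have "54 * (\<bar>2 * Im s\<bar> + 1) / \<eta>\<^sup>2 \<le> 108 * (T + 3) / \<eta>\<^sup>2"
        using s(1) by (intro divide_right_mono) auto
      moreover have "0 < 54 * (\<bar>2 * Im s\<bar> + 1) / \<eta>\<^sup>2" using \<eta> by (intro divide_pos_pos mult_pos_pos add_nonneg_pos) auto
      ultimately have "ln (54 * (\<bar>2 * Im s\<bar> + 1) / \<eta>\<^sup>2) \<le> ln (108 * (T + 3) / \<eta>\<^sup>2)"
        by (subst ln_le_cancel_iff) auto
      also have "\<dots> = ln (108 * (T + 3)) - ln (\<eta>\<^sup>2)" using T \<eta> by (subst ln_div) auto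
      also have "ln (108 * (T + 3)) = ln 108 + L" unfolding L_def using T by (intro ln_mult_pos) auto
      also have "ln (\<eta>\<^sup>2) = - 2 * ln (1 / \<eta>)" using \<eta> by (simp add: ln_realpow ln_div)
      also have "ln 108 + L - (- 2 * ln (1 / \<eta>)) = ln 108 + L + 2 * ln (1 / \<eta>)" by simp
      also have "ln (108::real) \<le> 107" using ln_le_minus_one[of "108::real"] by simp
      also have "ln (1 / \<eta>) \<le> 2 * (10 ^ 4 * L)"
      proof -
        have e: "1 / \<eta> = 10 ^ 8 * L" using L by (simp add: \<eta>_def)
        \<comment> \<open>Since \<open>L \<ge> 1\<close>, the logarithm of \<open>10\<^sup>8 L\<close> is small compared with \<open>10\<^sup>8 L\<close>.\<close>
        have "ln (10 ^ 8 * L) \<le> ln ((10 ^ 4 * L)\<^sup>2)"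
        proof (subst ln_le_cancel_iff)
          have "L * 1 \<le> L * L" using L by (intro mult_left_mono) auto
          then show "10 ^ 8 * L \<le> (10 ^ 4 * L)\<^sup>2" by (simp add: power2_eq_square)
        qed (use L in auto)
        also have "\<dots> = 2 * ln (10 ^ 4 * L)" by (subst ln_realpow) (use L in auto)
        also have "ln (10 ^ 4 * L) \<le> 10 ^ 4 * L"
          using ln_le_minus_one[of "10 ^ 4 * L"] L by simp
        finally show ?thesis unfolding e by simp
      qed
      finally show ?thesis unfolding log_size_def by simp
    qed
    finally have "4 / d \<le> 3 / \<eta> + 64 * (1 + (107 + L + 2 * (2 * (10 ^ 4 * L)))) + 40" by simp
    also have "\<dots> \<le> 3 / \<eta> + (10 ^ 8 * L) / 4" using L by simp
    also have "\<dots> = 13 / (4 * \<eta>)" by (simp add: \<eta>_def field_simps)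
    finally have "4 / d \<le> 13 / (4 * \<eta>)" .
    then have "16 * \<eta> \<le> 13 * d" using d \<eta> by (simp add: field_simps)
    then show False using d \<eta> by linarith
  qed
qed

lemma zeta_w_log:
  assumes "\<And>z. z \<in> ball c r \<Longrightarrow> Re z \<ge> 1 / 2" "\<And>z. z \<in> ball c r \<Longrightarrow> zeta_w z \<noteq> 0" "r > 0"
  obtains g where "g holomorphic_on ball c r" "\<And>z. z \<in> ball c r \<Longrightarrow> norm (zeta_w z) = exp (Re (g z))"
proof -
  have hol: "zeta_w holomorphic_on ball c r"
    by (rule holomorphic_zeta_w) (use assms(1) in force)
  obtain g where g: "g holomorphic_on ball c r" "\<And>z. z \<in> ball c r \<Longrightarrow> exp (g z) = zeta_w z"
    by (rule holomorphic_logarithm_exists[OF _ _ hol assms(2), of c]) (use assms(3) in auto)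
  have "norm (zeta_w z) = exp (Re (g z))" if "z \<in> ball c r" for z
    using norm_exp_eq_Re[of "g z"] g(2)[OF that] by simp
  with g show ?thesis using that by blast
qed

text \<open>On a disc inside the zero-free region around \<open>1 + \<eta> + \<i>t\<close> the function has a logarithm \<open>g\<close> with \<open>Re g < log (20 T)\<close>. The theorem of Borel and
Caratheodory with radii in ratio 5 shows that \<open>g\<close> changes by at most \<open>(log (20 T) - Re g(1 + \<eta> + \<i>t)) / 2\<close>. Together with the lower bound at the
centre this gives \<open>1 / \<bar>zeta_w(s)\<bar> = O(T\<^sup>1\<^sup>/\<^sup>2 (log T)\<^sup>3)\<close>, which is \<open>O(T)\<close>.\<close>

theorem zeta_w_inverse_bound:
  obtains c C where "0 < c" "c \<le> 1" "0 < C"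
    "\<And>T s. T \<ge> 1 \<Longrightarrow> \<bar>Im s\<bar> \<le> T \<Longrightarrow> Re s \<ge> 1 - c / ln (T + 4) \<Longrightarrow> Re s \<le> 1 \<Longrightarrow> zeta_w s \<noteq> 0 \<and> 1 / norm (zeta_w s) \<le> C * T"
proof -
  define c1 where "c1 = 1 / (5 * 10 ^ 8 :: real)"
  define C where "C = 10 * 216 * (9 * sqrt 6 / c1) ^ 3"
  have c1: "0 < c1" "c1 \<le> 1 / 10" by (auto simp: c1_def)
  have C: "C > 0" using c1 by (simp add: C_def)
  have main: "zeta_w s \<noteq> 0 \<and> 1 / norm (zeta_w s) \<le> C * T"
    if T: "T \<ge> 1" and s: "\<bar>Im s\<bar> \<le> T" "Re s \<ge> 1 - c1 / 9 / ln (T + 4)" "Re s \<le> 1" for T s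
  proof -
    define L where "L = ln (T + 4)"
    have L: "L \<ge> 1" unfolding L_def using T by (intro ln_ge_1) simp
    define \<eta> where "\<eta> = c1 / 9 / L"
    have "c1 / 9 / L \<le> c1 / 9 / 1" using L c1 by (intro divide_left_mono) auto
    then have \<eta>: "0 < \<eta>" "\<eta> \<le> 1 / 90" using L c1 by (auto simp: \<eta>_def)
    have sr: "Re s \<ge> 1 - \<eta>" using s(2) by (simp add: \<eta>_def L_def)
    define s1 where "s1 = Complex (1 + \<eta>) (Im s)"
    \<comment> \<open>The point \<open>s\<close> has distance at most \<open>2\<eta>\<close> from the centre, so that the radii are in ratio 5.\<close>
    define r where "r = 10 * \<eta>"
    have r: "0 < r" "r \<le> 1 / 9" using \<eta> by (auto simp: r_def)
    have ballD: "Re z > 1 - 9 * \<eta>" "\<bar>Im z\<bar> \<le> T + 1" "Re z \<le> 2" if "z \<in> ball s1 r" for z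
    proof -
      have n: "norm (s1 - z) < r" using that by (simp add: dist_norm)
      show "Re z > 1 - 9 * \<eta>" "Re z \<le> 2" using abs_Re_le_cmod[of "s1 - z"] n r \<eta> by (auto simp: s1_def r_def)
      show "\<bar>Im z\<bar> \<le> T + 1" using abs_Im_le_cmod[of "s1 - z"] n r s(1) by (simp add: s1_def)
    qed
    have zf: "zeta_w z \<noteq> 0" if "z \<in> ball s1 r" for z
    proof (rule zeta_w_zero_free[of "T + 1"])
      have "9 * \<eta> = 1 / (5 * 10 ^ 8 * ln (T + 1 + 3))" by (simp add: \<eta>_def c1_def L_def add.assoc)
      then show "Re z > 1 - 1 / (5 * 10 ^ 8 * ln (T + 1 + 3))" using ballD(1)[OF that] by simp
    qed (use ballD[OF that] T in auto)
    have half: "Re z \<ge> 1 / 2" if "z \<in> ball s1 r" for z using ballD(1)[OF that] \<eta> by simp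
    obtain g where g: "g holomorphic_on ball s1 r" "\<And>z. z \<in> ball s1 r \<Longrightarrow> norm (zeta_w z) = exp (Re (g z))"
      using zeta_w_log[OF half zf r(1)] by blast
    have A: "Re (g z) < ln (20 * T)" if z: "z \<in> ball s1 r" for z
    proof -
      have "exp (Re (g z)) = norm (zeta_w z)" using g(2)[OF z] by simp
      also have "\<dots> \<le> 1 + 3 * norm z" by (rule norm_zeta_w_le[OF half[OF z]])
      also have "\<dots> \<le> 1 + 3 * (2 + (T + 1))"
        using cmod_le[of z] ballD[OF z] \<eta> by simp
      also have "\<dots> < 20 * T" using T by simp
      finally show ?thesis by (rule less_lnI)
    qed
    have ns: "norm (s - s1) \<le> 2 * \<eta>"
    proof -
      have "s - s1 = of_real (Re s - 1 - \<eta>)" by (simp add: s1_def complex_eq_iff)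
      then have "norm (s - s1) = \<bar>Re s - 1 - \<eta>\<bar>" by (simp only: norm_of_real)
      then show ?thesis using sr s(3) \<eta> by simp
    qed
    have sb: "s \<in> ball s1 r" using ns \<eta> by (simp add: dist_norm norm_minus_commute r_def)
    have s1b: "s1 \<in> ball s1 r" using r by simp
    define M where "M = ln (20 * T) - Re (g s1)"
    have M: "M > 0" using A[OF s1b] by (simp add: M_def)
    have "norm (g s - g s1) \<le> 2 * M * norm (s - s1) / (r - norm (s - s1))"
      unfolding M_def by (rule borel_caratheodory(1)[OF g(1) r(1) A sb])
    also have "\<dots> \<le> 2 * M * (2 * \<eta>) / (8 * \<eta>)"
      using ns M \<eta> by (intro frac_le mult_left_mono) (auto simp: r_def)
    also have "\<dots> = M / 2" using \<eta> by simp
    finally have gd: "norm (g s - g s1) \<le> M / 2" .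
    then have "Re (g s) \<ge> Re (g s1) - M / 2" using abs_Re_le_cmod[of "g s - g s1"] by simp
    then have neg: "- Re (g s) \<le> ln (20 * T) / 2 + 3 / 2 * (- Re (g s1))" by (simp add: M_def field_simps)
    have low: "norm (zeta_w s1) \<ge> \<eta>\<^sup>2 / 6" using zeta_w_lower(1)[of \<eta> s1] \<eta> by (simp add: s1_def)
    have x: "- Re (g s1) \<le> 2 * ln (sqrt 6 / \<eta>)"
    proof -
      have "ln (\<eta>\<^sup>2 / 6) \<le> Re (g s1)"
        using low g(2)[OF s1b] \<eta> by (intro ln_leI) auto
      moreover have "ln (\<eta>\<^sup>2 / 6) = ln (\<eta>\<^sup>2) - ln 6" using \<eta> by (subst ln_div) auto
      moreover have "ln (\<eta>\<^sup>2) = 2 * ln \<eta>" by (subst ln_realpow) (use \<eta> in auto)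
      moreover have "ln (sqrt 6 / \<eta>) = ln (sqrt 6) - ln \<eta>" using \<eta> by (subst ln_div) auto
      moreover have "ln (sqrt 6) = ln 6 / 2" by (rule ln_sqrt) simp
      ultimately show ?thesis by linarith
    qed
    have "1 / norm (zeta_w s) = exp (- Re (g s))" using g(2)[OF sb] by (simp add: exp_minus divide_inverse)
    also have "\<dots> \<le> exp (ln (20 * T) / 2 + 3 * ln (sqrt 6 / \<eta>))"
      using neg x by simp
    also have "\<dots> = sqrt (20 * T) * (sqrt 6 / \<eta>) ^ 3"
    proof -
      have "exp (ln (20 * T) / 2) = sqrt (20 * T)"
        using T by (simp add: ln_sqrt[symmetric])
      moreover have "exp (3 * ln (sqrt 6 / \<eta>)) = (sqrt 6 / \<eta>) ^ 3"
        using \<eta> exp_of_nat_mult[of 3 "ln (sqrt 6 / \<eta>)"] by simp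
      ultimately show ?thesis by (simp add: exp_add)
    qed
    also have "sqrt 6 / \<eta> = (9 * sqrt 6 / c1) * L" using c1 by (simp add: \<eta>_def)
    also have "((9 * sqrt 6 / c1) * L) ^ 3 = (9 * sqrt 6 / c1) ^ 3 * L ^ 3" by (rule power_mult_distrib)
    also have "L ^ 3 \<le> 216 * sqrt (5 * T)"
    proof -
      have "L \<le> (T + 4) powr (1 / 6) / (1 / 6)" unfolding L_def using T by (intro ln_powr_bound) auto
      then have "L ^ 3 \<le> ((T + 4) powr (1 / 6) / (1 / 6)) ^ 3" using L by (intro power_mono) auto
      also have "\<dots> = 216 * (T + 4) powr (1 / 2)" using T by (simp add: power_mult_distrib powr_power)
      also have "(T + 4) powr (1 / 2) = sqrt (T + 4)" using T by (simp add: powr_half_sqrt)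
      also have "sqrt (T + 4) \<le> sqrt (5 * T)" using T by simp
      finally show ?thesis by simp
    qed
    finally have "1 / norm (zeta_w s) \<le> sqrt (20 * T) * ((9 * sqrt 6 / c1) ^ 3 * (216 * sqrt (5 * T)))"
      using c1 T by simp
    also have "\<dots> = 216 * (9 * sqrt 6 / c1) ^ 3 * (sqrt (20 * T) * sqrt (5 * T))" by (simp only: mult_ac)
    also have "sqrt (20 * T) * sqrt (5 * T) = 10 * T"
    proof -
      have "sqrt (20 * T) * sqrt (5 * T) = sqrt ((10 * T)\<^sup>2)" by (simp add: real_sqrt_mult[symmetric] power2_eq_square)
      also have "\<dots> = \<bar>10 * T\<bar>" by (rule real_sqrt_abs)
      finally show ?thesis using T by simp
    qed
    finally have "1 / norm (zeta_w s) \<le> C * T" by (simp add: C_def mult_ac)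
    then show ?thesis using zf[OF sb] by simp
  qed
  show ?thesis
  proof (rule that)
    show "0 < c1 / 9" "c1 / 9 \<le> 1" "0 < C" using c1 C by auto
    show "zeta_w s \<noteq> 0 \<and> 1 / norm (zeta_w s) \<le> C * T"
      if "T \<ge> 1" "\<bar>Im s\<bar> \<le> T" "Re s \<ge> 1 - c1 / 9 / ln (T + 4)" "Re s \<le> 1" for T s
      using main[OF that] .
  qed
qed

lemma norm_zeta_le:
  assumes s: "Re s > 1"
  shows "norm (zeta s) \<le> 1 + 1 / (Re s - 1)"
proof -
  have "zeta s = (\<Sum>n. 1 / of_nat (Suc n) powr s)"
    using dirichlet_series_1_eq[OF s] zeta_eq_dirichlet_series[OF s]
    unfolding dirichlet_series_def by (simp only: sums_iff)
  also have "norm \<dots> \<le> (\<Sum>n. (real n + 1) powr (- 1 - (Re s - 1)))"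
  proof (rule norm_suminf_le)
    show "summable (\<lambda>n. (real n + 1) powr (- 1 - (Re s - 1)))" using s by (intro summable_shift_powr) simp
    fix n
    have "norm (1 / of_nat (Suc n) powr s :: complex) = 1 / real (Suc n) powr Re s"
      by (simp add: norm_divide norm_nat_powr del: of_nat_Suc)
    also have "\<dots> = (real n + 1) powr (- 1 - (Re s - 1))" by (simp add: powr_minus_divide add.commute)
    finally show "norm (1 / of_nat (Suc n) powr s :: complex) \<le> (real n + 1) powr (- 1 - (Re s - 1))" by simp
  qed
  also have "\<dots> \<le> 1 + 1 / (Re s - 1)" using s by (intro summable_shift_powr) simp
  finally show ?thesis .
qed

lemma zeta_w_nonzero_RH:
  assumes "riemann_hypothesis" "Re s > 1 / 2"
  shows "zeta_w s \<noteq> 0"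
proof (cases "Re s < 1")
  case True
  then have "zeta s \<noteq> 0" using assms unfolding riemann_hypothesis_def by force
  moreover have "s \<noteq> 1" "s + 1 \<noteq> 0" using True norm_plus_1_ge(1)[of s] assms by auto
  ultimately show ?thesis using assms by (simp add: zeta_w_eq)
next
  case False
  have "ln (\<bar>Im s\<bar> + 3) \<ge> 1" by (intro ln_ge_1) simp
  then have "1 - 1 / (5 * 10 ^ 8 * ln (\<bar>Im s\<bar> + 3)) < 1" by simp
  then have "Re s > 1 - 1 / (5 * 10 ^ 8 * ln (\<bar>Im s\<bar> + 3))" using False by linarith
  then show ?thesis using zeta_w_zero_free[of "\<bar>Im s\<bar>" s] by simp
qed

text \<open>Under the Riemann hypothesis the logarithm \<open>g\<close> exists on the whole disc of radius \<open>3/2\<close> around \<open>2 + \<i>t\<close>. Borel and Caratheodory give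
\<open>g - g(2 + \<i>t) = O(log \<bar>t\<bar>)\<close> on a circle of radius slightly below \<open>3/2\<close> and \<open>O(1)\<close> on the circle of radius \<open>1/2\<close>. By \<open>two_radii_bound\<close> the growth on the
circles in between is at most \<open>O(1) + \<epsilon> log \<bar>t\<bar>\<close>.\<close>

theorem zeta_w_inverse_bound_RH:
  assumes RH: "riemann_hypothesis" and \<delta>: "0 < \<delta>" "\<delta> < 1 / 2" and \<epsilon>: "\<epsilon> > 0"
  obtains C where "0 < C" "\<And>s. Re s \<ge> 1 / 2 + \<delta> \<Longrightarrow> Re s \<le> 1 \<Longrightarrow> 1 / norm (zeta_w s) \<le> C * (\<bar>Im s\<bar> + 1) powr \<epsilon>"
proof -
  define \<rho> where "\<rho> = 3 / 2 - \<delta>"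
  define r3 where "r3 = 3 / 2 - \<delta> / 2"
  have rad: "0 < \<rho>" "\<rho> < r3" "r3 < 3 / 2" "0 < r3" using \<delta> by (auto simp: \<rho>_def r3_def)
  define q where "q = \<rho> / r3"
  have q: "0 < q" "q < 1" using rad by (auto simp: q_def)
  have "(\<lambda>n. 6 / \<delta> * (q ^ n / (1 - q))) \<longlonglongrightarrow> 6 / \<delta> * (0 / (1 - q))"
    using q by (intro tendsto_intros LIMSEQ_power_zero) auto
  then have "eventually (\<lambda>n. 6 / \<delta> * (q ^ n / (1 - q)) < \<epsilon>) sequentially"
    using \<epsilon> by (intro order_tendstoD(2)) auto
  \<comment> \<open>The choice of \<open>n0\<close> makes the coefficient of \<open>log \<bar>t\<bar>\<close> smaller than \<open>\<epsilon>\<close>.\<close>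
  then obtain n0 where n0: "6 / \<delta> * (q ^ n0 / (1 - q)) < \<epsilon>" by (auto simp: eventually_sequentially)
  define S where "S = (\<Sum>n<n0. (\<rho> / (1 / 2)) ^ n)"
  define C where "C = 6 * exp (8 * ln 6 * S) * 120 powr \<epsilon>"
  have main: "1 / norm (zeta_w s) \<le> C * (\<bar>Im s\<bar> + 1) powr \<epsilon>" if s: "Re s \<ge> 1 / 2 + \<delta>" "Re s \<le> 1" for s
  proof -
    define t where "t = Im s"
    define s0 where "s0 = Complex 2 t"
    have ballD: "Re z > 2 - r" "norm z \<le> 2 + \<bar>t\<bar> + r" if "z \<in> ball s0 r" for z r
    proof -
      have n: "norm (s0 - z) < r" using that by (simp add: dist_norm)
      show "Re z > 2 - r" using abs_Re_le_cmod[of "s0 - z"] n by (simp add: s0_def)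
      have "norm z \<le> norm s0 + norm (s0 - z)" by (metis norm_minus_commute norm_triangle_sub)
      then show "norm z \<le> 2 + \<bar>t\<bar> + r" using n cmod_le[of s0] by (simp add: s0_def)
    qed
    have half: "Re z \<ge> 1 / 2" if "z \<in> ball s0 (3 / 2)" for z using ballD(1)[OF that] by simp
    have nz: "zeta_w z \<noteq> 0" if "z \<in> ball s0 (3 / 2)" for z
      by (rule zeta_w_nonzero_RH[OF RH]) (use ballD(1)[OF that] in simp)
    obtain g where g: "g holomorphic_on ball s0 (3 / 2)" "\<And>z. z \<in> ball s0 (3 / 2) \<Longrightarrow> norm (zeta_w z) = exp (Re (g z))"
      using zeta_w_log[of s0 "3 / 2"] half nz by auto
    define A where "A = ln (20 * (\<bar>t\<bar> + 1))"
    have A: "Re (g z) < A" if z: "z \<in> ball s0 (3 / 2)" for z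
    proof -
      have "exp (Re (g z)) = norm (zeta_w z)" using g(2)[OF z] by simp
      also have "\<dots> \<le> 1 + 3 * norm z" by (rule norm_zeta_w_le[OF half[OF z]])
      also have "\<dots> \<le> 1 + 3 * (2 + \<bar>t\<bar> + 3 / 2)" using ballD(2)[OF z] by simp
      also have "\<dots> < 20 * (\<bar>t\<bar> + 1)" by simp
      finally show ?thesis unfolding A_def by (rule less_lnI)
    qed
    have g0: "- Re (g s0) \<le> ln 6"
    proof -
      have "1\<^sup>2 / 6 \<le> norm (zeta_w s0)" by (rule zeta_w_lower(1)) (auto simp: s0_def)
      also have "\<dots> = exp (Re (g s0))" by (rule g(2)) simp
      finally have "ln (1 / 6) \<le> Re (g s0)" by (intro ln_leI) auto
      then show ?thesis by (simp add: ln_div)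
    qed
    define p where "p z = g z - g s0" for z
    have hp: "p holomorphic_on ball s0 (3 / 2)" unfolding p_def by (intro holomorphic_on_diff g holomorphic_on_const)
    have A0: "A + ln 6 = ln (120 * (\<bar>t\<bar> + 1))"
    proof -
      have "ln (20 * (\<bar>t\<bar> + 1) * 6) = ln (20 * (\<bar>t\<bar> + 1)) + ln 6" by (rule ln_mult_pos) auto
      moreover have "20 * (\<bar>t\<bar> + 1) * 6 = 120 * (\<bar>t\<bar> + 1)" by simp
      ultimately show ?thesis unfolding A_def by (simp only:)
    qed
    have pL: "norm (p w) \<le> 6 / \<delta> * (A + ln 6)" if w: "norm (s0 - w) = r3" for w
    proof -
      have "norm (p w) \<le> 2 * (A - Re (g s0)) * norm (w - s0) / (3 / 2 - norm (w - s0))"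
        unfolding p_def by (rule borel_caratheodory(1)[OF g(1) _ A]) (use w rad in \<open>auto simp: dist_norm\<close>)
      also have "norm (w - s0) = r3" using w by (simp add: norm_minus_commute)
      also have "2 * (A - Re (g s0)) * r3 / (3 / 2 - r3) \<le> 2 * (A + ln 6) * (3 / 2) / (\<delta> / 2)"
      proof (rule frac_le)
        have pos: "0 < A - Re (g s0)" using A[of s0] by simp
        show "2 * (A - Re (g s0)) * r3 \<le> 2 * (A + ln 6) * (3 / 2)"
          by (rule mult_mono) (use pos g0 rad in auto)
        show "0 \<le> 2 * (A + ln 6) * (3 / 2)" using pos g0 by simp
      qed (use \<delta> in \<open>auto simp: r3_def\<close>)
      also have "\<dots> = 6 / \<delta> * (A + ln 6)" using \<delta> by (simp add: field_simps)
      finally show ?thesis .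
    qed
    have pK: "norm (p w) \<le> 8 * ln 6" if w: "norm (s0 - w) = 1 / 2" for w
    proof -
      \<comment> \<open>On the disc of radius \<open>3/4\<close> one has \<open>Re z > 5/4\<close>, where \<open>\<zeta>\<close> is bounded.\<close>
      have A1: "Re (g z) < ln 6" if z: "z \<in> ball s0 (3 / 4)" for z
      proof -
        have r: "Re z > 5 / 4" using ballD(1)[OF z] by simp
        have z': "z \<in> ball s0 (3 / 2)" using z by auto
        have np: "norm (z + 1) > 0" using norm_plus_1_ge(1)[of z] r by linarith
        have "z \<noteq> 1" "Re z > 0" using r by auto
        then have "norm (zeta_w z) = norm (z - 1) / norm (z + 1) * norm (zeta z)"
          by (simp add: zeta_w_eq norm_mult norm_divide)
        also have "\<dots> \<le> 1 * norm (zeta z)"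
          using norm_plus_1_ge(2)[of z] r np by (intro mult_right_mono) (auto simp: divide_le_eq)
        also have "norm (zeta z) \<le> 1 + 1 / (Re z - 1)" by (rule norm_zeta_le) (use r in simp)
        also have "1 / (Re z - 1) \<le> 1 / (1 / 4)" using r by (intro divide_left_mono) auto
        finally have "norm (zeta_w z) \<le> 5" by simp
        then have "exp (Re (g z)) < 6" using g(2)[OF z'] by simp
        then show ?thesis by (rule less_lnI)
      qed
      have "norm (p w) \<le> 2 * (ln 6 - Re (g s0)) * norm (w - s0) / (3 / 4 - norm (w - s0))"
        unfolding p_def
        by (rule borel_caratheodory(1)[OF holomorphic_on_subset[OF g(1)] _ A1]) (use w in \<open>auto simp: dist_norm\<close>)
      also have "norm (w - s0) = 1 / 2" using w by (simp add: norm_minus_commute)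
      also have "2 * (ln 6 - Re (g s0)) * (1 / 2) / (3 / 4 - 1 / 2) \<le> 8 * ln 6" using g0 by simp
      finally show ?thesis .
    qed
    have ns: "norm (s - s0) \<le> \<rho>"
    proof -
      have "s - s0 = of_real (Re s - 2)" by (simp add: s0_def t_def complex_eq_iff)
      then have "norm (s - s0) = \<bar>Re s - 2\<bar>" by (simp only: norm_of_real)
      then show ?thesis using s by (simp add: \<rho>_def)
    qed
    have "norm (p s) \<le> 8 * ln 6 * (\<Sum>n<n0. (\<rho> / (1 / 2)) ^ n) + 6 / \<delta> * (A + ln 6) * ((\<rho> / r3) ^ n0 / (1 - \<rho> / r3))"
      by (rule two_radii_bound[OF hp _ _ _ _ ns _ pK pL]) (use rad in auto)
    also have "\<dots> = 8 * ln 6 * S + (A + ln 6) * (6 / \<delta> * (q ^ n0 / (1 - q)))" by (simp add: S_def q_def)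
    also have "\<dots> \<le> 8 * ln 6 * S + (A + ln 6) * \<epsilon>"
    proof -
      have "0 \<le> A + ln 6" unfolding A0 by (intro ln_ge_zero) simp
      then show ?thesis using n0 by (intro add_left_mono mult_left_mono) auto
    qed
    finally have ps: "norm (p s) \<le> 8 * ln 6 * S + ln (120 * (\<bar>t\<bar> + 1)) * \<epsilon>" by (simp only: A0)
    have sb: "s \<in> ball s0 (3 / 2)" using ns rad by (simp add: dist_norm norm_minus_commute)
    have "- Re (g s) \<le> norm (p s) + ln 6" using abs_Re_le_cmod[of "p s"] g0 by (simp add: p_def)
    also note ps
    finally have e: "- Re (g s) \<le> 8 * ln 6 * S + ln (120 * (\<bar>t\<bar> + 1)) * \<epsilon> + ln 6" by simp
    have "1 / norm (zeta_w s) = exp (- Re (g s))" using g(2)[OF sb] by (simp add: exp_minus divide_inverse)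
    also have "\<dots> \<le> exp (8 * ln 6 * S + ln (120 * (\<bar>t\<bar> + 1)) * \<epsilon> + ln 6)" using e by simp
    also have "\<dots> = exp (8 * ln 6 * S) * (120 * (\<bar>t\<bar> + 1)) powr \<epsilon> * 6"
      by (simp add: exp_add powr_def mult_ac)
    also have "(120 * (\<bar>t\<bar> + 1)) powr \<epsilon> = 120 powr \<epsilon> * (\<bar>t\<bar> + 1) powr \<epsilon>" by (rule powr_mult)
    finally show ?thesis by (simp add: C_def t_def mult_ac)
  qed
  show ?thesis
  proof (rule that)
    show "0 < C" by (simp add: C_def)
    show "1 / norm (zeta_w s) \<le> C * (\<bar>Im s\<bar> + 1) powr \<epsilon>" if "Re s \<ge> 1 / 2 + \<delta>" "Re s \<le> 1" for s
      using main[OF that] .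
  qed
qed

section \<open>Sums of the Moebius function divided by its argument\<close>

text \<open>Newman's bound for \<open>F(z) = 1 / \<zeta>(1 + z)\<close>, which vanishes at \<open>z = 0\<close>. The bound for \<open>zeta_w\<close> carries over to \<open>F\<close> because
\<open>\<bar>z\<bar> \<le> \<bar>z + 2\<bar>\<close>.\<close>

lemma moebius_sum_newman:
  assumes \<delta>: "0 < \<delta>" "\<delta> < 1" and R: "1 \<le> R" and N: "1 \<le> N"
    and B: "\<And>s. 1 - \<delta> \<le> Re s \<Longrightarrow> Re s \<le> 1 \<Longrightarrow> \<bar>Im s\<bar> \<le> R \<Longrightarrow> zeta_w s \<noteq> 0 \<and> 1 / norm (zeta_w s) \<le> B"
  shows "\<bar>\<Sum>n=1..N. euler_fun (1 - fps_X) n / real n\<bar> \<le>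
    4 / R + 2 / real N + B * \<delta> ^ 2 / R ^ 2 + B * real N powr - \<delta> * (arsinh (R / \<delta>) + 1)"
proof -
  define a where "a n = (of_real (euler_fun (1 - fps_X) n) :: complex)" for n
  define F where "F z = z / ((z + 2) * zeta_w (1 + z))" for z
  have nz: "zeta_w (1 + z) \<noteq> 0" if "- \<delta> \<le> Re z" "\<bar>Im z\<bar> \<le> R" for z
  proof (cases "Re z \<le> 0")
    case True
    then show ?thesis using B[of "1 + z"] that by simp
  next
    case False
    then show ?thesis by (intro zeta_w_nonzero_gt1) simp
  qed
  have n2: "z + 2 \<noteq> 0" if "- \<delta> \<le> Re z" for z
    using norm_plus_1_ge(1)[of "1 + z"] that \<delta> by (auto simp: add.commute)
  have "norm (F 0 - (\<Sum>n=1..N. a n / of_nat n)) \<le>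
    4 / R + 2 / real N + B * \<delta> ^ 2 / R ^ 2 + B * real N powr - \<delta> * (arsinh (R / \<delta>) + 1)"
  proof (rule newman_bound[OF _ \<delta>(1) _ R N])
    show "norm (a n) \<le> 1" for n
      unfolding a_def norm_of_real by (rule abs_euler_fun_le_1) (simp add: nth_one_minus_X)
    show "F holomorphic_on cbox (Complex (- \<delta>) (- R)) (Complex R R)"
    proof -
      have "(\<lambda>z. zeta_w (1 + z)) holomorphic_on cbox (Complex (- \<delta>) (- R)) (Complex R R)"
      proof (rule holomorphic_on_compose_gen[OF _ holomorphic_zeta_w[OF order_refl], unfolded o_def])
        show "(\<lambda>z. 1 + z) holomorphic_on cbox (Complex (- \<delta>) (- R)) (Complex R R)"
          by (intro holomorphic_intros)
        show "(+) 1 ` cbox (Complex (- \<delta>) (- R)) (Complex R R) \<subseteq> {s. 0 < Re s}"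
          using \<delta> by (auto simp: in_cbox_complex_iff)
      qed
      then show ?thesis unfolding F_def
        by (intro holomorphic_on_divide holomorphic_on_mult holomorphic_intros)
           (use nz n2 in \<open>auto simp: in_cbox_complex_iff\<close>)
    qed
    show "(\<lambda>n. a (Suc n) * of_nat (Suc n) powr (- 1 - z)) sums F z" if z: "0 < Re z" for z
    proof -
      have s: "Re (1 + z) > 1" using z by simp
      have sm: "(\<lambda>n. of_real (euler_fun (1 - fps_X) n) * (1 / of_nat n powr (1 + z) :: complex)) norm_summable_on {1..}"
        by (rule norm_summable_bounded_euler[OF abs_euler_fun_le_1 s]) (simp add: nth_one_minus_X)
      have "euler_series (1 - fps_X) (\<lambda>n. 1 / of_nat n powr (1 + z)) = inverse (zeta (1 + z))"
        using zeta_euler_series(2,3)[OF s] by (simp add: field_simps)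
      also have "\<dots> = F z" using inverse_zeta_eq[of "1 + z"] s by (simp add: F_def add.commute)
      finally have "(\<lambda>n. of_real (euler_fun (1 - fps_X) (Suc n)) / of_nat (Suc n) powr (1 + z)) sums F z"
        using dirichlet_series_euler(1)[OF sm] by simp
      moreover have "of_real (euler_fun (1 - fps_X) (Suc n)) / of_nat (Suc n) powr (1 + z) = a (Suc n) * of_nat (Suc n) powr (- 1 - z)" for n
      proof -
        have "of_nat (Suc n) powr (- 1 - z) = (1 / of_nat (Suc n) powr (1 + z) :: complex)"
          using powr_minus_divide[of "of_nat (Suc n) :: complex" "1 + z"] by simp
        then show ?thesis by (simp add: a_def)
      qed
      ultimately show ?thesis by simp
    qed
    show "norm (F z) \<le> B" if z: "- \<delta> \<le> Re z" "Re z \<le> 0" "\<bar>Im z\<bar> \<le> R" for z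
    proof -
      have "norm (1 + z - 1) \<le> norm (1 + z + 1)" using z \<delta> by (intro norm_plus_1_ge) simp
      then have "norm z / norm (z + 2) \<le> 1" using n2[OF z(1)] by (simp add: divide_le_eq add.commute)
      then have "norm z / norm (z + 2) * (1 / norm (zeta_w (1 + z))) \<le> 1 * (1 / norm (zeta_w (1 + z)))"
        by (intro mult_right_mono) auto
      also have "\<dots> \<le> B" using B[of "1 + z"] z by simp
      finally show ?thesis by (simp add: F_def norm_divide norm_mult)
    qed
  qed (use \<delta> in simp)
  moreover have "F 0 - (\<Sum>n=1..N. a n / of_nat n) = of_real (- (\<Sum>n=1..N. euler_fun (1 - fps_X) n / real n))"
    by (simp add: F_def a_def)
  ultimately show ?thesis by (simp only: norm_of_real abs_minus_cancel)
qed

lemma abs_moebius_sum_trivial: "\<bar>\<Sum>n=1..N. euler_fun (1 - fps_X) n / real n\<bar> \<le> real N"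
proof -
  have "\<bar>\<Sum>n=1..N. euler_fun (1 - fps_X) n / real n\<bar> \<le> (\<Sum>n=1..N. 1)"
  proof (rule order_trans[OF sum_abs], rule sum_mono)
    fix n assume n: "n \<in> {1..N}"
    have "\<bar>euler_fun (1 - fps_X) n\<bar> / real n \<le> 1 / 1"
      using n by (intro frac_le abs_euler_fun_le_1) (auto simp: nth_one_minus_X)
    then show "\<bar>euler_fun (1 - fps_X) n / real n\<bar> \<le> 1" by simp
  qed
  then show ?thesis by simp
qed

lemma arsinh_le:
  assumes "(y::real) \<ge> 0"
  shows "arsinh y \<le> ln (2 * y + 1)"
proof -
  have "sqrt (y ^ 2 + 1) \<le> y + 1" using assms by (intro real_le_lsqrt) (auto simp: power2_eq_square algebra_simps)
  then have "y + sqrt (y ^ 2 + 1) \<le> 2 * y + 1" by simp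
  then show ?thesis unfolding arsinh_real_def using arsinh_real_aux[of y] assms by (subst ln_le_cancel_iff) auto
qed

text \<open>With \<open>l = \<surd>(log N)\<close> the choice \<open>R = exp (c\<^sub>2 l)\<close> and \<open>\<delta> = c / log (R + 4)\<close> balances the two errors of Newman's bound: it makes \<open>N\<^sup>-\<^sup>\<delta> \<le> R\<^sup>-\<^sup>3\<close>,
which beats the bound \<open>C R\<close> for \<open>1 / zeta_w\<close>.\<close>

theorem moebius_log_sum_bound:
  obtains c K where "0 < c" "0 < K" "\<And>N. N \<ge> 1 \<Longrightarrow>
    \<bar>\<Sum>n=1..N. euler_fun (1 - fps_X) n / real n\<bar> \<le> K * exp (- c * sqrt (ln (real N)))"
proof -
  obtain c C where c: "0 < c" "c \<le> 1" "0 < C" and W: "\<And>T s. T \<ge> 1 \<Longrightarrow> \<bar>Im s\<bar> \<le> T \<Longrightarrow> Re s \<ge> 1 - c / ln (T + 4) \<Longrightarrow>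
      Re s \<le> 1 \<Longrightarrow> zeta_w s \<noteq> 0 \<and> 1 / norm (zeta_w s) \<le> C * T"
    using zeta_w_inverse_bound by blast
  \<comment> \<open>The relation \<open>c = 6 c\<^sub>2\<^sup>2\<close> gives \<open>\<delta> log N \<ge> 3 c\<^sub>2 l\<close>.\<close>
  define c2 where "c2 = sqrt (c / 6)"
  have c2: "0 < c2" "c2 \<le> 1" "c = 6 * c2 ^ 2" using c by (auto simp: c2_def real_le_lsqrt)
  define N0 where "N0 = exp ((ln 3 / c2) ^ 2)"
  define K where "K = 2 * N0 + 6 + C + C * (1 + 18 / c)"
  have "0 < 1 + 18 / c" using c by (simp add: add_pos_pos)
  then have Ce: "0 < C * (1 + 18 / c)" using c by (intro mult_pos_pos)
  have K: "N0 > 0" by (simp add: N0_def)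
  have K0: "K > 0" using c Ce K unfolding K_def by linarith
  have main: "\<bar>\<Sum>n=1..N. euler_fun (1 - fps_X) n / real n\<bar> \<le> K * exp (- (c2 / 2) * sqrt (ln (real N)))" if N: "N \<ge> 1" for N
  proof -
    define l where "l = sqrt (ln (real N))"
    have l: "l \<ge> 0" "l ^ 2 = ln (real N)" using N by (auto simp: l_def)
    define R where "R = exp (c2 * l)"
    have R1: "R \<ge> 1" using c2 l by (simp add: R_def)
    have target: "exp (- (c2 / 2) * sqrt (ln (real N))) = 1 / sqrt R"
    proof -
      have sq: "sqrt R = exp (c2 * l / 2)"
        by (rule real_sqrt_unique) (simp_all add: R_def power2_eq_square flip: exp_add)
      have "- (c2 / 2) * sqrt (ln (real N)) = - (c2 * l / 2)" by (simp add: l_def)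
      then show ?thesis unfolding sq by (simp only: exp_minus inverse_eq_divide)
    qed
    show ?thesis
    proof (cases "R < 3")
      \<comment> \<open>For small \<open>R\<close> also \<open>N\<close> is bounded.\<close>
      case True
      then have "c2 * l < ln 3" by (simp add: R_def less_lnI)
      then have "l < ln 3 / c2" using c2 by (simp add: pos_less_divide_eq mult.commute)
      then have "l ^ 2 \<le> (ln 3 / c2) ^ 2" using l by (intro power_mono) auto
      then have "real N \<le> N0" using l N unfolding N0_def by (metis exp_le_cancel_iff exp_ln of_nat_0_less_iff less_le_trans zero_less_one)
      moreover have "1 \<le> 2 * (1 / sqrt R)"
      proof -
        have "sqrt R \<le> sqrt 4" using True by (intro real_sqrt_le_mono) simp
        then show ?thesis using R1 by (simp add: field_simps)
      qed
      ultimately have "real N * 1 \<le> N0 * (2 * (1 / sqrt R))" using K by (intro mult_mono) auto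
      also have "\<dots> \<le> K * (1 / sqrt R)"
      proof -
        have "2 * N0 \<le> K" using c Ce unfolding K_def by linarith
        then have "2 * N0 * (1 / sqrt R) \<le> K * (1 / sqrt R)" using R1 by (intro mult_right_mono) auto
        then show ?thesis by (simp add: mult.commute)
      qed
      finally show ?thesis unfolding target using abs_moebius_sum_trivial[of N] by linarith
    next
      case False
      then have R: "R \<ge> 3" by simp
      define \<delta> where "\<delta> = c / ln (R + 4)"
      have lnR: "ln (R + 4) \<le> 2 * (c2 * l)" "ln (R + 4) > 1"
      proof -
        have "3 * R \<le> R * R" using R by (intro mult_right_mono) auto
        then have "R + 4 \<le> R ^ 2" using R unfolding power2_eq_square by linarith
        then have "ln (R + 4) \<le> ln (R ^ 2)" using R by (subst ln_le_cancel_iff) auto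
        also have "\<dots> = 2 * (c2 * l)" by (subst ln_realpow) (simp add: R_def)
        finally show "ln (R + 4) \<le> 2 * (c2 * l)" .
        show "ln (R + 4) > 1" by (rule less_lnI) (use exp_le R in simp)
      qed
      have \<delta>: "0 < \<delta>" "\<delta> < 1" using c lnR by (auto simp: \<delta>_def divide_less_eq)
      have lpos: "l > 0" using lnR c2 l by (cases "l = 0") auto
      have S: "\<bar>\<Sum>n=1..N. euler_fun (1 - fps_X) n / real n\<bar> \<le>
        4 / R + 2 / real N + (C * R) * \<delta> ^ 2 / R ^ 2 + (C * R) * real N powr - \<delta> * (arsinh (R / \<delta>) + 1)"
        by (rule moebius_sum_newman[OF \<delta> R1 N]) (rule W[OF R1], auto simp: \<delta>_def)
      have Np: "real N powr - \<delta> \<le> 1 / R ^ 3"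
      proof -
        have "3 * (c2 * l) * (2 * (c2 * l)) = c * l ^ 2" by (simp add: c2(3) power2_eq_square)
        moreover have "3 * (c2 * l) * ln (R + 4) \<le> 3 * (c2 * l) * (2 * (c2 * l))"
          using lnR c2 l by (intro mult_left_mono) auto
        ultimately have "3 * (c2 * l) \<le> c * l ^ 2 / ln (R + 4)"
          using lnR by (simp add: pos_le_divide_eq)
        also have "\<dots> = \<delta> * ln (real N)" by (simp add: \<delta>_def l)
        finally have "- \<delta> * ln (real N) \<le> - (3 * (c2 * l))" by simp
        then have "real N powr - \<delta> \<le> exp (- (3 * (c2 * l)))" using N by (simp add: powr_def)
        also have "\<dots> = 1 / R ^ 3" using exp_of_nat_mult[of 3 "c2 * l"] by (simp add: R_def exp_minus divide_inverse)
        finally show ?thesis .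
      qed
      have as: "arsinh (R / \<delta>) \<le> 6 * R * sqrt R / c"
      proof -
        have "arsinh (R / \<delta>) \<le> ln (2 * (R / \<delta>) + 1)" using R \<delta> by (intro arsinh_le) auto
        also have "\<dots> \<le> 2 * (R / \<delta>)"
          using ln_add_one_self_le_self[of "2 * (R / \<delta>)"] R \<delta> by (simp add: add.commute)
        also have "\<dots> = 2 * R * ln (R + 4) / c" by (simp add: \<delta>_def)
        also have "\<dots> \<le> 2 * R * (3 * sqrt R) / c"
        proof (intro divide_right_mono mult_left_mono)
          have "ln (sqrt (R + 4)) \<le> sqrt (R + 4) - 1" using R by (intro ln_le_minus_one) simp
          then have "ln (R + 4) \<le> 2 * (sqrt (R + 4) - 1)" using R by (simp add: ln_sqrt)
          also have "sqrt (R + 4) \<le> 3 / 2 * sqrt R + 1"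
          proof (rule real_le_lsqrt)
            have "sqrt R ^ 2 = R" "1 \<le> sqrt R" using R by auto
            moreover have "(3 / 2 * sqrt R + 1)\<^sup>2 = 9 / 4 * sqrt R ^ 2 + 3 * sqrt R + 1"
              by (simp add: power2_eq_square algebra_simps)
            ultimately show "R + 4 \<le> (3 / 2 * sqrt R + 1)\<^sup>2" using R by linarith
          qed (use R in auto)
          finally show "ln (R + 4) \<le> 3 * sqrt R" by simp
        qed (use R c in auto)
        finally show ?thesis by simp
      qed
      have sR: "sqrt R \<ge> 1" "sqrt R * sqrt R = R" using R by auto
      have b0: "1 / R \<le> 1 / sqrt R"
      proof -
        have "sqrt R * 1 \<le> sqrt R * sqrt R" using sR by (intro mult_left_mono) auto
        then show ?thesis using sR R by (intro divide_left_mono) auto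
      qed
      have b1: "2 / real N \<le> 2 * (1 / sqrt R)"
      proof -
        have "1 \<le> l * (1 / c2)"
        proof -
          have "1 / 2 < c2 * l" using lnR by linarith
          moreover have "c2 * c2 \<le> 1 / 2" using c by (simp add: c2_def)
          ultimately have "c2 * c2 \<le> c2 * l" by linarith
          then have "c2 \<le> l" using c2 by simp
          then show ?thesis using c2 by (simp add: field_simps)
        qed
        then have "c2 \<le> l" using c2 by (simp add: field_simps)
        then have "c2 * l \<le> l ^ 2" unfolding power2_eq_square using l(1) by (rule mult_right_mono)
        then have "R \<le> exp (ln (real N))" unfolding R_def l(2) by simp
        then have "R \<le> real N" using N by simp
        then have "2 / real N \<le> 2 / R" using R by (intro divide_left_mono) auto
        then show ?thesis using b0 by simp
      qed
      have b2: "(C * R) * \<delta> ^ 2 / R ^ 2 \<le> C * (1 / sqrt R)"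
      proof -
        have "\<delta> ^ 2 \<le> 1" using \<delta> by (simp add: power_le_one)
        then have "(C * R) * \<delta> ^ 2 / R ^ 2 \<le> (C * R) * 1 / R ^ 2" using c R by (intro divide_right_mono mult_left_mono) auto
        also have "\<dots> = C * (1 / R)" using R by (simp add: power2_eq_square)
        also have "\<dots> \<le> C * (1 / sqrt R)" using c b0 by (intro mult_left_mono) auto
        finally show ?thesis .
      qed
      have b3: "(C * R) * real N powr - \<delta> * (arsinh (R / \<delta>) + 1) \<le> C * (1 + 18 / c) * (1 / sqrt R)"
      proof -
        have "0 \<le> arsinh (R / \<delta>)"
        proof -
          have "0 \<le> R / \<delta>" using R \<delta> by simp
          then have "1 \<le> R / \<delta> + sqrt ((R / \<delta>) ^ 2 + 1)" by (simp add: add_increasing)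
          then show ?thesis unfolding arsinh_real_def by (rule ln_ge_zero)
        qed
        then have "(C * R) * real N powr - \<delta> * (arsinh (R / \<delta>) + 1) \<le> (C * R) * (1 / R ^ 3) * (6 * R * sqrt R / c + 1)"
          using c R Np as by (intro mult_mono add_mono mult_nonneg_nonneg) auto
        also have "\<dots> = C * (6 / c * (sqrt R / R) + 1 / R ^ 2)"
          using R by (simp add: field_simps power2_eq_square power3_eq_cube)
        also have "sqrt R / R = 1 / sqrt R" using sR R by (simp add: field_simps)
        also have "1 / R ^ 2 \<le> 1 / sqrt R"
        proof -
          have "1 / R ^ 2 \<le> 1 / R ^ 1" using R by (intro divide_left_mono power_increasing) auto
          then show ?thesis using b0 by simp
        qed
        also have "C * (6 / c * (1 / sqrt R) + 1 / sqrt R) \<le> C * (1 + 18 / c) * (1 / sqrt R)"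
          using c R by (simp add: field_simps)
        finally show ?thesis using c by simp
      qed
      have "\<bar>\<Sum>n=1..N. euler_fun (1 - fps_X) n / real n\<bar> \<le> 6 * (1 / sqrt R) + C * (1 / sqrt R) + C * (1 + 18 / c) * (1 / sqrt R)"
        using S b0 b1 b2 b3 by linarith
      also have "\<dots> = (6 + C + C * (1 + 18 / c)) * (1 / sqrt R)" by (simp only: distrib_right)
      also have "\<dots> \<le> K * (1 / sqrt R)" using K R by (intro mult_right_mono) (auto simp: K_def)
      finally show ?thesis unfolding target .
    qed
  qed
  show ?thesis
  proof (rule that)
    show "0 < c2 / 2" "0 < K" using c2 K0 by auto
    show "\<bar>\<Sum>n=1..N. euler_fun (1 - fps_X) n / real n\<bar> \<le> K * exp (- (c2 / 2) * sqrt (ln (real N)))" if "N \<ge> 1" for N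
      by (rule main[OF that])
  qed
qed

text \<open>Newman's bound with \<open>R = \<surd>N\<close> and \<open>\<delta> = 1/2 - \<epsilon>\<close>.\<close>

theorem moebius_log_sum_bound_RH:
  assumes RH: "riemann_hypothesis" and \<epsilon>: "0 < \<epsilon>" "\<epsilon> < 1 / 4"
  obtains K where "0 < K" "\<And>N. N \<ge> 1 \<Longrightarrow>
    \<bar>\<Sum>n=1..N. euler_fun (1 - fps_X) n / real n\<bar> \<le> K * real N powr (- 1 / 2 + 2 * \<epsilon>)"
proof -
  obtain C where C: "0 < C" and W: "\<And>s. Re s \<ge> 1 / 2 + \<epsilon> \<Longrightarrow> Re s \<le> 1 \<Longrightarrow> 1 / norm (zeta_w s) \<le> C * (\<bar>Im s\<bar> + 1) powr \<epsilon>"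
    using zeta_w_inverse_bound_RH[OF RH \<epsilon>(1) _ \<epsilon>(1)] \<epsilon> by auto
  define \<delta> where "\<delta> = 1 / 2 - \<epsilon>"
  have \<delta>: "1 / 4 < \<delta>" "\<delta> < 1" "0 < \<delta>" using \<epsilon> by (auto simp: \<delta>_def)
  define D where "D = C * 2 powr \<epsilon>"
  have D: "D > 0" using C by (simp add: D_def)
  define K where "K = 6 + D + D * (9 powr \<epsilon> / \<epsilon> + 1)"
  have K: "K > 0" using D \<epsilon> by (auto simp: K_def intro!: add_pos_nonneg)
  have main: "\<bar>\<Sum>n=1..N. euler_fun (1 - fps_X) n / real n\<bar> \<le> K * real N powr (- 1 / 2 + 2 * \<epsilon>)" if N: "N \<ge> 1" for N
  proof -
    define x where "x = real N"
    have x: "x \<ge> 1" using N by (simp add: x_def)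
    define R where "R = sqrt x"
    have R: "R \<ge> 1" "R ^ 2 = x" using x by (auto simp: R_def)
    have Rp: "R = x powr (1 / 2)" using x by (simp add: R_def powr_half_sqrt)
    define B where "B = D * x powr (\<epsilon> / 2)"
    have "zeta_w s \<noteq> 0 \<and> 1 / norm (zeta_w s) \<le> B" if s: "1 - \<delta> \<le> Re s" "Re s \<le> 1" "\<bar>Im s\<bar> \<le> R" for s
    proof
      show "zeta_w s \<noteq> 0" by (rule zeta_w_nonzero_RH[OF RH]) (use s \<epsilon> in \<open>simp add: \<delta>_def\<close>)
      have "1 / norm (zeta_w s) \<le> C * (\<bar>Im s\<bar> + 1) powr \<epsilon>" by (rule W) (use s in \<open>auto simp: \<delta>_def\<close>)
      also have "\<dots> \<le> C * (2 * R) powr \<epsilon>" using s R C \<epsilon> by (intro mult_left_mono powr_mono2) auto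
      also have "(2 * R) powr \<epsilon> = 2 powr \<epsilon> * R powr \<epsilon>" by (rule powr_mult)
      also have "R powr \<epsilon> = x powr (\<epsilon> / 2)" unfolding Rp by (simp add: powr_powr)
      finally show "1 / norm (zeta_w s) \<le> B" by (simp add: B_def D_def)
    qed
    from moebius_sum_newman[OF \<delta>(3,2) R(1) N this]
    have S: "\<bar>\<Sum>n=1..N. euler_fun (1 - fps_X) n / real n\<bar> \<le> 4 / R + 2 / x + B * \<delta> ^ 2 / R ^ 2 + B * x powr - \<delta> * (arsinh (R / \<delta>) + 1)"
      by (simp add: x_def)
    let ?t = "x powr (- 1 / 2 + 2 * \<epsilon>)"
    have pw: "x powr p \<le> ?t" if "p \<le> - 1 / 2 + 2 * \<epsilon>" for p using x that by (intro powr_mono) auto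
    have b0: "4 / R \<le> 4 * ?t"
    proof -
      have "1 / R = x powr (- 1 / 2)" unfolding Rp by (simp add: powr_minus_divide)
      then show ?thesis using pw[of "- 1 / 2"] \<epsilon> by simp
    qed
    have b1: "2 / x \<le> 2 * ?t"
    proof -
      have "1 / x = x powr (- 1)" using x by (simp add: powr_minus_divide)
      then show ?thesis using pw[of "- 1"] \<epsilon> by simp
    qed
    have b2: "B * \<delta> ^ 2 / R ^ 2 \<le> D * ?t"
    proof -
      have "\<delta> ^ 2 \<le> 1" using \<delta> by (simp add: power_le_one)
      then have "B * \<delta> ^ 2 / R ^ 2 \<le> B * 1 / R ^ 2" using D by (intro divide_right_mono mult_left_mono) (auto simp: B_def)
      also have "\<dots> = D * x powr (\<epsilon> / 2 - 1)" using x by (simp add: B_def R powr_diff)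
      also have "\<dots> \<le> D * ?t" using D \<epsilon> by (intro mult_left_mono pw) auto
      finally show ?thesis .
    qed
    have b3: "B * x powr - \<delta> * (arsinh (R / \<delta>) + 1) \<le> D * (9 powr \<epsilon> / \<epsilon> + 1) * ?t"
    proof -
      have "arsinh (R / \<delta>) \<le> ln (2 * (R / \<delta>) + 1)" using R \<delta> by (intro arsinh_le) auto
      also have "\<dots> \<le> ln (9 * R)"
      proof -
        have "R / \<delta> \<le> R / (1 / 4)" using \<delta> R by (intro divide_left_mono) auto
        then have "2 * (R / \<delta>) + 1 \<le> 9 * R" using R by simp
        moreover have "0 \<le> R / \<delta>" using R \<delta> by simp
        ultimately show ?thesis by (subst ln_le_cancel_iff) auto
      qed
      also have "\<dots> \<le> (9 * R) powr \<epsilon> / \<epsilon>" using R \<epsilon> by (intro ln_powr_bound) auto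
      also have "(9 * R) powr \<epsilon> = 9 powr \<epsilon> * R powr \<epsilon>" by (rule powr_mult)
      also have "R powr \<epsilon> = x powr (\<epsilon> / 2)" unfolding Rp by (simp add: powr_powr)
      finally have "arsinh (R / \<delta>) + 1 \<le> 9 powr \<epsilon> * x powr (\<epsilon> / 2) / \<epsilon> + x powr (\<epsilon> / 2)"
        using ge_one_powr_ge_zero[of x "\<epsilon> / 2"] x \<epsilon> by simp
      also have "\<dots> = (9 powr \<epsilon> / \<epsilon> + 1) * x powr (\<epsilon> / 2)" by (simp add: distrib_right)
      finally have "B * x powr - \<delta> * (arsinh (R / \<delta>) + 1) \<le> B * x powr - \<delta> * ((9 powr \<epsilon> / \<epsilon> + 1) * x powr (\<epsilon> / 2))"
        using D by (intro mult_left_mono) (auto simp: B_def)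
      also have "\<dots> = D * (9 powr \<epsilon> / \<epsilon> + 1) * (x powr (\<epsilon> / 2) * x powr - \<delta> * x powr (\<epsilon> / 2))"
        by (simp add: B_def)
      also have "x powr (\<epsilon> / 2) * x powr - \<delta> * x powr (\<epsilon> / 2) = ?t"
        unfolding powr_add[symmetric] by (simp add: \<delta>_def)
      finally show ?thesis .
    qed
    have "\<bar>\<Sum>n=1..N. euler_fun (1 - fps_X) n / real n\<bar> \<le> 6 * ?t + D * ?t + D * (9 powr \<epsilon> / \<epsilon> + 1) * ?t"
      using S b0 b1 b2 b3 by linarith
    also have "\<dots> = K * ?t" unfolding K_def by (simp only: distrib_right)
    finally show ?thesis by (simp add: x_def)
  qed
  show ?thesis by (rule that[OF K main])
qed

section \<open>Sums of the Moebius function and of its convolution square\<close>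

text \<open>Passing from \<open>y\<close> to \<open>x\<close> in the saving factor costs an arbitrarily small power of \<open>x / y\<close>: the square root is subadditive, and
\<open>c \<surd>b \<le> c\<^sup>2 / (4\<theta>) + \<theta> b\<close>.\<close>

lemma exp_sqrt_ln_split:
  assumes "1 \<le> y" "y \<le> x" "\<theta> > 0" "c \<ge> 0"
  shows "exp (- c * sqrt (ln y)) \<le> exp (c ^ 2 / (4 * \<theta>)) * (x / y) powr \<theta> * exp (- c * sqrt (ln x))"
proof -
  define b where "b = ln x - ln y"
  have b: "b \<ge> 0" using assms by (simp add: b_def)
  have "sqrt (ln x) = sqrt (ln y + b)" by (simp add: b_def)
  also have "\<dots> \<le> sqrt (ln y) + sqrt b" using assms b by (intro sqrt_add_le_add_sqrt) auto
  finally have "c * sqrt (ln x) \<le> c * (sqrt (ln y) + sqrt b)" using assms by (intro mult_left_mono) auto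
  moreover have "c * sqrt b \<le> c ^ 2 / (4 * \<theta>) + \<theta> * b"
  proof -
    have "0 \<le> (c - 2 * \<theta> * sqrt b) ^ 2" by simp
    also have "\<dots> = c ^ 2 - 4 * \<theta> * (c * sqrt b) + 4 * \<theta> ^ 2 * b"
      using b by (simp add: power2_diff power_mult_distrib)
    finally have "4 * \<theta> * (c * sqrt b) \<le> 4 * \<theta> * (c ^ 2 / (4 * \<theta>) + \<theta> * b)"
      using assms(3) by (simp add: distrib_left power2_eq_square)
    then show ?thesis using assms(3) by simp
  qed
  ultimately have "- c * sqrt (ln y) \<le> c ^ 2 / (4 * \<theta>) + \<theta> * b + - c * sqrt (ln x)"
    by (simp add: distrib_left)
  then have "exp (- c * sqrt (ln y)) \<le> exp (c ^ 2 / (4 * \<theta>) + \<theta> * b + - c * sqrt (ln x))" by simp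
  also have "\<dots> = exp (c ^ 2 / (4 * \<theta>)) * exp (\<theta> * b) * exp (- c * sqrt (ln x))" by (simp only: exp_add)
  also have "exp (\<theta> * b) = (x / y) powr \<theta>" using assms by (simp add: powr_def b_def ln_div)
  finally show ?thesis .
qed

lemma one_plus_square_le_exp:
  fixes a l :: real
  assumes "a > 0" "l \<ge> 0"
  shows "1 + l ^ 2 \<le> (1 + 2 / a ^ 2) * exp (a * l)"
proof -
  have e: "1 + a * l + (a * l) ^ 2 / 2 \<le> exp (a * l)" by (rule exp_lower_Taylor_quadratic) (use assms in \<open>simp add: zero_le_mult_iff\<close>)
  have "l ^ 2 = 2 / a ^ 2 * ((a * l) ^ 2 / 2)" using assms by (simp add: power_mult_distrib)
  also have "\<dots> \<le> 2 / a ^ 2 * exp (a * l)"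
  proof (rule mult_left_mono)
    have "0 \<le> a * l" using assms by simp
    then show "(a * l) ^ 2 / 2 \<le> exp (a * l)" using e by linarith
  qed simp
  finally have "l ^ 2 \<le> 2 / a ^ 2 * exp (a * l)" .
  moreover have "0 \<le> a * l" using assms by simp
  then have "1 \<le> exp (a * l)" by simp
  ultimately show ?thesis unfolding distrib_right mult_1 by linarith
qed

text \<open>Partial summation that removes the weight \<open>1/k\<close>.\<close>

lemma sum_unweight:
  fixes g :: "nat \<Rightarrow> real"
  shows "sum g {1..N} = real N * (\<Sum>k=1..N. g k / real k) - (\<Sum>n=1..<N. \<Sum>k=1..n. g k / real k)"
proof (induction N)
  case (Suc N)
  show ?case
  proof (cases "N = 0")
    case False
    then have "(\<Sum>n=1..<Suc N. \<Sum>k=1..n. g k / real k) = (\<Sum>n=1..<N. \<Sum>k=1..n. g k / real k) + (\<Sum>k=1..N. g k / real k)"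
      by (simp add: sum.atLeastLessThan_Suc)
    then show ?thesis using Suc.IH by (simp add: algebra_simps del: of_nat_Suc) (simp add: algebra_simps)
  qed simp
qed simp

lemma sum_harmonic_le:
  assumes "n \<ge> 1"
  shows "(\<Sum>k=1..n. 1 / real k) \<le> 1 + ln (real n)"
  using assms
proof (induction n rule: dec_induct)
  case (step n)
  have "ln (real n / (real n + 1)) \<le> real n / (real n + 1) - 1" using step by (intro ln_le_minus_one) auto
  also have "real n / (real n + 1) - 1 = - (1 / (real n + 1))" by (simp add: field_simps)
  finally have "1 / (real n + 1) \<le> ln (real n + 1) - ln (real n)" using step by (simp add: ln_div)
  then show ?case using step.IH by (simp add: add.commute)
qed simp

theorem moebius_sum_bound:
  obtains c K where "0 < c" "0 < K" "\<And>N. N \<ge> 1 \<Longrightarrow>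
    \<bar>\<Sum>n=1..N. euler_fun (1 - fps_X) n\<bar> \<le> K * real N * exp (- c * sqrt (ln (real N)))"
proof -
  obtain c K where c: "0 < c" "0 < K" and b: "\<And>N. N \<ge> 1 \<Longrightarrow>
    \<bar>\<Sum>n=1..N. euler_fun (1 - fps_X) n / real n\<bar> \<le> K * exp (- c * sqrt (ln (real N)))"
    using moebius_log_sum_bound by blast
  define E where "E = exp (c ^ 2 / (4 * (1 / 2)))"
  define K' where "K' = K * (1 + 2 * E)"
  have main: "\<bar>\<Sum>n=1..N. euler_fun (1 - fps_X) n\<bar> \<le> K' * real N * exp (- c * sqrt (ln (real N)))" if N: "N \<ge> 1" for N
  proof -
    let ?S = "\<lambda>n. \<Sum>k=1..n. euler_fun (1 - fps_X) k / real k"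
    let ?e = "exp (- c * sqrt (ln (real N)))"
    have eq: "(\<Sum>n=1..N. euler_fun (1 - fps_X) n) = real N * ?S N - (\<Sum>n=1..<N. ?S n)" by (rule sum_unweight)
    have 1: "\<bar>real N * ?S N\<bar> \<le> real N * (K * ?e)" using b[OF N] by (simp add: abs_mult mult_left_mono)
    have 2: "\<bar>\<Sum>n=1..<N. ?S n\<bar> \<le> (\<Sum>n=1..<N. K * (E * sqrt (real N) * ?e * (1 / sqrt (real n))))"
    proof (rule order_trans[OF sum_abs], rule sum_mono)
      fix n assume n: "n \<in> {1..<N}"
      have "\<bar>?S n\<bar> \<le> K * exp (- c * sqrt (ln (real n)))" using n by (intro b) auto
      also have "\<dots> \<le> K * (E * (real N / real n) powr (1 / 2) * ?e)"
        unfolding E_def using n c by (intro mult_left_mono exp_sqrt_ln_split) auto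
      also have "(real N / real n) powr (1 / 2) = sqrt (real N) * (1 / sqrt (real n))"
        by (simp add: powr_half_sqrt real_sqrt_divide)
      finally show "\<bar>?S n\<bar> \<le> K * (E * sqrt (real N) * ?e * (1 / sqrt (real n)))" by (simp only: mult_ac)
    qed
    have 3: "(\<Sum>n=1..<N. K * (E * sqrt (real N) * ?e * (1 / sqrt (real n)))) = K * (E * sqrt (real N) * ?e) * (\<Sum>n=1..<N. 1 / sqrt (real n))"
      by (simp only: sum_distrib_left mult_ac)
    have 4: "K * (E * sqrt (real N) * ?e) * (\<Sum>n=1..<N. 1 / sqrt (real n)) \<le> K * (E * sqrt (real N) * ?e) * (2 * sqrt (real N))"
    proof (rule mult_left_mono)
      have "(\<Sum>n=1..<N. 1 / sqrt (real n)) \<le> (\<Sum>n=1..N. 1 / sqrt (real n))" by (rule sum_mono2) auto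
      also have "\<dots> \<le> 2 * sqrt (real N)" by (rule sum_inverse_sqrt_le)
      finally show "(\<Sum>n=1..<N. 1 / sqrt (real n)) \<le> 2 * sqrt (real N)" .
    qed (use c in \<open>simp add: E_def\<close>)
    have 5: "K * (E * sqrt (real N) * ?e) * (2 * sqrt (real N)) = real N * (K * (2 * E) * ?e)" by simp
    have 6: "K' * real N * ?e = real N * (K * ?e) + real N * (K * (2 * E) * ?e)"
      unfolding K'_def by (simp only: distrib_left distrib_right mult_1_right mult_ac)
    have "\<bar>\<Sum>n=1..N. euler_fun (1 - fps_X) n\<bar> \<le> \<bar>real N * ?S N\<bar> + \<bar>\<Sum>n=1..<N. ?S n\<bar>"
      unfolding eq by (rule abs_triangle_ineq4)
    then show ?thesis using 1 2 3 4 5 6 by linarith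
  qed
  show ?thesis
  proof (rule that)
    show "0 < c" "0 < K'" using c by (auto simp: K'_def E_def intro!: mult_pos_pos add_pos_pos)
  qed (rule main)
qed

theorem moebius_sum_bound_RH:
  assumes RH: "riemann_hypothesis" and \<epsilon>: "0 < \<epsilon>" "\<epsilon> < 1 / 4"
  obtains K where "0 < K" "\<And>N. N \<ge> 1 \<Longrightarrow> \<bar>\<Sum>n=1..N. euler_fun (1 - fps_X) n\<bar> \<le> K * real N powr (1 / 2 + 2 * \<epsilon>)"
proof -
  obtain K where K: "0 < K" and b: "\<And>N. N \<ge> 1 \<Longrightarrow>
    \<bar>\<Sum>n=1..N. euler_fun (1 - fps_X) n / real n\<bar> \<le> K * real N powr (- 1 / 2 + 2 * \<epsilon>)"
    using moebius_log_sum_bound_RH[OF assms] by blast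
  define a where "a = 1 / 2 + 2 * \<epsilon>"
  have a: "a \<ge> 1 / 2" "a - 1 = - 1 / 2 + 2 * \<epsilon>" using \<epsilon> by (auto simp: a_def)
  have main: "\<bar>\<Sum>n=1..N. euler_fun (1 - fps_X) n\<bar> \<le> 4 * K * real N powr (1 / 2 + 2 * \<epsilon>)" if N: "N \<ge> 1" for N
  proof -
    let ?S = "\<lambda>n. \<Sum>k=1..n. euler_fun (1 - fps_X) k / real k"
    have eq: "(\<Sum>n=1..N. euler_fun (1 - fps_X) n) = real N * ?S N - (\<Sum>n=1..<N. ?S n)" by (rule sum_unweight)
    have "\<bar>real N * ?S N\<bar> \<le> real N * (K * real N powr (a - 1))" using b[OF N] a by (simp add: abs_mult mult_left_mono)
    also have "\<dots> = K * real N powr a" using N by (simp add: powr_diff)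
    finally have 1: "\<bar>real N * ?S N\<bar> \<le> K * real N powr a" .
    have "\<bar>\<Sum>n=1..<N. ?S n\<bar> \<le> (\<Sum>n=1..<N. K * real n powr (a - 1))"
      by (rule order_trans[OF sum_abs], rule sum_mono) (use b a in auto)
    also have "\<dots> \<le> (\<Sum>n=1..N. K * real n powr (a - 1))" using K by (intro sum_mono2) auto
    also have "\<dots> = K * (\<Sum>n=1..N. real n powr (a - 1))" by (simp add: sum_distrib_left)
    also have "\<dots> \<le> K * (real N powr a * (1 / a + 1 / real N))"
      using K a N by (intro mult_left_mono sum_powr_head_le) auto
    also have "\<dots> \<le> K * (real N powr a * 3)"
    proof (intro mult_left_mono)
      have "1 / a \<le> 1 / (1 / 2)" using a by (intro divide_left_mono) auto
      moreover have "1 / real N \<le> 1" using N by simp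
      ultimately show "1 / a + 1 / real N \<le> 3" by simp
    qed (use K in auto)
    finally have 2: "\<bar>\<Sum>n=1..<N. ?S n\<bar> \<le> K * (real N powr a * 3)" .
    have "\<bar>\<Sum>n=1..N. euler_fun (1 - fps_X) n\<bar> \<le> \<bar>real N * ?S N\<bar> + \<bar>\<Sum>n=1..<N. ?S n\<bar>"
      unfolding eq by (rule abs_triangle_ineq4)
    then have "\<bar>\<Sum>n=1..N. euler_fun (1 - fps_X) n\<bar> \<le> 4 * K * real N powr a" using 1 2 by linarith
    then show ?thesis by (simp add: a_def)
  qed
  show ?thesis by (rule that[of "4 * K"]) (use K main in auto)
qed

text \<open>Pairs \<open>(m, k)\<close> with \<open>m \<le> Y\<close> are summed over \<open>k\<close> first; the pairs with \<open>m > Y\<close> have \<open>k \<le> x / Y\<close> and are summed over \<open>m\<close> first.\<close>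

lemma psum_dconv_hyperbola:
  fixes f g :: "nat \<Rightarrow> real"
  assumes Y: "1 \<le> Y" "real Y \<le> x"
  shows "psum (dconv f g) x = (\<Sum>m=1..Y. g m * psum f (x / real m)) +
    (\<Sum>k=1..nat \<lfloor>x / real Y\<rfloor>. f k * (psum g (x / real k) - psum g (real Y)))"
proof -
  have x: "x > 0" using Y by linarith
  define D where "D = {m. Y < m \<and> real m \<le> x}"
  define N where "N = {k. 1 \<le> k \<and> real k \<le> x / real Y}"
  have split: "{m. 1 \<le> m \<and> real m \<le> x} = {1..Y} \<union> D" "{1..Y} \<inter> D = {}"
    using Y by (auto simp: D_def not_less)
  have finD: "finite D" by (rule finite_subset[OF _ finite_nat_le_real[of x]]) (auto simp: D_def)
  have finN: "finite N" by (simp add: N_def)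
  have "psum (dconv f g) x = (\<Sum>m=1..Y. g m * psum f (x / real m)) + (\<Sum>m\<in>D. g m * psum f (x / real m))"
    unfolding psum_dconv split(1) using split(2) finD by (intro sum.union_disjoint) auto
  also have "(\<Sum>m\<in>D. g m * psum f (x / real m)) = (\<Sum>m\<in>D. \<Sum>k | k \<in> N \<and> real m * real k \<le> x. g m * f k)"
  proof (intro sum.cong refl)
    fix m assume m: "m \<in> D"
    then have mp: "real m > 0" "real Y \<le> real m" using Y by (auto simp: D_def)
    have "x / real m \<le> x / real Y" using mp x Y by (intro divide_left_mono) auto
    moreover have "real k \<le> x / real m \<longleftrightarrow> real m * real k \<le> x" for k
      using pos_le_divide_eq[OF mp(1), of "real k" x] by (simp only: mult.commute)
    ultimately have "{k. 1 \<le> k \<and> real k \<le> x / real m} = {k \<in> N. real m * real k \<le> x}"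
      unfolding N_def by (auto simp only: mem_Collect_eq intro: order_trans)
    then show "g m * psum f (x / real m) = (\<Sum>k | k \<in> N \<and> real m * real k \<le> x. g m * f k)"
      unfolding psum_def by (simp add: sum_distrib_left)
  qed
  also have "\<dots> = (\<Sum>k\<in>N. \<Sum>m | m \<in> D \<and> real m * real k \<le> x. g m * f k)"
    by (rule sum.swap_restrict[OF finD finN])
  also have "\<dots> = (\<Sum>k\<in>N. f k * (psum g (x / real k) - psum g (real Y)))"
  proof (intro sum.cong refl)
    fix k assume k: "k \<in> N"
    then have k0: "real k > 0" "real k \<ge> 1" by (auto simp: N_def)
    have Yk: "real Y \<le> x / real k"
    proof -
      have "real k * real Y \<le> x" using k Y by (simp add: N_def pos_le_divide_eq)
      then show ?thesis using k0 by (simp add: pos_le_divide_eq mult.commute)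
    qed
    have iff: "real m * real k \<le> x \<longleftrightarrow> real m \<le> x / real k" for m
      by (rule pos_le_divide_eq[OF k0(1), symmetric])
    have "x / real k \<le> x / 1" using x k0 by (intro divide_left_mono) auto
    then have "real m \<le> x" if "real m \<le> x / real k" for m using that by simp
    then have eq: "{m \<in> D. real m * real k \<le> x} = {m. Y < m \<and> real m \<le> x / real k}"
      unfolding iff by (auto simp: D_def)
    have "{m. 1 \<le> m \<and> real m \<le> x / real k} = {m. 1 \<le> m \<and> real m \<le> real Y} \<union> {m. Y < m \<and> real m \<le> x / real k}"
      using Yk Y by (auto intro: order_trans)
    then have "psum g (x / real k) = psum g (real Y) + sum g {m. Y < m \<and> real m \<le> x / real k}"
      unfolding psum_def using finite_subset[OF _ finite_nat_le_real[of "x / real k"], of "{m. Y < m \<and> real m \<le> x / real k}"] Y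
      by (simp only:) (subst sum.union_disjoint, auto)
    then show "(\<Sum>m | m \<in> D \<and> real m * real k \<le> x. g m * f k) = f k * (psum g (x / real k) - psum g (real Y))"
      unfolding eq by (simp add: sum_distrib_left mult.commute)
  qed
  finally show ?thesis unfolding N_def nat_le_real_set .
qed

lemma abs_moebius_fun_le: "\<bar>euler_fun (1 - fps_X) n\<bar> \<le> 1"
  by (rule abs_euler_fun_le_1) (simp add: nth_one_minus_X)

lemma euler_fun_mu_mu:
  assumes "n > 0"
  shows "euler_fun ((1 - fps_X) ^ 2) n = dconv (euler_fun (1 - fps_X)) (euler_fun (1 - fps_X)) n"
  using dconv_euler_fun[of "1 - fps_X" "1 - fps_X" n] assms by (simp add: nth_one_minus_X power2_eq_square)

text \<open>Dirichlet's hyperbola method with \<open>Y = \<surd>N\<close>: every sum of \<open>\<mu>\<close> that occurs has length at least \<open>Y\<close>, so it saves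
\<open>exp (- c \<surd>(log Y)) \<le> exp (- (c/2) \<surd>(log N))\<close> up to a constant. The factor \<open>1 + log N\<close> from the harmonic sums is absorbed by giving up part of
the exponent.\<close>

theorem moebius_square_sum_bound:
  obtains c K where "0 < c" "0 < K" "\<And>N. N \<ge> 1 \<Longrightarrow>
    \<bar>\<Sum>n=1..N. euler_fun ((1 - fps_X) ^ 2) n\<bar> \<le> K * real N * exp (- c * sqrt (ln (real N)))"
proof -
  obtain c K where c: "0 < c" "0 < K" and b: "\<And>N. N \<ge> 1 \<Longrightarrow>
    \<bar>\<Sum>n=1..N. euler_fun (1 - fps_X) n\<bar> \<le> K * real N * exp (- c * sqrt (ln (real N)))"
    using moebius_sum_bound by blast
  \<comment> \<open>The exponent that absorbs the logarithm.\<close>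
  define a where "a = c / 4"
  define K' where "K' = 3 * K * (2 * exp (c ^ 2 / 4)) * (1 + 2 / a ^ 2)"
  have ap: "a > 0" using c by (simp add: a_def)
  have K'pos: "K' > 0" using c ap by (auto simp: K'_def intro!: mult_pos_pos add_pos_pos)
  let ?\<mu> = "euler_fun (1 - fps_X)"
  have main: "\<bar>\<Sum>n=1..N. euler_fun ((1 - fps_X) ^ 2) n\<bar> \<le> K' * real N * exp (- (c / 4) * sqrt (ln (real N)))" if N: "N \<ge> 1" for N
  proof -
    define x where "x = real N"
    define l where "l = sqrt (ln x)"
    have x: "x \<ge> 1" using N by (simp add: x_def)
    have l: "l \<ge> 0" "l ^ 2 = ln x" using x by (auto simp: l_def)
    define Y where "Y = nat \<lfloor>sqrt x\<rfloor>"
    have sx: "sqrt x \<ge> 1" using x by simp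
    have Y1: "Y \<ge> 1" using sx by (simp add: Y_def le_nat_floor)
    have Yle: "real Y \<le> sqrt x" using sx by (simp add: Y_def)
    have Yge: "sqrt x \<le> 2 * real Y"
    proof -
      have "sqrt x < real Y + 1" unfolding Y_def using sx by linarith
      then show ?thesis using Y1 by simp
    qed
    have YY: "real Y * real Y \<le> x"
    proof -
      have "real Y * real Y \<le> sqrt x * sqrt x" using Yle x by (intro mult_mono) auto
      also have "\<dots> = x" using x by (intro real_sqrt_mult_self[THEN trans]) simp
      finally show ?thesis .
    qed
    have Yx: "real Y \<le> x"
    proof -
      have "real Y * 1 \<le> real Y * real Y" using Y1 by (intro mult_left_mono) auto
      then show ?thesis using YY by linarith
    qed
    define E where "E = exp (- c * sqrt (ln (real Y)))"
    have M: "\<bar>psum ?\<mu> z\<bar> \<le> K * z * E" if z: "z \<ge> real Y" for z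
    proof -
      have nz: "nat \<lfloor>z\<rfloor> \<ge> Y" using z by (simp add: le_nat_floor)
      have zl: "real (nat \<lfloor>z\<rfloor>) \<le> z" using z by simp
      have n1: "nat \<lfloor>z\<rfloor> \<ge> 1" using nz Y1 by linarith
      have "\<bar>psum ?\<mu> z\<bar> \<le> K * real (nat \<lfloor>z\<rfloor>) * exp (- c * sqrt (ln (real (nat \<lfloor>z\<rfloor>))))"
        unfolding psum_eq by (rule b[OF n1])
      also have "\<dots> \<le> K * z * E"
        unfolding E_def
      proof (intro mult_mono)
        have "ln (real Y) \<le> ln (real (nat \<lfloor>z\<rfloor>))" by (rule ln_mono) (use nz Y1 n1 in linarith)+
        then show "exp (- c * sqrt (ln (real (nat \<lfloor>z\<rfloor>)))) \<le> exp (- c * sqrt (ln (real Y)))"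
          using c by simp
      qed (use c zl z in auto)
      finally show ?thesis .
    qed
    have E0: "E > 0" by (simp add: E_def)
    have S1: "\<bar>\<Sum>m=1..Y. ?\<mu> m * psum ?\<mu> (x / real m)\<bar> \<le> K * x * E * (1 + ln x)"
    proof -
      have "\<bar>\<Sum>m=1..Y. ?\<mu> m * psum ?\<mu> (x / real m)\<bar> \<le> (\<Sum>m=1..Y. K * x * E * (1 / real m))"
      proof (rule order_trans[OF sum_abs], rule sum_mono)
        fix m assume m: "m \<in> {1..Y}"
        have "real Y * real m \<le> real Y * real Y" using m by (intro mult_left_mono) auto
        then have "real Y * real m \<le> x" using YY by linarith
        then have "real Y \<le> x / real m" using m by (simp add: pos_le_divide_eq)
        then have "\<bar>?\<mu> m * psum ?\<mu> (x / real m)\<bar> \<le> 1 * (K * (x / real m) * E)"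
          unfolding abs_mult by (intro mult_mono abs_moebius_fun_le M) auto
        then show "\<bar>?\<mu> m * psum ?\<mu> (x / real m)\<bar> \<le> K * x * E * (1 / real m)" by simp
      qed
      also have "\<dots> = K * x * E * (\<Sum>m=1..Y. 1 / real m)" by (simp add: sum_distrib_left)
      also have "\<dots> \<le> K * x * E * (1 + ln x)"
      proof (rule mult_left_mono)
        have "(\<Sum>m=1..Y. 1 / real m) \<le> 1 + ln (real Y)" by (rule sum_harmonic_le[OF Y1])
        also have "ln (real Y) \<le> ln x" using Yx Y1 x by (subst ln_le_cancel_iff) auto
        finally show "(\<Sum>m=1..Y. 1 / real m) \<le> 1 + ln x" by simp
      qed (use c x E0 in auto)
      finally show ?thesis .
    qed
    define Q where "Q = nat \<lfloor>x / real Y\<rfloor>"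
    have Q: "Q \<ge> 1" "real Q \<le> x / real Y" using Yx Y1 x by (auto simp: Q_def le_nat_floor)
    have S2: "\<bar>\<Sum>k=1..Q. ?\<mu> k * (psum ?\<mu> (x / real k) - psum ?\<mu> (real Y))\<bar> \<le> 2 * (K * x * E * (1 + ln x))"
    proof -
      have "\<bar>\<Sum>k=1..Q. ?\<mu> k * (psum ?\<mu> (x / real k) - psum ?\<mu> (real Y))\<bar> \<le> (\<Sum>k=1..Q. 2 * (K * x * E) * (1 / real k))"
      proof (rule order_trans[OF sum_abs], rule sum_mono)
        fix k assume k: "k \<in> {1..Q}"
        then have "real k \<le> x / real Y" using Q by (auto intro: order_trans)
        then have "real k * real Y \<le> x" using Y1 by (simp add: pos_le_divide_eq)
        then have kY: "real Y \<le> x / real k" using k by (simp add: pos_le_divide_eq mult.commute)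
        have "\<bar>psum ?\<mu> (x / real k) - psum ?\<mu> (real Y)\<bar> \<le> K * (x / real k) * E + K * real Y * E"
          using M[OF kY] M[OF order_refl] by linarith
        also have "\<dots> \<le> K * (x / real k) * E + K * (x / real k) * E"
          using kY c E0 by (intro add_left_mono mult_right_mono mult_left_mono) auto
        finally have "\<bar>?\<mu> k * (psum ?\<mu> (x / real k) - psum ?\<mu> (real Y))\<bar> \<le> 1 * (K * (x / real k) * E + K * (x / real k) * E)"
          unfolding abs_mult by (intro mult_mono abs_moebius_fun_le) auto
        then show "\<bar>?\<mu> k * (psum ?\<mu> (x / real k) - psum ?\<mu> (real Y))\<bar> \<le> 2 * (K * x * E) * (1 / real k)" by (simp add: mult_ac)
      qed
      also have "\<dots> = 2 * (K * x * E) * (\<Sum>k=1..Q. 1 / real k)" by (simp add: sum_distrib_left)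
      also have "\<dots> \<le> 2 * (K * x * E) * (1 + ln x)"
      proof (rule mult_left_mono)
        have "x / real Y \<le> x / 1" using x Y1 by (intro divide_left_mono) auto
        then have "real Q \<le> x" using Q by linarith
        have "(\<Sum>k=1..Q. 1 / real k) \<le> 1 + ln (real Q)" by (rule sum_harmonic_le[OF Q(1)])
        also have "ln (real Q) \<le> ln x" using \<open>real Q \<le> x\<close> Q(1) x by (subst ln_le_cancel_iff) auto
        finally show "(\<Sum>k=1..Q. 1 / real k) \<le> 1 + ln x" by simp
      qed (use c x E0 in auto)
      finally show ?thesis by simp
    qed
    have "(\<Sum>n=1..N. euler_fun ((1 - fps_X) ^ 2) n) = psum (dconv ?\<mu> ?\<mu>) x"
      unfolding psum_eq x_def by (rule sum.cong) (auto simp: euler_fun_mu_mu)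
    also have "\<bar>\<dots>\<bar> \<le> 3 * (K * x * E * (1 + ln x))"
      unfolding psum_dconv_hyperbola[OF Y1 Yx] Q_def[symmetric] using S1 S2 by linarith
    also have "\<dots> = 3 * K * x * (E * (1 + l ^ 2))" by (simp add: l)
    also have "\<dots> \<le> 3 * K * x * ((2 * exp (c ^ 2 / 4) * exp (- (c / 2) * l)) * ((1 + 2 / a ^ 2) * exp (a * l)))"
    proof (intro mult_left_mono mult_mono)
      have "E \<le> exp (c ^ 2 / (4 * 1)) * (sqrt x / real Y) powr 1 * exp (- c * sqrt (ln (sqrt x)))"
        unfolding E_def by (rule exp_sqrt_ln_split) (use Y1 Yle c in auto)
      also have "\<dots> \<le> exp (c ^ 2 / 4) * 2 * exp (- (c / 2) * l)"
      proof (intro mult_mono)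
        show "(sqrt x / real Y) powr 1 \<le> 2" using Yge Y1 x by (simp add: divide_le_eq)
        have "l / 2 \<le> sqrt (ln (sqrt x))"
        proof (rule real_le_rsqrt)
          have "(l / 2)\<^sup>2 = ln x / 4" using l by (simp add: power_divide)
          also have "\<dots> \<le> ln (sqrt x)" using x by (simp add: ln_sqrt)
          finally show "(l / 2)\<^sup>2 \<le> ln (sqrt x)" .
        qed
        then have "c * (l / 2) \<le> c * sqrt (ln (sqrt x))" using c by (intro mult_left_mono) auto
        then show "exp (- c * sqrt (ln (sqrt x))) \<le> exp (- (c / 2) * l)" unfolding exp_le_cancel_iff by linarith
      qed auto
      finally show "E \<le> 2 * exp (c ^ 2 / 4) * exp (- (c / 2) * l)" by simp
      show "1 + l ^ 2 \<le> (1 + 2 / a ^ 2) * exp (a * l)" by (rule one_plus_square_le_exp[OF ap l(1)])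
    qed (use c x in auto)
    also have "\<dots> = K' * x * (exp (- (c / 2) * l) * exp (a * l))" by (simp add: K'_def)
    also have "exp (- (c / 2) * l) * exp (a * l) = exp (- (c / 4) * l)"
      unfolding exp_add[symmetric] by (simp add: a_def)
    finally show ?thesis by (simp add: x_def l_def)
  qed
  show ?thesis
  proof (rule that)
    show "0 < c / 4" "0 < K'" using c K'pos by auto
  qed (rule main)
qed

section \<open>The exponential Moebius function without its cofactor\<close>

lemma sum_abs_mu_mu_le:
  assumes "Y \<ge> 1"
  shows "(\<Sum>d=1..Y. \<bar>euler_fun ((1 - fps_X) ^ 2) d\<bar>) \<le> real Y * (1 + ln (real Y))"
proof -
  let ?o = "\<lambda>_::nat. 1 :: real"
  have le: "\<bar>euler_fun ((1 - fps_X) ^ 2) d\<bar> \<le> dconv ?o ?o d" if "d > 0" for d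
  proof -
    have "\<bar>euler_fun ((1 - fps_X) ^ 2) d\<bar> \<le> dconv (\<lambda>n. \<bar>euler_fun (1 - fps_X) n\<bar>) (\<lambda>n. \<bar>euler_fun (1 - fps_X) n\<bar>) d"
      using norm_dconv_le[of "euler_fun (1 - fps_X)" "euler_fun (1 - fps_X)" d] that by (simp add: euler_fun_mu_mu)
    also have "\<dots> \<le> dconv ?o ?o d"
      unfolding dconv_def
    proof (rule sum_mono)
      fix ab :: "nat \<times> nat"
      have "\<bar>euler_fun (1 - fps_X) (fst ab)\<bar> * \<bar>euler_fun (1 - fps_X) (snd ab)\<bar> \<le> 1 * 1"
        by (intro mult_mono abs_moebius_fun_le) auto
      then show "(case ab of (a, b) \<Rightarrow> \<bar>euler_fun (1 - fps_X) a\<bar> * \<bar>euler_fun (1 - fps_X) b\<bar>)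
          \<le> (case ab of (a, b) \<Rightarrow> 1 * 1)" by (simp add: case_prod_unfold)
    qed
    finally show ?thesis .
  qed
  have "(\<Sum>d=1..Y. \<bar>euler_fun ((1 - fps_X) ^ 2) d\<bar>) \<le> (\<Sum>d=1..Y. dconv ?o ?o d)"
    by (intro sum_mono le) auto
  also have "\<dots> = psum (dconv ?o ?o) (real Y)" by (simp add: psum_eq)
  also have "\<dots> = (\<Sum>m=1..Y. real (nat \<lfloor>real Y / real m\<rfloor>))"
    unfolding psum_dconv nat_le_real_set by (simp add: psum_eq)
  also have "\<dots> \<le> (\<Sum>m=1..Y. real Y * (1 / real m))"
    by (intro sum_mono) simp
  also have "\<dots> = real Y * (\<Sum>m=1..Y. 1 / real m)" by (simp only: sum_distrib_left)
  also have "\<dots> \<le> real Y * (1 + ln (real Y))"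
    by (intro mult_left_mono sum_harmonic_le assms) auto
  finally show ?thesis .
qed

text \<open>The function \<open>\<mu>\<^sup>(\<^sup>e\<^sup>)\<close> without its cofactor: the Dirichlet series is \<open>\<zeta>(s) / \<zeta>\<^sup>2(2s)\<close>.\<close>

abbreviation main_fun :: "nat \<Rightarrow> real" where
  "main_fun \<equiv> euler_fun (geo_fps * fps_spread ((1 - fps_X) ^ 2))"

text \<open>The mean value \<open>\<Sum> (\<mu> * \<mu>)(d) / d\<^sup>2 = 1 / \<zeta>\<^sup>2(2)\<close> of \<open>main_fun\<close>.\<close>

abbreviation main_mean :: real where
  "main_mean \<equiv> euler_series ((1 - fps_X) ^ 2) (\<lambda>n. 1 / real n ^ 2)"

text \<open>Two factorizations of \<open>(1 - X)\<^sup>-\<^sup>1 (1 - X\<^sup>2)\<^sup>2 = (1 + X) (1 - X\<^sup>2)\<close>. The first combines the constant function 1 with \<open>\<mu> * \<mu>\<close> on the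
squares; the second \<open>\<mu>\<^sup>2\<close> with \<open>\<mu>\<close>, which is where the hypothesis on squarefree numbers comes in.\<close>

lemma psum_main_fun:
  "psum main_fun x = psum (dconv (euler_fun geo_fps) (euler_fun (fps_spread ((1 - fps_X) ^ 2)))) x"
  "psum main_fun x = psum (dconv (euler_fun (1 + fps_X)) (euler_fun (fps_spread (1 - fps_X)))) x"
proof -
  have 0: "fps_nth geo_fps 0 = 1" "fps_nth (fps_spread ((1 - fps_X) ^ 2)) 0 = 1"
     "fps_nth (1 + fps_X :: real fps) 0 = 1" "fps_nth (fps_spread (1 - fps_X)) 0 = 1"
    by (simp_all add: geo_fps_def fps_spread_def fps_power_zeroth)
  show "psum main_fun x = psum (dconv (euler_fun geo_fps) (euler_fun (fps_spread ((1 - fps_X) ^ 2)))) x"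
    by (rule psum_cong) (simp add: dconv_euler_fun 0)
  have "geo_fps * fps_spread ((1 - fps_X) ^ 2) = (geo_fps * (1 - fps_X)) * ((1 + fps_X) * fps_spread (1 - fps_X))"
    unfolding fps_spread_moebius by (simp add: power2_eq_square algebra_simps)
  then have "geo_fps * fps_spread ((1 - fps_X) ^ 2) = (1 + fps_X) * fps_spread (1 - fps_X)"
    by (simp only: geo_fps_inverse mult_1)
  then show "psum main_fun x = psum (dconv (euler_fun (1 + fps_X)) (euler_fun (fps_spread (1 - fps_X)))) x"
    by (intro psum_cong) (simp add: dconv_euler_fun 0)
qed

lemma psum_main_fun_trivial:
  assumes "x \<le> X"
  shows "\<bar>psum main_fun x\<bar> \<le> psum (\<lambda>n. \<bar>main_fun n\<bar>) X"
proof -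
  have "\<bar>psum main_fun x\<bar> \<le> psum (\<lambda>n. \<bar>main_fun n\<bar>) x"
    unfolding psum_eq by (rule sum_abs)
  also have "\<dots> \<le> psum (\<lambda>n. \<bar>main_fun n\<bar>) X"
    unfolding psum_eq by (rule sum_mono2) (use assms in \<open>auto intro: order_trans nat_mono floor_mono\<close>)
  finally show ?thesis .
qed

lemma has_sum_mu_mu: "((\<lambda>d. euler_fun ((1 - fps_X) ^ 2) d / real d ^ 2) has_sum main_mean) {1..}"
  using has_sum_infsum[OF abs_summable_summable[OF norm_summable_mu_mu]] by (simp add: euler_series_def)

text \<open>The hyperbola estimate for \<open>1\<close> and \<open>\<mu> * \<mu>\<close> with \<open>Y = \<surd>x / T\<close>, \<open>T = exp (b \<surd>(log x))\<close>. The error from \<open>d \<le> Y\<close> is about \<open>Y log Y\<close>, so that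
taking \<open>Y\<close> below \<open>\<surd>x\<close> by the factor \<open>T\<close> saves \<open>T\<close>; the error from \<open>d > Y\<close> loses \<open>T\<^sup>2\<close>, which the saving in the sums of \<open>\<mu> * \<mu>\<close> outweighs when \<open>b\<close>
is small. For bounded \<open>x\<close>, where \<open>T\<close> may exceed \<open>\<surd>x\<close>, the trivial bound is used.\<close>

theorem main_fun_sum_bound:
  obtains c K where "0 < c" "0 < K" "\<And>x. x \<ge> 1 \<Longrightarrow>
    \<bar>psum main_fun x - main_mean * x\<bar> \<le> K * sqrt x * exp (- c * sqrt (ln x))"
proof -
  obtain c5 K5 where c5: "0 < c5" "0 < K5" and b5: "\<And>N. N \<ge> 1 \<Longrightarrow>
    \<bar>\<Sum>n=1..N. euler_fun ((1 - fps_X) ^ 2) n\<bar> \<le> K5 * real N * exp (- c5 * sqrt (ln (real N)))"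
    using moebius_square_sum_bound by blast
  \<comment> \<open>The cut lies at \<open>\<surd>x exp (- b l)\<close> with \<open>l = \<surd>(log x)\<close>; the cut loses \<open>exp (2 b l)\<close> against a saving of \<open>exp (- (c5/2) l)\<close>, and half of the
    gain \<open>exp (- b l)\<close> absorbs a logarithm.\<close>
  define b where "b = c5 / 8"
  define c where "c = c5 / 16"
  define E where "E = exp (c5 ^ 2 / 4)"
  \<comment> \<open>Beyond \<open>X\<close> the cut is at least 1.\<close>
  define X where "X = exp (4 * b ^ 2)"
  define W where "W = psum (\<lambda>n. \<bar>main_fun n\<bar>) X + \<bar>main_mean\<bar> * X"
  define Ka where "Ka = 32 * K5 * E + (1 + 2 / c ^ 2)"
  define Kb where "Kb = W * exp (2 * b * c)"
  have pos: "b > 0" "c > 0" "E > 0" "X > 0" using c5 by (auto simp: b_def c_def E_def X_def)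
  have W0: "W \<ge> 0" using pos by (auto simp: W_def psum_def intro!: add_nonneg_nonneg sum_nonneg)
  have Ka0: "Ka > 0" using c5 pos by (auto simp: Ka_def intro!: add_pos_pos)
  have Kb0: "Kb \<ge> 0" using W0 by (simp add: Kb_def)
  have small: "\<bar>psum main_fun x - main_mean * x\<bar> \<le> Kb * sqrt x * exp (- c * sqrt (ln x))"
    if x: "x \<ge> 1" and lx: "sqrt (ln x) < 2 * b" for x
  proof -
    have "ln x = sqrt (ln x) ^ 2" using x by simp
    also have "\<dots> \<le> (2 * b) ^ 2" using lx by (intro power_mono) (auto simp: x)
    finally have "exp (ln x) \<le> X" by (simp add: X_def power_mult_distrib)
    then have xX: "x \<le> X" using x by simp
    have "\<bar>psum main_fun x - main_mean * x\<bar> \<le> \<bar>psum main_fun x\<bar> + \<bar>main_mean * x\<bar>" by (rule abs_triangle_ineq4)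
    also have "\<dots> \<le> W" unfolding W_def abs_mult
      using xX x by (intro add_mono psum_main_fun_trivial mult_left_mono) auto
    also have "W = W * 1 * 1" by simp
    also have "\<dots> \<le> W * exp (2 * b * c - c * sqrt (ln x)) * sqrt x"
    proof (intro mult_mono)
      have "c * sqrt (ln x) \<le> c * (2 * b)" using pos lx by (intro mult_left_mono) auto
      then show "1 \<le> exp (2 * b * c - c * sqrt (ln x))" by (simp add: mult_ac)
    qed (use W0 x in auto)
    also have "exp (2 * b * c - c * sqrt (ln x)) = exp (2 * b * c) * exp (- c * sqrt (ln x))"
      unfolding exp_add[symmetric] by simp
    finally show ?thesis unfolding Kb_def by (simp only: mult_ac)
  qed
  have large: "\<bar>psum main_fun x - main_mean * x\<bar> \<le> Ka * sqrt x * exp (- c * sqrt (ln x))"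
    if x: "x \<ge> 1" and lx: "\<not> sqrt (ln x) < 2 * b" for x
  proof -
    define l where "l = sqrt (ln x)"
    define T where "T = exp (b * l)"
    define Y where "Y = nat \<lfloor>sqrt x / T\<rfloor>"
    have l: "l \<ge> 0" "l ^ 2 = ln x" "2 * b \<le> l" using x lx by (auto simp: l_def)
    have T1: "T \<ge> 1" using l pos by (simp add: T_def)
    have "b * l \<le> ln x / 2"
      using mult_right_mono[OF l(3) l(1)] unfolding l(2)[symmetric] power2_eq_square by simp
    then have "T \<le> exp (ln x / 2)" by (simp add: T_def)
    also have "exp (ln x / 2) = sqrt x" using x by (simp add: powr_half_sqrt[symmetric] powr_def)
    finally have z1: "sqrt x / T \<ge> 1" using T1 by simp
    have Y1: "Y \<ge> 1" using z1 by (simp add: Y_def le_nat_floor)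
    have Yle: "real Y \<le> sqrt x / T" using z1 by (simp add: Y_def)
    have Yge: "sqrt x / T \<le> 2 * real Y"
    proof -
      have "sqrt x / T < real Y + 1" unfolding Y_def using z1 by linarith
      then show ?thesis using Y1 by simp
    qed
    have "sqrt x / T \<le> sqrt x / 1" using T1 x by (intro divide_left_mono) auto
    then have Ys: "real Y \<le> sqrt x" using Yle by simp
    then have "real Y ^ 2 \<le> sqrt x ^ 2" by (intro power_mono) auto
    then have YY: "real Y ^ 2 \<le> x" using x by simp
    define \<delta> where "\<delta> = K5 * exp (- c5 * sqrt (ln (real Y)))"
    have hyp: "\<bar>psum (dconv (euler_fun geo_fps) (euler_fun (fps_spread ((1 - fps_X) ^ 2)))) x - 1 * main_mean * x\<bar>
       \<le> (4 + 4 * \<bar>1\<bar>) * \<delta> * x / real Y + (\<Sum>d=1..Y. \<bar>euler_fun ((1 - fps_X) ^ 2) d\<bar> * 1)"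
    proof (rule square_hyperbola[OF _ _ Y1 YY has_sum_mu_mu])
      show "\<bar>euler_fun geo_fps n\<bar> \<le> 1" for n by (simp add: euler_fun_geo)
      show "\<bar>sum (euler_fun ((1 - fps_X) ^ 2)) {1..n}\<bar> \<le> \<delta> * real n" if n: "Y \<le> n" for n
      proof -
        have "\<bar>sum (euler_fun ((1 - fps_X) ^ 2)) {1..n}\<bar> \<le> K5 * real n * exp (- c5 * sqrt (ln (real n)))"
          using n Y1 by (intro b5) simp
        also have "\<dots> \<le> K5 * real n * exp (- c5 * sqrt (ln (real Y)))"
        proof (rule mult_left_mono)
          have "ln (real Y) \<le> ln (real n)" by (rule ln_mono) (use n Y1 in linarith)+
          then show "exp (- c5 * sqrt (ln (real n))) \<le> exp (- c5 * sqrt (ln (real Y)))" using c5 by simp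
        qed (use c5 in auto)
        finally show ?thesis unfolding \<delta>_def by (simp only: mult_ac)
      qed
      show "\<bar>psum (euler_fun geo_fps) z - 1 * z\<bar> \<le> 1" if "z \<ge> 1" for z
        using that by (simp add: psum_eq euler_fun_geo) linarith
    qed
    have "\<delta> \<le> K5 * (E * (2 * T) * exp (- (c5 / 2) * l))"
      unfolding \<delta>_def
    proof (rule mult_left_mono)
      have "exp (- c5 * sqrt (ln (real Y))) \<le> exp (c5 ^ 2 / (4 * 1)) * (sqrt x / real Y) powr 1 * exp (- c5 * sqrt (ln (sqrt x)))"
        by (rule exp_sqrt_ln_split) (use Y1 Ys c5 in auto)
      also have "\<dots> \<le> E * (2 * T) * exp (- (c5 / 2) * l)"
      proof (intro mult_mono)
        have "sqrt x \<le> 2 * T * real Y" using Yge T1 by (simp add: pos_divide_le_eq mult_ac)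
        then show "(sqrt x / real Y) powr 1 \<le> 2 * T" using Y1 x by (simp add: pos_divide_le_eq)
        have "l / 2 \<le> sqrt (ln (sqrt x))"
        proof (rule real_le_rsqrt)
          have "(l / 2)\<^sup>2 = ln x / 4" using l by (simp add: power_divide)
          also have "\<dots> \<le> ln (sqrt x)" using x by (simp add: ln_sqrt)
          finally show "(l / 2)\<^sup>2 \<le> ln (sqrt x)" .
        qed
        then have "c5 * (l / 2) \<le> c5 * sqrt (ln (sqrt x))" using c5 by (intro mult_left_mono) auto
        then show "exp (- c5 * sqrt (ln (sqrt x))) \<le> exp (- (c5 / 2) * l)" unfolding exp_le_cancel_iff by linarith
      qed (use T1 in \<open>auto simp: E_def\<close>)
      finally show "exp (- c5 * sqrt (ln (real Y))) \<le> E * (2 * T) * exp (- (c5 / 2) * l)" .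
    qed (use c5 in simp)
    moreover have "x / real Y \<le> sqrt x * (2 * T)"
    proof -
      have "sqrt x \<le> 2 * T * real Y" using Yge T1 by (simp add: pos_divide_le_eq mult_ac)
      then have "sqrt x * sqrt x \<le> sqrt x * (2 * T * real Y)" using x by (intro mult_left_mono) auto
      then have "x \<le> sqrt x * (2 * T) * real Y" using x by (simp add: mult_ac)
      then show ?thesis using Y1 by (subst pos_divide_le_eq) auto
    qed
    ultimately have "\<delta> * (x / real Y) \<le> K5 * (E * (2 * T) * exp (- (c5 / 2) * l)) * (sqrt x * (2 * T))"
      using c5 pos T1 x by (intro mult_mono) auto
    also have "\<dots> = 4 * K5 * E * sqrt x * (T * T * exp (- (c5 / 2) * l))" by (simp add: mult_ac)
    also have "\<dots> \<le> 4 * K5 * E * sqrt x * exp (- c * l)"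
    proof (rule mult_left_mono)
      have "T * T * exp (- (c5 / 2) * l) = exp (- (c5 / 4) * l)"
        unfolding T_def exp_add[symmetric] by (simp add: b_def)
      also have "\<dots> \<le> exp (- c * l)" using l c5 by (simp add: c_def)
      finally show "T * T * exp (- (c5 / 2) * l) \<le> exp (- c * l)" .
    qed (use c5 pos x in auto)
    finally have 1: "\<delta> * (x / real Y) \<le> 4 * K5 * E * sqrt x * exp (- c * l)" .
    have "(\<Sum>d=1..Y. \<bar>euler_fun ((1 - fps_X) ^ 2) d\<bar>) \<le> real Y * (1 + ln (real Y))"
      by (rule sum_abs_mu_mu_le[OF Y1])
    also have "\<dots> \<le> (sqrt x / T) * ((1 + 2 / c ^ 2) * exp (c * l))"
    proof (intro mult_mono Yle)
      have "sqrt x * 1 \<le> sqrt x * sqrt x" using x by (intro mult_left_mono) auto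
      then have "real Y \<le> x" using Ys x by simp
      then have "ln (real Y) \<le> ln x" using Y1 by (intro ln_mono) auto
      then have "1 + ln (real Y) \<le> 1 + l ^ 2" using l by simp
      also have "\<dots> \<le> (1 + 2 / c ^ 2) * exp (c * l)" by (rule one_plus_square_le_exp[OF pos(2) l(1)])
      finally show "1 + ln (real Y) \<le> (1 + 2 / c ^ 2) * exp (c * l)" .
      show "0 \<le> 1 + ln (real Y)" using Y1 by (simp add: add_nonneg_nonneg)
    qed (use x T1 in auto)
    also have "\<dots> = (1 + 2 / c ^ 2) * sqrt x * (exp (- (b * l)) * exp (c * l))"
      unfolding T_def exp_minus by (simp add: divide_inverse mult_ac)
    also have "exp (- (b * l)) * exp (c * l) = exp (- c * l)"
      unfolding exp_add[symmetric] by (simp add: b_def c_def)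
    finally have 2: "(\<Sum>d=1..Y. \<bar>euler_fun ((1 - fps_X) ^ 2) d\<bar>) \<le> (1 + 2 / c ^ 2) * sqrt x * exp (- c * l)" .
    have 3: "(4 + 4 * \<bar>1\<bar>) * \<delta> * x / real Y = 8 * (\<delta> * (x / real Y))" by simp
    have 4: "Ka * sqrt x * exp (- c * l) = 8 * (4 * K5 * E * sqrt x * exp (- c * l)) + (1 + 2 / c ^ 2) * sqrt x * exp (- c * l)"
      unfolding Ka_def by (simp add: algebra_simps)
    show ?thesis using hyp 1 2 3 4 unfolding psum_main_fun(1) l_def[symmetric] mult_1 mult_1_right by linarith
  qed
  have "\<bar>psum main_fun x - main_mean * x\<bar> \<le> (Ka + Kb) * sqrt x * exp (- c * sqrt (ln x))" if x: "x \<ge> 1" for x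
  proof -
    have "Kb * sqrt x * exp (- c * sqrt (ln x)) \<le> (Ka + Kb) * sqrt x * exp (- c * sqrt (ln x))"
      "Ka * sqrt x * exp (- c * sqrt (ln x)) \<le> (Ka + Kb) * sqrt x * exp (- c * sqrt (ln x))"
      using Ka0 Kb0 x by (auto intro!: mult_right_mono)
    then show ?thesis using small[OF x] large[OF x] by (cases "sqrt (ln x) < 2 * b") (auto intro: order_trans)
  qed
  then show ?thesis using pos Ka0 Kb0 by (intro that[of c "Ka + Kb"]) auto
qed

lemma has_sum_moebius_squares: "((\<lambda>d. euler_fun (1 - fps_X) d / real d ^ 2) has_sum 1 / Re (zeta 2)) {1..}"
proof -
  define Z where "Z = euler_series (1 - fps_X) (\<lambda>n. 1 / of_nat n powr (2::complex))"
  have zZ: "zeta 2 * Z = 1" unfolding Z_def by (rule zeta_euler_series) simp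
  have eq: "of_real (euler_fun (1 - fps_X) n) * (1 / of_nat n powr (2::complex)) = of_real (euler_fun (1 - fps_X) n / real n ^ 2)"
    if "n \<in> {1..}" for n
    using that by (simp add: powr_numeral)
  have "(\<lambda>n. of_real (euler_fun (1 - fps_X) n) * (1 / of_nat n powr (2::complex))) norm_summable_on {1..}"
    by (rule norm_summable_bounded_euler[OF abs_moebius_fun_le]) simp
  from has_sum_infsum[OF abs_summable_summable[OF this]]
  have hs0: "((\<lambda>n. of_real (euler_fun (1 - fps_X) n) * (1 / of_nat n powr (2::complex))) has_sum Z) {1..}"
    by (simp only: Z_def euler_series_def)
  have hs: "((\<lambda>n. complex_of_real (euler_fun (1 - fps_X) n / real n ^ 2)) has_sum Z) {1..}"
    by (rule has_sum_cong[THEN iffD1, OF _ hs0]) (rule eq)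
  \<comment> \<open>The sum of a real series is real, so that passing from \<open>\<zeta>(2)\<close> to its real part is harmless.\<close>
  have "infsum (\<lambda>n. Im (complex_of_real (euler_fun (1 - fps_X) n / real n ^ 2))) {1..} = Im Z"
    by (rule infsumI[OF has_sum_Im[OF hs]])
  then have Im: "Im Z = 0" unfolding Im_complex_of_real by simp
  have "Re (zeta 2 * Z) = 1" using zZ by simp
  then have "Re (zeta 2) * Re Z = 1" using Im by simp
  then have "Re Z = 1 / Re (zeta 2)" by (cases "Re (zeta 2) = 0") (simp_all add: eq_divide_eq mult.commute)
  then show ?thesis using has_sum_Re[OF hs] unfolding Re_complex_of_real by simp
qed

lemma main_mean_eq: "main_mean = 1 / Re (zeta 2) * (1 / Re (zeta 2))"
proof -
  have "euler_series (1 - fps_X) (\<lambda>n. 1 / real n ^ 2) = 1 / Re (zeta 2)"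
    using infsumI[OF has_sum_moebius_squares] by (simp add: euler_series_def)
  then show ?thesis unfolding euler_series_mu_mu by (simp add: power2_eq_square)
qed

lemma squarefree_discrepancy_psum: "squarefree_discrepancy x = psum (euler_fun (1 + fps_X)) x - 1 / Re (zeta 2) * x"
proof -
  have "psum (euler_fun (1 + fps_X)) x = psum (\<lambda>n. of_int ((moebius_mu n)\<^sup>2)) x"
    by (rule psum_cong) (simp add: euler_fun_moebius)
  then show ?thesis by (simp add: squarefree_discrepancy_def psum_def)
qed

lemma abs_squarefree_fun_le: "\<bar>euler_fun (1 + fps_X) n\<bar> \<le> 1"
  by (rule abs_euler_fun_le_1) (simp add: nth_one_plus_X)

text \<open>The \<open>O\<close>-bound is made uniform on \<open>[1, \<infinity>)\<close>, as the hyperbola method evaluates the sums at \<open>x / d\<^sup>2\<close>, which may be small.\<close>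

lemma squarefree_discrepancy_bound:
  assumes "squarefree_discrepancy \<in> O(\<lambda>x. x powr \<rho>)" "\<rho> \<ge> 0"
  obtains K where "0 < K" "\<And>z. z \<ge> 1 \<Longrightarrow> \<bar>squarefree_discrepancy z\<bar> \<le> K * z powr \<rho>"
proof -
  obtain C where C: "C > 0" "\<forall>\<^sub>F x in at_top. norm (squarefree_discrepancy x) \<le> C * norm (x powr \<rho>)"
    using landau_o.bigE[OF assms(1)] by blast
  then obtain X0 where X0: "\<And>x. x \<ge> X0 \<Longrightarrow> \<bar>squarefree_discrepancy x\<bar> \<le> C * x powr \<rho>"
    unfolding eventually_at_top_linorder by auto
  define q where "q = \<bar>1 / Re (zeta 2)\<bar>"
  define X where "X = max X0 1"
  define K where "K = C + X * (1 + q)"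
  have q: "q \<ge> 0" by (simp add: q_def)
  have X: "X \<ge> 1" by (simp add: X_def)
  have bound: "\<bar>squarefree_discrepancy z\<bar> \<le> K * z powr \<rho>" if z: "z \<ge> 1" for z
  proof (cases "z \<ge> X")
    case True
    have "C * z powr \<rho> \<le> K * z powr \<rho>"
      unfolding K_def using X q by (intro mult_right_mono) auto
    moreover have "\<bar>squarefree_discrepancy z\<bar> \<le> C * z powr \<rho>" by (rule X0) (use True in \<open>simp add: X_def\<close>)
    ultimately show ?thesis by linarith
  next
    case False
    have "\<bar>psum (euler_fun (1 + fps_X)) z\<bar> \<le> (\<Sum>n=1..nat \<lfloor>z\<rfloor>. 1)"
      unfolding psum_eq by (rule order_trans[OF sum_abs sum_mono[OF abs_squarefree_fun_le]])
    also have "\<dots> \<le> z" using z by simp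
    finally have "\<bar>psum (euler_fun (1 + fps_X)) z\<bar> \<le> z" .
    moreover have "\<bar>1 / Re (zeta 2) * z\<bar> = q * z" using z by (simp add: q_def abs_mult)
    ultimately have "\<bar>squarefree_discrepancy z\<bar> \<le> z + q * z"
      unfolding squarefree_discrepancy_psum by linarith
    also have "\<dots> \<le> X + q * X" using False q by (intro add_mono mult_left_mono) auto
    also have "\<dots> \<le> K * 1" using C(1) by (simp add: K_def algebra_simps)
    also have "\<dots> \<le> K * z powr \<rho>"
    proof (rule mult_left_mono)
      show "1 \<le> z powr \<rho>" using z assms(2) by (rule ge_one_powr_ge_zero)
      show "0 \<le> K" using C(1) X q by (simp add: K_def)
    qed
    finally show ?thesis .
  qed
  have "K > 0" unfolding K_def using C(1) X q by (intro add_pos_nonneg) auto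
  then show ?thesis by (rule that) (rule bound)
qed

text \<open>The hyperbola estimate for \<open>\<mu>\<^sup>2\<close> and \<open>\<mu>\<close> with \<open>Y = x\<^sup>\<kappa>\<close>. The cancellation in \<open>\<mu>\<close> gives an error \<open>x Y\<^sup>-\<^sup>3\<^sup>/\<^sup>2\<close>, the error in the squarefree
numbers adds up to \<open>x\<^sup>r Y\<^sup>1\<^sup>-\<^sup>2\<^sup>r\<close>. They balance for \<open>\<kappa> = 2 (1 - r) / (5 - 4r)\<close>, with the common value \<open>x\<^sup>\<beta>\<close>, \<open>\<beta> = (2 - r) / (5 - 4r)\<close>.\<close>

theorem main_fun_sum_bound_RH:
  assumes RH: "riemann_hypothesis" and r: "1 / 4 < r" "r < 1 / 3" and \<eta>: "0 < \<eta>" "\<eta> \<le> 1 / 100"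
    and D: "squarefree_discrepancy \<in> O(\<lambda>x. x powr (r + \<eta>))"
  obtains K where "0 < K" "\<And>x. x \<ge> 1 \<Longrightarrow>
    \<bar>psum main_fun x - main_mean * x\<bar> \<le> K * x powr ((2 - r) / (5 - 4 * r) + 2 * \<eta>)"
proof -
  define \<rho> where "\<rho> = r + \<eta>"
  define \<beta> where "\<beta> = (2 - r) / (5 - 4 * r)"
  define \<kappa> where "\<kappa> = 2 * (1 - r) / (5 - 4 * r)"
  define q where "q = 1 / Re (zeta 2)"
  have \<kappa>: "0 < \<kappa>" "\<kappa> < 1 / 2" using r by (auto simp: \<kappa>_def divide_less_eq)
  \<comment> \<open>The two sides of the balance.\<close>
  have \<beta>1: "1 - 3 / 2 * \<kappa> = \<beta>" and \<beta>2: "r + \<kappa> * (1 - 2 * r) = \<beta>"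
    using r by (simp_all add: \<kappa>_def \<beta>_def field_simps)
  have \<rho>0: "\<rho> \<ge> 0" using r \<eta> by (simp add: \<rho>_def)
  obtain K0 where K0: "0 < K0" "\<And>z. z \<ge> 1 \<Longrightarrow> \<bar>squarefree_discrepancy z\<bar> \<le> K0 * z powr \<rho>"
    using squarefree_discrepancy_bound[OF D[folded \<rho>_def] \<rho>0] by blast
  have \<eta>4: "\<eta> < 1 / 4" using \<eta> by simp
  obtain K1 where K1: "0 < K1" "\<And>N. N \<ge> 1 \<Longrightarrow> \<bar>\<Sum>n=1..N. euler_fun (1 - fps_X) n\<bar> \<le> K1 * real N powr (1 / 2 + 2 * \<eta>)"
    using moebius_sum_bound_RH[OF RH \<eta>(1) \<eta>4] by blast
  define a where "a = 1 - 2 * \<rho>"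
  have a: "a > 0" "a - 1 = - 2 * \<rho>" using r \<eta> by (auto simp: a_def \<rho>_def)
  define K where "K = (4 + 4 * \<bar>q\<bar>) * (4 * K1) + K0 * (1 / a + 1)"
  have Kpos: "K > 0" unfolding K_def using K0 K1 a by (intro add_pos_pos mult_pos_pos add_pos_nonneg) auto
  have main: "\<bar>psum main_fun x - main_mean * x\<bar> \<le> K * x powr (\<beta> + 2 * \<eta>)" if x: "x \<ge> 1" for x
  proof -
    define y where "y = x powr \<kappa>"
    define Y where "Y = nat \<lfloor>y\<rfloor>"
    have y: "y \<ge> 1" unfolding y_def using x \<kappa> by (intro ge_one_powr_ge_zero) auto
    have Y1: "Y \<ge> 1" using y by (simp add: Y_def le_nat_floor)
    have Yle: "real Y \<le> y" using y by (simp add: Y_def)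
    have Yge: "y / 2 \<le> real Y"
    proof -
      have "y < real Y + 1" unfolding Y_def using y by linarith
      then show ?thesis using Y1 by simp
    qed
    have "real Y ^ 2 \<le> y ^ 2" using Yle by (intro power_mono) auto
    also have "y ^ 2 = x powr (2 * \<kappa>)" unfolding y_def power2_eq_square powr_add[symmetric] by simp
    also have "\<dots> \<le> x powr 1" using x \<kappa> by (intro powr_mono) auto
    finally have YY: "real Y ^ 2 \<le> x" using x by simp
    define \<delta> where "\<delta> = K1 * real Y powr (- 1 / 2 + 2 * \<eta>)"
    have hyp: "\<bar>psum (dconv (euler_fun (1 + fps_X)) (euler_fun (fps_spread (1 - fps_X)))) x - q * q * x\<bar>
       \<le> (4 + 4 * \<bar>q\<bar>) * \<delta> * x / real Y + (\<Sum>d=1..Y. \<bar>euler_fun (1 - fps_X) d\<bar> * (K0 * (x / real d ^ 2) powr \<rho>))"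
    proof (rule square_hyperbola[OF abs_squarefree_fun_le _ Y1 YY has_sum_moebius_squares[folded q_def]])
      show "\<bar>sum (euler_fun (1 - fps_X)) {1..n}\<bar> \<le> \<delta> * real n" if n: "Y \<le> n" for n
      proof -
        have n1: "n \<ge> 1" using n Y1 by simp
        have "\<bar>sum (euler_fun (1 - fps_X)) {1..n}\<bar> \<le> K1 * real n powr (1 + (- 1 / 2 + 2 * \<eta>))"
          using K1(2)[OF n1] by simp
        also have "\<dots> = K1 * real n powr (- 1 / 2 + 2 * \<eta>) * real n"
          unfolding powr_add using n1 by simp
        also have "\<dots> \<le> \<delta> * real n"
          unfolding \<delta>_def using n Y1 K1 \<eta> by (intro mult_right_mono mult_left_mono powr_mono2') auto
        finally show ?thesis .
      qed
      show "\<bar>psum (euler_fun (1 + fps_X)) z - q * z\<bar> \<le> K0 * z powr \<rho>" if "z \<ge> 1" for z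
        using K0(2)[OF that] by (simp only: squarefree_discrepancy_psum q_def)
    qed
    have "\<delta> * x / real Y = K1 * x * real Y powr (- 3 / 2 + 2 * \<eta>)"
    proof -
      have "real Y powr (- 3 / 2 + 2 * \<eta>) = real Y powr ((- 1 / 2 + 2 * \<eta>) - 1)" by simp
      also have "\<dots> = real Y powr (- 1 / 2 + 2 * \<eta>) / real Y"
        unfolding powr_diff using Y1 by simp
      finally show ?thesis unfolding \<delta>_def by simp
    qed
    also have "\<dots> \<le> K1 * x * (y / 2) powr (- 3 / 2 + 2 * \<eta>)"
      using K1 x Yge y \<eta> by (intro mult_left_mono powr_mono2') auto
    also have "(y / 2) powr (- 3 / 2 + 2 * \<eta>) = y powr (- 3 / 2 + 2 * \<eta>) * 2 powr (3 / 2 - 2 * \<eta>)"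
      using y by (simp add: powr_divide powr_minus_divide[of 2 "3 / 2 - 2 * \<eta>", simplified])
    also have "K1 * x * (y powr (- 3 / 2 + 2 * \<eta>) * 2 powr (3 / 2 - 2 * \<eta>)) \<le> K1 * x * (y powr (- 3 / 2 + 2 * \<eta>) * 4)"
    proof (intro mult_left_mono)
      have "(2::real) powr (3 / 2 - 2 * \<eta>) \<le> 2 powr 2" using \<eta> by (intro powr_mono) auto
      then show "(2::real) powr (3 / 2 - 2 * \<eta>) \<le> 4" by simp
    qed (use K1 x in auto)
    also have "\<dots> = 4 * K1 * (x powr 1 * x powr (\<kappa> * (- 3 / 2 + 2 * \<eta>)))"
      using x by (simp add: y_def powr_powr)
    also have "\<dots> = 4 * K1 * x powr (\<beta> + 2 * \<eta> * \<kappa>)"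
      unfolding powr_add[symmetric] \<beta>1[symmetric] by (simp add: algebra_simps)
    also have "\<dots> \<le> 4 * K1 * x powr (\<beta> + 2 * \<eta>)"
      using K1 x \<kappa> \<eta> by (intro mult_left_mono powr_mono) auto
    finally have 1: "\<delta> * x / real Y \<le> 4 * K1 * x powr (\<beta> + 2 * \<eta>)" .
    have "(\<Sum>d=1..Y. \<bar>euler_fun (1 - fps_X) d\<bar> * (K0 * (x / real d ^ 2) powr \<rho>)) \<le> (\<Sum>d=1..Y. K0 * x powr \<rho> * real d powr (a - 1))"
    proof (rule sum_mono)
      fix d assume d: "d \<in> {1..Y}"
      have "(x / real d ^ 2) powr \<rho> = x powr \<rho> / (real d powr 2) powr \<rho>"
        using d x by (simp add: powr_divide)
      also have "\<dots> = x powr \<rho> * real d powr (a - 1)"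
        unfolding a(2) powr_powr by (simp add: powr_minus_divide)
      finally have e: "(x / real d ^ 2) powr \<rho> = x powr \<rho> * real d powr (a - 1)" .
      have "\<bar>euler_fun (1 - fps_X) d\<bar> * (K0 * (x / real d ^ 2) powr \<rho>) \<le> 1 * (K0 * (x / real d ^ 2) powr \<rho>)"
        using K0 by (intro mult_right_mono abs_moebius_fun_le) auto
      then show "\<bar>euler_fun (1 - fps_X) d\<bar> * (K0 * (x / real d ^ 2) powr \<rho>) \<le> K0 * x powr \<rho> * real d powr (a - 1)"
        unfolding e by (simp only: mult_1 mult.assoc)
    qed
    also have "\<dots> = K0 * x powr \<rho> * (\<Sum>d=1..Y. real d powr (a - 1))" by (simp only: sum_distrib_left)
    also have "\<dots> \<le> K0 * x powr \<rho> * (real Y powr a * (1 / a + 1 / real Y))"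
      using K0 by (intro mult_left_mono sum_powr_head_le a Y1) auto
    also have "\<dots> \<le> K0 * x powr \<rho> * (y powr a * (1 / a + 1))"
      using K0 a Y1 Yle by (intro mult_left_mono mult_mono powr_mono2 add_left_mono) auto
    also have "\<dots> = K0 * (1 / a + 1) * (x powr \<rho> * x powr (\<kappa> * a))"
      by (simp only: y_def powr_powr mult_ac)
    also have "\<dots> = K0 * (1 / a + 1) * x powr (\<beta> + \<eta> * (1 - 2 * \<kappa>))"
      unfolding powr_add[symmetric] \<beta>2[symmetric] by (simp add: a_def \<rho>_def algebra_simps)
    also have "\<dots> \<le> K0 * (1 / a + 1) * x powr (\<beta> + 2 * \<eta>)"
    proof (intro mult_left_mono powr_mono add_left_mono)
      have "\<eta> * (1 - 2 * \<kappa>) \<le> \<eta> * 2" using \<kappa> \<eta> by (intro mult_left_mono) auto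
      then show "\<eta> * (1 - 2 * \<kappa>) \<le> 2 * \<eta>" by simp
    qed (use K0 a x in auto)
    finally have 2: "(\<Sum>d=1..Y. \<bar>euler_fun (1 - fps_X) d\<bar> * (K0 * (x / real d ^ 2) powr \<rho>)) \<le> K0 * (1 / a + 1) * x powr (\<beta> + 2 * \<eta>)" .
    have 3: "(4 + 4 * \<bar>q\<bar>) * \<delta> * x / real Y \<le> (4 + 4 * \<bar>q\<bar>) * (4 * K1 * x powr (\<beta> + 2 * \<eta>))"
      using mult_left_mono[OF 1, of "4 + 4 * \<bar>q\<bar>"] by simp
    have 4: "K * x powr (\<beta> + 2 * \<eta>) = (4 + 4 * \<bar>q\<bar>) * (4 * K1 * x powr (\<beta> + 2 * \<eta>)) + K0 * (1 / a + 1) * x powr (\<beta> + 2 * \<eta>)"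
      unfolding K_def by (simp only: distrib_right mult.assoc)
    show ?thesis using hyp 2 3 4 unfolding psum_main_fun(2) main_mean_eq q_def[symmetric] by linarith
  qed
  show ?thesis by (rule that[OF Kpos main[unfolded \<beta>_def]])
qed

section \<open>The exponential Moebius function\<close>

text \<open>Reinstating the cofactor by convolution turns a bound for \<open>main_fun\<close> into one for \<open>\<mu>\<^sup>(\<^sup>e\<^sup>)\<close>.\<close>

lemma exp_moebius_sum_error:
  assumes B: "\<And>z. z \<ge> 1 \<Longrightarrow> \<bar>psum main_fun z - main_mean * z\<bar> \<le> e z"
    and \<theta>: "1 / 5 < \<theta>" "\<theta> \<le> 1" and x: "x \<ge> 1"
  shows "\<bar>(\<Sum>n | 1 \<le> n \<and> real n \<le> x. of_int (exp_moebius_mu n)) - exp_moebius_mean * x\<bar> \<le>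
    \<bar>main_mean\<bar> * infsum (\<lambda>n. norm (euler_fun cofactor_fps n * real n powr - \<theta>)) {1..} * x powr \<theta>
    + (\<Sum>m=1..nat \<lfloor>x\<rfloor>. \<bar>euler_fun cofactor_fps m\<bar> * e (x / real m))"
proof -
  let ?u = "euler_fun cofactor_fps" and ?B = "main_fun"
  let ?U = "euler_series cofactor_fps (\<lambda>n. 1 / real n)"
  have "(\<lambda>n. ?u n * real n powr - 1) summable_on {1..}"
    by (rule abs_summable_summable, rule norm_summable_cofactor) simp
  then have "((\<lambda>n. ?u n * real n powr - 1) has_sum infsum (\<lambda>n. ?u n * real n powr - 1) {1..}) {1..}"
    by (rule has_sum_infsum)
  moreover have "infsum (\<lambda>n. ?u n * real n powr - 1) {1..} = ?U"
    unfolding euler_series_def by (rule infsum_cong) (simp add: powr_minus_divide)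
  moreover have "?u n * real n powr - 1 = ?u n / real n" for n
    by (cases "n = 0") (simp_all add: powr_minus_divide)
  ultimately have U: "((\<lambda>n. ?u n / real n) has_sum ?U) {1..}" by simp
  have 0: "fps_nth (geo_fps * fps_spread ((1 - fps_X) ^ 2)) 0 = 1" "fps_nth cofactor_fps 0 = 1"
    by (simp_all add: geo_fps_def fps_spread_def fps_power_zeroth cofactor_nth_small)
  have "(\<Sum>n | 1 \<le> n \<and> real n \<le> x. of_int (exp_moebius_mu n)) = psum (euler_fun exp_moebius_fps) x"
    by (simp only: psum_def euler_fun_exp_moebius)
  also have "\<dots> = psum (dconv ?B ?u) x"
    by (rule psum_cong) (simp only: dconv_euler_fun[OF 0] exp_moebius_fps_factorization)
  finally have eq: "(\<Sum>n | 1 \<le> n \<and> real n \<le> x. of_int (exp_moebius_mu n)) = psum (dconv ?B ?u) x" .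
  show ?thesis unfolding eq exp_moebius_mean_eq
    by (rule psum_dconv_asymptotics[OF B norm_summable_cofactor _ _ U x]) (use \<theta> in auto)
qed

lemma cofactor_sum_le:
  assumes "1 / 5 < \<theta>"
  shows "(\<Sum>m=1..N. \<bar>euler_fun cofactor_fps m\<bar> * real m powr - \<theta>)
    \<le> infsum (\<lambda>n. norm (euler_fun cofactor_fps n * real n powr - \<theta>)) {1..}"
proof -
  have "(\<Sum>m=1..N. \<bar>euler_fun cofactor_fps m\<bar> * real m powr - \<theta>) = (\<Sum>m\<in>{1..N}. norm (euler_fun cofactor_fps m * real m powr - \<theta>))"
    by (simp add: abs_mult)
  also have "\<dots> \<le> infsum (\<lambda>n. norm (euler_fun cofactor_fps n * real n powr - \<theta>)) {1..}"
    by (rule finite_sum_le_infsum[OF norm_summable_cofactor[OF assms]]) auto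
  finally show ?thesis .
qed

text \<open>Any \<open>\<theta>\<close> between \<open>1/5\<close> and \<open>1/2\<close> serves; \<open>\<theta> = 2/5\<close> leaves a power \<open>m\<^sup>1\<^sup>/\<^sup>1\<^sup>0\<close> to pay for replacing \<open>x / m\<close> by \<open>x\<close> in the saving factor.\<close>

theorem exp_moebius_sum_bound:
  obtains c K where "0 < c" "\<And>x. x \<ge> 1 \<Longrightarrow>
    \<bar>(\<Sum>n | 1 \<le> n \<and> real n \<le> x. of_int (exp_moebius_mu n)) - exp_moebius_mean * x\<bar>
      \<le> K * (sqrt x * exp (- c * sqrt (ln x)))"
proof -
  obtain c K where c: "0 < c" "0 < K" and B: "\<And>x. x \<ge> 1 \<Longrightarrow>
    \<bar>psum main_fun x - main_mean * x\<bar> \<le> K * sqrt x * exp (- c * sqrt (ln x))"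
    using main_fun_sum_bound by blast
  define I where "I = infsum (\<lambda>n. norm (euler_fun cofactor_fps n * real n powr - (2 / 5))) {1..}"
  define E where "E = exp (c ^ 2 / (4 * (1 / 10)))"
  have I0: "I \<ge> 0" unfolding I_def by (rule infsum_nonneg) simp
  have main: "\<bar>(\<Sum>n | 1 \<le> n \<and> real n \<le> x. of_int (exp_moebius_mu n)) - exp_moebius_mean * x\<bar>
      \<le> (\<bar>main_mean\<bar> * I * E + K * E * I) * (sqrt x * exp (- c * sqrt (ln x)))" if x: "x \<ge> 1" for x
  proof -
    let ?e = "exp (- c * sqrt (ln x))"
    have 1: "x powr (2 / 5) \<le> E * (sqrt x * ?e)"
    proof -
      have "exp (- c * sqrt (ln 1)) \<le> E * (x / 1) powr (1 / 10) * ?e"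
        unfolding E_def by (rule exp_sqrt_ln_split) (use x c in auto)
      then have "1 \<le> E * x powr (1 / 10) * ?e" by simp
      then have "x powr (2 / 5) * 1 \<le> x powr (2 / 5) * (E * x powr (1 / 10) * ?e)" by (intro mult_left_mono) auto
      also have "\<dots> = E * ((x powr (2 / 5) * x powr (1 / 10)) * ?e)" by (simp only: mult_ac)
      also have "x powr (2 / 5) * x powr (1 / 10) = sqrt x"
        unfolding powr_add[symmetric] using x by (simp add: powr_half_sqrt)
      finally show ?thesis by simp
    qed
    have "(\<Sum>m=1..nat \<lfloor>x\<rfloor>. \<bar>euler_fun cofactor_fps m\<bar> * (K * sqrt (x / real m) * exp (- c * sqrt (ln (x / real m)))))
       \<le> (\<Sum>m=1..nat \<lfloor>x\<rfloor>. K * E * (sqrt x * ?e) * (\<bar>euler_fun cofactor_fps m\<bar> * real m powr - (2 / 5)))"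
    proof (rule sum_mono)
      fix m assume m: "m \<in> {1..nat \<lfloor>x\<rfloor>}"
      then have mx: "real m \<le> x" "real m \<ge> 1" using x by (auto simp: le_nat_iff le_floor_iff)
      have "exp (- c * sqrt (ln (x / real m))) \<le> E * (x / (x / real m)) powr (1 / 10) * ?e"
        unfolding E_def
      proof (rule exp_sqrt_ln_split)
        show "1 \<le> x / real m" using mx by simp
        have "x / real m \<le> x / 1" using mx x by (intro divide_left_mono) auto
        then show "x / real m \<le> x" by simp
      qed (use c in auto)
      also have "x / (x / real m) = real m" using x by simp
      finally have 2: "exp (- c * sqrt (ln (x / real m))) \<le> E * real m powr (1 / 10) * ?e" .
      have "real m powr - (2 / 5) = real m powr (- (1 / 2) + 1 / 10)" by simp
      also have "\<dots> = real m powr - (1 / 2) * real m powr (1 / 10)" by (rule powr_add)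
      finally have 3: "real m powr - (2 / 5) = real m powr (1 / 10) / sqrt (real m)"
        by (simp add: powr_minus_divide powr_half_sqrt)
      have "\<bar>euler_fun cofactor_fps m\<bar> * (K * sqrt (x / real m) * exp (- c * sqrt (ln (x / real m))))
        \<le> \<bar>euler_fun cofactor_fps m\<bar> * (K * sqrt (x / real m) * (E * real m powr (1 / 10) * ?e))"
        using 2 c x by (intro mult_left_mono) auto
      also have "\<dots> = K * E * (sqrt x * ?e) * (\<bar>euler_fun cofactor_fps m\<bar> * real m powr - (2 / 5))"
        unfolding 3 real_sqrt_divide by simp
      finally show "\<bar>euler_fun cofactor_fps m\<bar> * (K * sqrt (x / real m) * exp (- c * sqrt (ln (x / real m))))
        \<le> K * E * (sqrt x * ?e) * (\<bar>euler_fun cofactor_fps m\<bar> * real m powr - (2 / 5))" .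
    qed
    also have "\<dots> = K * E * (sqrt x * ?e) * (\<Sum>m=1..nat \<lfloor>x\<rfloor>. \<bar>euler_fun cofactor_fps m\<bar> * real m powr - (2 / 5))"
      by (simp only: sum_distrib_left)
    also have "\<dots> \<le> K * E * (sqrt x * ?e) * I"
      unfolding I_def using c x by (intro mult_left_mono cofactor_sum_le) (auto simp: E_def)
    finally have 2: "(\<Sum>m=1..nat \<lfloor>x\<rfloor>. \<bar>euler_fun cofactor_fps m\<bar> * (K * sqrt (x / real m) * exp (- c * sqrt (ln (x / real m)))))
       \<le> K * E * (sqrt x * ?e) * I" .
    have 3: "\<bar>main_mean\<bar> * I * x powr (2 / 5) \<le> \<bar>main_mean\<bar> * I * (E * (sqrt x * ?e))"
      using 1 I0 by (intro mult_left_mono) auto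
    have 4: "(\<bar>main_mean\<bar> * I * E + K * E * I) * (sqrt x * ?e) =
        \<bar>main_mean\<bar> * I * (E * (sqrt x * ?e)) + K * E * (sqrt x * ?e) * I"
      by (simp add: algebra_simps)
    have "\<bar>(\<Sum>n | 1 \<le> n \<and> real n \<le> x. of_int (exp_moebius_mu n)) - exp_moebius_mean * x\<bar> \<le>
       \<bar>main_mean\<bar> * I * x powr (2 / 5) + (\<Sum>m=1..nat \<lfloor>x\<rfloor>. \<bar>euler_fun cofactor_fps m\<bar> * (K * sqrt (x / real m) * exp (- c * sqrt (ln (x / real m)))))"
      unfolding I_def by (rule exp_moebius_sum_error[OF B]) (use x in auto)
    then show ?thesis using 2 3 unfolding 4 by linarith
  qed
  show ?thesis by (rule that[OF c(1) main])
qed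

theorem exp_moebius_sum_bound_RH:
  assumes RH: "riemann_hypothesis" and r: "1 / 4 < r" "r < 1 / 3" and \<eta>: "0 < \<eta>" "\<eta> \<le> 1 / 100"
    and D: "squarefree_discrepancy \<in> O(\<lambda>x. x powr (r + \<eta>))"
  obtains K where "\<And>x. x \<ge> 1 \<Longrightarrow>
    \<bar>(\<Sum>n | 1 \<le> n \<and> real n \<le> x. of_int (exp_moebius_mu n)) - exp_moebius_mean * x\<bar>
      \<le> K * x powr ((2 - r) / (5 - 4 * r) + 2 * \<eta>)"
proof -
  define \<theta> where "\<theta> = (2 - r) / (5 - 4 * r) + 2 * \<eta>"
  have "1 / 5 < (2 - r) / (5 - 4 * r)" "(2 - r) / (5 - 4 * r) < 1 / 2"
    using r by (simp_all add: less_divide_eq divide_less_eq)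
  then have \<theta>: "1 / 5 < \<theta>" "\<theta> \<le> 1" unfolding \<theta>_def using \<eta> by linarith+
  obtain K where K: "0 < K" and B: "\<And>x. x \<ge> 1 \<Longrightarrow> \<bar>psum main_fun x - main_mean * x\<bar> \<le> K * x powr \<theta>"
    using main_fun_sum_bound_RH[OF assms] unfolding \<theta>_def by blast
  define I where "I = infsum (\<lambda>n. norm (euler_fun cofactor_fps n * real n powr - \<theta>)) {1..}"
  have main: "\<bar>(\<Sum>n | 1 \<le> n \<and> real n \<le> x. of_int (exp_moebius_mu n)) - exp_moebius_mean * x\<bar>
      \<le> (\<bar>main_mean\<bar> * I + K * I) * x powr \<theta>" if x: "x \<ge> 1" for x
  proof -
    have "(\<Sum>m=1..nat \<lfloor>x\<rfloor>. \<bar>euler_fun cofactor_fps m\<bar> * (K * (x / real m) powr \<theta>)) =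
       (\<Sum>m=1..nat \<lfloor>x\<rfloor>. K * x powr \<theta> * (\<bar>euler_fun cofactor_fps m\<bar> * real m powr - \<theta>))"
      using x by (intro sum.cong refl) (simp add: powr_divide powr_minus_divide)
    also have "\<dots> = K * x powr \<theta> * (\<Sum>m=1..nat \<lfloor>x\<rfloor>. \<bar>euler_fun cofactor_fps m\<bar> * real m powr - \<theta>)"
      by (simp only: sum_distrib_left)
    also have "\<dots> \<le> K * x powr \<theta> * I"
      unfolding I_def using K by (intro mult_left_mono cofactor_sum_le \<theta>) auto
    finally have 2: "(\<Sum>m=1..nat \<lfloor>x\<rfloor>. \<bar>euler_fun cofactor_fps m\<bar> * (K * (x / real m) powr \<theta>)) \<le> K * x powr \<theta> * I" .
    have 4: "(\<bar>main_mean\<bar> * I + K * I) * x powr \<theta> = \<bar>main_mean\<bar> * I * x powr \<theta> + K * x powr \<theta> * I"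
      by (simp add: algebra_simps)
    have "\<bar>(\<Sum>n | 1 \<le> n \<and> real n \<le> x. of_int (exp_moebius_mu n)) - exp_moebius_mean * x\<bar> \<le>
       \<bar>main_mean\<bar> * I * x powr \<theta> + (\<Sum>m=1..nat \<lfloor>x\<rfloor>. \<bar>euler_fun cofactor_fps m\<bar> * (K * (x / real m) powr \<theta>))"
      unfolding I_def by (rule exp_moebius_sum_error[OF B \<theta> x])
    then show ?thesis using 2 unfolding 4 by linarith
  qed
  show ?thesis by (rule that[OF main[unfolded \<theta>_def]])
qed

text \<open>The exponent \<open>9/25\<close> is below the classical \<open>1/2\<close>, so that \<open>exp (- c \<surd>(log x))\<close> is smaller than every \<open>exp (- c (log x)\<^sup>\<Delta>)\<close> in the second part. In
the third part \<open>\<epsilon>\<close> is split into two equal pieces \<open>\<eta>\<close>, and \<open>\<eta> \<le> 1/100\<close> keeps all exponents in their ranges.\<close>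

theorem theorem2:
  shows "(\<exists>u :: nat \<Rightarrow> complex.
      (\<forall>s. Re s > 1 / 5 \<longrightarrow> summable (\<lambda>n. norm (u (Suc n) / of_nat (Suc n) powr s))) \<and>
      (\<forall>s. Re s > 1 \<longrightarrow>
        (\<lambda>n. of_int (exp_moebius_mu (Suc n)) / of_nat (Suc n) powr s) sums
          (zeta s / (zeta (2 * s))\<^sup>2 * dirichlet_series u s))) \<and>
    (\<forall>\<Delta>::real. 0 < \<Delta> \<and> \<Delta> < 9 / 25 \<longrightarrow> (\<exists>c>0.
      (\<lambda>x::real. (\<Sum>n | 1 \<le> n \<and> real n \<le> x. of_int (exp_moebius_mu n)) - exp_moebius_mean * x)
        \<in> O(\<lambda>x. x powr (1 / 2) * exp (- c * ln x powr \<Delta>)))) \<and>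
    (riemann_hypothesis \<longrightarrow> (\<forall>r::real. 1 / 4 < r \<and> r < 1 / 3 \<and>
        (\<forall>\<epsilon>>0. squarefree_discrepancy \<in> O(\<lambda>x. x powr (r + \<epsilon>))) \<longrightarrow>
      (\<forall>\<epsilon>>0. (\<lambda>x::real. (\<Sum>n | 1 \<le> n \<and> real n \<le> x. of_int (exp_moebius_mu n)) - exp_moebius_mean * x)
        \<in> O(\<lambda>x. x powr ((2 - r) / (5 - 4 * r) + \<epsilon>)))))"
proof (intro conjI impI allI)
  let ?R = "\<lambda>x::real. (\<Sum>n | 1 \<le> n \<and> real n \<le> x. of_int (exp_moebius_mu n)) - exp_moebius_mean * x"
  show "\<exists>u :: nat \<Rightarrow> complex.
      (\<forall>s. Re s > 1 / 5 \<longrightarrow> summable (\<lambda>n. norm (u (Suc n) / of_nat (Suc n) powr s))) \<and>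
      (\<forall>s. Re s > 1 \<longrightarrow>
        (\<lambda>n. of_int (exp_moebius_mu (Suc n)) / of_nat (Suc n) powr s) sums
          (zeta s / (zeta (2 * s))\<^sup>2 * dirichlet_series u s))"
  proof (rule exI[of _ "\<lambda>n. of_real (euler_fun cofactor_fps n)"], intro conjI allI impI)
    fix s :: complex assume "Re s > 1 / 5"
    from norm_summable_cofactor_complex[OF this, unfolded norm_summable_on_iff_Suc]
    show "summable (\<lambda>n. norm (of_real (euler_fun cofactor_fps (Suc n)) / of_nat (Suc n) powr s))"
      by simp
  qed (rule exp_moebius_dirichlet_series)
  show "\<exists>c>0. ?R \<in> O(\<lambda>x. x powr (1 / 2) * exp (- c * ln x powr \<Delta>))" if \<Delta>: "0 < \<Delta> \<and> \<Delta> < 9 / 25" for \<Delta>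
  proof -
    obtain c K where c: "0 < c" and K: "\<And>x. x \<ge> 1 \<Longrightarrow> \<bar>?R x\<bar> \<le> K * (sqrt x * exp (- c * sqrt (ln x)))"
      using exp_moebius_sum_bound by blast
    have "?R \<in> O(\<lambda>x. x powr (1 / 2) * exp (- c * ln x powr \<Delta>))"
    proof (rule bigoI)
      show "\<forall>\<^sub>F x in at_top. norm (?R x) \<le> \<bar>K\<bar> * norm (x powr (1 / 2) * exp (- c * ln x powr \<Delta>))"
        using eventually_ge_at_top[of "exp 1"]
      proof eventually_elim
        fix x :: real assume x: "exp 1 \<le> x"
        have "(1::real) \<le> exp 1" by simp
        then have x1: "x \<ge> 1" using x by linarith
        have lx: "ln x \<ge> 1" using x x1 by (simp add: ln_ge_iff)
        have "ln x powr \<Delta> \<le> ln x powr (1 / 2)" using lx \<Delta> by (intro powr_mono) auto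
        then have "c * ln x powr \<Delta> \<le> c * sqrt (ln x)" using c lx by (simp add: powr_half_sqrt)
        then have e: "exp (- c * sqrt (ln x)) \<le> exp (- c * ln x powr \<Delta>)" by simp
        have "\<bar>?R x\<bar> \<le> K * (sqrt x * exp (- c * sqrt (ln x)))" by (rule K[OF x1])
        also have "\<dots> \<le> \<bar>K\<bar> * (sqrt x * exp (- c * ln x powr \<Delta>))"
          using e x1 by (intro mult_mono) auto
        also have "\<dots> = \<bar>K\<bar> * norm (x powr (1 / 2) * exp (- c * ln x powr \<Delta>))"
          using x1 by (simp add: powr_half_sqrt)
        finally show "norm (?R x) \<le> \<bar>K\<bar> * norm (x powr (1 / 2) * exp (- c * ln x powr \<Delta>))" by simp
      qed
    qed
    then show ?thesis using c by blast
  qed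
  show "?R \<in> O(\<lambda>x. x powr ((2 - r) / (5 - 4 * r) + \<epsilon>))"
    if RH: riemann_hypothesis
      and r: "1 / 4 < r \<and> r < 1 / 3 \<and> (\<forall>\<epsilon>>0. squarefree_discrepancy \<in> O(\<lambda>x. x powr (r + \<epsilon>)))"
      and \<epsilon>: "\<epsilon> > 0" for r \<epsilon>
  proof -
    define \<eta> where "\<eta> = min (\<epsilon> / 2) (1 / 100)"
    have \<eta>: "0 < \<eta>" "\<eta> \<le> 1 / 100" "2 * \<eta> \<le> \<epsilon>" using \<epsilon> by (auto simp: \<eta>_def min_def)
    obtain K where K: "\<And>x. x \<ge> 1 \<Longrightarrow> \<bar>?R x\<bar> \<le> K * x powr ((2 - r) / (5 - 4 * r) + 2 * \<eta>)"
      using exp_moebius_sum_bound_RH[OF RH _ _ \<eta>(1,2), of r] r \<eta>(1) by blast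
    show ?thesis
    proof (rule bigoI)
      show "\<forall>\<^sub>F x in at_top. norm (?R x) \<le> \<bar>K\<bar> * norm (x powr ((2 - r) / (5 - 4 * r) + \<epsilon>))"
        using eventually_ge_at_top[of 1]
      proof eventually_elim
        fix x :: real assume x: "1 \<le> x"
        have "\<bar>?R x\<bar> \<le> K * x powr ((2 - r) / (5 - 4 * r) + 2 * \<eta>)" by (rule K[OF x])
        also have "\<dots> \<le> \<bar>K\<bar> * x powr ((2 - r) / (5 - 4 * r) + \<epsilon>)"
          using x \<eta>(3) by (intro mult_mono powr_mono add_left_mono) auto
        finally show "norm (?R x) \<le> \<bar>K\<bar> * norm (x powr ((2 - r) / (5 - 4 * r) + \<epsilon>))" by simp
      qed
    qed
  qed
qed

end
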